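(* Let $\Bbbk$ be an algebraically closed field of characteristic zero and let $A=\bigoplus_{\nu\ge 0}A_\nu$ be a positively graded normal affine domain over $\Bbbk$ with $e(A)=1$. Put $S=\operatorname{Spec}A_0$, $Y=\operatorname{Proj}A$, assume $\dim_S Y\ge1$, and let $H$ be an ample $\mathbb{Q}$-divisor on $Y$ with $A=A(Y,H)$. Assume that the pair $(Y,H)$ is cylindrical with a cylinder $$Y\setminus\operatorname{supp}D\simeq Z\times\mathbb{A}^1,$$ where $D$ is an effective $\mathbb{Q}$-divisor on $Y$ such that $D\sim\frac pq H$ for some coprime integers $p,q>0$. Then the Veronese quasicone $V^{(p)}=\operatorname{Spec}A^{(p)}$ over $Y$ is cylindrical and possesses a principal cylinder $\mathbb{D}(h)\simeq Z'\times\mathbb{A}^1$, where $Z'\simeq Z\times\mathbb{A}^1_*$, $Z$ is affine, and $h\in A_p$.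
   Context: A positively graded $\Bbbk$-algebra is $A=\bigoplus_{\nu\ge0}A_\nu$ with $\Bbbk\subseteq A_0$ ($A_0=\Bbbk$ is not required). The saturation index is $e(A)=\gcd\{\nu:A_\nu\neq0\}$. $\dim_S Y$ is the relative dimension of $Y\to S$. $A^{(p)}=\bigoplus_{\nu\ge0}A_{p\nu}$ is the $p$th Veronese subring. $\mathbb{A}^1_*=\mathbb{A}^1\setminus\{0\}$. $A(Y,H)=\bigoplus_{\nu\ge0}H^0(Y,\mathcal{O}_Y(\lfloor\nu H\rfloor))u^\nu$, where $u$ is a homogeneous element of degree $1$ of $\operatorname{Frac}A$ and the degree-zero part $(\operatorname{Frac}A)_0$ is identified with the function field of $Y$. Two $\mathbb{Q}$-divisors $D,D'$ on $Y$ satisfy $D\sim D'$ if $D-D'=\operatorname{div}(f)$ for a rational function $f$ on $Y$. The pair $(Y,H)$ is cylindrical if there is an effective $\mathbb{Q}$-divisor $D$ with $D\sim\frac pqH$ for some coprime positive integers $p,q$ such that $Y\setminus\operatorname{supp}D\simeq Z\times\mathbb{A}^1$ for some variety $Z$. For an affine variety $X$ and $h\in\mathcal{O}(X)$ put $\mathbb{D}(h)=X\setminus h^{-1}(0)$ (here $X=V^{(p)}$); it is a principal cylinder if $\mathbb{D}(h)\simeq Z'\times\mathbb{A}^1$ for some variety $Z'$. $X$ is cylindrical if it contains a principal cylinder. *)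

theory Defs
  imports
    "HOL-Analysis.Abstract_Topology"
    "HOL-Library.Extended_Nat"
    "HOL-Computational_Algebra.Computational_Algebra"
begin

section \<open>Subrings, algebras, primes, localization\<close>

definition is_subring :: "'a::comm_ring_1 set \<Rightarrow> bool" where
  "is_subring R \<longleftrightarrow> 0 \<in> R \<and> 1 \<in> R \<and> (\<forall>a\<in>R. \<forall>b\<in>R. a - b \<in> R \<and> a * b \<in> R)"

definition ring_hom_on :: "'a::comm_ring_1 set \<Rightarrow> ('a \<Rightarrow> 'b::comm_ring_1) \<Rightarrow> bool" where
  "ring_hom_on R \<psi> \<longleftrightarrow> \<psi> 1 = 1 \<and>
     (\<forall>a\<in>R. \<forall>b\<in>R. \<psi> (a + b) = \<psi> a + \<psi> b \<and> \<psi> (a * b) = \<psi> a * \<psi> b)"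

text \<open>An algebra over the field \<open>'k\<close> is a subring \<open>R\<close> together with the structure map
  \<open>s\<close> from \<open>'k\<close> to \<open>R\<close>.\<close>

definition is_algebra :: "('k::field \<Rightarrow> 'a::comm_ring_1) \<Rightarrow> 'a set \<Rightarrow> bool" where
  "is_algebra s R \<longleftrightarrow> is_subring R \<and> ring_hom_on UNIV s \<and> range s \<subseteq> R"

definition algebra_generated :: "('k::field \<Rightarrow> 'a::comm_ring_1) \<Rightarrow> 'a set \<Rightarrow> 'a set" where
  "algebra_generated s G = \<Inter>{R. is_algebra s R \<and> G \<subseteq> R}"

definition affine_algebra :: "('k::field \<Rightarrow> 'a::comm_ring_1) \<Rightarrow> 'a set \<Rightarrow> bool" where
  "affine_algebra s R \<longleftrightarrow> is_algebra s R \<and> (\<exists>G. finite G \<and> R = algebra_generated s G)"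

definition prime_ideal_of :: "'a::comm_ring_1 set \<Rightarrow> 'a set \<Rightarrow> bool" where
  "prime_ideal_of R P \<longleftrightarrow> P \<subseteq> R \<and> 0 \<in> P \<and> 1 \<notin> P \<and>
     (\<forall>a\<in>P. \<forall>b\<in>P. a + b \<in> P) \<and> (\<forall>r\<in>R. \<forall>a\<in>P. r * a \<in> P) \<and>
     (\<forall>a\<in>R. \<forall>b\<in>R. a * b \<in> P \<longrightarrow> a \<in> P \<or> b \<in> P)"

definition localization :: "'a::field set \<Rightarrow> 'a set \<Rightarrow> 'a set" where
  "localization R P = {a / b | a b. a \<in> R \<and> b \<in> R \<and> b \<notin> P}"

definition frac_field :: "'a::field set \<Rightarrow> 'a set" where
  "frac_field R = {a / b | a b. a \<in> R \<and> b \<in> R \<and> b \<noteq> 0}"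

definition normal_domain :: "'a::field set \<Rightarrow> bool" where
  "normal_domain R \<longleftrightarrow> is_subring R \<and>
     (\<forall>x\<in>frac_field R. (\<exists>f. lead_coeff f = 1 \<and> (\<forall>i. coeff f i \<in> R) \<and> poly f x = 0) \<longrightarrow> x \<in> R)"

text \<open>The non-units of a local ring.\<close>

definition max_ideal :: "'a::field set \<Rightarrow> 'a set" where
  "max_ideal R = {a \<in> R. a = 0 \<or> inverse a \<notin> R}"


section \<open>Integral schemes over a field\<close>

text \<open>The structure sheaf of an integral scheme is a subsheaf of the constant sheaf of its function
  field, with \<open>O(U)\<close> the intersection of the stalks \<open>O\<^sub>x\<close>, \<open>x \<in> U\<close>, for nonempty \<open>U\<close>, and with
  inclusions as restriction maps. Such a scheme over \<open>'k\<close> is therefore recorded by its topological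
  space (of all scheme-theoretic points), its stalks as subrings of an ambient field \<open>'f\<close>, and the
  embedding of \<open>'k\<close>. The record itself carries no axioms; these are in \<open>variety\<close>.\<close>

record ('k, 'p, 'f) scheme =
  zariski :: "'p topology"
  stalk :: "'p \<Rightarrow> 'f set"
  scal :: "'k \<Rightarrow> 'f"

abbreviation points :: "('k, 'p, 'f) scheme \<Rightarrow> 'p set" where
  "points X \<equiv> topspace (zariski X)"

definition sections :: "('k, 'p, 'f) scheme \<Rightarrow> 'p set \<Rightarrow> 'f set" where
  "sections X U = (\<Inter>x\<in>U. stalk X x)"

text \<open>The stalk at the generic point contains every other stalk.\<close>

definition function_field :: "('k, 'p, 'f) scheme \<Rightarrow> 'f set" where
  "function_field X = (\<Union>x\<in>points X. stalk X x)"

definition open_subscheme :: "('k, 'p, 'f) scheme \<Rightarrow> 'p set \<Rightarrow> ('k, 'p, 'f) scheme" where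
  "open_subscheme X U =
     \<lparr>zariski = subtopology (zariski X) U, stalk = stalk X, scal = scal X\<rparr>"

text \<open>Isomorphism over \<open>'k\<close>: a homeomorphism and a compatible isomorphism of structure sheaves, the
  latter given by the isomorphism of function fields that it induces.\<close>

definition isomorphic ::
  "('k, 'p, 'f::field) scheme \<Rightarrow> ('k, 'q, 'g::field) scheme \<Rightarrow> bool" where
  "isomorphic X X' \<longleftrightarrow> (\<exists>\<phi> \<psi>.
     homeomorphic_map (zariski X) (zariski X') \<phi> \<and>
     bij_betw \<psi> (function_field X) (function_field X') \<and> ring_hom_on (function_field X) \<psi> \<and>
     (\<forall>c. \<psi> (scal X c) = scal X' c) \<and>
     (\<forall>x\<in>points X. \<psi> ` stalk X x = stalk X' (\<phi> x)))"

definition Spec :: "('k \<Rightarrow> 'f::field) \<Rightarrow> 'f set \<Rightarrow> ('k, 'f set, 'f) scheme" where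
  "Spec s R =
     \<lparr>zariski = topology_generated_by {{P. prime_ideal_of R P \<and> f \<notin> P} | f. f \<in> R},
      stalk = localization R,
      scal = s\<rparr>"

definition affine_variety :: "('k::field, 'p, 'f::field) scheme \<Rightarrow> bool" where
  "affine_variety X \<longleftrightarrow>
     affine_algebra (scal X) (sections X (points X)) \<and>
     isomorphic X (Spec (scal X) (sections X (points X)))"

definition affine_open :: "('k::field, 'p, 'f::field) scheme \<Rightarrow> 'p set \<Rightarrow> bool" where
  "affine_open X U \<longleftrightarrow> openin (zariski X) U \<and> affine_variety (open_subscheme X U)"

definition irreducible_in :: "'p topology \<Rightarrow> 'p set \<Rightarrow> bool" where
  "irreducible_in T C \<longleftrightarrow> C \<subseteq> topspace T \<and> C \<noteq> {} \<and>
     (\<forall>A B. closedin T A \<longrightarrow> closedin T B \<longrightarrow> C \<subseteq> A \<union> B \<longrightarrow> C \<subseteq> A \<or> C \<subseteq> B)"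

text \<open>Separatedness, i.e. closedness of the diagonal, is expressed on affine open pairs \<open>U, V\<close>:
  \<open>U \<inter> V\<close> is affine and \<open>O(U) \<otimes> O(V) \<rightarrow> O(U \<inter> V)\<close> is surjective.\<close>

definition separated :: "('k::field, 'p, 'f::field) scheme \<Rightarrow> bool" where
  "separated X \<longleftrightarrow> (\<forall>U V. affine_open X U \<longrightarrow> affine_open X V \<longrightarrow>
     affine_open X (U \<inter> V) \<and>
     sections X (U \<inter> V) = algebra_generated (scal X) (sections X U \<union> sections X V))"

text \<open>An integral separated scheme of finite type over \<open>'k\<close>.\<close>

definition variety :: "('k::field, 'p, 'f::field) scheme \<Rightarrow> bool" where
  "variety X \<longleftrightarrow> irreducible_in (zariski X) (points X) \<and>
     (\<exists>\<U>. finite \<U> \<and> (\<forall>U\<in>\<U>. affine_open X U) \<and> \<Union>\<U> = points X) \<and> separated X"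

definition krull_dim :: "'p topology \<Rightarrow> enat" where
  "krull_dim T = Sup {enat n | n. \<exists>C. (\<forall>i\<le>n. closedin T (C i) \<and> irreducible_in T (C i)) \<and>
     (\<forall>i<n. C i \<subset> C (Suc i))}"

text \<open>Relative dimension of a dominant morphism \<open>Y \<rightarrow> S\<close> of varieties, i.e. the dimension of its
  generic fibre.\<close>

definition rel_dim :: "('k, 'q, 'g) scheme \<Rightarrow> ('k, 'p, 'f) scheme \<Rightarrow> enat" where
  "rel_dim S Y = krull_dim (zariski Y) - krull_dim (zariski S)"


section \<open>Products with the affine line and the punctured affine line\<close>

definition poly_over :: "'a::zero set \<Rightarrow> 'a poly set" where
  "poly_over R = {g. \<forall>i. coeff g i \<in> R}"

text \<open>\<open>X \<times> \<bbbA>\<^sup>1\<close> is the relative spectrum of \<open>O\<^sub>X[t]\<close>. A point over \<open>x\<close> is a prime \<open>Q\<close> of \<open>O\<^sub>x[t]\<close> lying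
  over the maximal ideal of \<open>O\<^sub>x\<close>; equivalently, a prime of \<open>\<kappa>(x)[t]\<close>. The stalk at \<open>(x, Q)\<close> is
  \<open>O\<^sub>x[t]\<^sub>Q\<close>, a subring of the field of fractions of \<open>'f[t]\<close>.\<close>

definition A1_points :: "('k, 'p, 'f::field) scheme \<Rightarrow> ('p \<times> 'f poly set) set" where
  "A1_points X = {(x, Q). x \<in> points X \<and> prime_ideal_of (poly_over (stalk X x)) Q \<and>
     {c \<in> stalk X x. [:c:] \<in> Q} = max_ideal (stalk X x)}"

definition times_A1 ::
  "('k, 'p, 'f::field) scheme \<Rightarrow> ('k, 'p \<times> 'f poly set, 'f poly fract) scheme" where
  "times_A1 X =
     \<lparr>zariski = topology_generated_by
        {{(x, Q) \<in> A1_points X. x \<in> U \<and> g \<notin> Q} | U g.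
           openin (zariski X) U \<and> g \<in> poly_over (sections X U)},
      stalk = (\<lambda>(x, Q). {Fract a b | a b.
        a \<in> poly_over (stalk X x) \<and> b \<in> poly_over (stalk X x) \<and> b \<notin> Q}),
      scal = (\<lambda>c. Fract [:scal X c:] 1)\<rparr>"

text \<open>\<open>X \<times> (\<bbbA>\<^sup>1 \<setminus> {0})\<close>, the open subscheme of \<open>X \<times> \<bbbA>\<^sup>1\<close> where \<open>t \<noteq> 0\<close>.\<close>

definition times_A1_star ::
  "('k, 'p, 'f::field) scheme \<Rightarrow> ('k, 'p \<times> 'f poly set, 'f poly fract) scheme" where
  "times_A1_star X = open_subscheme (times_A1 X) {(x, Q) \<in> A1_points X. [:0, 1:] \<notin> Q}"


section \<open>Weil divisors with rational coefficients on a normal variety\<close>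

text \<open>A prime divisor is represented by its generic point, a point \<open>x\<close> whose local ring has
  dimension one.\<close>

definition prime_divisors :: "('k, 'p, 'f::field) scheme \<Rightarrow> 'p set" where
  "prime_divisors X = {x \<in> points X. max_ideal (stalk X x) \<noteq> {0} \<and>
     {P. prime_ideal_of (stalk X x) P} = {{0}, max_ideal (stalk X x)}}"

text \<open>The valuation of \<open>f \<noteq> 0\<close> along a prime divisor; on a normal variety \<open>O\<^sub>x\<close> is a discrete
  valuation ring, with uniformizer \<open>w\<close>.\<close>

definition ord_at :: "('k, 'p, 'f::field) scheme \<Rightarrow> 'p \<Rightarrow> 'f \<Rightarrow> int" where
  "ord_at X x f = (THE n. \<exists>w v. max_ideal (stalk X x) = {w * r | r. r \<in> stalk X x} \<and>
     v \<in> stalk X x - max_ideal (stalk X x) \<and> f = v * w powi n)"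

definition Q_divisor :: "('k, 'p, 'f::field) scheme \<Rightarrow> ('p \<Rightarrow> rat) \<Rightarrow> bool" where
  "Q_divisor X D \<longleftrightarrow> finite {x. D x \<noteq> 0} \<and> {x. D x \<noteq> 0} \<subseteq> prime_divisors X"

definition effective_Q_divisor :: "('k, 'p, 'f::field) scheme \<Rightarrow> ('p \<Rightarrow> rat) \<Rightarrow> bool" where
  "effective_Q_divisor X D \<longleftrightarrow> Q_divisor X D \<and> (\<forall>x. D x \<ge> 0)"

definition divisor_of :: "('k, 'p, 'f::field) scheme \<Rightarrow> 'f \<Rightarrow> 'p \<Rightarrow> rat" where
  "divisor_of X f = (\<lambda>x. if x \<in> prime_divisors X then of_int (ord_at X x f) else 0)"

definition divisor_supp :: "('k, 'p, 'f) scheme \<Rightarrow> ('p \<Rightarrow> rat) \<Rightarrow> 'p set" where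
  "divisor_supp X D = zariski X closure_of {x. D x \<noteq> 0}"

definition divisor_equiv ::
  "('k, 'p, 'f::field) scheme \<Rightarrow> ('p \<Rightarrow> rat) \<Rightarrow> ('p \<Rightarrow> rat) \<Rightarrow> bool" where
  "divisor_equiv X D D' \<longleftrightarrow>
     (\<exists>f\<in>function_field X. f \<noteq> 0 \<and> (\<forall>x. D x - D' x = divisor_of X f x))"

definition divisor_floor :: "('p \<Rightarrow> rat) \<Rightarrow> 'p \<Rightarrow> rat" where
  "divisor_floor D = (\<lambda>x. of_int \<lfloor>D x\<rfloor>)"

definition H0 :: "('k, 'p, 'f::field) scheme \<Rightarrow> ('p \<Rightarrow> rat) \<Rightarrow> 'f set" where
  "H0 X D = {f \<in> function_field X. f = 0 \<or>
     (\<forall>x\<in>prime_divisors X. divisor_of X f x + D x \<ge> 0)}"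

definition cartier :: "('k, 'p, 'f::field) scheme \<Rightarrow> ('p \<Rightarrow> rat) \<Rightarrow> bool" where
  "cartier X D \<longleftrightarrow> (\<forall>y\<in>points X. \<exists>U f. openin (zariski X) U \<and> y \<in> U \<and>
     f \<in> function_field X \<and> f \<noteq> 0 \<and> (\<forall>x\<in>U. D x = divisor_of X f x))"

text \<open>\<open>O(D)\<close> is ample: the affine ones among the open sets \<open>X\<^sub>s\<close>, where \<open>s\<close> is a global section of a
  positive power \<open>O(nD)\<close>, cover \<open>X\<close>. The zero locus of \<open>s \<noteq> 0\<close> is the support of \<open>div s + nD\<close>.\<close>

definition ample_cartier :: "('k::field, 'p, 'f::field) scheme \<Rightarrow> ('p \<Rightarrow> rat) \<Rightarrow> bool" where
  "ample_cartier X D \<longleftrightarrow> cartier X D \<and>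
     (\<forall>y\<in>points X. \<exists>n>0. \<exists>s\<in>H0 X (\<lambda>x. of_nat n * D x). s \<noteq> 0 \<and>
        (let U = points X - divisor_supp X (\<lambda>x. divisor_of X s x + of_nat n * D x)
         in y \<in> U \<and> affine_open X U))"

definition ample_Q_divisor :: "('k::field, 'p, 'f::field) scheme \<Rightarrow> ('p \<Rightarrow> rat) \<Rightarrow> bool" where
  "ample_Q_divisor X H \<longleftrightarrow> Q_divisor X H \<and> (\<exists>m>0. ample_cartier X (\<lambda>x. of_nat m * H x))"


section \<open>Graded domains and Proj\<close>

text \<open>A grading is the family of its homogeneous components inside a field containing the domain.\<close>

definition total_ring :: "(nat \<Rightarrow> 'f::comm_ring_1 set) \<Rightarrow> 'f set" where
  "total_ring A = {(\<Sum>i\<le>n. a i) | n a. \<forall>i\<le>n. a i \<in> A i}"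

definition positively_graded_algebra ::
  "('k::field \<Rightarrow> 'f::comm_ring_1) \<Rightarrow> (nat \<Rightarrow> 'f set) \<Rightarrow> bool" where
  "positively_graded_algebra s A \<longleftrightarrow>
     ring_hom_on UNIV s \<and> range s \<subseteq> A 0 \<and>
     (\<forall>i. 0 \<in> A i \<and> (\<forall>a\<in>A i. \<forall>b\<in>A i. a - b \<in> A i)) \<and>
     (\<forall>i j. \<forall>a\<in>A i. \<forall>b\<in>A j. a * b \<in> A (i + j)) \<and>
     (\<forall>n a. (\<forall>i\<le>n. a i \<in> A i) \<and> (\<Sum>i\<le>n. a i) = 0 \<longrightarrow> (\<forall>i\<le>n. a i = 0))"

definition saturation_index :: "(nat \<Rightarrow> 'f::zero set) \<Rightarrow> nat" where
  "saturation_index A = Gcd {i. A i \<noteq> {0}}"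

definition veronese :: "nat \<Rightarrow> (nat \<Rightarrow> 'f set) \<Rightarrow> nat \<Rightarrow> 'f set" where
  "veronese p A = (\<lambda>i. A (p * i))"

definition frac_degree :: "(nat \<Rightarrow> 'f::field set) \<Rightarrow> int \<Rightarrow> 'f set" where
  "frac_degree A d = {a / b | a b i j. a \<in> A i \<and> b \<in> A j \<and> b \<noteq> 0 \<and> int i - int j = d}"

definition homogeneous_ideal :: "(nat \<Rightarrow> 'f::comm_ring_1 set) \<Rightarrow> 'f set \<Rightarrow> bool" where
  "homogeneous_ideal A P \<longleftrightarrow>
     (\<forall>n a. (\<forall>i\<le>n. a i \<in> A i) \<and> (\<Sum>i\<le>n. a i) \<in> P \<longrightarrow> (\<forall>i\<le>n. a i \<in> P))"

definition Proj_points :: "(nat \<Rightarrow> 'f::comm_ring_1 set) \<Rightarrow> 'f set set" where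
  "Proj_points A = {P. prime_ideal_of (total_ring A) P \<and> homogeneous_ideal A P \<and>
     \<not> (\<Union>i\<in>{1..}. A i) \<subseteq> P}"

text \<open>The stalks lie in the degree-zero part of the field of fractions, which is thereby the function
  field.\<close>

definition Proj :: "('k \<Rightarrow> 'f::field) \<Rightarrow> (nat \<Rightarrow> 'f set) \<Rightarrow> ('k, 'f set, 'f) scheme" where
  "Proj s A =
     \<lparr>zariski = topology_generated_by
        {{P \<in> Proj_points A. f \<notin> P} | f i. i > 0 \<and> f \<in> A i},
      stalk = (\<lambda>P. {a / b | a b i. a \<in> A i \<and> b \<in> A i \<and> b \<notin> P}),
      scal = s\<rparr>"

text \<open>The graded ring \<open>A(Y,H)\<close>, with \<open>u\<close> the chosen homogeneous element of degree one.\<close>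

definition divisor_ring ::
  "('k, 'p, 'f::field) scheme \<Rightarrow> ('p \<Rightarrow> rat) \<Rightarrow> 'f \<Rightarrow> nat \<Rightarrow> 'f set" where
  "divisor_ring Y H u = (\<lambda>n. {f * u ^ n | f. f \<in> H0 Y (divisor_floor (\<lambda>x. of_nat n * H x))})"


section \<open>Cylinders\<close>

text \<open>\<open>(Y, H)\<close> is cylindrical, as witnessed by \<open>D\<close>, \<open>p\<close>, \<open>q\<close> and \<open>Z\<close>.\<close>

definition cylindrical_pair_by ::
  "('k::field, 'p, 'f::field) scheme \<Rightarrow> ('p \<Rightarrow> rat) \<Rightarrow> ('p \<Rightarrow> rat) \<Rightarrow> nat \<Rightarrow> nat \<Rightarrow>
   ('k, 'q, 'g::field) scheme \<Rightarrow> bool" where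
  "cylindrical_pair_by Y H D p q Z \<longleftrightarrow>
     effective_Q_divisor Y D \<and> p > 0 \<and> q > 0 \<and> coprime p q \<and>
     divisor_equiv Y D (\<lambda>x. (of_nat p / of_nat q) * H x) \<and>
     variety Z \<and> isomorphic (open_subscheme Y (points Y - divisor_supp Y D)) (times_A1 Z)"

text \<open>The principal open set \<open>\<D>(h)\<close>; a function vanishes at \<open>x\<close> when its germ lies in the maximal
  ideal.\<close>

definition principal_open :: "('k, 'p, 'f::field) scheme \<Rightarrow> 'f \<Rightarrow> 'p set" where
  "principal_open X h = {x \<in> points X. h \<notin> max_ideal (stalk X x)}"

definition principal_cylinder ::
  "('k::field, 'p, 'f::field) scheme \<Rightarrow> 'f \<Rightarrow> ('k, 'q, 'g::field) scheme \<Rightarrow> bool" where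
  "principal_cylinder X h Z' \<longleftrightarrow>
     affine_variety X \<and> h \<in> sections X (points X) \<and> variety Z' \<and>
     isomorphic (open_subscheme X (principal_open X h)) (times_A1 Z')"

text \<open>Taking \<open>Z'\<close> over the types of \<open>X\<close> loses no generality: \<open>Z' \<times> {0}\<close> is a closed subvariety of
  \<open>\<D>(h)\<close>, and the function field of \<open>Z'\<close> embeds into that of \<open>X\<close>.\<close>

definition cylindrical :: "('k::field, 'p, 'f::field) scheme \<Rightarrow> bool" where
  "cylindrical X \<longleftrightarrow> (\<exists>h. \<exists>Z' :: ('k, 'p, 'f) scheme. principal_cylinder X h Z')"

end

theory Submission
  imports Defs
begin

text \<open>Let \<open>D - (p/q) H = div f\<close>. Then \<open>h = f ^ q * u ^ p\<close> lies in \<open>A p\<close> and has the divisor \<open>q D\<close>, so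
  that the complement of the support of \<open>D\<close> is the affine open set where \<open>h\<close> does not vanish, with
  coordinate ring \<open>B = A\<^bsub>(h)\<^esub>\<close>. Since \<open>h\<close> has degree one in the Veronese ring, inverting \<open>h\<close> there
  gives \<open>B[h, 1/h]\<close>, i.e. the product of this open set with the punctured line. The isomorphism
  \<open>B \<simeq> O(Z)[t]\<close> turns \<open>B[h, 1/h]\<close> into \<open>O(Z)[h, 1/h][t]\<close>, and \<open>Z\<close> is affine as the zero section of an
  affine scheme.\<close>

section \<open>Subrings, ideals and localizations\<close>

text \<open>Two obstacles shape the proof. \<open>isomorphic\<close> and
  \<open>affine_variety\<close> compare stalks only through a map \<open>\<psi>\<close> of function
  fields, and a union of stalks of \<open>Z\<close> need not a priori be closed under
  multiplication. So even the ring structure of the stalks of \<open>Z\<close> has to be extracted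
  from the isomorphism with an affine cylinder; this causes the case distinction between special and
  generic points of \<open>Z\<close>, where finite generation over an infinite field excludes the
  degenerate case. Secondly, the support of \<open>D\<close> is described by valuations, whereas a
  point of Proj is a homogeneous prime. Both descriptions are matched at prime divisors, whose local
  rings are discrete valuation rings because graded localizations inherit Noetherianity and
  normality. The exponent \<open>q\<close> clears the denominator of \<open>p/q\<close>:
  \<open>q D = q div f + p H\<close> is the divisor of an element of degree exactly
  \<open>p\<close>, which is regular because \<open>D\<close> is effective. Finally,
  \<open>h\<close> and the cylinder coordinate \<open>t\<close> are independent for reasons of
  degree: \<open>t\<close> is a fraction of degree zero, \<open>h\<close> has positive
  degree.\<close>

lemma subring_zero: "is_subring R \<Longrightarrow> 0 \<in> R"
  and subring_one: "is_subring R \<Longrightarrow> 1 \<in> R"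
  and subring_diff: "is_subring R \<Longrightarrow> a \<in> R \<Longrightarrow> b \<in> R \<Longrightarrow> a - b \<in> R"
  and subring_mult: "is_subring R \<Longrightarrow> a \<in> R \<Longrightarrow> b \<in> R \<Longrightarrow> a * b \<in> R"
  by (auto simp: is_subring_def)

lemma subring_uminus: "is_subring R \<Longrightarrow> a \<in> R \<Longrightarrow> - a \<in> R"
  using subring_diff[of R 0 a] subring_zero by auto

lemma subring_add: "is_subring R \<Longrightarrow> a \<in> R \<Longrightarrow> b \<in> R \<Longrightarrow> a + b \<in> R"
  using subring_diff[of R a "- b"] subring_uminus by auto

lemma subring_power: "is_subring R \<Longrightarrow> a \<in> R \<Longrightarrow> a ^ n \<in> R"
  by (induction n) (auto intro: subring_one subring_mult)

lemma subring_sum: "is_subring R \<Longrightarrow> (\<And>i. i \<in> I \<Longrightarrow> f i \<in> R) \<Longrightarrow> sum f I \<in> R"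
  by (induction I rule: infinite_finite_induct) (auto intro: subring_zero subring_add)

lemma subring_prod: "is_subring R \<Longrightarrow> (\<And>i. i \<in> I \<Longrightarrow> f i \<in> R) \<Longrightarrow> prod f I \<in> R"
  by (induction I rule: infinite_finite_induct) (auto intro: subring_one subring_mult)

lemmas subring_closed = subring_zero subring_one subring_diff subring_mult subring_uminus
  subring_add subring_power subring_sum subring_prod

definition ideal_of :: "'a::comm_ring_1 set \<Rightarrow> 'a set \<Rightarrow> bool" where
  "ideal_of R J \<longleftrightarrow> J \<subseteq> R \<and> 0 \<in> J \<and> (\<forall>a\<in>J. \<forall>b\<in>J. a + b \<in> J) \<and> (\<forall>r\<in>R. \<forall>a\<in>J. r * a \<in> J)"

text \<open>Krull's argument: Zorn's lemma gives a proper ideal that is maximal among those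
  containing \<open>J\<close>, and such an ideal is prime.\<close>

lemma ideal_in_prime:
  assumes R: "is_subring R" and J: "ideal_of R J" "1 \<notin> J"
  shows "\<exists>P. prime_ideal_of R P \<and> J \<subseteq> P"
proof -
  let ?A = "{I. ideal_of R I \<and> 1 \<notin> I \<and> J \<subseteq> I}"
  have "\<exists>M\<in>?A. \<forall>X\<in>?A. M \<subseteq> X \<longrightarrow> X = M"
  proof (rule subset_Zorn_nonempty)
    show "?A \<noteq> {}" using J by auto
    fix C assume C: "C \<noteq> {}" "subset.chain ?A C"
    have tot: "X \<subseteq> Y \<or> Y \<subseteq> X" if "X \<in> C" "Y \<in> C" for X Y
      using C that by (auto simp: subset_chain_def)
    have sub: "C \<subseteq> ?A" using C by (auto simp: subset_chain_def)
    have "a + b \<in> \<Union>C" if a: "a \<in> X" "X \<in> C" and b: "b \<in> Y" "Y \<in> C" for a b X Y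
    proof -
      obtain W where W: "W \<in> C" "a \<in> W" "b \<in> W" using tot[OF a(2) b(2)] a b by blast
      then have "a + b \<in> W" using sub by (auto simp: ideal_of_def)
      then show ?thesis using W(1) by blast
    qed
    moreover have "I \<subseteq> R \<and> 0 \<in> I \<and> 1 \<notin> I \<and> J \<subseteq> I \<and> (\<forall>r\<in>R. \<forall>a\<in>I. r * a \<in> I)" if "I \<in> C" for I
      using that sub by (auto simp: ideal_of_def)
    then have "\<Union>C \<subseteq> R" "0 \<in> \<Union>C" "1 \<notin> \<Union>C" "J \<subseteq> \<Union>C" "\<forall>r\<in>R. \<forall>a\<in>\<Union>C. r * a \<in> \<Union>C"
      using C(1) by blast+
    ultimately show "\<Union>C \<in> ?A" by (auto simp: ideal_of_def)
  qed
  then obtain M where M: "ideal_of R M" "1 \<notin> M" "J \<subseteq> M"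
    and mx: "\<And>X. ideal_of R X \<Longrightarrow> 1 \<notin> X \<Longrightarrow> M \<subseteq> X \<Longrightarrow> J \<subseteq> X \<Longrightarrow> X = M"
    by auto
  have add: "a + b \<in> M" if "a \<in> M" "b \<in> M" for a b using M(1) that by (auto simp: ideal_of_def)
  have mul: "r * a \<in> M" if "r \<in> R" "a \<in> M" for a r using M(1) that by (auto simp: ideal_of_def)
  have MR: "a \<in> R" if "a \<in> M" for a using M(1) that by (auto simp: ideal_of_def)
  have M0: "0 \<in> M" using M(1) by (auto simp: ideal_of_def)
  \<comment> \<open>\<open>M + R a\<close> is an ideal strictly larger than \<open>M\<close>, so
    maximality forces it to contain \<open>1\<close>.\<close>
  have ex: "\<exists>m\<in>M. \<exists>r\<in>R. 1 = m + r * a" if a: "a \<in> R" "a \<notin> M" for a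
  proof (rule ccontr)
    assume c: "\<not> ?thesis"
    let ?X = "{m + r * a | m r. m \<in> M \<and> r \<in> R}"
    have "ideal_of R ?X"
      unfolding ideal_of_def
    proof (intro conjI ballI)
      show "?X \<subseteq> R" using MR a R by (auto intro!: subring_add subring_mult)
      have "0 = 0 + 0 * a" by simp
      then show "0 \<in> ?X" using M0 subring_zero[OF R] by blast
      fix x y assume "x \<in> ?X" "y \<in> ?X"
      then obtain m r n t where 1: "x = m + r * a" "y = n + t * a" "m \<in> M" "n \<in> M" "r \<in> R" "t \<in> R" by blast
      then have "x + y = (m + n) + (r + t) * a" by (simp add: algebra_simps)
      then show "x + y \<in> ?X" using 1 add subring_add[OF R] by blast
    next
      fix x y assume x: "x \<in> R" "y \<in> ?X"
      then obtain n t where 1: "y = n + t * a" "n \<in> M" "t \<in> R" by blast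
      then have "x * y = x * n + (x * t) * a" by (simp add: algebra_simps)
      then show "x * y \<in> ?X" using 1 x(1) mul subring_mult[OF R] by blast
    qed
    moreover have "1 \<notin> ?X" using c by blast
    moreover have "M \<subseteq> ?X"
    proof
      fix m assume "m \<in> M"
      moreover have "m = m + 0 * a" by simp
      ultimately show "m \<in> ?X" using subring_zero[OF R] by blast
    qed
    moreover from this M(3) have "J \<subseteq> ?X" by (rule order_trans[rotated])
    ultimately have "?X = M" by (rule mx)
    moreover have "0 + 1 * a \<in> ?X" using M0 subring_one[OF R] by blast
    ultimately show False using a by simp
  qed
  have "a \<in> M \<or> b \<in> M" if ab: "a \<in> R" "b \<in> R" "a * b \<in> M" for a b
  proof (rule ccontr)
    assume "\<not> ?thesis"
    then obtain m r n t where 1: "1 = m + r * a" "1 = n + t * b" "m \<in> M" "n \<in> M" "r \<in> R" "t \<in> R"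
      using ex ab by metis
    \<comment> \<open>Multiplied out, every summand has a factor \<open>m\<close>, \<open>n\<close>
      or \<open>a * b\<close>, all of which lie in \<open>M\<close>.\<close>
    have "1 = (m + r * a) * (n + t * b)" using 1(1,2) by simp
    also have "\<dots> = n * m + ((t * b) * m + ((r * a) * n + (r * t) * (a * b)))" by (simp add: algebra_simps)
    also have "\<dots> \<in> M"
      by (intro add mul subring_mult[OF R] MR[OF 1(3)] MR[OF 1(4)] 1 ab)
    finally show False using M by simp
  qed
  then have "prime_ideal_of R M" using M by (auto simp: prime_ideal_of_def ideal_of_def)
  then show ?thesis using M by blast
qed

lemma prime_idealD:
  assumes "prime_ideal_of R P"
  shows "P \<subseteq> R" "0 \<in> P" "1 \<notin> P" "a \<in> P \<Longrightarrow> b \<in> P \<Longrightarrow> a + b \<in> P"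
    "r \<in> R \<Longrightarrow> a \<in> P \<Longrightarrow> r * a \<in> P" "r \<in> R \<Longrightarrow> a \<in> P \<Longrightarrow> a * r \<in> P"
    "a \<in> R \<Longrightarrow> b \<in> R \<Longrightarrow> a * b \<in> P \<Longrightarrow> a \<in> P \<or> b \<in> P"
  using assms by (auto simp: prime_ideal_of_def mult.commute)

lemma prime_ideal_power:
  assumes "prime_ideal_of R P" "is_subring R" "a \<in> R" "a ^ n \<in> P"
  shows "a \<in> P"
  using assms(4)
proof (induction n)
  case 0 then show ?case using prime_idealD(3)[OF assms(1)] by simp
next
  case (Suc n)
  then show ?case using prime_idealD(7)[OF assms(1), of a "a ^ n"] assms(2,3) by (auto simp: subring_power)
qed

lemma prime_ideal_sum:
  "prime_ideal_of R P \<Longrightarrow> (\<And>i. i \<in> I \<Longrightarrow> f i \<in> P) \<Longrightarrow> sum f I \<in> P"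
  by (induction I rule: infinite_finite_induct) (auto simp: prime_ideal_of_def)

lemma prime_ideal_zero:
  fixes R :: "'a::idom set"
  shows "is_subring R \<Longrightarrow> prime_ideal_of R {0}"
  by (auto simp: prime_ideal_of_def intro: subring_closed)

lemma localizationE:
  assumes "x \<in> localization R P"
  obtains a b where "a \<in> R" "b \<in> R" "b \<notin> P" "x = a / b"
  using assms by (auto simp: localization_def)

lemma localizationI: "a \<in> R \<Longrightarrow> b \<in> R \<Longrightarrow> b \<notin> P \<Longrightarrow> a / b \<in> localization R P"
  by (auto simp: localization_def)

lemma localization_base: "is_subring R \<Longrightarrow> prime_ideal_of R P \<Longrightarrow> a \<in> R \<Longrightarrow> a \<in> localization R P"
  using localizationI[of a R 1 P] by (auto simp: prime_ideal_of_def is_subring_def)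

lemma subring_localization:
  assumes R: "is_subring R" and P: "prime_ideal_of R P"
  shows "is_subring (localization R P)"
  unfolding is_subring_def
proof (intro conjI ballI)
  show "0 \<in> localization R P" "1 \<in> localization R P"
    using localization_base[OF assms] R by (auto intro: subring_zero subring_one)
  fix x y assume "x \<in> localization R P" "y \<in> localization R P"
  then obtain a b c d where 1: "a \<in> R" "b \<in> R" "b \<notin> P" "x = a / b" "c \<in> R" "d \<in> R" "d \<notin> P" "y = c / d"
    by (metis localizationE)
  have nz: "b \<noteq> 0" "d \<noteq> 0" "b * d \<notin> P" using 1 P by (auto simp: prime_ideal_of_def)
  have "x - y = (a * d - c * b) / (b * d)" "x * y = (a * c) / (b * d)"
    using 1 nz by (auto simp: field_simps)
  then show "x - y \<in> localization R P" "x * y \<in> localization R P"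
    using 1 nz R by (simp_all add: localizationI subring_closed)
qed

text \<open>\<open>max_ideal\<close> is defined by non-invertibility alone. Outside \<open>P\<close>
  the inverse \<open>1 / r\<close> is available; inside \<open>P\<close>, an inverse
  \<open>a / b\<close> would give \<open>b = a * r\<close> in \<open>P\<close>. This is the way back
  from a stalk to its prime.\<close>

lemma localization_unit_iff:
  assumes R: "is_subring R" and P: "prime_ideal_of R P" and r: "r \<in> R"
  shows "r \<in> max_ideal (localization R P) \<longleftrightarrow> r \<in> P"
proof
  assume "r \<in> P"
  have False if r0: "r \<noteq> 0" and inv: "inverse r \<in> localization R P"
  proof -
    obtain a b where 1: "a \<in> R" "b \<in> R" "b \<notin> P" "inverse r = a / b"
      using inv by (metis localizationE)
    then have "b = a * r" using r0 P by (auto simp: field_simps prime_ideal_of_def)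
    then show False using 1 \<open>r \<in> P\<close> P by (auto simp: prime_ideal_of_def)
  qed
  then show "r \<in> max_ideal (localization R P)"
    using assms by (auto simp: max_ideal_def intro: localization_base)
next
  assume m: "r \<in> max_ideal (localization R P)"
  show "r \<in> P"
  proof (rule ccontr)
    assume "r \<notin> P"
    then have "1 / r \<in> localization R P" using R r by (auto intro!: localizationI subring_closed)
    then show False using m \<open>r \<notin> P\<close> P by (auto simp: max_ideal_def inverse_eq_divide prime_ideal_of_def)
  qed
qed

text \<open>For \<open>x\<close> in every localization, the ideal of its denominators, i.e. of all
  \<open>b\<close> with \<open>b * x\<close> in \<open>R\<close>, is contained in no prime and
  therefore contains \<open>1\<close>.\<close>

lemma inter_localizations:
  assumes R: "is_subring R"
  shows "(\<Inter>P\<in>Collect (prime_ideal_of R). localization R P) = R"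
proof
  show "R \<subseteq> (\<Inter>P\<in>Collect (prime_ideal_of R). localization R P)"
    using R by (auto intro: localization_base)
  show "(\<Inter>P\<in>Collect (prime_ideal_of R). localization R P) \<subseteq> R"
  proof
    fix x assume x: "x \<in> (\<Inter>P\<in>Collect (prime_ideal_of R). localization R P)"
    let ?J = "{b \<in> R. b * x \<in> R}"
    have "ideal_of R ?J" using R
      by (auto simp: ideal_of_def algebra_simps intro: subring_closed)
    moreover have "\<not> (\<exists>P. prime_ideal_of R P \<and> ?J \<subseteq> P)"
    proof clarify
      fix P assume P: "prime_ideal_of R P" "?J \<subseteq> P"
      obtain a b where 1: "a \<in> R" "b \<in> R" "b \<notin> P" "x = a / b"
        using x P(1) localizationE[of x R P] by blast
      have "b \<noteq> 0" using 1 P by (auto simp: prime_ideal_of_def)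
      then have "b \<in> ?J" using 1 by auto
      then show False using 1 P by auto
    qed
    ultimately have "1 \<in> ?J" using ideal_in_prime[OF R] by blast
    then show "x \<in> R" by auto
  qed
qed

lemma localization_zero: "localization R {0} = frac_field R"
  by (auto simp: localization_def frac_field_def)

lemma localization_subset_frac: "prime_ideal_of R P \<Longrightarrow> localization R P \<subseteq> frac_field R"
  by (auto simp: localization_def frac_field_def prime_ideal_of_def)

lemma subring_frac: "is_subring R \<Longrightarrow> is_subring (frac_field R)"
  using subring_localization[of R "{0}"] prime_ideal_zero by (auto simp: localization_zero)

lemma frac_base: "is_subring R \<Longrightarrow> a \<in> R \<Longrightarrow> a \<in> frac_field R"
  using localization_base[of R "{0}"] prime_ideal_zero by (auto simp: localization_zero)

lemma fracI: "a \<in> R \<Longrightarrow> b \<in> R \<Longrightarrow> b \<noteq> 0 \<Longrightarrow> a / b \<in> frac_field R"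
  by (auto simp: frac_field_def)

lemma fracE:
  assumes "x \<in> frac_field R"
  obtains a b where "a \<in> R" "b \<in> R" "b \<noteq> 0" "x = a / b"
  using assms by (auto simp: frac_field_def)

lemma frac_inverse: "is_subring R \<Longrightarrow> x \<in> frac_field R \<Longrightarrow> inverse x \<in> frac_field R"
  by (cases "x = 0") (auto simp: subring_frac subring_zero elim!: fracE intro: fracI)

lemma frac_divide: "is_subring R \<Longrightarrow> x \<in> frac_field R \<Longrightarrow> y \<in> frac_field R \<Longrightarrow> x / y \<in> frac_field R"
  by (simp add: divide_inverse frac_inverse subring_frac subring_mult)

lemma frac_mono: "R \<subseteq> T \<Longrightarrow> frac_field R \<subseteq> frac_field T"
  by (auto simp: frac_field_def)

section \<open>Ring homomorphisms on subrings\<close>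

lemma hom_add: "ring_hom_on R \<psi> \<Longrightarrow> a \<in> R \<Longrightarrow> b \<in> R \<Longrightarrow> \<psi> (a + b) = \<psi> a + \<psi> b"
  and hom_mult: "ring_hom_on R \<psi> \<Longrightarrow> a \<in> R \<Longrightarrow> b \<in> R \<Longrightarrow> \<psi> (a * b) = \<psi> a * \<psi> b"
  and hom_one: "ring_hom_on R \<psi> \<Longrightarrow> \<psi> 1 = 1"
  by (auto simp: ring_hom_on_def)

lemma hom_zero: "ring_hom_on R \<psi> \<Longrightarrow> 0 \<in> R \<Longrightarrow> \<psi> 0 = 0"
  using hom_add[of R \<psi> 0 0] by simp

lemma hom_subset: "ring_hom_on R \<psi> \<Longrightarrow> T \<subseteq> R \<Longrightarrow> ring_hom_on T \<psi>"
  by (auto simp: ring_hom_on_def)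

lemma hom_diff:
  assumes "ring_hom_on R \<psi>" "is_subring R" "a \<in> R" "b \<in> R"
  shows "\<psi> (a - b) = \<psi> a - \<psi> b"
  using hom_add[OF assms(1), of "a - b" b] assms by (simp add: subring_diff)

lemma hom_power: "ring_hom_on R \<psi> \<Longrightarrow> is_subring R \<Longrightarrow> a \<in> R \<Longrightarrow> \<psi> (a ^ n) = \<psi> a ^ n"
  by (induction n) (auto simp: hom_one hom_mult subring_power)

lemma hom_sum:
  assumes "ring_hom_on R \<psi>" "is_subring R" "\<And>i. i \<in> I \<Longrightarrow> f i \<in> R"
  shows "\<psi> (sum f I) = (\<Sum>i\<in>I. \<psi> (f i))"
  using assms(3)
  by (induction I rule: infinite_finite_induct)
    (use assms(1,2) in \<open>auto simp: hom_zero[OF assms(1)] subring_zero hom_add[OF assms(1)] subring_sum\<close>)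

lemma hom_image_subring:
  assumes "ring_hom_on R \<psi>" "is_subring R"
  shows "is_subring (\<psi> ` R)"
  unfolding is_subring_def
proof (intro conjI ballI)
  show "0 \<in> \<psi> ` R" using hom_zero[OF assms(1)] assms(2) by (metis imageI subring_zero)
  show "1 \<in> \<psi> ` R" using hom_one[OF assms(1)] assms(2) by (metis imageI subring_one)
  fix x y assume "x \<in> \<psi> ` R" "y \<in> \<psi> ` R"
  then obtain a b where "a \<in> R" "b \<in> R" "x = \<psi> a" "y = \<psi> b" by auto
  then show "x - y \<in> \<psi> ` R" "x * y \<in> \<psi> ` R"
    using hom_diff[OF assms] hom_mult[OF assms(1)] assms(2)
    by (metis imageI subring_diff, metis imageI subring_mult)
qed

lemma hom_inj_iff:
  assumes "ring_hom_on R \<psi>" "is_subring R"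
  shows "inj_on \<psi> R \<longleftrightarrow> (\<forall>a\<in>R. \<psi> a = 0 \<longrightarrow> a = 0)"
proof
  assume "inj_on \<psi> R" then show "\<forall>a\<in>R. \<psi> a = 0 \<longrightarrow> a = 0"
    using assms by (metis hom_zero inj_onD subring_zero)
next
  assume z: "\<forall>a\<in>R. \<psi> a = 0 \<longrightarrow> a = 0"
  show "inj_on \<psi> R"
  proof (rule inj_onI)
    fix a b assume ab: "a \<in> R" "b \<in> R" "\<psi> a = \<psi> b"
    then have "\<psi> (a - b) = 0" using hom_diff[OF assms] by simp
    then show "a = b" using z ab subring_diff[OF assms(2)] by fastforce
  qed
qed

lemma hom_frac_inj:
  fixes R :: "'a::field set" and \<psi> :: "'a \<Rightarrow> 'b::field"
  assumes \<psi>: "ring_hom_on (frac_field R) \<psi>" and R: "is_subring R"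
  shows "inj_on \<psi> (frac_field R)"
  unfolding hom_inj_iff[OF \<psi> subring_frac[OF R]]
proof (intro ballI impI, rule ccontr)
  fix a assume a: "a \<in> frac_field R" "\<psi> a = 0" "a \<noteq> 0"
  have "\<psi> (a * inverse a) = \<psi> a * \<psi> (inverse a)" using a R \<psi> by (intro hom_mult) (auto intro: frac_inverse)
  then show False using a hom_one[OF \<psi>] by simp
qed

lemma hom_frac_divide:
  fixes R :: "'a::field set" and \<psi> :: "'a \<Rightarrow> 'b::field"
  assumes \<psi>: "ring_hom_on (frac_field R) \<psi>" and R: "is_subring R"
    and a: "a \<in> frac_field R" and b: "b \<in> frac_field R"
  shows "\<psi> (a / b) = \<psi> a / \<psi> b"
proof (cases "b = 0")
  case True then show ?thesis using hom_zero[OF \<psi>] R by (simp add: subring_frac subring_zero)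
next
  case False
  have "\<psi> b \<noteq> 0" using hom_frac_inj[OF \<psi> R] False b hom_zero[OF \<psi>] R
    by (metis inj_onD subring_frac subring_zero)
  moreover have "\<psi> (a / b * b) = \<psi> (a / b) * \<psi> b"
    using assms by (intro hom_mult) (auto intro: frac_divide)
  ultimately show ?thesis using False by (simp add: field_simps)
qed

lemma hom_image_frac:
  fixes R :: "'a::field set" and \<psi> :: "'a \<Rightarrow> 'b::field"
  assumes \<psi>: "ring_hom_on (frac_field R) \<psi>" and R: "is_subring R"
  shows "\<psi> ` frac_field R = frac_field (\<psi> ` R)"
proof -
  have nz: "\<psi> b \<noteq> 0 \<longleftrightarrow> b \<noteq> 0" if "b \<in> R" for b
    using hom_frac_inj[OF \<psi> R] hom_zero[OF \<psi>] R that
    by (metis frac_base inj_onD subring_zero)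
  have eq: "\<psi> (a / b) = \<psi> a / \<psi> b" if "a \<in> R" "b \<in> R" for a b
    using that hom_frac_divide[OF \<psi> R] R by (auto intro: frac_base)
  show ?thesis
  proof (intro equalityI subsetI)
    fix x assume "x \<in> \<psi> ` frac_field R"
    then obtain a b where "a \<in> R" "b \<in> R" "b \<noteq> 0" "x = \<psi> (a / b)" by (auto elim: fracE)
    then show "x \<in> frac_field (\<psi> ` R)" using eq nz by (auto intro: fracI)
  next
    fix x assume "x \<in> frac_field (\<psi> ` R)"
    then obtain a b where "a \<in> R" "b \<in> R" "\<psi> b \<noteq> 0" "x = \<psi> a / \<psi> b" by (auto elim!: fracE)
    then show "x \<in> \<psi> ` frac_field R" using eq nz by (metis fracI imageI)
  qed
qed

lemma hom_image_localization:
  fixes R :: "'a::field set" and \<psi> :: "'a \<Rightarrow> 'b::field"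
  assumes \<psi>: "ring_hom_on (frac_field R) \<psi>" and R: "is_subring R" and P: "P \<subseteq> R"
  shows "\<psi> ` localization R P = localization (\<psi> ` R) (\<psi> ` P)"
proof -
  have inj: "\<psi> b \<in> \<psi> ` P \<longleftrightarrow> b \<in> P" if "b \<in> R" for b
    using hom_frac_inj[OF \<psi> R] R that P
    by (smt (verit, ccfv_SIG) frac_base image_iff inj_on_eq_iff subset_eq)
  have eq: "\<psi> (a / b) = \<psi> a / \<psi> b" if "a \<in> R" "b \<in> R" for a b
    using that hom_frac_divide[OF \<psi> R] R by (auto intro: frac_base)
  show ?thesis
  proof (intro equalityI subsetI)
    fix x assume "x \<in> \<psi> ` localization R P"
    then obtain a b where "a \<in> R" "b \<in> R" "b \<notin> P" "x = \<psi> (a / b)" by (auto elim: localizationE)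
    then show "x \<in> localization (\<psi> ` R) (\<psi> ` P)" using eq inj by (auto intro!: localizationI)
  next
    fix x assume "x \<in> localization (\<psi> ` R) (\<psi> ` P)"
    then obtain a b where "a \<in> R" "b \<in> R" "\<psi> b \<notin> \<psi> ` P" "x = \<psi> a / \<psi> b" by (auto elim!: localizationE)
    then show "x \<in> \<psi> ` localization R P" using eq inj by (metis localizationI imageI)
  qed
qed

lemma hom_inv_into:
  assumes \<psi>: "ring_hom_on R \<psi>" and R: "is_subring R" and inj: "inj_on \<psi> R"
  shows "ring_hom_on (\<psi> ` R) (inv_into R \<psi>)"
  unfolding ring_hom_on_def
proof (intro conjI ballI)
  show "inv_into R \<psi> 1 = 1" using hom_one[OF \<psi>] inv_into_f_f[OF inj subring_one[OF R]] by simp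
  fix x y assume "x \<in> \<psi> ` R" "y \<in> \<psi> ` R"
  then obtain a b where 1: "a \<in> R" "b \<in> R" "x = \<psi> a" "y = \<psi> b" by auto
  have "x + y = \<psi> (a + b)" "x * y = \<psi> (a * b)" using 1 \<psi> by (auto simp: hom_add hom_mult)
  then show "inv_into R \<psi> (x + y) = inv_into R \<psi> x + inv_into R \<psi> y"
    "inv_into R \<psi> (x * y) = inv_into R \<psi> x * inv_into R \<psi> y"
    using 1 R inj by (auto simp: inv_into_f_f subring_closed)
qed

text \<open>Injectivity keeps the images of denominators non-zero, and cross-multiplication shows
  that the fraction picked by \<open>SOME\<close> does not matter.\<close>

lemma hom_extend:
  fixes R :: "'a::field set" and \<psi> :: "'a \<Rightarrow> 'b::field"
  assumes \<psi>: "ring_hom_on R \<psi>" and R: "is_subring R" and inj: "inj_on \<psi> R"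
  obtains \<Psi> where "ring_hom_on (frac_field R) \<Psi>" "\<And>r. r \<in> R \<Longrightarrow> \<Psi> r = \<psi> r"
proof -
  define \<Psi> where "\<Psi> x = (SOME y. \<exists>a\<in>R. \<exists>b\<in>R. b \<noteq> 0 \<and> x = a / b \<and> y = \<psi> a / \<psi> b)" for x
  have nz: "\<psi> b \<noteq> 0 \<longleftrightarrow> b \<noteq> 0" if "b \<in> R" for b
    using inj that hom_zero[OF \<psi>] R by (metis inj_onD subring_zero)
  have eq: "\<Psi> (a / b) = \<psi> a / \<psi> b" if "a \<in> R" "b \<in> R" "b \<noteq> 0" for a b
  proof -
    have "\<exists>y. \<exists>c\<in>R. \<exists>d\<in>R. d \<noteq> 0 \<and> a / b = c / d \<and> y = \<psi> c / \<psi> d" using that by blast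
    from someI_ex[OF this] obtain c d where 1: "c \<in> R" "d \<in> R" "d \<noteq> 0" "a / b = c / d" "\<Psi> (a / b) = \<psi> c / \<psi> d"
      unfolding \<Psi>_def by blast
    have "a * d = c * b" using 1 that by (simp add: field_simps)
    then have "\<psi> a * \<psi> d = \<psi> c * \<psi> b" using 1 that by (metis hom_mult[OF \<psi>])
    then show ?thesis using 1 that nz[of b] nz[of d] by (simp add: frac_eq_eq)
  qed
  have base: "\<Psi> r = \<psi> r" if "r \<in> R" for r
    using eq[of r 1] that R hom_one[OF \<psi>] by (simp add: subring_one)
  have "ring_hom_on (frac_field R) \<Psi>"
    unfolding ring_hom_on_def
  proof (intro conjI ballI)
    show "\<Psi> 1 = 1" using base[of 1] R hom_one[OF \<psi>] by (simp add: subring_one)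
    fix x y assume "x \<in> frac_field R" "y \<in> frac_field R"
    then obtain a b c d where 1: "a \<in> R" "b \<in> R" "b \<noteq> 0" "x = a / b" "c \<in> R" "d \<in> R" "d \<noteq> 0" "y = c / d"
      by (metis fracE)
    have 2: "x + y = (a * d + c * b) / (b * d)" "x * y = (a * c) / (b * d)" using 1 by (auto simp: field_simps)
    show "\<Psi> (x + y) = \<Psi> x + \<Psi> y" unfolding 2 using 1 R nz
      by (simp add: eq subring_closed hom_add[OF \<psi>] hom_mult[OF \<psi>] add_frac_eq)
    show "\<Psi> (x * y) = \<Psi> x * \<Psi> y" unfolding 2 using 1 R nz
      by (simp add: eq subring_closed hom_mult[OF \<psi>])
  qed
  then show ?thesis using base that by blast
qed

lemma hom_image_prime:
  assumes \<psi>: "ring_hom_on R \<psi>" and R: "is_subring R" and inj: "inj_on \<psi> R"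
    and P: "prime_ideal_of R P"
  shows "prime_ideal_of (\<psi> ` R) (\<psi> ` P)"
proof -
  note PD = prime_idealD[OF P]
  have mem: "\<psi> b \<in> \<psi> ` P \<longleftrightarrow> b \<in> P" if "b \<in> R" for b
    using inj that PD(1) by (auto dest: inj_onD)
  show ?thesis unfolding prime_ideal_of_def
  proof (intro conjI)
    show "\<psi> ` P \<subseteq> \<psi> ` R" using PD by auto
    show "0 \<in> \<psi> ` P" using PD(2) hom_zero[OF \<psi> subring_zero[OF R]] by force
    show "1 \<notin> \<psi> ` P" using PD(3) hom_one[OF \<psi>] R mem[of 1] by (simp add: subring_one)
    show "\<forall>a\<in>\<psi> ` P. \<forall>b\<in>\<psi> ` P. a + b \<in> \<psi> ` P"
    proof clarify
      fix a b assume "a \<in> P" "b \<in> P"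
      then have "\<psi> a + \<psi> b = \<psi> (a + b)" using PD(1) by (auto simp: hom_add[OF \<psi>] subset_iff)
      then show "\<psi> a + \<psi> b \<in> \<psi> ` P" using PD \<open>a \<in> P\<close> \<open>b \<in> P\<close> by auto
    qed
    show "\<forall>r\<in>\<psi> ` R. \<forall>a\<in>\<psi> ` P. r * a \<in> \<psi> ` P"
    proof clarify
      fix a b assume "a \<in> R" "b \<in> P"
      then have "\<psi> a * \<psi> b = \<psi> (a * b)" using PD(1) by (auto simp: hom_mult[OF \<psi>] subset_iff)
      then show "\<psi> a * \<psi> b \<in> \<psi> ` P" using PD \<open>a \<in> R\<close> \<open>b \<in> P\<close> by auto
    qed
    have "\<psi> a \<in> \<psi> ` P \<or> \<psi> b \<in> \<psi> ` P" if 1: "a \<in> R" "b \<in> R" "\<psi> a * \<psi> b \<in> \<psi> ` P" for a b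
    proof -
      have "\<psi> (a * b) \<in> \<psi> ` P" using 1 by (simp add: hom_mult[OF \<psi>])
      then show ?thesis using 1 PD(7)[of a b] mem[of "a * b"] R by (auto simp: subring_mult)
    qed
    then show "\<forall>a\<in>\<psi> ` R. \<forall>b\<in>\<psi> ` R. a * b \<in> \<psi> ` P \<longrightarrow> a \<in> \<psi> ` P \<or> b \<in> \<psi> ` P" by blast
  qed
qed

lemma hom_primes_bij:
  assumes \<psi>: "ring_hom_on R \<psi>" and R: "is_subring R" and inj: "inj_on \<psi> R"
  shows "bij_betw (image \<psi>) (Collect (prime_ideal_of R)) (Collect (prime_ideal_of (\<psi> ` R)))"
proof (rule bij_betw_byWitness[where f' = "image (inv_into R \<psi>)"])
  have sub: "P \<subseteq> R" if "prime_ideal_of R P" for P using that by (rule prime_idealD)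
  show "\<forall>a\<in>Collect (prime_ideal_of R). inv_into R \<psi> ` \<psi> ` a = a"
    using sub inj by (auto intro: inv_into_image_cancel)
  show "\<forall>a'\<in>Collect (prime_ideal_of (\<psi> ` R)). \<psi> ` inv_into R \<psi> ` a' = a'"
    by (metis (no_types) image_inv_into_cancel mem_Collect_eq prime_idealD(1))
  show "image \<psi> ` Collect (prime_ideal_of R) \<subseteq> Collect (prime_ideal_of (\<psi> ` R))"
    using assms by (auto intro: hom_image_prime)
  have "prime_ideal_of (inv_into R \<psi> ` \<psi> ` R) (inv_into R \<psi> ` Q)" if "prime_ideal_of (\<psi> ` R) Q" for Q
    using that by (intro hom_image_prime hom_inv_into hom_image_subring inj_on_inv_into assms) auto
  then show "image (inv_into R \<psi>) ` Collect (prime_ideal_of (\<psi> ` R)) \<subseteq> Collect (prime_ideal_of R)"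
    using inj by (auto simp: inv_into_image_cancel)
qed

section \<open>Generated algebras\<close>

lemma subring_generated:
  assumes "ring_hom_on UNIV s"
  shows "is_algebra s (algebra_generated s G)"
proof -
  let ?F = "{R. is_algebra s R \<and> G \<subseteq> R}"
  have "is_algebra s UNIV" using assms by (auto simp: is_algebra_def is_subring_def)
  then show ?thesis using assms
    unfolding algebra_generated_def is_algebra_def is_subring_def by blast
qed

lemma generated_incl: "G \<subseteq> algebra_generated s G"
  by (auto simp: algebra_generated_def)

lemma generated_least: "is_algebra s R \<Longrightarrow> G \<subseteq> R \<Longrightarrow> algebra_generated s G \<subseteq> R"
  by (auto simp: algebra_generated_def)

lemma generated_mono: "G \<subseteq> G' \<Longrightarrow> algebra_generated s G \<subseteq> algebra_generated s G'"
  by (auto simp: algebra_generated_def)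

lemma generated_idem: "ring_hom_on UNIV s \<Longrightarrow> G \<subseteq> algebra_generated s G' \<Longrightarrow>
   algebra_generated s G \<subseteq> algebra_generated s G'"
  by (intro generated_least subring_generated)

text \<open>The image lies in the algebra generated by the images by pulling back: the elements of
  the source that are mapped into that algebra form an algebra containing \<open>G\<close>.\<close>

lemma generated_image:
  assumes s: "ring_hom_on UNIV s" and \<psi>: "ring_hom_on (algebra_generated s G) \<psi>"
    and s': "\<And>c. \<psi> (s c) = s' c"
  shows "\<psi> ` algebra_generated s G = algebra_generated s' (\<psi> ` G)" "ring_hom_on UNIV s'"
proof -
  let ?R = "algebra_generated s G"
  have R: "is_subring ?R" "range s \<subseteq> ?R" using subring_generated[OF s] by (auto simp: is_algebra_def)
  show hs': "ring_hom_on UNIV s'"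
    unfolding ring_hom_on_def s'[symmetric]
    using s hom_add[OF \<psi> rangeI[THEN subsetD[OF R(2)]] rangeI[THEN subsetD[OF R(2)]]]
      hom_mult[OF \<psi> rangeI[THEN subsetD[OF R(2)]] rangeI[THEN subsetD[OF R(2)]]] hom_one[OF \<psi>]
    by (auto simp: ring_hom_on_def)
  show "\<psi> ` ?R = algebra_generated s' (\<psi> ` G)"
  proof
    have "is_algebra s' (\<psi> ` ?R)" using hs' hom_image_subring[OF \<psi> R(1)] R(2)
      by (auto simp: is_algebra_def s'[symmetric])
    then show "algebra_generated s' (\<psi> ` G) \<subseteq> \<psi> ` ?R"
      using generated_incl[of G s] by (intro generated_least) auto
    let ?E = "algebra_generated s' (\<psi> ` G)" and ?W = "{r \<in> ?R. \<psi> r \<in> algebra_generated s' (\<psi> ` G)}"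
    have E: "is_subring ?E" "range s' \<subseteq> ?E" using subring_generated[OF hs'] by (auto simp: is_algebra_def)
    have "is_subring ?W"
      unfolding is_subring_def
      by (simp add: subring_zero subring_one subring_diff subring_mult R(1) E(1) hom_zero[OF \<psi>]
        hom_one[OF \<psi>] hom_diff[OF \<psi>] hom_mult[OF \<psi>])
    then have "is_algebra s ?W"
      using s R(2) E(2) by (auto simp: is_algebra_def s')
    moreover have "G \<subseteq> ?W" using generated_incl[of G s] generated_incl[of "\<psi> ` G" s'] by auto
    ultimately have "?R \<subseteq> ?W" by (rule generated_least)
    then show "\<psi> ` ?R \<subseteq> ?E" by auto
  qed
qed

lemma affine_algebra_image:
  assumes "affine_algebra s R" "ring_hom_on R \<psi>" "\<And>c. \<psi> (s c) = s' c"
  shows "affine_algebra s' (\<psi> ` R)"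
proof -
  obtain G where G: "finite G" "R = algebra_generated s G" and s: "ring_hom_on UNIV s"
    using assms(1) by (auto simp: affine_algebra_def is_algebra_def)
  have "\<psi> ` R = algebra_generated s' (\<psi> ` G)" "ring_hom_on UNIV s'"
    using generated_image[of s G \<psi> s'] s assms(2,3) G by auto
  then show ?thesis using G(1) subring_generated unfolding affine_algebra_def by (metis finite_imageI)
qed

lemma affine_algebra_finite_ext:
  assumes "affine_algebra s R" "finite F"
  shows "affine_algebra s (algebra_generated s (R \<union> F))"
proof -
  obtain G where G: "finite G" "R = algebra_generated s G" and s: "ring_hom_on UNIV s"
    using assms(1) by (auto simp: affine_algebra_def is_algebra_def)
  have "algebra_generated s (R \<union> F) = algebra_generated s (G \<union> F)"
  proof
    show "algebra_generated s (R \<union> F) \<subseteq> algebra_generated s (G \<union> F)"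
      using G generated_incl generated_mono[of G "G \<union> F" s] generated_incl[of "G \<union> F" s]
      by (intro generated_idem[OF s]) auto
    show "algebra_generated s (G \<union> F) \<subseteq> algebra_generated s (R \<union> F)"
      using G generated_incl[of G s] by (intro generated_mono) auto
  qed
  then show ?thesis using subring_generated[OF s] G(1) assms(2) unfolding affine_algebra_def
    by (metis finite_UnI)
qed

section \<open>Affine models\<close>

text \<open>In general the generating family is only a subbasis; the hypothesis \<open>int\<close>
  on pairwise intersections makes it a basis, by induction on the generation of the open
  set.\<close>

lemma generated_topology_basis:
  assumes "openin (topology_generated_by \<S>) U" "x \<in> U"
    and int: "\<And>A B y. A \<in> \<S> \<Longrightarrow> B \<in> \<S> \<Longrightarrow> y \<in> A \<Longrightarrow> y \<in> B \<Longrightarrow> \<exists>C\<in>\<S>. y \<in> C \<and> C \<subseteq> A \<inter> B"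
  shows "\<exists>C\<in>\<S>. x \<in> C \<and> C \<subseteq> U"
proof -
  have "generate_topology_on \<S> U" using assms(1) by (simp add: openin_topology_generated_by_iff)
  then have "\<forall>x\<in>U. \<exists>C\<in>\<S>. x \<in> C \<and> C \<subseteq> U"
  proof induction
    case Empty show ?case by simp
  next
    case (Int a b)
    show ?case
    proof
      fix x assume "x \<in> a \<inter> b"
      then obtain A B where 1: "A \<in> \<S>" "x \<in> A" "A \<subseteq> a" "B \<in> \<S>" "x \<in> B" "B \<subseteq> b" using Int by blast
      then obtain C where "C \<in> \<S>" "x \<in> C" "C \<subseteq> A \<inter> B" using int by blast
      then show "\<exists>C\<in>\<S>. x \<in> C \<and> C \<subseteq> a \<inter> b" using 1 by blast
    qed
  next
    case (UN K)
    show ?case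
    proof
      fix x assume "x \<in> \<Union>K"
      then obtain k where k: "k \<in> K" "x \<in> k" by blast
      then obtain C where "C \<in> \<S>" "x \<in> C" "C \<subseteq> k" using UN(2)[OF k(1)] by blast
      then show "\<exists>C\<in>\<S>. x \<in> C \<and> C \<subseteq> \<Union>K" using k(1) by blast
    qed
  next
    case (Basis s) then show ?case by auto
  qed
  then show ?thesis using assms(2) by blast
qed

text \<open>Both bases are indexed by the same set and given by predicates on points, so the
  bijection has to be compared with them only pointwise. In the application the index is a ring
  element and the predicate says that it lies outside the prime of the point.\<close>

lemma homeomorphic_map_of_bases:
  assumes bij: "bij_betw F (topspace T) (topspace T')"
    and op: "\<And>i. i \<in> I \<Longrightarrow> openin T {x \<in> topspace T. W i x}"
    and bs: "\<And>U x. openin T U \<Longrightarrow> x \<in> U \<Longrightarrow> \<exists>i\<in>I. W i x \<and> {y \<in> topspace T. W i y} \<subseteq> U"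
    and op': "\<And>i. i \<in> I \<Longrightarrow> openin T' {x \<in> topspace T'. W' i x}"
    and bs': "\<And>U x. openin T' U \<Longrightarrow> x \<in> U \<Longrightarrow> \<exists>i\<in>I. W' i x \<and> {y \<in> topspace T'. W' i y} \<subseteq> U"
    and eq: "\<And>i x. i \<in> I \<Longrightarrow> x \<in> topspace T \<Longrightarrow> W' i (F x) \<longleftrightarrow> W i x"
  shows "homeomorphic_map T T' F"
proof (rule bijective_open_imp_homeomorphic_map)
  have im: "F ` topspace T = topspace T'" and inj: "inj_on F (topspace T)"
    using bij by (auto simp: bij_betw_def)
  show "F ` topspace T = topspace T'" "inj_on F (topspace T)" by fact+
  show "continuous_map T T' F"
    unfolding continuous_map_def
  proof (intro conjI allI impI)
    show "F \<in> topspace T \<rightarrow> topspace T'" using im by auto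
    fix U assume U: "openin T' U"
    show "openin T {x \<in> topspace T. F x \<in> U}"
    proof (subst openin_subopen, intro ballI)
      fix x assume x: "x \<in> {x \<in> topspace T. F x \<in> U}"
      then obtain i where i: "i \<in> I" "W' i (F x)" "{y \<in> topspace T'. W' i y} \<subseteq> U" using bs'[OF U] by blast
      have "x \<in> {y \<in> topspace T. W i y}" using x i eq by auto
      moreover have "{y \<in> topspace T. W i y} \<subseteq> {x \<in> topspace T. F x \<in> U}"
      proof
        fix y assume y: "y \<in> {y \<in> topspace T. W i y}"
        then have "F y \<in> topspace T'" using im by blast
        then show "y \<in> {x \<in> topspace T. F x \<in> U}" using y i eq[OF i(1), of y] by blast
      qed
      ultimately show "\<exists>S. openin T S \<and> x \<in> S \<and> S \<subseteq> {x \<in> topspace T. F x \<in> U}" using op i(1) by blast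
    qed
  qed
  show "open_map T T' F"
    unfolding open_map_def
  proof (intro allI impI)
    fix U assume U: "openin T U"
    show "openin T' (F ` U)"
    proof (subst openin_subopen, intro ballI)
      fix z assume "z \<in> F ` U"
      then obtain x where x: "x \<in> U" "z = F x" by auto
      have Us: "U \<subseteq> topspace T" using U by (rule openin_subset)
      obtain i where i: "i \<in> I" "W i x" "{y \<in> topspace T. W i y} \<subseteq> U" using bs[OF U x(1)] by blast
      have xT: "x \<in> topspace T" using x Us by blast
      then have "F x \<in> topspace T'" using im by blast
      then have "z \<in> {y \<in> topspace T'. W' i y}" using x i eq xT by simp
      moreover have "{y \<in> topspace T'. W' i y} \<subseteq> F ` U"
      proof
        fix w assume w: "w \<in> {y \<in> topspace T'. W' i y}"
        then have "w \<in> F ` topspace T" using im by simp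
        then obtain y where y: "y \<in> topspace T" "w = F y" by blast
        then show "w \<in> F ` U" using w i eq[OF i(1) y(1)] by blast
      qed
      ultimately show "\<exists>S. openin T' S \<and> z \<in> S \<and> S \<subseteq> F ` U" using op' i(1) by blast
    qed
  qed
qed

text \<open>\<open>X\<close> is isomorphic to the spectrum of \<open>C\<close> through \<open>\<phi>\<close> on points and the identity on
  functions.\<close>

definition affine_model :: "('k, 'p, 'f::field) scheme \<Rightarrow> 'f set \<Rightarrow> ('p \<Rightarrow> 'f set) \<Rightarrow> bool" where
  "affine_model X C \<phi> \<longleftrightarrow> is_subring C \<and>
     bij_betw \<phi> (points X) (Collect (prime_ideal_of C)) \<and>
     (\<forall>x\<in>points X. stalk X x = localization C (\<phi> x)) \<and>
     (\<forall>f\<in>C. openin (zariski X) {x\<in>points X. f \<notin> \<phi> x}) \<and>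
     (\<forall>U x. openin (zariski X) U \<longrightarrow> x \<in> U \<longrightarrow>
        (\<exists>f\<in>C. f \<notin> \<phi> x \<and> {y\<in>points X. f \<notin> \<phi> y} \<subseteq> U))"

lemma affine_modelD:
  assumes "affine_model X C \<phi>"
  shows "is_subring C" "bij_betw \<phi> (points X) (Collect (prime_ideal_of C))"
    "x \<in> points X \<Longrightarrow> stalk X x = localization C (\<phi> x)"
    "x \<in> points X \<Longrightarrow> prime_ideal_of C (\<phi> x)"
    "f \<in> C \<Longrightarrow> openin (zariski X) {x\<in>points X. f \<notin> \<phi> x}"
    "openin (zariski X) U \<Longrightarrow> x \<in> U \<Longrightarrow> \<exists>f\<in>C. f \<notin> \<phi> x \<and> {y\<in>points X. f \<notin> \<phi> y} \<subseteq> U"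
    "prime_ideal_of C P \<Longrightarrow> \<exists>x\<in>points X. \<phi> x = P"
    "x \<in> points X \<Longrightarrow> y \<in> points X \<Longrightarrow> \<phi> x = \<phi> y \<Longrightarrow> x = y"
proof -
  note a = assms[unfolded affine_model_def]
  note a2 = a[THEN conjunct2] note a3 = a2[THEN conjunct2] note a4 = a3[THEN conjunct2]
  show b: "bij_betw \<phi> (points X) (Collect (prime_ideal_of C))" by (rule a2[THEN conjunct1])
  have bij: "inj_on \<phi> (points X)" "\<phi> ` points X = Collect (prime_ideal_of C)"
    using b unfolding bij_betw_def by blast+
  show "is_subring C" by (rule a[THEN conjunct1])
  show "x \<in> points X \<Longrightarrow> stalk X x = localization C (\<phi> x)" by (rule bspec[OF a3[THEN conjunct1]])
  show "f \<in> C \<Longrightarrow> openin (zariski X) {x\<in>points X. f \<notin> \<phi> x}" by (rule bspec[OF a4[THEN conjunct1]])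
  show "openin (zariski X) U \<Longrightarrow> x \<in> U \<Longrightarrow> \<exists>f\<in>C. f \<notin> \<phi> x \<and> {y\<in>points X. f \<notin> \<phi> y} \<subseteq> U"
    by (rule a4[THEN conjunct2, rule_format])
  show "x \<in> points X \<Longrightarrow> prime_ideal_of C (\<phi> x)" using bij(2) by blast
  show "\<exists>x\<in>points X. \<phi> x = P" if "prime_ideal_of C P"
  proof -
    have "P \<in> \<phi> ` points X" using that bij(2) by simp
    then show ?thesis by blast
  qed
  show "x \<in> points X \<Longrightarrow> y \<in> points X \<Longrightarrow> \<phi> x = \<phi> y \<Longrightarrow> x = y" using bij(1) by (rule inj_onD)
qed

lemma points_Spec: "is_subring R \<Longrightarrow> points (Spec s R) = Collect (prime_ideal_of R)"
  using subring_one[of R] prime_idealD(3)[of R] by (auto simp: Spec_def)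

lemma stalk_Spec: "stalk (Spec s R) = localization R"
  and scal_Spec: "scal (Spec s R) = s"
  by (simp_all add: Spec_def)

lemma affine_model_Spec:
  assumes R: "is_subring R"
  shows "affine_model (Spec s R) R (\<lambda>P. P)"
  unfolding affine_model_def points_Spec[OF R] stalk_Spec
proof (intro conjI ballI allI impI)
  let ?S = "{{P. prime_ideal_of R P \<and> f \<notin> P} |f. f \<in> R}"
  have z: "zariski (Spec s R) = topology_generated_by ?S" by (simp add: Spec_def)
  show "is_subring R" by fact
  show "bij_betw (\<lambda>P. P) (Collect (prime_ideal_of R)) (Collect (prime_ideal_of R))"
    by (simp add: bij_betw_def)
  show "localization R x = localization R x" for x ..
  fix f assume f: "f \<in> R"
  have "{P. prime_ideal_of R P \<and> f \<notin> P} \<in> ?S" using f by blast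
  then have "openin (topology_generated_by ?S) {P. prime_ideal_of R P \<and> f \<notin> P}"
    by (rule topology_generated_by_Basis)
  then show "openin (zariski (Spec s R)) {x \<in> Collect (prime_ideal_of R). f \<notin> x}"
    unfolding z by simp
next
  let ?S = "{{P. prime_ideal_of R P \<and> f \<notin> P} |f. f \<in> R}"
  fix U x assume U: "openin (zariski (Spec s R)) U" "x \<in> U"
  have "\<exists>C\<in>?S. x \<in> C \<and> C \<subseteq> U"
  proof (rule generated_topology_basis)
    show "openin (topology_generated_by ?S) U" using U by (simp add: Spec_def)
    show "x \<in> U" by fact
    fix A B y assume AB: "A \<in> ?S" "B \<in> ?S" "y \<in> A" "y \<in> B"
    then obtain f g where fg: "f \<in> R" "g \<in> R" "A = {P. prime_ideal_of R P \<and> f \<notin> P}" "B = {P. prime_ideal_of R P \<and> g \<notin> P}"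
      by blast
    have "f * g \<notin> P \<longleftrightarrow> f \<notin> P \<and> g \<notin> P" if "prime_ideal_of R P" for P
      using prime_idealD(5-7)[OF that] fg(1,2) by metis
    then have "{P. prime_ideal_of R P \<and> f * g \<notin> P} = A \<inter> B" unfolding fg(3,4) by auto
    moreover have "{P. prime_ideal_of R P \<and> f * g \<notin> P} \<in> ?S" using fg(1,2) subring_mult[OF R] by blast
    ultimately show "\<exists>C\<in>?S. y \<in> C \<and> C \<subseteq> A \<inter> B" using AB(3,4) by auto
  qed
  then show "\<exists>f\<in>R. f \<notin> x \<and> {y \<in> Collect (prime_ideal_of R). f \<notin> y} \<subseteq> U" by auto
qed

lemma model_generic_point:
  assumes "affine_model X C \<phi>"
  obtains x where "x \<in> points X" "\<phi> x = {0}"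
  using affine_modelD(7)[OF assms prime_ideal_zero] affine_modelD(1)[OF assms] by blast

text \<open>Sections are an intersection of stalks, so this is \<open>inter_localizations\<close>
  reindexed along \<open>\<phi>\<close>.\<close>

lemma model_sections:
  assumes m: "affine_model X C \<phi>"
  shows "sections X (points X) = C"
proof -
  have "sections X (points X) = (\<Inter>P\<in>\<phi> ` points X. localization C P)"
    using affine_modelD(3)[OF m] by (auto simp: sections_def)
  also have "\<phi> ` points X = Collect (prime_ideal_of C)"
    using affine_modelD(2)[OF m] by (simp add: bij_betw_def)
  finally show ?thesis using inter_localizations[OF affine_modelD(1)[OF m]] by simp
qed

lemma model_function_field:
  assumes m: "affine_model X C \<phi>"
  shows "function_field X = frac_field C"
proof -
  obtain x where x: "x \<in> points X" "\<phi> x = {0}" by (rule model_generic_point[OF m])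
  then have "stalk X x = frac_field C" using affine_modelD(3)[OF m] localization_zero by metis
  moreover have "stalk X y \<subseteq> frac_field C" if "y \<in> points X" for y
    using affine_modelD(3,4)[OF m that] localization_subset_frac by simp
  ultimately show ?thesis using x(1) unfolding function_field_def by blast
qed

lemma model_max_ideal:
  assumes m: "affine_model X C \<phi>" and "x \<in> points X" "r \<in> C"
  shows "r \<in> max_ideal (stalk X x) \<longleftrightarrow> r \<in> \<phi> x"
  using localization_unit_iff[OF affine_modelD(1)[OF m] affine_modelD(4)[OF m]] affine_modelD(3)[OF m] assms(2,3)
  by metis

lemma model_subset_stalk: "affine_model X C \<phi> \<Longrightarrow> x \<in> points X \<Longrightarrow> C \<subseteq> stalk X x"
  using affine_modelD(1,3,4)[of X C \<phi>] localization_base[of C "\<phi> x"] by auto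

text \<open>For affine schemes the data of \<open>isomorphic\<close> come from a ring isomorphism:
  primes are sent to their images, which matches basic open sets, and localizations follow. The map
  is required on the field of fractions because stalks are compared there.\<close>

lemma isomorphic_of_models:
  assumes X: "affine_model X C \<phi>" and X': "affine_model X' C' \<phi>'"
    and \<Psi>: "ring_hom_on (frac_field C) \<Psi>" and im: "\<Psi> ` C = C'"
    and sc: "\<And>c. \<Psi> (scal X c) = scal X' c"
  shows "isomorphic X X'"
proof -
  note D = affine_modelD[OF X] and D' = affine_modelD[OF X']
  have inj: "inj_on \<Psi> (frac_field C)" using hom_frac_inj[OF \<Psi> D(1)] .
  have CF: "C \<subseteq> frac_field C" using frac_base[OF D(1)] by blast
  have injC: "inj_on \<Psi> C" using inj CF by (rule inj_on_subset)
  have b: "bij_betw (image \<Psi>) (Collect (prime_ideal_of C)) (Collect (prime_ideal_of C'))"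
    using hom_primes_bij[OF hom_subset[OF \<Psi> CF] D(1) injC] im by simp
  define F where "F = inv_into (points X') \<phi>' \<circ> (image \<Psi> \<circ> \<phi>)"
  have bF: "bij_betw F (points X) (points X')"
    unfolding F_def using bij_betw_trans[OF bij_betw_trans[OF D(2) b] bij_betw_inv_into[OF D'(2)]] .
  have F: "F x \<in> points X'" "\<phi>' (F x) = \<Psi> ` \<phi> x" if "x \<in> points X" for x
  proof -
    show "F x \<in> points X'" using bF that by (auto simp: bij_betw_def)
    have "\<Psi> ` \<phi> x \<in> Collect (prime_ideal_of C')" using b D(4)[OF that] by (auto simp: bij_betw_def)
    then show "\<phi>' (F x) = \<Psi> ` \<phi> x" unfolding F_def
      using D'(2) by (auto simp: bij_betw_def f_inv_into_f)
  qed
  have mem: "\<Psi> f \<in> \<Psi> ` \<phi> x \<longleftrightarrow> f \<in> \<phi> x" if "f \<in> C" "x \<in> points X" for f x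
    using injC that prime_idealD(1)[OF D(4)[OF that(2)]] by (meson inj_on_image_mem_iff)
  have "homeomorphic_map (zariski X) (zariski X') F"
  proof (rule homeomorphic_map_of_bases[where I = C and W = "\<lambda>f x. f \<notin> \<phi> x" and W' = "\<lambda>f x. \<Psi> f \<notin> \<phi>' x"])
    show "bij_betw F (points X) (points X')" by fact
    show "openin (zariski X) {x \<in> points X. i \<notin> \<phi> x}" if "i \<in> C" for i using D(5) that .
    show "openin (zariski X') {x \<in> points X'. \<Psi> i \<notin> \<phi>' x}" if "i \<in> C" for i using D'(5) that im by blast
    show "\<exists>i\<in>C. i \<notin> \<phi> x \<and> {y \<in> points X. i \<notin> \<phi> y} \<subseteq> U" if "openin (zariski X) U" "x \<in> U" for U x
      using D(6) that .
    show "\<exists>i\<in>C. \<Psi> i \<notin> \<phi>' x \<and> {y \<in> points X'. \<Psi> i \<notin> \<phi>' y} \<subseteq> U" if "openin (zariski X') U" "x \<in> U" for U x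
      using D'(6)[OF that] im by blast
    show "(\<Psi> i \<notin> \<phi>' (F x)) = (i \<notin> \<phi> x)" if "i \<in> C" "x \<in> points X" for i x
      using F(2)[OF that(2)] mem[OF that] by simp
  qed
  moreover have "bij_betw \<Psi> (function_field X) (function_field X')"
    unfolding model_function_field[OF X] model_function_field[OF X'] bij_betw_def
    using inj hom_image_frac[OF \<Psi> D(1)] im by simp
  moreover have "\<Psi> ` stalk X x = stalk X' (F x)" if "x \<in> points X" for x
    using hom_image_localization[OF \<Psi> D(1) prime_idealD(1)[OF D(4)[OF that]]] im
      D(3)[OF that] D'(3)[OF F(1)[OF that]] F(2)[OF that] by simp
  ultimately show ?thesis unfolding isomorphic_def model_function_field[OF X]
    by (intro exI[of _ F] exI[of _ \<Psi>] conjI ballI allI sc \<Psi>)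
qed

lemma affine_model_transport:
  assumes X: "affine_model X C \<phi>" and iso: "isomorphic X X'"
  obtains \<psi> \<phi>' where "ring_hom_on (frac_field C) \<psi>" "\<And>c. \<psi> (scal X c) = scal X' c"
    "affine_model X' (\<psi> ` C) \<phi>'"
proof -
  note D = affine_modelD[OF X]
  obtain F \<psi> where F: "homeomorphic_map (zariski X) (zariski X') F"
    and bij: "bij_betw \<psi> (frac_field C) (function_field X')"
    and \<psi>: "ring_hom_on (frac_field C) \<psi>" and sc: "\<And>c. \<psi> (scal X c) = scal X' c"
    and st: "\<And>x. x \<in> points X \<Longrightarrow> \<psi> ` stalk X x = stalk X' (F x)"
    using iso unfolding isomorphic_def model_function_field[OF X] by blast
  have bF: "bij_betw F (points X) (points X')"
    using F by (auto simp: bij_betw_def homeomorphic_imp_surjective_map homeomorphic_imp_injective_map)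
  have CF: "C \<subseteq> frac_field C" using frac_base[OF D(1)] by blast
  have injC: "inj_on \<psi> C" using hom_frac_inj[OF \<psi> D(1)] CF by (rule inj_on_subset)
  have b: "bij_betw (image \<psi>) (Collect (prime_ideal_of C)) (Collect (prime_ideal_of (\<psi> ` C)))"
    using hom_primes_bij[OF hom_subset[OF \<psi> CF] D(1) injC] .
  define \<phi>' where "\<phi>' = image \<psi> \<circ> (\<phi> \<circ> inv_into (points X) F)"
  have \<phi>': "\<phi>' (F x) = \<psi> ` \<phi> x" if "x \<in> points X" for x
    using that bF by (simp add: \<phi>'_def bij_betw_def)
  have mem: "\<psi> f \<in> \<psi> ` \<phi> x \<longleftrightarrow> f \<in> \<phi> x" if "f \<in> C" "x \<in> points X" for f x
    using injC that prime_idealD(1)[OF D(4)[OF that(2)]] by (meson inj_on_image_mem_iff)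
  have im: "points X' = F ` points X" using bF by (simp add: bij_betw_def)
  have FD: "F ` {x \<in> points X. f \<notin> \<phi> x} = {y \<in> points X'. \<psi> f \<notin> \<phi>' y}" if "f \<in> C" for f
    using mem[OF that] \<phi>' im by auto
  have "affine_model X' (\<psi> ` C) \<phi>'"
    unfolding affine_model_def
  proof (intro conjI ballI allI impI)
    show "is_subring (\<psi> ` C)" using hom_image_subring[OF hom_subset[OF \<psi> CF] D(1)] .
    show "bij_betw \<phi>' (points X') (Collect (prime_ideal_of (\<psi> ` C)))"
      unfolding \<phi>'_def by (intro bij_betw_trans[OF bij_betw_trans[OF bij_betw_inv_into[OF bF] D(2)] b])
    fix y assume "y \<in> points X'"
    then obtain x where x: "x \<in> points X" "y = F x" using im by auto
    then show "stalk X' y = localization (\<psi> ` C) (\<phi>' y)"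
      using st[OF x(1)] D(3)[OF x(1)] \<phi>'[OF x(1)]
        hom_image_localization[OF \<psi> D(1) prime_idealD(1)[OF D(4)[OF x(1)]]] by simp
  next
    fix g assume "g \<in> \<psi> ` C"
    then obtain f where f: "f \<in> C" "g = \<psi> f" by auto
    have "openin (zariski X') (F ` {x \<in> points X. f \<notin> \<phi> x})"
      using homeomorphic_map_openness[OF F] D(5)[OF f(1)] openin_subset by blast
    then show "openin (zariski X') {x \<in> points X'. g \<notin> \<phi>' x}" using FD f by simp
  next
    fix U y assume U: "openin (zariski X') U" "y \<in> U"
    then have Us: "U \<subseteq> points X'" by (simp add: openin_subset)
    let ?V = "{x \<in> points X. F x \<in> U}"
    have "openin (zariski X) ?V"
      using F U(1) openin_continuous_map_preimage homeomorphic_imp_continuous_map by blast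
    moreover obtain x where x: "x \<in> points X" "y = F x" using U Us im by auto
    ultimately obtain f where f: "f \<in> C" "f \<notin> \<phi> x" "{y \<in> points X. f \<notin> \<phi> y} \<subseteq> ?V"
      using D(6)[of ?V x] U(2) by blast
    have "F ` {y \<in> points X. f \<notin> \<phi> y} \<subseteq> U" using f(3) by auto
    then have "{y \<in> points X'. \<psi> f \<notin> \<phi>' y} \<subseteq> U" using FD[OF f(1)] by simp
    then show "\<exists>f\<in>\<psi> ` C. f \<notin> \<phi>' y \<and> {y \<in> points X'. f \<notin> \<phi>' y} \<subseteq> U"
      using f(1,2) x(2) \<phi>'[OF x(1)] mem[OF f(1) x(1)] by (intro bexI[of _ "\<psi> f"]) simp_all
  qed
  then show ?thesis using that \<psi> sc by blast
qed

lemma affine_variety_of_model: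
  assumes X: "affine_model X C \<phi>" and aff: "affine_algebra (scal X) C"
  shows "affine_variety X"
proof -
  have "isomorphic X (Spec (scal X) C)"
    by (rule isomorphic_of_models[OF X affine_model_Spec[OF affine_modelD(1)[OF X]], where \<Psi> = "\<lambda>x. x"])
       (auto simp: ring_hom_on_def scal_Spec)
  then show ?thesis using aff by (simp add: affine_variety_def model_sections[OF X])
qed

text \<open>\<open>isomorphic\<close> does not require the function field of its first argument to be closed under
  the field operations, so that the functions of an affine variety \<open>X\<close> need not be fractions of
  global sections; only their images under \<open>\<psi>\<close> are.\<close>

lemma affine_variety_normal_form:
  assumes X: "affine_variety X" and T_def: "T = sections X (points X)"
  obtains \<phi> \<psi> where "is_subring T" "T \<subseteq> function_field X"
    "bij_betw \<phi> (points X) (Collect (prime_ideal_of T))"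
    "\<And>f. f \<in> T \<Longrightarrow> openin (zariski X) {x\<in>points X. f \<notin> \<phi> x}"
    "\<And>U x. openin (zariski X) U \<Longrightarrow> x \<in> U \<Longrightarrow> \<exists>f\<in>T. f \<notin> \<phi> x \<and> {y\<in>points X. f \<notin> \<phi> y} \<subseteq> U"
    "bij_betw \<psi> (function_field X) (frac_field T)" "ring_hom_on (function_field X) \<psi>"
    "\<And>t. t \<in> T \<Longrightarrow> \<psi> t = t" "\<And>x. x \<in> points X \<Longrightarrow> \<psi> ` stalk X x = localization T (\<phi> x)"
proof -
  have T: "is_subring T" using X by (auto simp: affine_variety_def affine_algebra_def is_algebra_def T_def)
  define Sp where "Sp = Spec (scal X) T"
  have Sp: "affine_model Sp T (\<lambda>P. P)" unfolding Sp_def by (rule affine_model_Spec[OF T])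
  note D = affine_modelD[OF Sp]
  have pSp: "points Sp = Collect (prime_ideal_of T)" unfolding Sp_def by (rule points_Spec[OF T])
  obtain F \<psi>0 where F: "homeomorphic_map (zariski X) (zariski Sp) F"
    and bij: "bij_betw \<psi>0 (function_field X) (frac_field T)"
    and \<psi>0: "ring_hom_on (function_field X) \<psi>0"
    and st: "\<And>x. x \<in> points X \<Longrightarrow> \<psi>0 ` stalk X x = localization T (F x)"
    using X unfolding affine_variety_def isomorphic_def T_def[symmetric] Sp_def[symmetric]
      model_function_field[OF Sp] by (auto simp: Sp_def stalk_Spec)
  have bF: "bij_betw F (points X) (Collect (prime_ideal_of T))"
    using F pSp by (auto simp: bij_betw_def homeomorphic_imp_surjective_map homeomorphic_imp_injective_map)
  have stF: "stalk X x \<subseteq> function_field X" if "x \<in> points X" for x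
    using that by (auto simp: function_field_def)
  have "prime_ideal_of T {0}" using T by (rule prime_ideal_zero)
  then obtain x0 where x0: "x0 \<in> points X" using bF by (auto simp: bij_betw_def)
  have TF: "T \<subseteq> function_field X" using stF[OF x0] x0 by (auto simp: T_def sections_def)
  \<comment> \<open>An injective map commutes with the intersection of stalks that defines
    \<open>T\<close>, and the images of the stalks are all the localizations of
    \<open>T\<close>.\<close>
  have "\<psi>0 ` T = (\<Inter>x\<in>points X. \<psi>0 ` stalk X x)"
    unfolding T_def sections_def
    by (rule image_INT[of _ "function_field X"]) (use bij x0 stF in \<open>auto simp: bij_betw_def\<close>)
  also have "\<dots> = (\<Inter>P\<in>F ` points X. localization T P)" using st by simp
  also have "F ` points X = Collect (prime_ideal_of T)" using bF by (simp add: bij_betw_def)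
  finally have imT: "\<psi>0 ` T = T" using inter_localizations[OF T] by simp
  have injT: "inj_on \<psi>0 T" using bij TF by (auto simp: bij_betw_def intro: inj_on_subset)
  \<comment> \<open>\<open>\<psi>0\<close> maps \<open>T\<close> onto itself but possibly not
    identically. Its restriction extends to an automorphism \<open>\<alpha>\<close> of the field of
    fractions, and composing points and functions with the inverse \<open>\<beta>\<close> makes the
    restriction to \<open>T\<close> the identity.\<close>
  obtain \<alpha> where \<alpha>: "ring_hom_on (frac_field T) \<alpha>" "\<And>r. r \<in> T \<Longrightarrow> \<alpha> r = \<psi>0 r"
    using hom_extend[OF hom_subset[OF \<psi>0 TF] T injT] by blast
  have TFr: "T \<subseteq> frac_field T" using frac_base[OF T] by blast
  have inj\<alpha>: "inj_on \<alpha> (frac_field T)" by (rule hom_frac_inj[OF \<alpha>(1) T])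
  have \<alpha>T: "\<alpha> ` T = T" using imT \<alpha>(2) by auto
  have \<alpha>F: "\<alpha> ` frac_field T = frac_field T" using hom_image_frac[OF \<alpha>(1) T] \<alpha>T by simp
  define \<beta> where "\<beta> = inv_into (frac_field T) \<alpha>"
  have \<beta>: "ring_hom_on (frac_field T) \<beta>"
    using hom_inv_into[OF \<alpha>(1) subring_frac[OF T] inj\<alpha>] \<alpha>F by (simp add: \<beta>_def)
  have \<beta>\<alpha>: "\<beta> (\<alpha> r) = r" if "r \<in> frac_field T" for r
    using inj\<alpha> that by (simp add: \<beta>_def)
  have \<beta>T: "\<beta> ` T = T"
  proof -
    have "\<beta> ` \<alpha> ` T = T" using \<beta>\<alpha> TFr by (force simp: image_image)
    then show ?thesis using \<alpha>T by simp
  qed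
  have b\<beta>: "bij_betw \<beta> (frac_field T) (frac_field T)"
    unfolding \<beta>_def using inj\<alpha> \<alpha>F by (metis bij_betw_def bij_betw_inv_into)
  define \<phi> where "\<phi> = image \<beta> \<circ> F"
  define \<psi> where "\<psi> = \<beta> \<circ> \<psi>0"
  have Fsub: "F x \<subseteq> T" if "x \<in> points X" for x
    using bF that prime_idealD(1) by (fastforce simp: bij_betw_def)
  have inj\<beta>T: "inj_on \<beta> T" using b\<beta> TFr by (auto simp: bij_betw_def intro: inj_on_subset)
  have mem: "f \<notin> \<phi> x \<longleftrightarrow> \<alpha> f \<notin> F x" if "f \<in> T" "x \<in> points X" for f x
  proof -
    have "\<alpha> f \<in> T" using \<alpha>T that by auto
    then have "\<beta> (\<alpha> f) \<in> \<beta> ` F x \<longleftrightarrow> \<alpha> f \<in> F x" using inj\<beta>T Fsub[OF that(2)] by (meson inj_on_image_mem_iff)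
    moreover have "\<beta> (\<alpha> f) = f" using \<beta>\<alpha> that(1) TFr by blast
    ultimately show ?thesis by (simp add: \<phi>_def)
  qed
  have op: "openin (zariski X) {x \<in> points X. g \<notin> F x}" if "g \<in> T" for g
  proof -
    have "openin (zariski X) {x \<in> points X. F x \<in> {y \<in> points Sp. g \<notin> y}}"
      using D(5)[OF that] F openin_continuous_map_preimage homeomorphic_imp_continuous_map by blast
    moreover have "{x \<in> points X. F x \<in> {y \<in> points Sp. g \<notin> y}} = {x \<in> points X. g \<notin> F x}"
      using bF pSp by (auto simp: bij_betw_def)
    ultimately show ?thesis by simp
  qed
  show ?thesis
  proof (rule that[of \<phi> \<psi>])
    show "is_subring T" "T \<subseteq> function_field X" by fact+
    show "bij_betw \<phi> (points X) (Collect (prime_ideal_of T))" unfolding \<phi>_def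
      using bij_betw_trans[OF bF hom_primes_bij[OF hom_subset[OF \<beta> TFr] T inj\<beta>T]] \<beta>T by simp
    show "openin (zariski X) {x \<in> points X. f \<notin> \<phi> x}" if f: "f \<in> T" for f
    proof -
      have "\<alpha> f \<in> T" using \<alpha>T f by auto
      moreover have "{x \<in> points X. f \<notin> \<phi> x} = {x \<in> points X. \<alpha> f \<notin> F x}" using mem[OF f] by auto
      ultimately show ?thesis using op by simp
    qed
    show "\<exists>f\<in>T. f \<notin> \<phi> x \<and> {y \<in> points X. f \<notin> \<phi> y} \<subseteq> U" if U: "openin (zariski X) U" "x \<in> U" for U x
    proof -
      have Us: "U \<subseteq> points X" using U by (simp add: openin_subset)
      have "openin (zariski Sp) (F ` U)" using homeomorphic_map_openness[OF F Us] U by simp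
      then obtain g where g: "g \<in> T" "g \<notin> F x" "{y \<in> points Sp. g \<notin> y} \<subseteq> F ` U"
        using D(6)[of "F ` U" "F x"] U by blast
      obtain f where f: "f \<in> T" "g = \<alpha> f" using \<alpha>T g(1) by blast
      have "y \<in> U" if y: "y \<in> points X" "f \<notin> \<phi> y" for y
      proof -
        have "F y \<in> F ` U" using mem[OF f(1) y(1)] y f(2) g(3) pSp bF by (auto simp: bij_betw_def)
        then show ?thesis using bF Us y(1) by (meson bij_betw_def inj_on_image_mem_iff)
      qed
      then have "{y \<in> points X. f \<notin> \<phi> y} \<subseteq> U" by blast
      moreover have "f \<notin> \<phi> x" using mem[OF f(1)] f(2) g(2) Us U(2) by blast
      ultimately show ?thesis using f(1) by blast
    qed
    show "bij_betw \<psi> (function_field X) (frac_field T)" unfolding \<psi>_def by (rule bij_betw_trans[OF bij b\<beta>])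
    have \<psi>0F: "\<psi>0 a \<in> frac_field T" if "a \<in> function_field X" for a using bij that by (auto simp: bij_betw_def)
    show "ring_hom_on (function_field X) \<psi>" unfolding ring_hom_on_def \<psi>_def
      using hom_one[OF \<psi>0] hom_add[OF \<psi>0] hom_mult[OF \<psi>0] hom_one[OF \<beta>] hom_add[OF \<beta>] hom_mult[OF \<beta>] \<psi>0F
      by simp
    show "\<psi> t = t" if "t \<in> T" for t using \<alpha>(2)[OF that] \<beta>\<alpha>[of t] that TFr by (auto simp: \<psi>_def)
    show "\<psi> ` stalk X x = localization T (\<phi> x)" if "x \<in> points X" for x
    proof -
      have "\<psi> ` stalk X x = \<beta> ` localization T (F x)" unfolding \<psi>_def image_comp[symmetric] st[OF that] ..
      then show ?thesis using hom_image_localization[OF \<beta> T Fsub[OF that]] \<beta>T by (simp add: \<phi>_def)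
    qed
  qed
qed

text \<open>With products available in the function field, \<open>\<psi>\<close> must be the
  identity: if \<open>\<psi> r = g / e\<close>, then \<open>r * e\<close> and \<open>g\<close> have
  the same image, so injectivity gives \<open>r * e = g\<close>. Hence the stalks themselves, not
  only their images, are localizations.\<close>

lemma affine_variety_model:
  assumes X: "affine_variety X" and K: "is_subring (function_field X)"
  obtains \<phi> where "affine_model X (sections X (points X)) \<phi>"
proof -
  define T where "T = sections X (points X)"
  obtain \<phi> \<psi> where 1: "is_subring T" "T \<subseteq> function_field X"
    "bij_betw \<phi> (points X) (Collect (prime_ideal_of T))"
    "\<And>f. f \<in> T \<Longrightarrow> openin (zariski X) {x\<in>points X. f \<notin> \<phi> x}"
    "\<And>U x. openin (zariski X) U \<Longrightarrow> x \<in> U \<Longrightarrow> \<exists>f\<in>T. f \<notin> \<phi> x \<and> {y\<in>points X. f \<notin> \<phi> y} \<subseteq> U"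
    and bij: "bij_betw \<psi> (function_field X) (frac_field T)" and \<psi>: "ring_hom_on (function_field X) \<psi>"
    and id: "\<And>t. t \<in> T \<Longrightarrow> \<psi> t = t" and st: "\<And>x. x \<in> points X \<Longrightarrow> \<psi> ` stalk X x = localization T (\<phi> x)"
    using affine_variety_normal_form[OF X T_def] by blast
  have "\<psi> r = r" if r: "r \<in> function_field X" for r
  proof -
    obtain g e where ge: "g \<in> T" "e \<in> T" "e \<noteq> 0" "\<psi> r = g / e"
      using bij r by (metis bij_betw_apply fracE)
    have "\<psi> (r * e) = \<psi> r * \<psi> e" using \<psi> r ge 1(2) by (intro hom_mult[OF \<psi>]) auto
    also have "\<dots> = \<psi> g" using ge id by simp
    finally have eq: "\<psi> (r * e) = \<psi> g" .
    have "r * e \<in> function_field X" using subring_mult[OF K r subsetD[OF 1(2) ge(2)]] .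
    then have "r * e = g" using inj_onD[OF bij_betw_imp_inj_on[OF bij] eq] ge(1) 1(2) by blast
    then have "\<psi> r = (r * e) / e" using ge(4) by simp
    then show ?thesis using ge(3) by simp
  qed
  then have "stalk X x = localization T (\<phi> x)" if "x \<in> points X" for x
    using st[OF that] that by (force simp: function_field_def)
  then have "affine_model X T \<phi>" unfolding affine_model_def using 1(1,3-5) by simp
  then show ?thesis using that T_def by blast
qed

section \<open>Products with the affine line\<close>

lemma prime_contraction:
  assumes "prime_ideal_of R Q" "T \<subseteq> R" "is_subring T"
  shows "prime_ideal_of T (Q \<inter> T)"
  unfolding prime_ideal_of_def
proof (intro conjI ballI impI)
  note D = prime_idealD[OF assms(1)]
  show "Q \<inter> T \<subseteq> T" "0 \<in> Q \<inter> T" "1 \<notin> Q \<inter> T" using D(2,3) subring_zero[OF assms(3)] by simp_all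
  show "a + b \<in> Q \<inter> T" if "a \<in> Q \<inter> T" "b \<in> Q \<inter> T" for a b
    using that D(4) subring_add[OF assms(3)] by simp
  show "r * a \<in> Q \<inter> T" if "r \<in> T" "a \<in> Q \<inter> T" for r a
    using that D(5) subring_mult[OF assms(3)] assms(2) by auto
  show "a \<in> Q \<inter> T \<or> b \<in> Q \<inter> T" if "a \<in> T" "b \<in> T" "a * b \<in> Q \<inter> T" for a b
    using that D(7)[of a b] assms(2) by auto
qed

text \<open>A fraction is a non-unit exactly when its numerator lies in \<open>P\<close>. The form
  with a multiplier \<open>s\<close> avoids choosing a fraction, and it has the shape of the
  extended prime in \<open>prime_extension_poly\<close>.\<close>

lemma localization_max_iff:
  assumes R: "is_subring R" and P: "prime_ideal_of R P" and x: "x \<in> localization R P"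
  shows "x \<in> max_ideal (localization R P) \<longleftrightarrow> (\<exists>s\<in>R. s \<notin> P \<and> s * x \<in> P)"
proof -
  obtain a b where 1: "a \<in> R" "b \<in> R" "b \<notin> P" "x = a / b" using x by (rule localizationE)
  have b0: "b \<noteq> 0" using 1 prime_idealD(2)[OF P] by auto
  have "x \<in> max_ideal (localization R P) \<longleftrightarrow> a \<in> P"
  proof
    assume m: "x \<in> max_ideal (localization R P)"
    show "a \<in> P"
    proof (rule ccontr)
      assume a: "a \<notin> P"
      then have "b / a \<in> localization R P" using 1 by (intro localizationI)
      moreover have "x \<noteq> 0" "inverse x = b / a" using a b0 1 prime_idealD(2)[OF P] by auto
      ultimately show False using m by (simp add: max_ideal_def)
    qed
  next
    assume a: "a \<in> P"
    show "x \<in> max_ideal (localization R P)"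
    proof (rule ccontr)
      assume m: "x \<notin> max_ideal (localization R P)"
      then have x0: "x \<noteq> 0" "inverse x \<in> localization R P" using x by (simp_all add: max_ideal_def)
      obtain c d where 2: "c \<in> R" "d \<in> R" "d \<notin> P" "inverse x = c / d" using x0(2) by (rule localizationE)
      have d0: "d \<noteq> 0" using 2 prime_idealD(2)[OF P] by auto
      have "b * d = (inverse x * d) * (x * b)" using x0(1) by simp
      also have "\<dots> = c * a" unfolding 2(4) unfolding 1(4) using b0 d0 by simp
      finally have "b * d = c * a" .
      then have "b * d \<in> P" using a 2 prime_idealD(5)[OF P] by simp
      then show False using 1 2 prime_idealD(7)[OF P] by blast
    qed
  qed
  also have "a \<in> P \<longleftrightarrow> (\<exists>s\<in>R. s \<notin> P \<and> s * x \<in> P)"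
  proof
    assume "a \<in> P"
    then show "\<exists>s\<in>R. s \<notin> P \<and> s * x \<in> P" using 1 b0 by (intro bexI[of _ b]) simp_all
  next
    assume "\<exists>s\<in>R. s \<notin> P \<and> s * x \<in> P"
    then obtain s where s: "s \<in> R" "s \<notin> P" "s * x \<in> P" by blast
    have "b * (s * x) \<in> P" using prime_idealD(5)[OF P 1(2) s(3)] .
    then have "s * a \<in> P" using 1 b0 by (simp add: mult.left_commute)
    then show "a \<in> P" using s 1 prime_idealD(7)[OF P] by blast
  qed
  finally show ?thesis .
qed

text \<open>Localizations at primes are local rings. Sums are handled by clearing denominators,
  products by computing with inverses of units.\<close>

lemma max_ideal_prime:
  assumes R: "is_subring R" and P: "prime_ideal_of R P"
  shows "prime_ideal_of (localization R P) (max_ideal (localization R P))"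
proof -
  let ?O = "localization R P" and ?m = "max_ideal (localization R P)"
  have O: "is_subring ?O" using R P by (rule subring_localization)
  note pD = prime_idealD[OF P]
  have inv: "inverse z \<in> ?O" if "z \<in> ?O" "z \<notin> ?m" for z
    using that by (simp add: max_ideal_def)
  have nun: "inverse z \<notin> ?O" if "z \<noteq> 0" "z \<in> ?m" for z
    using that by (simp add: max_ideal_def)
  have mO: "?m \<subseteq> ?O" by (auto simp: max_ideal_def)
  show ?thesis
    unfolding prime_ideal_of_def
  proof (intro conjI ballI impI)
    show "?m \<subseteq> ?O" by fact
    show "0 \<in> ?m" using subring_zero[OF O] by (simp add: max_ideal_def)
    show "1 \<notin> ?m" using subring_one[OF O] by (simp add: max_ideal_def)
    show "a + b \<in> ?m" if ab: "a \<in> ?m" "b \<in> ?m" for a b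
    proof -
      have abO: "a \<in> ?O" "b \<in> ?O" using ab mO by auto
      obtain s where s: "s \<in> R" "s \<notin> P" "s * a \<in> P"
        using ab(1) localization_max_iff[OF R P abO(1)] by blast
      obtain t where t: "t \<in> R" "t \<notin> P" "t * b \<in> P"
        using ab(2) localization_max_iff[OF R P abO(2)] by blast
      have "(s * t) * (a + b) = t * (s * a) + s * (t * b)" by (simp add: algebra_simps)
      also have "\<dots> \<in> P" by (intro pD(4) pD(5) s t)
      finally have "(s * t) * (a + b) \<in> P" .
      moreover have "s * t \<in> R" "s * t \<notin> P" using s t pD(7) subring_mult[OF R] by blast+
      ultimately show ?thesis using localization_max_iff[OF R P subring_add[OF O abO]] by blast
    qed
    show "r * a \<in> ?m" if ra: "r \<in> ?O" "a \<in> ?m" for r a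
    proof (rule ccontr)
      assume n: "r * a \<notin> ?m"
      have raO: "r * a \<in> ?O" using ra mO subring_mult[OF O] by blast
      have "r * a \<noteq> 0" using n subring_zero[OF O] by (auto simp: max_ideal_def)
      then have eq: "inverse a = inverse (r * a) * r" and a0: "a \<noteq> 0" by auto
      have "inverse (r * a) * r \<in> ?O" using inv[OF raO n] ra(1) by (rule subring_mult[OF O])
      then show False using nun[OF a0 ra(2)] eq by metis
    qed
    show "a \<in> ?m \<or> b \<in> ?m" if ab: "a \<in> ?O" "b \<in> ?O" "a * b \<in> ?m" for a b
    proof (rule ccontr)
      assume n: "\<not> ?thesis"
      then have ab0: "a * b \<noteq> 0" using subring_zero[OF O] by (auto simp: max_ideal_def)
      have "inverse (a * b) = inverse a * inverse b" by simp
      also have "\<dots> \<in> ?O" using n ab by (intro subring_mult[OF O] inv) auto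
      finally show False using nun[OF ab0 ab(3)] by simp
    qed
  qed
qed

lemma common_denominator:
  assumes R: "is_subring R" and P: "prime_ideal_of R P"
    and "finite I" "\<And>i. i \<in> I \<Longrightarrow> f i \<in> localization R P"
  shows "\<exists>s\<in>R. s \<notin> P \<and> (\<forall>i\<in>I. s * f i \<in> R)"
  using assms(3,4)
proof (induction I)
  case empty
  then show ?case using subring_one[OF R] prime_idealD(3)[OF P] by auto
next
  case (insert j I)
  then obtain s where s: "s \<in> R" "s \<notin> P" "\<forall>i\<in>I. s * f i \<in> R" by auto
  obtain a b where 1: "a \<in> R" "b \<in> R" "b \<notin> P" "f j = a / b"
    using localizationE[OF insert.prems[OF insertI1]] by blast
  have b0: "b \<noteq> 0" using 1 prime_idealD(2)[OF P] by auto
  have "b * s \<in> R" "b * s \<notin> P" using 1 s prime_idealD(7)[OF P] subring_mult[OF R] by blast+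
  moreover have "b * s * f i \<in> R" if "i \<in> insert j I" for i
  proof (cases "i = j")
    case True
    have "b * s * f j = s * a" using 1 b0 by simp
    moreover have "s * a \<in> R" using s(1) 1(1) by (rule subring_mult[OF R])
    ultimately show ?thesis using True by metis
  next
    case False
    then have "s * f i \<in> R" using that s(3) by simp
    then show ?thesis using subring_mult[OF R 1(2)] by (simp add: mult.assoc)
  qed
  ultimately show ?case by blast
qed

lemma poly_overD: "g \<in> poly_over R \<Longrightarrow> coeff g i \<in> R"
  by (simp add: poly_over_def)

lemma poly_over_mono: "R \<subseteq> T \<Longrightarrow> poly_over R \<subseteq> poly_over T"
  by (auto simp: poly_over_def)

lemma poly_over_const: "0 \<in> R \<Longrightarrow> c \<in> R \<Longrightarrow> [:c:] \<in> poly_over R"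
  by (auto simp: poly_over_def coeff_pCons split: nat.split)

lemma poly_over_smult: "is_subring R \<Longrightarrow> c \<in> R \<Longrightarrow> g \<in> poly_over R \<Longrightarrow> smult c g \<in> poly_over R"
  by (simp add: poly_over_def subring_mult)

lemma poly_over_var: "0 \<in> R \<Longrightarrow> 1 \<in> R \<Longrightarrow> [:0, 1:] \<in> poly_over R"
  by (auto simp: poly_over_def coeff_pCons split: nat.split)

lemma subring_poly_over:
  assumes R: "is_subring R"
  shows "is_subring (poly_over R)"
  unfolding is_subring_def
proof (intro conjI ballI)
  show "0 \<in> poly_over R" "1 \<in> poly_over R"
    using subring_zero[OF R] subring_one[OF R] by (auto simp: poly_over_def coeff_1)
  fix a b assume ab: "a \<in> poly_over R" "b \<in> poly_over R"
  show "a - b \<in> poly_over R" using ab subring_diff[OF R] by (simp add: poly_over_def)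
  show "a * b \<in> poly_over R" unfolding poly_over_def mem_Collect_eq coeff_mult
    using ab by (intro allI subring_sum[OF R] subring_mult[OF R] poly_overD)
qed

lemma poly_common_denominator:
  assumes R: "is_subring R" and P: "prime_ideal_of R P" and g: "g \<in> poly_over (localization R P)"
  shows "\<exists>s\<in>R. s \<notin> P \<and> smult s g \<in> poly_over R"
proof -
  obtain s where s: "s \<in> R" "s \<notin> P" "\<forall>i\<in>{..degree g}. s * coeff g i \<in> R"
    using common_denominator[OF R P, of "{..degree g}" "coeff g"] poly_overD[OF g] by auto
  have "s * coeff g i \<in> R" for i
    using s(3) subring_zero[OF R] by (cases "i \<le> degree g") (auto simp: coeff_eq_0)
  then show ?thesis using s by (auto simp: poly_over_def)
qed

lemma hom_to_fract: "ring_hom_on R to_fract"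
  by (simp add: ring_hom_on_def)

lemma inj_to_fract: "inj_on to_fract R"
  by (simp add: inj_on_def)

lemma A1_pointsD:
  assumes "(x, Q) \<in> A1_points X"
  shows "x \<in> points X" "prime_ideal_of (poly_over (stalk X x)) Q"
    "c \<in> stalk X x \<Longrightarrow> [:c:] \<in> Q \<longleftrightarrow> c \<in> max_ideal (stalk X x)"
proof -
  have e: "{c \<in> stalk X x. [:c:] \<in> Q} = max_ideal (stalk X x)" using assms by (simp add: A1_points_def)
  show "c \<in> stalk X x \<Longrightarrow> [:c:] \<in> Q \<longleftrightarrow> c \<in> max_ideal (stalk X x)" unfolding e[symmetric] by simp
qed (use assms in \<open>auto simp: A1_points_def\<close>)

text \<open>A \<open>scheme\<close> carries no axioms, so the presence of \<open>0\<close> and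
  \<open>1\<close> in the stalks is an assumption. It makes the constant polynomial \<open>1\<close>
  a section over the whole space, whose basic open set contains every point.\<close>

lemma points_times_A1:
  assumes "\<And>x. x \<in> points X \<Longrightarrow> 0 \<in> stalk X x \<and> 1 \<in> stalk X x"
  shows "points (times_A1 X) = A1_points X"
proof
  let ?S = "{{(x, Q) \<in> A1_points X. x \<in> U \<and> g \<notin> Q} | U g. openin (zariski X) U \<and> g \<in> poly_over (sections X U)}"
  have p: "points (times_A1 X) = \<Union>?S" by (simp add: times_A1_def)
  show "points (times_A1 X) \<subseteq> A1_points X" unfolding p by blast
  have "1 \<in> poly_over (sections X (points X))" using assms by (auto simp: poly_over_def sections_def coeff_1)
  then have "{(x, Q) \<in> A1_points X. x \<in> points X \<and> 1 \<notin> Q} \<in> ?S" using openin_topspace by blast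
  moreover have "A1_points X \<subseteq> {(x, Q) \<in> A1_points X. x \<in> points X \<and> 1 \<notin> Q}"
  proof
    fix z assume z: "z \<in> A1_points X"
    obtain x Q where "z = (x, Q)" by (cases z)
    then show "z \<in> {(x, Q) \<in> A1_points X. x \<in> points X \<and> 1 \<notin> Q}"
      using z A1_pointsD(1)[of x Q X] prime_idealD(3)[OF A1_pointsD(2)[of x Q X]] by simp
  qed
  ultimately show "A1_points X \<subseteq> points (times_A1 X)" unfolding p by blast
qed

lemma stalk_times_A1:
  "stalk (times_A1 X) (x, Q) = {Fract a b | a b. a \<in> poly_over (stalk X x) \<and> b \<in> poly_over (stalk X x) \<and> b \<notin> Q}"
  and scal_times_A1: "scal (times_A1 X) c = to_fract [:scal X c:]"
  by (simp_all add: times_A1_def to_fract_def)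

lemma openin_times_A1:
  assumes "openin (zariski X) U" "g \<in> poly_over (sections X U)"
  shows "openin (zariski (times_A1 X)) {(x, Q) \<in> A1_points X. x \<in> U \<and> g \<notin> Q}"
proof -
  have "{(x, Q) \<in> A1_points X. x \<in> U \<and> g \<notin> Q} \<in>
    {{(x, Q) \<in> A1_points X. x \<in> U \<and> g \<notin> Q} | U g. openin (zariski X) U \<and> g \<in> poly_over (sections X U)}"
    using assms by blast
  then show ?thesis by (simp add: times_A1_def topology_generated_by_Basis)
qed

lemma subring_sections:
  "(\<And>x. x \<in> U \<Longrightarrow> is_subring (stalk X x)) \<Longrightarrow> is_subring (sections X U)"
  by (simp add: is_subring_def sections_def)

text \<open>Restriction of sections is inclusion, so two basic sets given by \<open>g\<close> over
  \<open>U\<close> and \<open>h\<close> over \<open>V\<close> intersect in the one given by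
  \<open>g * h\<close> over \<open>U \<inter> V\<close>.\<close>

lemma times_A1_basis:
  assumes R: "\<And>x. x \<in> points X \<Longrightarrow> is_subring (stalk X x)"
    and W: "openin (zariski (times_A1 X)) W" "(x, Q) \<in> W"
  obtains U g where "openin (zariski X) U" "g \<in> poly_over (sections X U)" "x \<in> U" "g \<notin> Q"
    "{(x, Q) \<in> A1_points X. x \<in> U \<and> g \<notin> Q} \<subseteq> W"
proof -
  let ?S = "{{(x, Q) \<in> A1_points X. x \<in> U \<and> g \<notin> Q} | U g. openin (zariski X) U \<and> g \<in> poly_over (sections X U)}"
  have "\<exists>C\<in>?S. (x, Q) \<in> C \<and> C \<subseteq> W"
  proof (rule generated_topology_basis[OF _ W(2)])
    show "openin (topology_generated_by ?S) W" using W(1) by (simp add: times_A1_def)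
    fix A B y assume A: "A \<in> ?S" and B: "B \<in> ?S" and y: "y \<in> A" "y \<in> B"
    obtain U g where U: "A = {(x, Q) \<in> A1_points X. x \<in> U \<and> g \<notin> Q}" "openin (zariski X) U" "g \<in> poly_over (sections X U)"
      using A by blast
    obtain V h where V: "B = {(x, Q) \<in> A1_points X. x \<in> V \<and> h \<notin> Q}" "openin (zariski X) V" "h \<in> poly_over (sections X V)"
      using B by blast
    have UV: "openin (zariski X) (U \<inter> V)" using U(2) V(2) by (rule openin_Int)
    have sub: "is_subring (sections X (U \<inter> V))" using R openin_subset[OF UV] by (intro subring_sections) blast
    have "sections X U \<subseteq> sections X (U \<inter> V)" "sections X V \<subseteq> sections X (U \<inter> V)"
      by (auto simp: sections_def)
    then have "g \<in> poly_over (sections X (U \<inter> V))" "h \<in> poly_over (sections X (U \<inter> V))"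
      using U(3) V(3) poly_over_mono by blast+
    then have gh: "g * h \<in> poly_over (sections X (U \<inter> V))" using subring_mult[OF subring_poly_over[OF sub]] by blast
    have iff: "g * h \<notin> Q \<longleftrightarrow> g \<notin> Q \<and> h \<notin> Q" if "(x, Q) \<in> A1_points X" "x \<in> U" "x \<in> V" for x Q
    proof -
      have "sections X U \<subseteq> stalk X x" "sections X V \<subseteq> stalk X x" using that by (auto simp: sections_def)
      then have "g \<in> poly_over (stalk X x)" "h \<in> poly_over (stalk X x)" using U(3) V(3) poly_over_mono by blast+
      then show ?thesis using prime_idealD(5-7)[OF A1_pointsD(2)[OF that(1)]] by metis
    qed
    have "{(x, Q) \<in> A1_points X. x \<in> U \<inter> V \<and> g * h \<notin> Q} = A \<inter> B"
      unfolding U(1) V(1) using iff by auto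
    moreover have "{(x, Q) \<in> A1_points X. x \<in> U \<inter> V \<and> g * h \<notin> Q} \<in> ?S" using UV gh by blast
    ultimately show "\<exists>C\<in>?S. y \<in> C \<and> C \<subseteq> A \<inter> B" using y by auto
  qed
  then obtain C where C: "C \<in> ?S" "(x, Q) \<in> C" "C \<subseteq> W" by blast
  then obtain U g where "C = {(x, Q) \<in> A1_points X. x \<in> U \<and> g \<notin> Q}" "openin (zariski X) U" "g \<in> poly_over (sections X U)"
    by blast
  then show ?thesis using that[of U g] C by simp
qed

text \<open>A prime \<open>q\<close> of \<open>R[t]\<close> is turned into a point of the relative
  line: \<open>P\<close> is its contraction to the constants and \<open>Q\<close> its extension to
  \<open>R_P[t]\<close>. Localizing only the constants outside \<open>P\<close> loses nothing, as
  these avoid \<open>q\<close>.\<close>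

lemma prime_extension_poly:
  assumes R: "is_subring R" and q: "prime_ideal_of (poly_over R) q"
  defines "P \<equiv> {c \<in> R. [:c:] \<in> q}"
  defines "Q \<equiv> {g \<in> poly_over (localization R P). \<exists>s\<in>R. s \<notin> P \<and> smult s g \<in> q}"
  shows "prime_ideal_of R P" "prime_ideal_of (poly_over (localization R P)) Q"
    "{c \<in> localization R P. [:c:] \<in> Q} = max_ideal (localization R P)" "Q \<inter> poly_over R = q"
proof -
  note Dq = prime_idealD[OF q]
  have PR: "P \<subseteq> R" by (auto simp: P_def)
  have c: "[:c:] \<in> poly_over R" if "c \<in> R" for c using that subring_zero[OF R] by (intro poly_over_const)
  show P: "prime_ideal_of R P"
    unfolding prime_ideal_of_def
  proof (intro conjI ballI impI)
    show "P \<subseteq> R" by fact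
    show "0 \<in> P" "1 \<notin> P" using Dq(2,3) subring_zero[OF R] by (simp_all add: P_def pCons_one)
    show "a + b \<in> P" if "a \<in> P" "b \<in> P" for a b
      using that Dq(4)[of "[:a:]" "[:b:]"] subring_add[OF R] by (simp add: P_def)
    show "r * a \<in> P" if "r \<in> R" "a \<in> P" for r a
      using that Dq(5)[of "[:r:]" "[:a:]"] subring_mult[OF R] c by (simp add: P_def mult.commute)
    show "a \<in> P \<or> b \<in> P" if "a \<in> R" "b \<in> R" "a * b \<in> P" for a b
      using that Dq(7)[of "[:a:]" "[:b:]"] c by (simp add: P_def mult.commute)
  qed
  let ?O = "localization R P"
  have O: "is_subring ?O" using R P by (rule subring_localization)
  have RO: "R \<subseteq> ?O" using localization_base[OF R P] by blast
  have den: "\<exists>s\<in>R. s \<notin> P \<and> smult s g \<in> poly_over R" if "g \<in> poly_over ?O" for g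
    using poly_common_denominator[OF R P that] .
  have nq: "[:s:] \<notin> q" if "s \<in> R" "s \<notin> P" for s using that by (simp add: P_def)
  have sm: "smult s g \<in> q" if "s \<in> R" "g \<in> q" for s g using Dq(5)[OF c[OF that(1)] that(2)] by simp
  \<comment> \<open>A constant outside \<open>P\<close> is not in \<open>q\<close>, so it can be
    cancelled modulo \<open>q\<close>.\<close>
  have canc: "g \<in> q" if "s \<in> R" "s \<notin> P" "g \<in> poly_over R" "smult s g \<in> q" for s g
    using Dq(7)[OF c[OF that(1)] that(3)] that nq by simp
  have mP: "s * s' \<in> R" "s * s' \<notin> P" if "s \<in> R" "s \<notin> P" "s' \<in> R" "s' \<notin> P" for s s'
    using that subring_mult[OF R] prime_idealD(7)[OF P] by blast+
  show "prime_ideal_of (poly_over ?O) Q"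
    unfolding prime_ideal_of_def
  proof (intro conjI ballI impI)
    show "Q \<subseteq> poly_over ?O" by (auto simp: Q_def)
    have "0 \<in> poly_over ?O" using subring_zero[OF subring_poly_over[OF O]] .
    then show "0 \<in> Q" using Dq(2) subring_one[OF R] prime_idealD(3)[OF P] by (auto simp: Q_def)
    show "1 \<notin> Q"
    proof
      assume "1 \<in> Q"
      then obtain s where "s \<in> R" "s \<notin> P" "smult s 1 \<in> q" by (auto simp: Q_def)
      then show False using nq by simp
    qed
    fix a b assume "a \<in> Q" "b \<in> Q"
    then obtain s t where 1: "a \<in> poly_over ?O" "b \<in> poly_over ?O" "s \<in> R" "s \<notin> P" "t \<in> R" "t \<notin> P" "smult s a \<in> q" "smult t b \<in> q"
      by (auto simp: Q_def)
    have "smult (s * t) (a + b) = smult t (smult s a) + smult s (smult t b)" by (simp add: smult_add_right mult.commute)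
    also have "\<dots> \<in> q" using Dq(4)[OF sm[OF 1(5,7)] sm[OF 1(3,8)]] .
    finally show "a + b \<in> Q" using 1 mP[of s t] subring_add[OF subring_poly_over[OF O]] by (auto simp: Q_def)
  next
    fix r a assume r: "r \<in> poly_over ?O" and "a \<in> Q"
    then obtain s where 1: "a \<in> poly_over ?O" "s \<in> R" "s \<notin> P" "smult s a \<in> q" by (auto simp: Q_def)
    obtain t where t: "t \<in> R" "t \<notin> P" "smult t r \<in> poly_over R" using den[OF r] by blast
    have "smult (s * t) (r * a) = smult t r * smult s a" by simp
    also have "\<dots> \<in> q" using 1 t by (intro Dq(5))
    finally show "r * a \<in> Q" using 1 r t mP[of s t] subring_mult[OF subring_poly_over[OF O]] by (auto simp: Q_def)
  next
    fix a b assume ab: "a \<in> poly_over ?O" "b \<in> poly_over ?O" "a * b \<in> Q"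
    then obtain s where s: "s \<in> R" "s \<notin> P" "smult s (a * b) \<in> q" by (auto simp: Q_def)
    obtain t where t: "t \<in> R" "t \<notin> P" "smult t a \<in> poly_over R" using den[OF ab(1)] by blast
    obtain u where u: "u \<in> R" "u \<notin> P" "smult u b \<in> poly_over R" using den[OF ab(2)] by blast
    have "smult s (smult t a * smult u b) = smult (t * u) (smult s (a * b))" by (simp add: mult.commute mult.left_commute)
    also have "\<dots> \<in> q" using sm[OF subring_mult[OF R t(1) u(1)] s(3)] .
    finally have "smult t a * smult u b \<in> q"
      by (rule canc[OF s(1,2) subring_mult[OF subring_poly_over[OF R] t(3) u(3)]])
    then have "smult t a \<in> q \<or> smult u b \<in> q" by (rule Dq(7)[OF t(3) u(3)])
    then show "a \<in> Q \<or> b \<in> Q" using t u ab by (auto simp: Q_def)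
  qed
  have "[:c:] \<in> Q \<longleftrightarrow> c \<in> max_ideal ?O" if cO: "c \<in> ?O" for c
  proof -
    have "[:c:] \<in> poly_over ?O" using cO subring_zero[OF O] by (intro poly_over_const)
    moreover have "s * c \<in> P \<longleftrightarrow> [:s * c:] \<in> q" if "s \<in> R" for s
    proof
      assume q1: "[:s * c:] \<in> q"
      then have "coeff [:s * c:] 0 \<in> R" using Dq(1) poly_overD by blast
      then show "s * c \<in> P" using q1 by (simp add: P_def)
    qed (simp add: P_def)
    ultimately show ?thesis unfolding localization_max_iff[OF R P cO] Q_def by auto
  qed
  moreover have "max_ideal ?O \<subseteq> ?O" by (auto simp: max_ideal_def)
  ultimately show "{c \<in> ?O. [:c:] \<in> Q} = max_ideal ?O" by blast
  have "g \<in> Q" if "g \<in> q" for g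
  proof -
    have "g \<in> poly_over ?O" using that Dq(1) poly_over_mono[OF RO] by blast
    moreover have "smult 1 g \<in> q" using that by simp
    ultimately show ?thesis unfolding Q_def using subring_one[OF R] prime_idealD(3)[OF P] by blast
  qed
  then show "Q \<inter> poly_over R = q" using Dq(1) canc by (auto simp: Q_def)
qed

text \<open>Denominators of germs at \<open>x\<close> are units there, so \<open>Q\<close> is
  determined by \<open>x\<close> and by its trace on \<open>C[t]\<close>. This is what makes
  contraction to \<open>C[t]\<close> injective on points of the product.\<close>

lemma A1_point_in_model:
  assumes m: "affine_model X C \<phi>" and xQ: "(x, Q) \<in> A1_points X"
    and g: "g \<in> poly_over (stalk X x)"
  shows "g \<in> Q \<longleftrightarrow> (\<exists>s\<in>C. s \<notin> \<phi> x \<and> smult s g \<in> Q \<inter> poly_over C)"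
proof -
  note D = affine_modelD[OF m] and A = A1_pointsD[OF xQ]
  have st: "stalk X x = localization C (\<phi> x)" using D(3) A(1) .
  have CO: "C \<subseteq> stalk X x" using model_subset_stalk[OF m A(1)] .
  have sub: "is_subring (stalk X x)" unfolding st using subring_localization[OF D(1) D(4)[OF A(1)]] .
  have c: "[:c:] \<in> poly_over (stalk X x)" if "c \<in> C" for c
    using that CO subring_zero[OF sub] by (intro poly_over_const) auto
  show ?thesis
  proof
    assume gQ: "g \<in> Q"
    obtain s where s: "s \<in> C" "s \<notin> \<phi> x" "smult s g \<in> poly_over C"
      using poly_common_denominator[OF D(1) D(4)[OF A(1)]] g st by auto
    have "[:s:] * g \<in> Q" using prime_idealD(5)[OF A(2) c[OF s(1)] gQ] .
    then show "\<exists>s\<in>C. s \<notin> \<phi> x \<and> smult s g \<in> Q \<inter> poly_over C" using s by auto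
  next
    assume "\<exists>s\<in>C. s \<notin> \<phi> x \<and> smult s g \<in> Q \<inter> poly_over C"
    then obtain s where s: "s \<in> C" "s \<notin> \<phi> x" "[:s:] * g \<in> Q" by auto
    have "[:s:] \<notin> Q" using A(3) s CO model_max_ideal[OF m A(1) s(1)] by blast
    then show "g \<in> Q" using prime_idealD(7)[OF A(2) c[OF s(1)] g s(3)] by blast
  qed
qed

text \<open>The relative line over Spec \<open>C\<close> is Spec \<open>C[t]\<close>. The points are
  matched by contracting the fibre prime \<open>Q\<close> to \<open>C[t]\<close>;
  \<open>to_fract\<close> only moves the polynomial ring into the function field of the
  product.\<close>

lemma affine_model_times_A1:
  assumes m: "affine_model X C \<phi>"
  shows "affine_model (times_A1 X) (to_fract ` poly_over C) (\<lambda>(x, Q). to_fract ` (Q \<inter> poly_over C))"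
proof -
  note D = affine_modelD[OF m]
  have st: "stalk X x = localization C (\<phi> x)" if "x \<in> points X" for x using D(3) that .
  have sub: "is_subring (stalk X x)" if "x \<in> points X" for x
    unfolding st[OF that] using subring_localization[OF D(1) D(4)[OF that]] .
  have CO: "C \<subseteq> stalk X x" if "x \<in> points X" for x using model_subset_stalk[OF m that] .
  have pC: "is_subring (poly_over C)" using subring_poly_over[OF D(1)] .
  have pts: "points (times_A1 X) = A1_points X"
    using sub by (intro points_times_A1) (auto intro: subring_zero subring_one)
  have Fp: "prime_ideal_of (poly_over C) (Q \<inter> poly_over C)" if "(x, Q) \<in> A1_points X" for x Q
    using A1_pointsD(1,2)[OF that] poly_over_mono[OF CO] pC by (intro prime_contraction)
  \<comment> \<open>The base point is recovered from the constants in the contracted prime.\<close>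
  have px: "\<phi> x = {c \<in> C. [:c:] \<in> Q \<inter> poly_over C}" if xQ: "(x, Q) \<in> A1_points X" for x Q
  proof -
    have "c \<in> \<phi> x \<longleftrightarrow> [:c:] \<in> Q \<inter> poly_over C" if "c \<in> C" for c
      using A1_pointsD(3)[OF xQ, of c] model_max_ideal[OF m A1_pointsD(1)[OF xQ] that] CO[OF A1_pointsD(1)[OF xQ]] that
        poly_over_const[OF subring_zero[OF D(1)] that] by blast
    then show ?thesis using prime_idealD(1)[OF D(4)[OF A1_pointsD(1)[OF xQ]]] by blast
  qed
  have b1: "bij_betw (\<lambda>(x, Q). Q \<inter> poly_over C) (A1_points X) (Collect (prime_ideal_of (poly_over C)))"
    unfolding bij_betw_def
  proof
    show "inj_on (\<lambda>(x, Q). Q \<inter> poly_over C) (A1_points X)"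
    proof (rule inj_onI, clarify)
      fix x Q y Q' assume 1: "(x, Q) \<in> A1_points X" "(y, Q') \<in> A1_points X" "Q \<inter> poly_over C = Q' \<inter> poly_over C"
      have "\<phi> x = \<phi> y" using px[OF 1(1)] px[OF 1(2)] 1(3) by simp
      then have xy: "x = y" using D(8) A1_pointsD(1)[OF 1(1)] A1_pointsD(1)[OF 1(2)] by blast
      have "g \<in> Q \<longleftrightarrow> g \<in> Q'" if "g \<in> poly_over (stalk X x)" for g
        using A1_point_in_model[OF m 1(1) that] A1_point_in_model[OF m 1(2), of g] that 1(3) xy by simp
      then have "Q = Q'" using prime_idealD(1)[OF A1_pointsD(2)[OF 1(1)]] prime_idealD(1)[OF A1_pointsD(2)[OF 1(2)]] xy by blast
      then show "x = y \<and> Q = Q'" using xy by simp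
    qed
    show "(\<lambda>(x, Q). Q \<inter> poly_over C) ` A1_points X = Collect (prime_ideal_of (poly_over C))"
    proof (intro equalityI subsetI)
      fix q assume "q \<in> Collect (prime_ideal_of (poly_over C))"
      then have q: "prime_ideal_of (poly_over C) q" by simp
      \<comment> \<open>The constants of \<open>q\<close> choose the base point, and the extension
        of \<open>q\<close> to the local ring chooses the point of the fibre.\<close>
      define P where "P = {c \<in> C. [:c:] \<in> q}"
      define Q where "Q = {g \<in> poly_over (localization C P). \<exists>s\<in>C. s \<notin> P \<and> smult s g \<in> q}"
      note E = prime_extension_poly[OF D(1) q, folded P_def, folded Q_def]
      obtain x where x: "x \<in> points X" "\<phi> x = P" using D(7)[OF E(1)] by blast
      have "(x, Q) \<in> A1_points X" unfolding A1_points_def using x st[OF x(1)] E(2,3) by simp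
      then show "q \<in> (\<lambda>(x, Q). Q \<inter> poly_over C) ` A1_points X" using E(4) by force
    qed (use Fp in auto)
  qed
  have b2: "bij_betw (image to_fract) (Collect (prime_ideal_of (poly_over C))) (Collect (prime_ideal_of (to_fract ` poly_over C)))"
    by (rule hom_primes_bij[OF hom_to_fract pC inj_to_fract])
  show ?thesis
    unfolding affine_model_def pts
  proof (intro conjI ballI allI impI)
    show "is_subring (to_fract ` poly_over C)" by (rule hom_image_subring[OF hom_to_fract pC])
    have "image to_fract \<circ> (\<lambda>(x, Q). Q \<inter> poly_over C) = (\<lambda>(x, Q). to_fract ` (Q \<inter> poly_over C))" by auto
    then show "bij_betw (\<lambda>(x, Q). to_fract ` (Q \<inter> poly_over C)) (A1_points X) (Collect (prime_ideal_of (to_fract ` poly_over C)))"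
      using bij_betw_trans[OF b1 b2] by metis
  next
    fix z assume z: "z \<in> A1_points X"
    obtain x Q where zx: "z = (x, Q)" by (cases z)
    note A = A1_pointsD[OF z[unfolded zx]]
    have "{Fract a b |a b. a \<in> poly_over (stalk X x) \<and> b \<in> poly_over (stalk X x) \<and> b \<notin> Q}
        = localization (to_fract ` poly_over C) (to_fract ` (Q \<inter> poly_over C))" (is "?L = ?R")
    proof (intro equalityI subsetI)
      fix y assume "y \<in> ?R"
      then obtain a b where ab: "a \<in> poly_over C" "b \<in> poly_over C" "b \<notin> Q" "y = to_fract a / to_fract b"
        by (auto elim!: localizationE)
      then have "a \<in> poly_over (stalk X x)" "b \<in> poly_over (stalk X x)" using poly_over_mono[OF CO[OF A(1)]] by auto
      then show "y \<in> ?L" unfolding ab(4) Fract_conv_to_fract[symmetric] using ab(3) by blast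
    next
      fix y assume "y \<in> ?L"
      then obtain a b where ab: "a \<in> poly_over (stalk X x)" "b \<in> poly_over (stalk X x)" "b \<notin> Q" "y = Fract a b" by blast
      have b0: "b \<noteq> 0" using ab prime_idealD(2)[OF A(2)] by auto
      obtain s where s: "s \<in> C" "s \<notin> \<phi> x" "smult s a \<in> poly_over C"
        using poly_common_denominator[OF D(1) D(4)[OF A(1)]] ab(1) st[OF A(1)] by auto
      obtain t where t: "t \<in> C" "t \<notin> \<phi> x" "smult t b \<in> poly_over C"
        using poly_common_denominator[OF D(1) D(4)[OF A(1)]] ab(2) st[OF A(1)] by auto
      have nz: "s \<noteq> 0" "t \<noteq> 0" using s t prime_idealD(2)[OF D(4)[OF A(1)]] by auto
      have stC: "s * t \<in> C" "s * t \<notin> \<phi> x" using s t subring_mult[OF D(1)] prime_idealD(7)[OF D(4)[OF A(1)]] by blast+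
      have 1: "smult (s * t) a \<in> poly_over C" "smult (s * t) b \<in> poly_over C"
        using poly_over_smult[OF D(1) t(1) s(3)] poly_over_smult[OF D(1) s(1) t(3)] by (simp_all add: mult.commute)
      have "smult (s * t) b \<notin> Q" using A1_point_in_model[OF m z[unfolded zx] ab(2)] stC 1(2) ab(3) by blast
      then have "to_fract (smult (s * t) a) / to_fract (smult (s * t) b) \<in> ?R"
        using 1 by (intro localizationI) auto
      moreover have "to_fract (smult (s * t) a) / to_fract (smult (s * t) b) = Fract (smult (s * t) a) (smult (s * t) b)"
        by (simp only: Fract_conv_to_fract)
      moreover have "Fract (smult (s * t) a) (smult (s * t) b) = Fract a b"
        using nz b0 by (simp add: eq_fract)
      ultimately show "y \<in> ?R" using ab(4) by simp
    qed
    then show "stalk (times_A1 X) z = localization (to_fract ` poly_over C) (case z of (x, Q) \<Rightarrow> to_fract ` (Q \<inter> poly_over C))"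
      by (simp add: zx stalk_times_A1)
  next
    fix f assume "f \<in> to_fract ` poly_over C"
    then obtain g where g: "g \<in> poly_over C" "f = to_fract g" by auto
    have "openin (zariski (times_A1 X)) {(x, Q) \<in> A1_points X. x \<in> points X \<and> g \<notin> Q}"
      by (intro openin_times_A1 openin_topspace) (simp add: model_sections[OF m] g)
    moreover have "{(x, Q) \<in> A1_points X. x \<in> points X \<and> g \<notin> Q}
      = {x \<in> A1_points X. f \<notin> (case x of (x, Q) \<Rightarrow> to_fract ` (Q \<inter> poly_over C))}"
      using A1_pointsD(1) g by auto
    ultimately show "openin (zariski (times_A1 X)) {x \<in> A1_points X. f \<notin> (case x of (x, Q) \<Rightarrow> to_fract ` (Q \<inter> poly_over C))}" by simp
  next
    fix W z assume W: "openin (zariski (times_A1 X)) W" "z \<in> W"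
    obtain x Q where zx: "z = (x, Q)" by (cases z)
    have "z \<in> points (times_A1 X)" using W openin_subset by blast
    then have xQ: "(x, Q) \<in> A1_points X" using pts zx by simp
    note A = A1_pointsD[OF xQ]
    obtain U g where U: "openin (zariski X) U" "g \<in> poly_over (sections X U)" "x \<in> U" "g \<notin> Q"
      "{(x, Q) \<in> A1_points X. x \<in> U \<and> g \<notin> Q} \<subseteq> W"
      using times_A1_basis[OF sub W(1)] W(2) zx by blast
    have secst: "sections X U \<subseteq> stalk X y" if "y \<in> U" for y using that by (auto simp: sections_def)
    have gO: "g \<in> poly_over (stalk X y)" if "y \<in> U" for y using U(2) poly_over_mono[OF secst[OF that]] by blast
    obtain f where f: "f \<in> C" "f \<notin> \<phi> x" "{y \<in> points X. f \<notin> \<phi> y} \<subseteq> U" using D(6)[OF U(1,3)] by blast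
    obtain s where s: "s \<in> C" "s \<notin> \<phi> x" "smult s g \<in> poly_over C"
      using poly_common_denominator[OF D(1) D(4)[OF A(1)]] gO[OF U(3)] st[OF A(1)] by auto
    \<comment> \<open>The factor \<open>s\<close> clears the denominators of \<open>g\<close> and
      the factor \<open>f\<close> confines the base point to \<open>U\<close>. Where
      \<open>k\<close> does not vanish, neither \<open>f\<close> nor \<open>g\<close> does.\<close>
    define k where "k = smult (f * s) g"
    have k: "k \<in> poly_over C" using poly_over_smult[OF D(1) f(1) s(3)] by (simp add: k_def)
    have fs: "f * s \<in> C" "f * s \<notin> \<phi> x" using f s subring_mult[OF D(1)] prime_idealD(7)[OF D(4)[OF A(1)]] by blast+
    have kQ: "k \<notin> Q" using A1_point_in_model[OF m xQ gO[OF U(3)]] fs k U(4) unfolding k_def by blast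
    have "z' \<in> W" if z': "z' \<in> A1_points X" "k \<notin> snd z'" for z'
    proof -
      obtain y Q' where zy: "z' = (y, Q')" by (cases z')
      note B = A1_pointsD[OF z'(1)[unfolded zy]]
      have kQ': "k \<notin> Q'" using z' zy by simp
      have fy: "f \<notin> \<phi> y"
      proof
        assume "f \<in> \<phi> y"
        then have "[:f:] \<in> Q'" using B(3)[of f] model_max_ideal[OF m B(1) f(1)] CO[OF B(1)] f(1) by blast
        moreover have "smult s g \<in> poly_over (stalk X y)" using s(3) poly_over_mono[OF CO[OF B(1)]] by blast
        ultimately have "smult s g * [:f:] \<in> Q'" using prime_idealD(5)[OF B(2)] by blast
        then show False using kQ' by (simp add: k_def)
      qed
      then have yU: "y \<in> U" using f(3) B(1) by blast
      have "g \<notin> Q'"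
      proof
        assume "g \<in> Q'"
        moreover have "[:f * s:] \<in> poly_over (stalk X y)"
          using fs(1) CO[OF B(1)] by (intro poly_over_const[OF subring_zero[OF sub[OF B(1)]]]) blast
        ultimately have "[:f * s:] * g \<in> Q'" using prime_idealD(5)[OF B(2)] by blast
        then show False using kQ' by (simp add: k_def)
      qed
      then have "z' \<in> {(x, Q) \<in> A1_points X. x \<in> U \<and> g \<notin> Q}" using z'(1) zy yU by simp
      then show ?thesis using U(5) by blast
    qed
    moreover have "k \<notin> snd y" if "to_fract k \<notin> (case y of (x, Q) \<Rightarrow> to_fract ` (Q \<inter> poly_over C))" "y \<in> A1_points X" for y
      using that k by (auto split: prod.splits)
    ultimately have "{y \<in> A1_points X. to_fract k \<notin> (case y of (x, Q) \<Rightarrow> to_fract ` (Q \<inter> poly_over C))} \<subseteq> W"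
      by blast
    moreover have "to_fract k \<notin> (case z of (x, Q) \<Rightarrow> to_fract ` (Q \<inter> poly_over C))" using kQ zx by auto
    ultimately show "\<exists>f\<in>to_fract ` poly_over C. f \<notin> (case z of (x, Q) \<Rightarrow> to_fract ` (Q \<inter> poly_over C)) \<and>
        {y \<in> A1_points X. f \<notin> (case y of (x, Q) \<Rightarrow> to_fract ` (Q \<inter> poly_over C))} \<subseteq> W"
      using k by (intro bexI[of _ "to_fract k"]) auto
  qed
qed

section \<open>Principal open subschemes\<close>

text \<open>The first argument is either a ring, giving the localization at the powers of
  \<open>h\<close>, or a prime of that ring, giving its extension.\<close>

definition away :: "'a::field set \<Rightarrow> 'a \<Rightarrow> 'a set" where
  "away P h = {a / h ^ n | a n. a \<in> P}"

lemma awayI: "a \<in> P \<Longrightarrow> a / h ^ n \<in> away P h"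
  by (auto simp: away_def)

lemma awayE:
  assumes "x \<in> away P h"
  obtains a n where "a \<in> P" "x = a / h ^ n"
  using assms by (auto simp: away_def)

lemma away_base: "a \<in> P \<Longrightarrow> a \<in> away P h"
  using awayI[of a P h 0] by simp

lemma subring_away:
  assumes C: "is_subring C" and h: "h \<in> C" "h \<noteq> 0"
  shows "is_subring (away C h)"
  unfolding is_subring_def
proof (intro conjI ballI)
  show "0 \<in> away C h" "1 \<in> away C h" using C by (auto intro: away_base subring_zero subring_one)
  fix x y assume "x \<in> away C h" "y \<in> away C h"
  then obtain a n b m where 1: "a \<in> C" "x = a / h ^ n" "b \<in> C" "y = b / h ^ m" by (metis awayE)
  have eq: "x - y = (a * h ^ m - b * h ^ n) / h ^ (n + m)" "x * y = (a * b) / h ^ (n + m)"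
    unfolding 1(2,4) using h(2) by (simp_all add: field_simps power_add)
  show "x - y \<in> away C h" "x * y \<in> away C h" unfolding eq
    using 1 C h by (simp_all only: awayI subring_closed)
qed

lemma frac_away:
  assumes C: "is_subring C" and h: "h \<in> C" "h \<noteq> 0"
  shows "frac_field (away C h) = frac_field C"
proof
  show "frac_field C \<subseteq> frac_field (away C h)" by (intro frac_mono) (auto intro: away_base)
  have "away C h \<subseteq> frac_field C" using C h by (auto elim!: awayE intro!: fracI subring_power)
  then show "frac_field (away C h) \<subseteq> frac_field C"
    using frac_divide[OF C] by (auto elim!: fracE)
qed

text \<open>Powers of \<open>h\<close> can be cancelled modulo \<open>P\<close>, so membership in
  the extended prime does not depend on the chosen fraction.\<close>

lemma away_mem_iff:
  assumes P: "prime_ideal_of C P" and h: "h \<in> C" "h \<notin> P" and C: "is_subring C" and a: "a \<in> C"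
  shows "a / h ^ n \<in> away P h \<longleftrightarrow> a \<in> P"
proof
  assume "a / h ^ n \<in> away P h"
  then obtain b m where 1: "b \<in> P" "a / h ^ n = b / h ^ m" by (rule awayE)
  have h0: "h \<noteq> 0" using h(2) prime_idealD(2)[OF P] by auto
  have "a * h ^ m = h ^ n * b" using 1(2) h0 by (simp add: frac_eq_eq mult.commute)
  also have "\<dots> \<in> P" using prime_idealD(5)[OF P subring_power[OF C h(1)] 1(1)] .
  finally have "a * h ^ m \<in> P" .
  then show "a \<in> P"
    using prime_idealD(7)[OF P a subring_power[OF C h(1)]] prime_ideal_power[OF P C h(1)] h(2) by blast
qed (rule awayI)

lemma away_prime:
  assumes P: "prime_ideal_of C P" and h: "h \<in> C" "h \<notin> P" and C: "is_subring C"
  shows "prime_ideal_of (away C h) (away P h)"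
  unfolding prime_ideal_of_def
proof (intro conjI ballI impI)
  note D = prime_idealD[OF P]
  have h0: "h \<noteq> 0" using h(2) D(2) by auto
  show "away P h \<subseteq> away C h" using D(1) by (auto simp: away_def)
  show "0 \<in> away P h" using D(2) by (rule away_base)
  show "1 \<notin> away P h" using away_mem_iff[OF P h C subring_one[OF C], of 0] D(3) by simp
  show "x + y \<in> away P h" if xy: "x \<in> away P h" "y \<in> away P h" for x y
  proof -
    obtain a n where a: "a \<in> P" "x = a / h ^ n" using xy(1) by (rule awayE)
    obtain b m where b: "b \<in> P" "y = b / h ^ m" using xy(2) by (rule awayE)
    note 1 = a b
    have "x + y = (a * h ^ m + b * h ^ n) / h ^ (n + m)" unfolding 1(2,4) using h0 by (simp add: field_simps power_add)
    moreover have "a * h ^ m + b * h ^ n \<in> P"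
      using D(4)[OF D(6)[OF subring_power[OF C h(1)] a(1)] D(6)[OF subring_power[OF C h(1)] b(1)]] .
    ultimately show ?thesis by (simp add: awayI)
  qed
  show "x * y \<in> away P h" if xy: "x \<in> away C h" "y \<in> away P h" for x y
  proof -
    obtain a n where a: "a \<in> C" "x = a / h ^ n" using xy(1) by (rule awayE)
    obtain b m where b: "b \<in> P" "y = b / h ^ m" using xy(2) by (rule awayE)
    note 1 = a b
    have "x * y = (a * b) / h ^ (n + m)" unfolding 1(2,4) using h0 by (simp add: field_simps power_add)
    then show ?thesis using D(5)[OF 1(1,3)] by (simp add: awayI)
  qed
  show "x \<in> away P h \<or> y \<in> away P h" if xy: "x \<in> away C h" "y \<in> away C h" "x * y \<in> away P h" for x y
  proof -
    obtain a n where a: "a \<in> C" "x = a / h ^ n" using xy(1) by (rule awayE)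
    obtain b m where b: "b \<in> C" "y = b / h ^ m" using xy(2) by (rule awayE)
    note 1 = a b
    have "x * y = (a * b) / h ^ (n + m)" unfolding 1(2,4) using h0 by (simp add: field_simps power_add)
    then have "a * b \<in> P" using xy(3) away_mem_iff[OF P h C subring_mult[OF C 1(1,3)]] by simp
    then have "a \<in> P \<or> b \<in> P" by (rule D(7)[OF 1(1,3)])
    then show ?thesis unfolding a(2) b(2) using awayI[of _ P h] by blast
  qed
qed

lemma localization_away:
  assumes P: "prime_ideal_of C P" and h: "h \<in> C" "h \<notin> P" and C: "is_subring C"
  shows "localization (away C h) (away P h) = localization C P"
proof (intro equalityI subsetI)
  have h0: "h \<noteq> 0" using h(2) prime_idealD(2)[OF P] by auto
  fix x
  {
    assume "x \<in> localization (away C h) (away P h)"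
    then obtain y z where 1: "y \<in> away C h" "z \<in> away C h" "z \<notin> away P h" "x = y / z" by (rule localizationE)
    obtain a n where a: "a \<in> C" "y = a / h ^ n" using 1(1) by (rule awayE)
    obtain b m where b: "b \<in> C" "z = b / h ^ m" using 1(2) by (rule awayE)
    have "b \<notin> P" using 1(3) b away_mem_iff[OF P h C] by simp
    moreover have "h ^ n \<notin> P" using h(2) prime_ideal_power[OF P C h(1)] by blast
    ultimately have "h ^ n * b \<notin> P" using prime_idealD(7)[OF P subring_power[OF C h(1)] b(1)] by blast
    then have "(a * h ^ m) / (h ^ n * b) \<in> localization C P"
      using a b by (intro localizationI subring_mult[OF C] subring_power[OF C h(1)])
    moreover have "x = (a * h ^ m) / (h ^ n * b)" unfolding 1(4) a(2) b(2) using h0 by simp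
    ultimately show "x \<in> localization C P" by simp
  next
    assume "x \<in> localization C P"
    then obtain a b where 1: "a \<in> C" "b \<in> C" "b \<notin> P" "x = a / b" by (rule localizationE)
    have "b \<notin> away P h" using away_mem_iff[OF P h C 1(2), of 0] 1(3) by simp
    then show "x \<in> localization (away C h) (away P h)" unfolding 1(4)
      using 1 by (intro localizationI away_base)
  }
qed

lemma principal_open_model:
  assumes m: "affine_model X C \<phi>" and h: "h \<in> C"
  shows "principal_open X h = {x \<in> points X. h \<notin> \<phi> x}"
  using model_max_ideal[OF m _ h] by (auto simp: principal_open_def)

lemma points_open_subscheme: "points (open_subscheme X U) = points X \<inter> U"
  and stalk_open_subscheme: "stalk (open_subscheme X U) = stalk X"
  and scal_open_subscheme: "scal (open_subscheme X U) = scal X"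
  and zariski_open_subscheme: "zariski (open_subscheme X U) = subtopology (zariski X) U"
  by (simp_all add: open_subscheme_def)

text \<open>Extension and contraction identify the primes avoiding \<open>h\<close> with those of
  the localization at \<open>h\<close>, where \<open>h\<close> is a unit; stalks are unchanged
  because powers of \<open>h\<close> already are denominators at such points.\<close>

lemma affine_model_principal_open:
  assumes m: "affine_model X C \<phi>" and h: "h \<in> C" "h \<noteq> 0"
  shows "affine_model (open_subscheme X (principal_open X h)) (away C h) (\<lambda>x. away (\<phi> x) h)"
proof -
  note D = affine_modelD[OF m]
  let ?U = "{x \<in> points X. h \<notin> \<phi> x}"
  have PO: "principal_open X h = ?U" by (rule principal_open_model[OF m h(1)])
  have pts: "points (open_subscheme X ?U) = ?U" by (auto simp: points_open_subscheme)
  show ?thesis unfolding PO affine_model_def pts unfolding stalk_open_subscheme zariski_open_subscheme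
  proof (intro conjI ballI allI impI)
    show "is_subring (away C h)" using D(1) h by (rule subring_away)
    show "bij_betw (\<lambda>x. away (\<phi> x) h) ?U (Collect (prime_ideal_of (away C h)))"
      unfolding bij_betw_def
    proof
      show "inj_on (\<lambda>x. away (\<phi> x) h) ?U"
      proof (rule inj_onI)
        fix x y assume "x \<in> ?U" "y \<in> ?U" "away (\<phi> x) h = away (\<phi> y) h"
        then have 1: "x \<in> points X" "h \<notin> \<phi> x" "y \<in> points X" "h \<notin> \<phi> y" "away (\<phi> x) h = away (\<phi> y) h" by auto
        have "a \<in> \<phi> x \<longleftrightarrow> a \<in> \<phi> y" if "a \<in> C" for a
          using away_mem_iff[OF D(4)[OF 1(1)] h(1) 1(2) D(1) that, of 0]
            away_mem_iff[OF D(4)[OF 1(3)] h(1) 1(4) D(1) that, of 0] 1(5) by simp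
        then have "\<phi> x = \<phi> y" using prime_idealD(1)[OF D(4)[OF 1(1)]] prime_idealD(1)[OF D(4)[OF 1(3)]] by blast
        then show "x = y" using D(8) 1 by blast
      qed
      show "(\<lambda>x. away (\<phi> x) h) ` ?U = Collect (prime_ideal_of (away C h))"
      proof (intro equalityI subsetI)
        fix P assume "P \<in> (\<lambda>x. away (\<phi> x) h) ` ?U"
        then show "P \<in> Collect (prime_ideal_of (away C h))"
          using away_prime[OF D(4) h(1) _ D(1)] by auto
      next
        fix Q assume "Q \<in> Collect (prime_ideal_of (away C h))"
        then have Q: "prime_ideal_of (away C h) Q" by simp
        have CA: "C \<subseteq> away C h" by (auto intro: away_base)
        obtain x where x: "x \<in> points X" "\<phi> x = Q \<inter> C" using D(7)[OF prime_contraction[OF Q CA D(1)]] by blast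
        have ih: "1 / h \<in> away C h" using awayI[OF subring_one[OF D(1)], of h 1] by simp
        have "h \<notin> Q"
        proof
          assume "h \<in> Q"
          then have "1 / h * h \<in> Q" using prime_idealD(5)[OF Q ih] by blast
          then show False using h(2) prime_idealD(3)[OF Q] by simp
        qed
        moreover have "away (Q \<inter> C) h = Q"
        proof (intro equalityI subsetI)
          fix z assume "z \<in> away (Q \<inter> C) h"
          then obtain a n where "a \<in> Q \<inter> C" and a2: "z = a / h ^ n" by (rule awayE)
          then have a: "a \<in> Q" "z = a / h ^ n" by auto
          have "(1 / h ^ n) * a \<in> Q" using prime_idealD(5)[OF Q awayI[OF subring_one[OF D(1)]] a(1)] .
          then show "z \<in> Q" using a(2) by simp
        next
          fix z assume z: "z \<in> Q"
          then obtain a n where a: "a \<in> C" "z = a / h ^ n" using prime_idealD(1)[OF Q] by (meson awayE subsetD)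
          have "h ^ n * z \<in> Q" using CA subring_power[OF D(1) h(1)] by (intro prime_idealD(5)[OF Q _ z]) auto
          then have "a \<in> Q" using a h(2) by simp
          then show "z \<in> away (Q \<inter> C) h" using a by (auto intro: awayI)
        qed
        ultimately show "Q \<in> (\<lambda>x. away (\<phi> x) h) ` ?U" using x by (intro image_eqI[of _ _ x]) auto
      qed
    qed
  next
    fix x assume "x \<in> ?U"
    then show "stalk X x = localization (away C h) (away (\<phi> x) h)"
      using localization_away[OF D(4) h(1) _ D(1)] D(3) by simp
  next
    fix f assume "f \<in> away C h"
    then obtain a n where a: "a \<in> C" "f = a / h ^ n" by (rule awayE)
    have "{x \<in> ?U. f \<notin> away (\<phi> x) h} = {x \<in> points X. a \<notin> \<phi> x} \<inter> ?U"
      using away_mem_iff[OF D(4) h(1) _ D(1) a(1)] a(2) by auto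
    then show "openin (subtopology (zariski X) ?U) {x \<in> ?U. f \<notin> away (\<phi> x) h}"
      using D(5)[OF a(1)] by (auto simp: openin_subtopology)
  next
    fix U x assume U: "openin (subtopology (zariski X) ?U) U" "x \<in> U"
    obtain V where V: "openin (zariski X) V" "U = V \<inter> ?U" using U(1) by (auto simp: openin_subtopology)
    have x: "x \<in> V" "x \<in> points X" "h \<notin> \<phi> x" using U(2) V(2) by auto
    obtain f where f: "f \<in> C" "f \<notin> \<phi> x" "{y \<in> points X. f \<notin> \<phi> y} \<subseteq> V" using D(6)[OF V(1) x(1)] by blast
    have "f \<in> away (\<phi> y) h \<longleftrightarrow> f \<in> \<phi> y" if "y \<in> ?U" for y
      using away_mem_iff[OF D(4) h(1) _ D(1) f(1), of y 0] that by simp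
    then have "f \<notin> away (\<phi> x) h \<and> {y \<in> ?U. f \<notin> away (\<phi> y) h} \<subseteq> U"
      using f x V(2) by auto
    then show "\<exists>f\<in>away C h. f \<notin> away (\<phi> x) h \<and> {y \<in> ?U. f \<notin> away (\<phi> y) h} \<subseteq> U"
      using away_base[OF f(1)] by blast
  qed
qed

section \<open>Affine schemes of finite type are varieties\<close>

text \<open>The denominator of one fraction representing the germ \<open>inverse e\<close> describes
  a neighbourhood on which that fraction stays a germ.\<close>

lemma model_unit_nbhd:
  assumes m: "affine_model X C \<phi>" and x: "x \<in> points X" and e: "inverse e \<in> stalk X x"
  shows "\<exists>b\<in>C. b \<notin> \<phi> x \<and> (\<forall>y\<in>points X. b \<notin> \<phi> y \<longrightarrow> inverse e \<in> stalk X y)"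
proof -
  note D = affine_modelD[OF m]
  obtain a b where 1: "a \<in> C" "b \<in> C" "b \<notin> \<phi> x" "inverse e = a / b"
    using e D(3)[OF x] localizationE[of "inverse e" C "\<phi> x"] by auto
  have "inverse e \<in> stalk X y" if "y \<in> points X" "b \<notin> \<phi> y" for y
    unfolding 1(4) D(3)[OF that(1)] using 1(1,2) that(2) by (rule localizationI)
  then show ?thesis using 1(2,3) by blast
qed

lemma affine_algebra_generated_Un:
  assumes "affine_algebra s T" "affine_algebra s W"
  shows "affine_algebra s (algebra_generated s (T \<union> W))"
proof -
  obtain G where G: "finite G" "W = algebra_generated s G" and s: "ring_hom_on UNIV s"
    using assms(2) by (auto simp: affine_algebra_def is_algebra_def)
  have "algebra_generated s (T \<union> W) = algebra_generated s (T \<union> G)"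
  proof
    have "W \<subseteq> algebra_generated s (T \<union> G)" unfolding G(2) by (rule generated_mono) simp
    then show "algebra_generated s (T \<union> W) \<subseteq> algebra_generated s (T \<union> G)"
      using generated_incl[of "T \<union> G" s] by (intro generated_idem[OF s]) auto
    show "algebra_generated s (T \<union> G) \<subseteq> algebra_generated s (T \<union> W)"
      using generated_incl[of G s] G(2) by (intro generated_mono) auto
  qed
  then show ?thesis using affine_algebra_finite_ext[OF assms(1) G(1)] by simp
qed

text \<open>The generic point lies in \<open>U\<close>, so the union of the stalks over
  \<open>U\<close> is the whole field of fractions of \<open>C\<close>. It is therefore a ring, and
  \<open>affine_variety_model\<close> applies.\<close>

lemma affine_open_model:
  assumes m: "affine_model X C \<phi>" and U: "affine_open X U"
  obtains \<phi>' where "affine_model (open_subscheme X U) (sections X U) \<phi>'"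
proof -
  note D = affine_modelD[OF m]
  have oU: "openin (zariski X) U" and aff: "affine_variety (open_subscheme X U)"
    using U by (auto simp: affine_open_def)
  have pU: "points (open_subscheme X U) = U" using openin_subset[OF oU] by (auto simp: points_open_subscheme)
  have sec: "sections (open_subscheme X U) U = sections X U" by (simp add: sections_def stalk_open_subscheme)
  obtain \<chi> where "bij_betw \<chi> U (Collect (prime_ideal_of (sections X U)))" "is_subring (sections X U)"
    using affine_variety_normal_form[OF aff refl] unfolding pU sec by metis
  then obtain x where x: "x \<in> U" using prime_ideal_zero by (force simp: bij_betw_def)
  obtain g where g: "g \<in> points X" "\<phi> g = {0}" by (rule model_generic_point[OF m])
  obtain f where f: "f \<in> C" "f \<notin> \<phi> x" "{y \<in> points X. f \<notin> \<phi> y} \<subseteq> U" using D(6)[OF oU x] by blast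
  have "f \<noteq> 0" using f(2) x openin_subset[OF oU] prime_idealD(2)[OF D(4)] by auto
  then have gU: "g \<in> U" using f g by auto
  have "function_field (open_subscheme X U) = frac_field C"
  proof
    have "stalk X g = frac_field C" using D(3)[OF g(1)] g(2) localization_zero by metis
    then show "frac_field C \<subseteq> function_field (open_subscheme X U)"
      unfolding function_field_def pU stalk_open_subscheme using gU by blast
    show "function_field (open_subscheme X U) \<subseteq> frac_field C"
      unfolding function_field_def pU stalk_open_subscheme
      using openin_subset[OF oU] D(3) localization_subset_frac[OF D(4)] by blast
  qed
  then have "is_subring (function_field (open_subscheme X U))" using subring_frac[OF D(1)] by simp
  then show ?thesis using affine_variety_model[OF aff] that unfolding pU sec by metis
qed

text \<open>This is separatedness of affine schemes. A prime of \<open>E\<close> contracts to a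
  point of \<open>U\<close> and to a point of \<open>V\<close>; both have the same contraction to
  \<open>C\<close>, hence are the same point of \<open>U \<inter> V\<close>. So the spectrum of
  \<open>E\<close> has no points besides those of the intersection.\<close>

lemma affine_open_Int:
  assumes m: "affine_model X C \<phi>" and U: "affine_open X U" and V: "affine_open X V"
  defines "E \<equiv> algebra_generated (scal X) (sections X U \<union> sections X V)"
  shows "affine_open X (U \<inter> V) \<and> sections X (U \<inter> V) = E"
proof -
  note D = affine_modelD[OF m]
  define T where "T = sections X U"
  define W where "W = sections X V"
  have oU: "openin (zariski X) U" and oV: "openin (zariski X) V"
    using U V by (auto simp: affine_open_def)
  have oUV: "openin (zariski X) (U \<inter> V)" using oU oV by (rule openin_Int)
  have sU: "U \<subseteq> points X" "V \<subseteq> points X" using oU oV by (auto dest: openin_subset)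
  have pp: "points (open_subscheme X S) = S" if "S \<subseteq> points X" for S
    using that by (auto simp: points_open_subscheme)
  have sec: "sections (open_subscheme X S) S = sections X S" for S by (simp add: sections_def stalk_open_subscheme)
  obtain \<phi>U where mU: "affine_model (open_subscheme X U) T \<phi>U" using affine_open_model[OF m U] T_def by blast
  obtain \<phi>V where mV: "affine_model (open_subscheme X V) W \<phi>V" using affine_open_model[OF m V] W_def by blast
  note DU = affine_modelD[OF mU, unfolded pp[OF sU(1)] stalk_open_subscheme]
  note DV = affine_modelD[OF mV, unfolded pp[OF sU(2)] stalk_open_subscheme]
  have aT: "affine_algebra (scal X) T" and aW: "affine_algebra (scal X) W"
    using U V pp[OF sU(1)] pp[OF sU(2)] sec
    by (auto simp: affine_open_def affine_variety_def scal_open_subscheme T_def W_def)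
  have s: "ring_hom_on UNIV (scal X)" "range (scal X) \<subseteq> T" using aT by (auto simp: affine_algebra_def is_algebra_def)
  have EE: "E = algebra_generated (scal X) (T \<union> W)" by (simp add: E_def T_def W_def)
  have aE: "affine_algebra (scal X) E" unfolding EE by (rule affine_algebra_generated_Un[OF aT aW])
  have E: "is_subring E" using aE by (auto simp: affine_algebra_def is_algebra_def)
  have TE: "T \<subseteq> E" "W \<subseteq> E" unfolding EE using generated_incl[of "T \<union> W" "scal X"] by auto
  have CT: "C \<subseteq> T" unfolding T_def sections_def using model_subset_stalk[OF m] sU by blast
  have CW: "C \<subseteq> W" unfolding W_def sections_def using model_subset_stalk[OF m] sU by blast
  have stsub: "is_subring (stalk X x)" if "x \<in> points X" for x
    using subring_localization[OF D(1) D(4)[OF that]] D(3)[OF that] by simp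
  have Est: "E \<subseteq> stalk X x" if x: "x \<in> U" "x \<in> V" for x
  proof -
    have "T \<subseteq> stalk X x" "W \<subseteq> stalk X x" using x by (auto simp: T_def W_def sections_def)
    moreover have "is_algebra (scal X) (stalk X x)"
      using s stsub[of x] x sU \<open>T \<subseteq> stalk X x\<close> by (auto simp: is_algebra_def)
    ultimately show ?thesis unfolding EE by (intro generated_least) auto
  qed
  \<comment> \<open>The prime of \<open>E\<close> at a point is read off from the stalk, which
    treats \<open>U\<close> and \<open>V\<close> symmetrically.\<close>
  define \<phi>E where "\<phi>E x = {e \<in> E. e \<in> max_ideal (stalk X x)}" for x
  have maxT: "t \<in> \<phi>U x \<longleftrightarrow> t \<in> max_ideal (stalk X x)" if "x \<in> U" "t \<in> T" for x t
    using model_max_ideal[OF mU, unfolded pp[OF sU(1)] stalk_open_subscheme] that by blast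
  have maxW: "t \<in> \<phi>V x \<longleftrightarrow> t \<in> max_ideal (stalk X x)" if "x \<in> V" "t \<in> W" for x t
    using model_max_ideal[OF mV, unfolded pp[OF sU(2)] stalk_open_subscheme] that by blast
  have maxC: "t \<in> \<phi> x \<longleftrightarrow> t \<in> max_ideal (stalk X x)" if "x \<in> points X" "t \<in> C" for x t
    using model_max_ideal[OF m] that by blast
  have unit: "e \<in> max_ideal (stalk X x) \<longleftrightarrow> e = 0 \<or> inverse e \<notin> stalk X x" if "x \<in> U" "x \<in> V" "e \<in> E" for x e
    using Est[OF that(1,2)] that(3) by (auto simp: max_ideal_def)
  have prime: "prime_ideal_of E (\<phi>E x)" and loc: "stalk X x = localization E (\<phi>E x)" if x: "x \<in> U" "x \<in> V" for x
  proof -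
    have xp: "x \<in> points X" using x sU by auto
    note st = DU(3)[OF x(1)]
    note p = DU(4)[OF x(1)]
    have O: "is_subring (stalk X x)" by (rule stsub[OF xp])
    have inv: "inverse z \<in> stalk X x" if "z \<in> stalk X x" "z \<notin> max_ideal (stalk X x)" for z
      using that by (simp add: max_ideal_def)
    have pm: "prime_ideal_of (stalk X x) (max_ideal (stalk X x))"
      using max_ideal_prime[OF DU(1) p] st by simp
    have "\<phi>E x = max_ideal (stalk X x) \<inter> E" by (auto simp: \<phi>E_def)
    then show "prime_ideal_of E (\<phi>E x)" using prime_contraction[OF pm Est[OF x] E] by simp
    show "stalk X x = localization E (\<phi>E x)"
    proof (intro equalityI subsetI)
      fix z assume "z \<in> stalk X x"
      then obtain a b where 1: "a \<in> T" "b \<in> T" "b \<notin> \<phi>U x" "z = a / b" unfolding st by (rule localizationE)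
      have "b \<notin> \<phi>E x" using maxT[OF x(1) 1(2)] 1(3) by (simp add: \<phi>E_def)
      then show "z \<in> localization E (\<phi>E x)" unfolding 1(4) using 1(1,2) TE(1) by (intro localizationI) auto
    next
      fix z assume "z \<in> localization E (\<phi>E x)"
      then obtain a b where 1: "a \<in> E" "b \<in> E" "b \<notin> \<phi>E x" "z = a / b" by (rule localizationE)
      have "inverse b \<in> stalk X x" using 1 Est[OF x] by (intro inv) (auto simp: \<phi>E_def)
      then show "z \<in> stalk X x" unfolding 1(4) divide_inverse using 1(1) Est[OF x] by (intro subring_mult[OF O]) auto
    qed
  qed
  have pUV: "points (open_subscheme X (U \<inter> V)) = U \<inter> V" by (rule pp) (use sU in auto)
  have mE: "affine_model (open_subscheme X (U \<inter> V)) E \<phi>E"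
    unfolding affine_model_def pUV unfolding stalk_open_subscheme zariski_open_subscheme
  proof (intro conjI ballI allI impI)
    show "is_subring E" by fact
    show "bij_betw \<phi>E (U \<inter> V) (Collect (prime_ideal_of E))"
      unfolding bij_betw_def
    proof
      show "inj_on \<phi>E (U \<inter> V)"
      proof (rule inj_onI)
        fix x y assume 1: "x \<in> U \<inter> V" "y \<in> U \<inter> V" "\<phi>E x = \<phi>E y"
        have "t \<in> \<phi>U x \<longleftrightarrow> t \<in> \<phi>U y" if "t \<in> T" for t
        proof -
          have "t \<in> \<phi>E x \<longleftrightarrow> t \<in> \<phi>E y" using 1(3) by simp
          then show ?thesis using maxT[of x t] maxT[of y t] 1(1,2) that TE(1) by (auto simp: \<phi>E_def)
        qed
        then have "\<phi>U x = \<phi>U y" using prime_idealD(1)[OF DU(4)[of x]] prime_idealD(1)[OF DU(4)[of y]] 1 by blast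
        then show "x = y" using DU(8) 1 by blast
      qed
      show "\<phi>E ` (U \<inter> V) = Collect (prime_ideal_of E)"
      proof (intro equalityI subsetI)
        fix Q assume "Q \<in> Collect (prime_ideal_of E)"
        then have Q: "prime_ideal_of E Q" by simp
        obtain x where x: "x \<in> U" "\<phi>U x = Q \<inter> T" using DU(7)[OF prime_contraction[OF Q TE(1) DU(1)]] by blast
        obtain y where y: "y \<in> V" "\<phi>V y = Q \<inter> W" using DV(7)[OF prime_contraction[OF Q TE(2) DV(1)]] by blast
        have xp: "x \<in> points X" "y \<in> points X" using x y sU by auto
        \<comment> \<open>Both sides say that \<open>c\<close> lies in \<open>Q\<close>; injectivity
          of \<open>\<phi>\<close> then gives \<open>x = y\<close>.\<close>
        have "c \<in> \<phi> x \<longleftrightarrow> c \<in> \<phi> y" if c: "c \<in> C" for c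
        proof -
          have "c \<in> T" "c \<in> W" using c CT CW by auto
          then show ?thesis using maxC[OF xp(1) c] maxC[OF xp(2) c] maxT[OF x(1), of c] maxW[OF y(1), of c] x(2) y(2)
            by simp
        qed
        then have "\<phi> x = \<phi> y" using prime_idealD(1)[OF D(4)[OF xp(1)]] prime_idealD(1)[OF D(4)[OF xp(2)]] by blast
        then have xV: "x \<in> V" using D(8)[OF xp] y(1) by simp
        have st: "stalk X x = localization T (Q \<inter> T)" using DU(3)[OF x(1)] x(2) by simp
        \<comment> \<open>An element of \<open>E\<close> is a fraction over \<open>T\<close> at
          \<open>x\<close>, so membership in either prime can be decided on numerators and
          denominators in \<open>T\<close>.\<close>
        have "e \<in> \<phi>E x \<longleftrightarrow> e \<in> Q" if e: "e \<in> E" for e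
        proof
          assume "e \<in> \<phi>E x"
          then have m: "e = 0 \<or> inverse e \<notin> stalk X x" using unit[OF x(1) xV e] by (simp add: \<phi>E_def)
          show "e \<in> Q"
          proof (rule ccontr)
            assume eQ: "e \<notin> Q"
            then have e0: "e \<noteq> 0" using prime_idealD(2)[OF Q] by auto
            have "e \<in> localization T (Q \<inter> T)" using e Est[OF x(1) xV] st by blast
            then obtain a b where 1: "a \<in> T" "b \<in> T" "b \<notin> Q \<inter> T" "e = a / b" by (rule localizationE)
            have b0: "b \<noteq> 0" using 1(4) e0 by auto
            have "e * b = a" using 1(4) b0 by simp
            moreover have "e * b \<notin> Q" using prime_idealD(7)[OF Q e] 1 TE(1) eQ by blast
            ultimately have "a \<notin> Q" by simp
            then have "b / a \<in> stalk X x" unfolding st using 1 by (intro localizationI) auto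
            then show False using m e0 1(4) by simp
          qed
        next
          assume eQ: "e \<in> Q"
          show "e \<in> \<phi>E x"
          proof (rule ccontr)
            assume "e \<notin> \<phi>E x"
            then have m: "e \<noteq> 0" "inverse e \<in> stalk X x" using unit[OF x(1) xV e] e by (simp_all add: \<phi>E_def)
            obtain a b where 1: "a \<in> T" "b \<in> T" "b \<notin> Q \<inter> T" "inverse e = a / b"
              using m(2) unfolding st by (rule localizationE)
            have "b \<noteq> 0" using 1(4) m(1) by auto
            then have "b = (inverse e * b) * e" using m(1) by simp
            also have "inverse e * b = a" using 1(4) \<open>b \<noteq> 0\<close> by simp
            finally have "b = a * e" .
            then have "b \<in> Q" using prime_idealD(5)[OF Q _ eQ] 1(1) TE(1) by auto
            then show False using 1 by blast
          qed
        qed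
        then have "\<phi>E x = Q" using prime_idealD(1)[OF Q] by (auto simp: \<phi>E_def)
        then show "Q \<in> \<phi>E ` (U \<inter> V)" using x(1) xV by blast
      qed (use prime in auto)
    qed
    show "stalk X x = localization E (\<phi>E x)" if "x \<in> U \<inter> V" for x using loc that by blast
  next
    fix e assume e: "e \<in> E"
    have "openin (zariski X) {x \<in> U \<inter> V. e \<notin> \<phi>E x}"
    proof (subst openin_subopen, intro ballI)
      fix x assume "x \<in> {x \<in> U \<inter> V. e \<notin> \<phi>E x}"
      then have x: "x \<in> U" "x \<in> V" "e \<notin> \<phi>E x" by auto
      then have e1: "e \<noteq> 0" "inverse e \<in> stalk X x" using unit[OF x(1,2) e] e by (simp_all add: \<phi>E_def)
      have xp: "x \<in> points X" using x sU by auto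
      obtain b where b: "b \<in> C" "b \<notin> \<phi> x" "\<And>y. y \<in> points X \<Longrightarrow> b \<notin> \<phi> y \<Longrightarrow> inverse e \<in> stalk X y"
        using model_unit_nbhd[OF m xp e1(2)] by blast
      let ?S = "{y \<in> points X. b \<notin> \<phi> y} \<inter> (U \<inter> V)"
      have "openin (zariski X) ?S" using D(5)[OF b(1)] oUV by (rule openin_Int)
      moreover have "x \<in> ?S" using x xp b by simp
      moreover have "?S \<subseteq> {x \<in> U \<inter> V. e \<notin> \<phi>E x}"
        using b(3) e1(1) unit e by (auto simp: \<phi>E_def)
      ultimately show "\<exists>S. openin (zariski X) S \<and> x \<in> S \<and> S \<subseteq> {x \<in> U \<inter> V. e \<notin> \<phi>E x}" by blast
    qed
    moreover have "{x \<in> U \<inter> V. e \<notin> \<phi>E x} = {x \<in> U \<inter> V. e \<notin> \<phi>E x} \<inter> (U \<inter> V)" by auto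
    ultimately show "openin (subtopology (zariski X) (U \<inter> V)) {x \<in> U \<inter> V. e \<notin> \<phi>E x}"
      unfolding openin_subtopology by blast
  next
    fix S x assume S: "openin (subtopology (zariski X) (U \<inter> V)) S" "x \<in> S"
    then have oS: "openin (zariski X) S" using oUV by (simp add: openin_open_subtopology)
    have SUV: "S \<subseteq> U \<inter> V" using S(1) openin_subset by fastforce
    obtain f where f: "f \<in> C" "f \<notin> \<phi> x" "{y \<in> points X. f \<notin> \<phi> y} \<subseteq> S" using D(6)[OF oS S(2)] by blast
    have fE: "f \<in> E" using f(1) CT TE by auto
    have fy: "f \<in> \<phi>E y \<longleftrightarrow> f \<in> \<phi> y" if "y \<in> U \<inter> V" for y
      using maxC[of y f] f(1) fE that sU by (auto simp: \<phi>E_def)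
    have "x \<in> U \<inter> V" using S(2) SUV by blast
    then have "f \<notin> \<phi>E x" using fy f(2) by blast
    moreover have "{y \<in> U \<inter> V. f \<notin> \<phi>E y} \<subseteq> S" using fy f(3) sU by auto
    ultimately have "f \<notin> \<phi>E x \<and> {y \<in> U \<inter> V. f \<notin> \<phi>E y} \<subseteq> S" by blast
    then show "\<exists>f\<in>E. f \<notin> \<phi>E x \<and> {y \<in> U \<inter> V. f \<notin> \<phi>E y} \<subseteq> S" using fE by blast
  qed
  have "affine_variety (open_subscheme X (U \<inter> V))"
    using affine_variety_of_model[OF mE] aE by (simp add: scal_open_subscheme)
  moreover have "sections X (U \<inter> V) = E" using model_sections[OF mE] pUV sec by simp
  ultimately show ?thesis using oUV by (simp add: affine_open_def)
qed

text \<open>The point of the zero ideal lies in every non-empty open set, so a closed set containing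
  it is everything.\<close>

lemma model_irreducible:
  assumes m: "affine_model X C \<phi>"
  shows "irreducible_in (zariski X) (points X)"
proof -
  note D = affine_modelD[OF m]
  obtain g where g: "g \<in> points X" "\<phi> g = {0}" by (rule model_generic_point[OF m])
  have cl: "points X \<subseteq> A" if A: "closedin (zariski X) A" "g \<in> A" for A
  proof (rule ccontr)
    assume "\<not> points X \<subseteq> A"
    then obtain x where x: "x \<in> points X - A" by blast
    have "openin (zariski X) (points X - A)" using A(1) by (simp add: closedin_def)
    then obtain f where f: "f \<in> C" "f \<notin> \<phi> x" "{y \<in> points X. f \<notin> \<phi> y} \<subseteq> points X - A" using D(6) x by blast
    have "f \<noteq> 0" using f(2) x prime_idealD(2)[OF D(4)] by auto
    then show False using f(3) g A(2) by auto
  qed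
  then show ?thesis unfolding irreducible_in_def using g(1) by blast
qed

lemma variety_of_model:
  assumes m: "affine_model X C \<phi>" and aff: "affine_algebra (scal X) C"
  shows "variety X"
proof -
  have "open_subscheme X (points X) = X" by (simp add: open_subscheme_def)
  then have "affine_open X (points X)"
    using affine_variety_of_model[OF assms] by (simp add: affine_open_def)
  then have "\<exists>\<U>. finite \<U> \<and> (\<forall>U\<in>\<U>. affine_open X U) \<and> \<Union>\<U> = points X"
    by (intro exI[of _ "{points X}"]) simp
  then show ?thesis unfolding variety_def separated_def
    using model_irreducible[OF m] affine_open_Int[OF m] by blast
qed

section \<open>A variety whose cylinder is affine is affine\<close>

text \<open>This is the preimage of \<open>m\<close> under evaluation at \<open>t = 0\<close>, the
  ideal generated by \<open>m\<close> and \<open>t\<close>. Over a local ring it is the origin of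
  the closed fibre.\<close>

lemma prime_zero_section:
  assumes O: "is_subring R" and m: "prime_ideal_of R m"
  shows "prime_ideal_of (poly_over R) {g \<in> poly_over R. coeff g 0 \<in> m}"
  unfolding prime_ideal_of_def
proof (intro conjI ballI impI)
  note D = prime_idealD[OF m] and p = subring_poly_over[OF O]
  let ?Q = "{g \<in> poly_over R. coeff g 0 \<in> m}"
  show "?Q \<subseteq> poly_over R" by auto
  show "0 \<in> ?Q" using D(2) subring_zero[OF p] by simp
  show "1 \<notin> ?Q" using D(3) by simp
  show "a + b \<in> ?Q" if "a \<in> ?Q" "b \<in> ?Q" for a b using that D(4) subring_add[OF p] by simp
  show "r * a \<in> ?Q" if "r \<in> poly_over R" "a \<in> ?Q" for r a
    using that D(5)[OF poly_overD[OF that(1)]] subring_mult[OF p] by (simp add: coeff_mult)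
  show "a \<in> ?Q \<or> b \<in> ?Q" if "a \<in> poly_over R" "b \<in> poly_over R" "a * b \<in> ?Q" for a b
    using that D(7)[OF poly_overD[OF that(1)] poly_overD[OF that(2)]] by (simp add: coeff_mult)
qed

lemma zero_section_point:
  assumes x: "x \<in> points X" and R: "is_subring R" and P: "prime_ideal_of R P" and st: "stalk X x = localization R P"
  shows "(x, {g \<in> poly_over (stalk X x). coeff g 0 \<in> max_ideal (stalk X x)}) \<in> A1_points X"
proof -
  have O: "is_subring (stalk X x)" using st subring_localization[OF R P] by simp
  have "prime_ideal_of (stalk X x) (max_ideal (stalk X x))" using st max_ideal_prime[OF R P] by simp
  then have "prime_ideal_of (poly_over (stalk X x)) {g \<in> poly_over (stalk X x). coeff g 0 \<in> max_ideal (stalk X x)}"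
    by (rule prime_zero_section[OF O])
  moreover have "[:c:] \<in> poly_over (stalk X x)" if "c \<in> stalk X x" for c
    using poly_over_const[OF subring_zero[OF O] that] .
  ultimately show ?thesis using x by (auto simp: A1_points_def max_ideal_def)
qed

text \<open>The normal form of the open subscheme \<open>U\<close>, see \<open>affine_variety_normal_form\<close>.\<close>

definition chart :: "('k::field, 'p, 'f::field) scheme \<Rightarrow> 'p set \<Rightarrow> ('p \<Rightarrow> 'f set) \<Rightarrow> ('f \<Rightarrow> 'f) \<Rightarrow> bool" where
  "chart X U \<phi> \<psi> \<longleftrightarrow> openin (zariski X) U \<and> affine_algebra (scal X) (sections X U) \<and>
     bij_betw \<phi> U (Collect (prime_ideal_of (sections X U))) \<and>
     (\<forall>f\<in>sections X U. openin (zariski X) {x\<in>U. f \<notin> \<phi> x}) \<and>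
     (\<forall>W x. openin (zariski X) W \<longrightarrow> x \<in> W \<longrightarrow> x \<in> U \<longrightarrow>
        (\<exists>f\<in>sections X U. f \<notin> \<phi> x \<and> {y\<in>U. f \<notin> \<phi> y} \<subseteq> W)) \<and>
     bij_betw \<psi> (\<Union>x\<in>U. stalk X x) (frac_field (sections X U)) \<and>
     ring_hom_on (\<Union>x\<in>U. stalk X x) \<psi> \<and> (\<forall>t\<in>sections X U. \<psi> t = t) \<and>
     (\<forall>x\<in>U. \<psi> ` stalk X x = localization (sections X U) (\<phi> x))"

lemma affine_open_chart:
  assumes "affine_open X U"
  obtains \<phi> \<psi> where "chart X U \<phi> \<psi>"
proof -
  have oU: "openin (zariski X) U" and aff: "affine_variety (open_subscheme X U)"
    using assms by (auto simp: affine_open_def)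
  have pU: "points (open_subscheme X U) = U" using openin_subset[OF oU] by (auto simp: points_open_subscheme)
  have sec: "sections (open_subscheme X U) U = sections X U" by (simp add: sections_def stalk_open_subscheme)
  have ff: "function_field (open_subscheme X U) = (\<Union>x\<in>U. stalk X x)"
    by (simp only: function_field_def pU stalk_open_subscheme)
  have aa: "affine_algebra (scal X) (sections X U)"
    using aff unfolding affine_variety_def pU sec scal_open_subscheme by blast
  show ?thesis
  proof (rule affine_variety_normal_form[OF aff refl, unfolded pU sec ff, unfolded stalk_open_subscheme])
    fix \<phi> \<psi>
    assume n: "bij_betw \<phi> U (Collect (prime_ideal_of (sections X U)))"
      "\<And>f. f \<in> sections X U \<Longrightarrow> openin (zariski (open_subscheme X U)) {x\<in>U. f \<notin> \<phi> x}"
      "\<And>W x. openin (zariski (open_subscheme X U)) W \<Longrightarrow> x \<in> W \<Longrightarrow> \<exists>f\<in>sections X U. f \<notin> \<phi> x \<and> {y\<in>U. f \<notin> \<phi> y} \<subseteq> W"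
      "bij_betw \<psi> (\<Union>x\<in>U. stalk X x) (frac_field (sections X U))" "ring_hom_on (\<Union>x\<in>U. stalk X x) \<psi>"
      "\<And>t. t \<in> sections X U \<Longrightarrow> \<psi> t = t" "\<And>x. x \<in> U \<Longrightarrow> \<psi> ` stalk X x = localization (sections X U) (\<phi> x)"
    have "chart X U \<phi> \<psi>"
      unfolding chart_def
    proof (intro conjI ballI allI impI oU aa n(1) n(4,5))
      show "openin (zariski X) {x\<in>U. f \<notin> \<phi> x}" if "f \<in> sections X U" for f
        using n(2)[OF that] oU by (simp add: zariski_open_subscheme openin_open_subtopology)
      show "\<exists>f\<in>sections X U. f \<notin> \<phi> x \<and> {y \<in> U. f \<notin> \<phi> y} \<subseteq> W"
        if W: "openin (zariski X) W" "x \<in> W" "x \<in> U" for W x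
      proof -
        have "openin (zariski (open_subscheme X U)) (W \<inter> U)"
          using W(1) by (auto simp: zariski_open_subscheme openin_subtopology)
        then show ?thesis using n(3)[of "W \<inter> U" x] W by blast
      qed
    qed (use n(6,7) in auto)
    then show thesis using that by blast
  qed
qed

lemma chartD:
  assumes "chart X U \<phi> \<psi>"
  shows "openin (zariski X) U" "affine_algebra (scal X) (sections X U)"
    "bij_betw \<phi> U (Collect (prime_ideal_of (sections X U)))"
    "f \<in> sections X U \<Longrightarrow> openin (zariski X) {x\<in>U. f \<notin> \<phi> x}"
    "openin (zariski X) W \<Longrightarrow> x \<in> W \<Longrightarrow> x \<in> U \<Longrightarrow> \<exists>f\<in>sections X U. f \<notin> \<phi> x \<and> {y\<in>U. f \<notin> \<phi> y} \<subseteq> W"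
    "bij_betw \<psi> (\<Union>x\<in>U. stalk X x) (frac_field (sections X U))"
    "ring_hom_on (\<Union>x\<in>U. stalk X x) \<psi>" "f \<in> sections X U \<Longrightarrow> \<psi> f = f"
    "x \<in> U \<Longrightarrow> \<psi> ` stalk X x = localization (sections X U) (\<phi> x)"
    "x \<in> U \<Longrightarrow> prime_ideal_of (sections X U) (\<phi> x)" "is_subring (sections X U)"
    "x \<in> U \<Longrightarrow> sections X U \<subseteq> stalk X x" "prime_ideal_of (sections X U) P \<Longrightarrow> \<exists>x\<in>U. \<phi> x = P"
proof -
  note a = assms[unfolded chart_def]
  note a2 = a[THEN conjunct2] note a3 = a2[THEN conjunct2] note a4 = a3[THEN conjunct2]
  note a5 = a4[THEN conjunct2] note a6 = a5[THEN conjunct2] note a7 = a6[THEN conjunct2]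
  note a8 = a7[THEN conjunct2]
  show "openin (zariski X) U" by (rule a[THEN conjunct1])
  show aa: "affine_algebra (scal X) (sections X U)" by (rule a2[THEN conjunct1])
  show b: "bij_betw \<phi> U (Collect (prime_ideal_of (sections X U)))" by (rule a3[THEN conjunct1])
  show "f \<in> sections X U \<Longrightarrow> openin (zariski X) {x\<in>U. f \<notin> \<phi> x}" by (rule bspec[OF a4[THEN conjunct1]])
  show "openin (zariski X) W \<Longrightarrow> x \<in> W \<Longrightarrow> x \<in> U \<Longrightarrow> \<exists>f\<in>sections X U. f \<notin> \<phi> x \<and> {y\<in>U. f \<notin> \<phi> y} \<subseteq> W"
    by (rule a5[THEN conjunct1, rule_format])
  show "bij_betw \<psi> (\<Union>x\<in>U. stalk X x) (frac_field (sections X U))" by (rule a6[THEN conjunct1])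
  show "ring_hom_on (\<Union>x\<in>U. stalk X x) \<psi>" by (rule a7[THEN conjunct1])
  show "f \<in> sections X U \<Longrightarrow> \<psi> f = f" by (rule bspec[OF a8[THEN conjunct1]])
  show "x \<in> U \<Longrightarrow> \<psi> ` stalk X x = localization (sections X U) (\<phi> x)" by (rule bspec[OF a8[THEN conjunct2]])
  have im: "\<phi> ` U = Collect (prime_ideal_of (sections X U))" using b by (simp add: bij_betw_def)
  show "prime_ideal_of (sections X U) (\<phi> x)" if "x \<in> U"
  proof -
    have "\<phi> x \<in> \<phi> ` U" using that by (rule imageI)
    then show ?thesis unfolding im by simp
  qed
  show "is_subring (sections X U)" using aa by (simp add: affine_algebra_def is_algebra_def)
  show "x \<in> U \<Longrightarrow> sections X U \<subseteq> stalk X x" by (auto simp: sections_def)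
  show "\<exists>x\<in>U. \<phi> x = P" if "prime_ideal_of (sections X U) P"
  proof -
    have "P \<in> \<phi> ` U" using that im by simp
    then show ?thesis by blast
  qed
qed

text \<open>The stalk is not yet known to be a ring. But \<open>Q\<close> is an ideal, and its
  constants are exactly \<open>max_ideal (stalk X x)\<close>; multiplying constant polynomials
  inside \<open>Q\<close> therefore shows that products with elements of \<open>max_ideal\<close>
  stay in the stalk.\<close>

lemma A1_constants:
  assumes Q: "(x, Q) \<in> A1_points X"
  shows "r \<in> stalk X x \<Longrightarrow> a \<in> max_ideal (stalk X x) \<Longrightarrow> 0 \<in> stalk X x \<Longrightarrow> r * a \<in> max_ideal (stalk X x)"
    "1 \<in> stalk X x \<Longrightarrow> 1 \<notin> max_ideal (stalk X x)"
proof -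
  note A = A1_pointsD[OF Q]
  show "r * a \<in> max_ideal (stalk X x)" if r: "r \<in> stalk X x" "a \<in> max_ideal (stalk X x)" "0 \<in> stalk X x"
  proof -
    have "a \<in> stalk X x" using r(2) by (simp add: max_ideal_def)
    then have "[:a:] \<in> Q" using A(3) r(2) by simp
    then have q: "[:r:] * [:a:] \<in> Q" using poly_over_const[OF r(3,1)] by (intro prime_idealD(5)[OF A(2)])
    then have "[:r * a:] \<in> poly_over (stalk X x)" using prime_idealD(1)[OF A(2)] by (auto simp: mult.commute)
    then have "r * a \<in> stalk X x" using poly_overD[of "[:r * a:]" _ 0] by simp
    then show ?thesis using A(3)[of "r * a"] q by (simp add: mult.commute)
  qed
  show "1 \<notin> max_ideal (stalk X x)" if "1 \<in> stalk X x"
    using A(3)[OF that] prime_idealD(3)[OF A(2)] by (simp add: pCons_one)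
qed

lemma chart_inj:
  assumes "chart X U \<phi> \<psi>" "x \<in> U" "a \<in> stalk X x" "b \<in> stalk X x" "\<psi> a = \<psi> b"
  shows "a = b"
  using chartD(6)[OF assms(1)] assms(2-) by (metis UN_I bij_betw_imp_inj_on inj_onD)

lemma chart_mult:
  assumes "chart X U \<phi> \<psi>" "x \<in> U" "a \<in> stalk X x" "b \<in> stalk X x"
  shows "\<psi> (a * b) = \<psi> a * \<psi> b"
  by (rule hom_mult[OF chartD(7)[OF assms(1)]]) (use assms in auto)

text \<open>Over a non-generic point of a chart, a nonzero function \<open>f\<close> vanishing there satisfies
  \<open>r * f \<in> stalk X x\<close> for all germs \<open>r\<close>, which pins down \<open>r\<close> as the fraction \<open>\<psi> r\<close>.\<close>

lemma stalk_special_point: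
  assumes c: "chart X U \<phi> \<psi>" and x: "x \<in> U" and Q: "(x, Q) \<in> A1_points X" and nz: "\<phi> x \<noteq> {0}"
  shows "stalk X x = localization (sections X U) (\<phi> x)"
proof -
  let ?T = "sections X U" and ?O = "stalk X x"
  note D = chartD[OF c] and A = A1_constants[OF Q]
  note inj = chart_inj[OF c x] and mult = chart_mult[OF c x]
  have T: "is_subring ?T" by (rule D(11))
  have p: "prime_ideal_of ?T (\<phi> x)" by (rule D(10)[OF x])
  have TO: "?T \<subseteq> ?O" by (rule D(12)[OF x])
  have O01: "0 \<in> ?O" "1 \<in> ?O" using TO subring_zero[OF T] subring_one[OF T] by auto
  have \<psi>1: "\<psi> 1 = 1" using D(8)[OF subring_one[OF T]] .
  have \<psi>O: "\<psi> r \<in> localization ?T (\<phi> x)" if "r \<in> ?O" for r using D(9)[OF x] that by blast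
  have mO: "max_ideal ?O \<subseteq> ?O" by (auto simp: max_ideal_def)
  obtain f where f: "f \<in> \<phi> x" "f \<noteq> 0" using nz prime_idealD(2)[OF p] by blast
  have fT: "f \<in> ?T" using prime_idealD(1)[OF p] f(1) by blast
  \<comment> \<open>Otherwise \<open>inverse f\<close> is a germ, \<open>\<psi>\<close> fixes it,
    and it lies in the localization at a prime containing \<open>f\<close>.\<close>
  have fm: "f \<in> max_ideal ?O"
  proof (rule ccontr)
    assume n: "f \<notin> max_ideal ?O"
    have fO: "f \<in> ?O" using TO fT by blast
    have i: "inverse f \<in> ?O" using n fO by (simp add: max_ideal_def)
    have "\<psi> (f * inverse f) = f * \<psi> (inverse f)" using mult[OF fO i] D(8)[OF fT] by simp
    then have "\<psi> (inverse f) = inverse f" using f(2) \<psi>1 by (simp add: field_simps)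
    then have "inverse f \<in> localization ?T (\<phi> x)" using \<psi>O[OF i] by simp
    moreover have "f \<in> max_ideal (localization ?T (\<phi> x))" using localization_unit_iff[OF T p fT] f(1) by simp
    ultimately show False using f(2) by (simp add: max_ideal_def)
  qed
  \<comment> \<open>Let \<open>r\<close> be the germ with \<open>\<psi> r = 1 / e\<close>. If
    \<open>e\<close> were in \<open>max_ideal\<close>, then \<open>r * e\<close> would be a germ in
    \<open>max_ideal\<close> with image \<open>1\<close>, hence equal to \<open>1\<close>, which is
    impossible.\<close>
  have den: "1 / e \<in> ?O \<and> \<psi> (1 / e) = 1 / e" if e: "e \<in> ?T" "e \<notin> \<phi> x" for e
  proof -
    have e0: "e \<noteq> 0" using e(2) prime_idealD(2)[OF p] by auto
    have eO: "e \<in> ?O" using e(1) TO by blast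
    have "e \<notin> max_ideal ?O"
    proof
      assume em: "e \<in> max_ideal ?O"
      have "1 / e \<in> localization ?T (\<phi> x)" using subring_one[OF T] e by (intro localizationI)
      then obtain r where r: "r \<in> ?O" "\<psi> r = 1 / e" using D(9)[OF x] by (metis imageE)
      have re: "r * e \<in> max_ideal ?O" using A(1)[OF r(1) em O01(1)] .
      have "\<psi> (r * e) = \<psi> 1" using mult[OF r(1) eO] r(2) D(8)[OF e(1)] \<psi>1 e0 by simp
      then have "r * e = 1" using inj re mO O01(2) by blast
      then show False using A(2)[OF O01(2)] re by simp
    qed
    then have i: "1 / e \<in> ?O" using eO by (simp add: max_ideal_def inverse_eq_divide)
    have "\<psi> (e * (1 / e)) = e * \<psi> (1 / e)" using mult[OF eO i] D(8)[OF e(1)] by simp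
    then have "e * \<psi> (1 / e) = 1" using e0 \<psi>1 by simp
    then show ?thesis using i e0 by (simp add: field_simps)
  qed
  \<comment> \<open>The product \<open>r * e\<close> might not be a germ, but \<open>r * f\<close>
    and \<open>g * ((1 / e) * f)\<close> are, since \<open>f\<close> lies in
    \<open>max_ideal\<close>. They have the same image under \<open>\<psi>\<close>, and
    \<open>f\<close> cancels.\<close>
  have key: "r = g / e" if r: "r \<in> ?O" and ge: "g \<in> ?T" "e \<in> ?T" "e \<notin> \<phi> x" "\<psi> r = g / e" for r g e
  proof -
    have gO: "g \<in> ?O" and eO: "e \<in> ?O" and fO: "f \<in> ?O" using ge TO fT by auto
    have fr: "r * f \<in> max_ideal ?O" using A(1)[OF r fm O01(1)] .
    have fe: "(1 / e) * f \<in> max_ideal ?O" using A(1)[OF _ fm O01(1)] den[OF ge(2,3)] by blast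
    then have gfe: "g * ((1 / e) * f) \<in> max_ideal ?O" using A(1)[OF gO _ O01(1)] by blast
    have "\<psi> (g * ((1 / e) * f)) = g * ((1 / e) * f)"
      using mult[OF gO, of "(1 / e) * f"] mult[of "1 / e" f] fO fe mO den[OF ge(2,3)] D(8)[OF ge(1)] D(8)[OF fT] by auto
    also have "\<dots> = \<psi> (r * f)" using mult[OF r fO] ge(4) D(8)[OF fT] by simp
    finally have "g * ((1 / e) * f) = r * f" using inj gfe fr mO by blast
    then have "(g * (1 / e)) * f = r * f" by (simp only: mult.assoc)
    then have "g * (1 / e) = r" using mult_right_cancel[OF f(2)] by blast
    then show ?thesis by simp
  qed
  show ?thesis
  proof (intro equalityI subsetI)
    fix r assume r: "r \<in> ?O"
    obtain g e where ge: "g \<in> ?T" "e \<in> ?T" "e \<notin> \<phi> x" "\<psi> r = g / e" using \<psi>O[OF r] by (rule localizationE)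
    show "r \<in> localization ?T (\<phi> x)" unfolding key[OF r ge] using ge(1-3) by (rule localizationI)
  next
    fix z assume z: "z \<in> localization ?T (\<phi> x)"
    then obtain r where r: "r \<in> ?O" "\<psi> r = z" using D(9)[OF x] by (metis imageE)
    obtain g e where ge: "g \<in> ?T" "e \<in> ?T" "e \<notin> \<phi> x" "z = g / e" using z by (rule localizationE)
    have "r = z" using key[OF r(1) ge(1-3)] r(2) ge(4) by simp
    then show "z \<in> ?O" using r(1) by simp
  qed
qed

text \<open>At a generic point no non-zero constant lies in \<open>max_ideal\<close>, so
  \<open>A1_constants\<close> gives no products. A non-zero polynomial in \<open>Q\<close> takes
  over this role: multiples of it by constants stay in \<open>Q\<close>, and their leading
  coefficients are products of germs.\<close>

lemma stalk_generic_point: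
  assumes c: "chart X U \<phi> \<psi>" and x: "x \<in> U" and Q: "(x, Q) \<in> A1_points X"
    and z: "\<phi> x = {0}" and nz: "Q \<noteq> {0}"
  shows "stalk X x = frac_field (sections X U)"
proof -
  let ?T = "sections X U" and ?K = "stalk X x"
  note D = chartD[OF c] and A = A1_constants[OF Q] and B = A1_pointsD[OF Q]
  note inj = chart_inj[OF c x] and mult = chart_mult[OF c x]
  have T: "is_subring ?T" by (rule D(11))
  have TO: "?T \<subseteq> ?K" by (rule D(12)[OF x])
  have O01: "0 \<in> ?K" "1 \<in> ?K" using TO subring_zero[OF T] subring_one[OF T] by auto
  have \<psi>1: "\<psi> 1 = 1" "\<psi> 0 = 0" using D(8)[OF subring_one[OF T]] D(8)[OF subring_zero[OF T]] .
  have im: "\<psi> ` ?K = frac_field ?T" using D(9)[OF x] z localization_zero by metis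
  have mO: "max_ideal ?K \<subseteq> ?K" by (auto simp: max_ideal_def)
  have inv: "inverse a \<in> ?K" if a: "a \<in> ?K" for a
  proof (cases "a = 0")
    case True then show ?thesis using O01 by simp
  next
    case False
    \<comment> \<open>\<open>\<psi>\<close> maps the stalk onto a field, so some germ
      \<open>r\<close> has \<open>\<psi> (r * a) = 1\<close>. For \<open>a\<close> in
      \<open>max_ideal\<close> this would give \<open>r * a = 1\<close> inside
      \<open>max_ideal\<close>.\<close>
    have "a \<notin> max_ideal ?K"
    proof
      assume am: "a \<in> max_ideal ?K"
      have \<psi>a: "\<psi> a \<noteq> 0" using inj[OF a O01(1)] False \<psi>1(2) by metis
      have "\<psi> a \<in> frac_field ?T" using im a by blast
      then have "inverse (\<psi> a) \<in> frac_field ?T" by (rule frac_inverse[OF T])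
      then obtain r where r: "r \<in> ?K" "\<psi> r = inverse (\<psi> a)" using im by (metis imageE)
      have ra: "r * a \<in> max_ideal ?K" using A(1)[OF r(1) am O01(1)] .
      have "\<psi> (r * a) = \<psi> 1" using mult[OF r(1) a] r(2) \<psi>a \<psi>1 by simp
      then have "r * a = 1" using inj ra mO O01(2) by blast
      then show False using A(2)[OF O01(2)] ra by simp
    qed
    then show ?thesis using a by (simp add: max_ideal_def)
  qed
  obtain g where g: "g \<in> Q" "g \<noteq> 0" using nz prime_idealD(2)[OF B(2)] by blast
  define a where "a = lead_coeff g"
  have a0: "a \<noteq> 0" using g(2) by (simp add: a_def)
  have gK: "g \<in> poly_over ?K" using prime_idealD(1)[OF B(2)] g(1) by blast
  have aK: "a \<in> ?K" unfolding a_def using poly_overD[OF gK] .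
  have cst: "[:r:] \<in> poly_over ?K" if "r \<in> ?K" for r using poly_over_const[OF O01(1) that] .
  have "r * r' \<in> ?K" if r: "r \<in> ?K" "r' \<in> ?K" for r r'
  proof -
    \<comment> \<open>Dividing by the leading coefficient \<open>a\<close> first makes the leading
      coefficient of the whole product equal to \<open>r * r'\<close>, which is a germ because
      \<open>Q\<close> consists of polynomials over the stalk.\<close>
    have "[:r:] * ([:r':] * ([:inverse a:] * g)) \<in> Q"
      by (intro prime_idealD(5)[OF B(2)] cst r inv aK g(1))
    then have "coeff ([:r:] * ([:r':] * ([:inverse a:] * g))) (degree g) \<in> ?K"
      using prime_idealD(1)[OF B(2)] poly_overD by blast
    moreover have "coeff ([:r:] * ([:r':] * ([:inverse a:] * g))) (degree g) = r * r' * (inverse a * a)"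
      by (simp add: a_def)
    ultimately show ?thesis by (simp only: left_inverse[OF a0] mult_1_right)
  qed
  then have KK: "r * r' \<in> ?K" if "r \<in> ?K" "r' \<in> ?K" for r r' using that by blast
  show ?thesis
  proof (intro equalityI subsetI)
    fix r assume r: "r \<in> ?K"
    then have "\<psi> r \<in> frac_field ?T" using im by blast
    then obtain h e where he: "h \<in> ?T" "e \<in> ?T" "e \<noteq> 0" "\<psi> r = h / e" by (rule fracE)
    have hK: "h \<in> ?K" "e \<in> ?K" using he TO by auto
    have "\<psi> (r * e) = \<psi> h" using mult[OF r hK(2)] he D(8) by simp
    then have "r * e = h" using inj KK[OF r hK(2)] hK(1) by blast
    then have "r = h / e" using he(3) by (simp add: field_simps)
    then show "r \<in> frac_field ?T" using he by (auto intro: fracI)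
  next
    fix w assume "w \<in> frac_field ?T"
    then obtain h e where he: "h \<in> ?T" "e \<in> ?T" "e \<noteq> 0" "w = h / e" by (rule fracE)
    have hK: "h \<in> ?K" "inverse e \<in> ?K" using he TO inv by auto
    then show "w \<in> ?K" unfolding he(4) divide_inverse by (rule KK)
  qed
qed

lemma stalk_times_A1_localization:
  shows "stalk (times_A1 X) (x, Q) = localization (to_fract ` poly_over (stalk X x)) (to_fract ` Q)"
proof -
  show ?thesis (is "?L = ?R")
  proof (intro equalityI subsetI)
    fix z assume "z \<in> ?L"
    then obtain a b where "a \<in> poly_over (stalk X x)" "b \<in> poly_over (stalk X x)" "b \<notin> Q" "z = Fract a b"
      unfolding stalk_times_A1 by blast
    then show "z \<in> ?R" unfolding Fract_conv_to_fract by (auto intro!: localizationI)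
  next
    fix z assume "z \<in> ?R"
    then obtain a b where "a \<in> poly_over (stalk X x)" "b \<in> poly_over (stalk X x)" "b \<notin> Q" "z = Fract a b"
      unfolding Fract_conv_to_fract by (auto elim!: localizationE)
    then show "z \<in> ?L" unfolding stalk_times_A1 by blast
  qed
qed

lemma variety_chart:
  assumes "variety X" "x \<in> points X"
  obtains U \<phi> \<psi> where "x \<in> U" "affine_open X U" "chart X U \<phi> \<psi>"
proof -
  obtain \<U> where "\<forall>U\<in>\<U>. affine_open X U" "\<Union>\<U> = points X" using assms(1) by (auto simp: variety_def)
  then obtain U where "x \<in> U" "affine_open X U" using assms(2) by blast
  moreover from this(2) obtain \<phi> \<psi> where "chart X U \<phi> \<psi>" by (rule affine_open_chart)
  ultimately show ?thesis using that by blast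
qed

lemma fract_common_denominator:
  fixes G :: "'a::idom fract set"
  assumes "finite G"
  obtains e where "e \<noteq> 0" "G \<subseteq> away (range to_fract) (to_fract e)"
proof -
  let ?R = "range to_fract :: 'a fract set"
  have U: "is_subring (UNIV :: 'a set)" by (simp add: is_subring_def)
  have R: "is_subring ?R" by (rule hom_image_subring[OF hom_to_fract U])
  have "x \<in> localization ?R {0}" for x :: "'a fract"
  proof (cases x)
    case (Fract a b)
    then show ?thesis unfolding Fract_conv_to_fract by (auto intro!: localizationI)
  qed
  then obtain s where s: "s \<in> ?R" "s \<notin> {0}" "\<forall>g\<in>G. s * g \<in> ?R"
    using common_denominator[OF R prime_ideal_zero[OF R] assms, of "\<lambda>g. g"] by blast
  obtain e where e: "s = to_fract e" using s(1) by blast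
  have "g \<in> away ?R (to_fract e)" if "g \<in> G" for g
  proof -
    have "s * g \<in> ?R" using s(3) that by blast
    then have "s * g / s ^ 1 \<in> away ?R s" by (rule awayI)
    then show ?thesis using s(2) e by simp
  qed
  then show ?thesis using that[of e] s(2) e by auto
qed

lemma scal_inj:
  fixes s :: "'k::field \<Rightarrow> 'f::field"
  assumes "ring_hom_on UNIV s"
  shows "inj s"
proof -
  have R: "is_subring (UNIV :: 'k set)" by (simp add: is_subring_def)
  have "frac_field (UNIV :: 'k set) = UNIV" using frac_base[OF R] by blast
  then show ?thesis using hom_frac_inj[OF _ R, of s] assms by simp
qed

text \<open>Inverting \<open>t - c\<close> for infinitely many constants \<open>c\<close> requires infinitely many generators.\<close>

lemma not_all_linear_invertible:
  fixes s :: "'k::field_char_0 \<Rightarrow> 'g::field"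
  assumes s: "ring_hom_on UNIV s" and aff: "affine_algebra (\<lambda>c. to_fract [:s c:]) R"
  shows "\<exists>c. inverse (to_fract [:- s c, 1:]) \<notin> R"
proof (rule ccontr)
  assume "\<not> ?thesis"
  then have all: "inverse (to_fract [:- s c, 1:]) \<in> R" for c by blast
  let ?s = "\<lambda>c. to_fract [:s c:]"
  obtain G where G: "finite G" "R = algebra_generated ?s G" and s': "ring_hom_on UNIV ?s"
    using aff by (auto simp: affine_algebra_def is_algebra_def)
  obtain e where e: "e \<noteq> 0" "G \<subseteq> away (range to_fract) (to_fract e)"
    by (rule fract_common_denominator[OF G(1)])
  have U: "is_subring (UNIV :: 'g poly set)" by (simp add: is_subring_def)
  have sub: "is_subring (away (range to_fract) (to_fract e))"
    using e(1) by (intro subring_away hom_image_subring[OF hom_to_fract U]) auto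
  have "is_algebra ?s (away (range to_fract) (to_fract e))"
    using s' sub by (auto simp: is_algebra_def intro!: away_base)
  then have RA: "R \<subseteq> away (range to_fract) (to_fract e)" unfolding G(2) using e(2) by (rule generated_least)
  \<comment> \<open>If \<open>t - c\<close> is invertible with only powers of \<open>e\<close> as
    denominators, it divides a power of \<open>e\<close>, so \<open>e\<close> vanishes at
    \<open>c\<close>. A non-zero \<open>e\<close> cannot vanish at all the infinitely many
    constants.\<close>
  have "poly e (s c) = 0" for c
  proof -
    have "inverse (to_fract [:- s c, 1:]) \<in> away (range to_fract) (to_fract e)" using all RA by blast
    then obtain a n where "inverse (to_fract [:- s c, 1:]) = to_fract a / to_fract e ^ n" by (auto elim!: awayE)
    moreover have "to_fract [:- s c, 1:] \<noteq> 0" by simp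
    moreover have "to_fract e ^ n \<noteq> 0" using e(1) by simp
    ultimately have "to_fract e ^ n = to_fract a * to_fract [:- s c, 1:]" by (simp add: field_simps)
    also have "to_fract e ^ n = to_fract (e ^ n)" by (induction n) auto
    also have "to_fract a * to_fract [:- s c, 1:] = to_fract (a * [:- s c, 1:])" by (rule to_fract_mult[symmetric])
    finally have "e ^ n = a * [:- s c, 1:]" using to_fract_eq_iff by blast
    then have "poly (e ^ n) (s c) = poly (a * [:- s c, 1:]) (s c)" by simp
    then have "poly e (s c) ^ n = 0" by (simp add: poly_power)
    then show ?thesis by simp
  qed
  then have "range s \<subseteq> {x. poly e x = 0}" by auto
  then have "finite (range s)" using poly_roots_finite[OF e(1)] finite_subset by blast
  then have "finite (UNIV :: 'k set)" using scal_inj[OF s] by (rule finite_imageD)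
  then show False using infinite_UNIV_char_0 by blast
qed

text \<open>A non-generic point \<open>x\<close> below the cylinder makes its stalk a genuine local ring. The functions
  divisible by \<open>t\<close> at the origin of the line over \<open>x\<close> then form a prime whose point lies over the
  generic point, since no nonzero germ of the base is divisible by \<open>t\<close>.\<close>

lemma special_point_gives_generic:
  fixes X :: "('k::field, 'p, 'f::field) scheme"
  assumes X: "variety X" and pts: "points (times_A1 X) = A1_points X"
    and m: "affine_model (times_A1 X) B \<theta>"
    and xQ: "(x, Q) \<in> A1_points X" and st: "stalk X x = localization R P" and R: "is_subring R" "prime_ideal_of R P"
  shows "\<exists>y U \<phi> \<psi>. y \<in> U \<and> affine_open X U \<and> chart X U \<phi> \<psi> \<and> \<phi> y = {0} \<and>
     stalk X y = frac_field (sections X U)"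
proof -
  note D = affine_modelD[OF m, unfolded pts]
  let ?O = "stalk X x"
  define mO where "mO = max_ideal ?O"
  define t where "t = to_fract [:0, 1 :: 'f:]"
  define Q1 where "Q1 = {g \<in> poly_over ?O. coeff g 0 \<in> mO}"
  have x: "x \<in> points X" using A1_pointsD(1)[OF xQ] .
  have xQ1: "(x, Q1) \<in> A1_points X" unfolding Q1_def mO_def by (rule zero_section_point[OF x R st])
  have O: "is_subring ?O" using subring_localization[OF R] st by simp
  have pO: "is_subring (poly_over ?O)" by (rule subring_poly_over[OF O])
  have mp: "prime_ideal_of ?O mO" unfolding mO_def st by (rule max_ideal_prime[OF R])
  note pQ1 = prime_idealD[OF A1_pointsD(2)[OF xQ1]]
  have unit0: "coeff b 0 \<noteq> 0" if "b \<in> poly_over ?O" "b \<notin> Q1" for b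
    using that prime_idealD(2)[OF mp] by (auto simp: Q1_def)
  have BS: "B \<subseteq> stalk (times_A1 X) z" if "z \<in> A1_points X" for z
    using model_subset_stalk[OF m] that pts by simp
  have Brep: "\<exists>a b. a \<in> poly_over ?O \<and> b \<in> poly_over ?O \<and> b \<notin> Q1 \<and> \<beta> = Fract a b" if "\<beta> \<in> B" for \<beta>
    using BS[OF xQ1] that unfolding stalk_times_A1 by blast
  have c01: "0 \<in> stalk X y \<and> 1 \<in> stalk X y" if y: "y \<in> points X" for y
  proof -
    obtain U \<phi> \<psi> where U: "y \<in> U" "chart X U \<phi> \<psi>" using variety_chart[OF X y] by metis
    show ?thesis using chartD(11)[OF U(2)] chartD(12)[OF U(2,1)] subring_zero subring_one by blast
  qed
  have tS: "t \<in> stalk (times_A1 X) z" if "z \<in> A1_points X" for z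
  proof -
    obtain y Q' where z: "z = (y, Q')" by (cases z)
    note A = A1_pointsD[OF that[unfolded z]]
    have c: "0 \<in> stalk X y" "1 \<in> stalk X y" using c01[OF A(1)] by auto
    have "[:0, 1:] \<in> poly_over (stalk X y)" "1 \<in> poly_over (stalk X y)"
      using poly_over_var[OF c] poly_over_const[OF c] by (simp_all add: pCons_one)
    then show ?thesis unfolding z stalk_times_A1 t_def to_fract_def using prime_idealD(3)[OF A(2)] by blast
  qed
  have tB: "t \<in> B"
    using tS model_sections[OF m] unfolding pts sections_def by blast
  \<comment> \<open>The kernel of evaluation at \<open>t = 0\<close>; it makes sense on
    \<open>B\<close> because denominators outside \<open>Q1\<close> have a non-zero constant term
    (\<open>unit0\<close>), and \<open>ev\<close> shows that the representing fraction does not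
    matter.\<close>
  define b' where "b' = {\<beta> \<in> B. \<exists>a b. a \<in> poly_over ?O \<and> b \<in> poly_over ?O \<and> b \<notin> Q1 \<and> coeff a 0 = 0 \<and> \<beta> = Fract a b}"
  have ev: "Fract a b \<in> b' \<longleftrightarrow> coeff a 0 = 0"
    if "Fract a b \<in> B" "a \<in> poly_over ?O" "b \<in> poly_over ?O" "b \<notin> Q1" for a b
  proof
    assume "Fract a b \<in> b'"
    then obtain c d where cd: "c \<in> poly_over ?O" "d \<in> poly_over ?O" "d \<notin> Q1" "coeff c 0 = 0" "Fract a b = Fract c d"
      by (auto simp: b'_def)
    have "b \<noteq> 0" "d \<noteq> 0" using unit0[OF that(3,4)] unit0[OF cd(2,3)] by auto
    then have "a * d = c * b" using cd(5) by (simp add: eq_fract)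
    then have "coeff (a * d) 0 = coeff (c * b) 0" by simp
    then show "coeff a 0 = 0" using cd(4) unit0[OF cd(2,3)] by (simp add: coeff_mult)
  next
    assume "coeff a 0 = 0"
    then show "Fract a b \<in> b'" using that unfolding b'_def by blast
  qed
  have B: "is_subring B" by (rule D(1))
  have b'B: "b' \<subseteq> B" by (auto simp: b'_def)
  have prim: "prime_ideal_of B b'"
    unfolding prime_ideal_of_def
  proof (intro conjI ballI impI)
    show "b' \<subseteq> B" by fact
    have z1: "0 \<in> poly_over ?O" "1 \<in> poly_over ?O" using subring_zero[OF pO] subring_one[OF pO] .
    have z: "(0 :: 'f poly fract) = Fract 0 1" "(1 :: 'f poly fract) = Fract 1 1"
      by (simp_all add: fract_collapse)
    show "0 \<in> b'" unfolding z(1) using ev[of 0 1] z1 z subring_zero[OF B] pQ1(3) by simp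
    show "1 \<notin> b'" unfolding z(2) using ev[of 1 1] z1 z subring_one[OF B] pQ1(3) by simp
    fix \<beta> \<gamma> assume b: "\<beta> \<in> b'" "\<gamma> \<in> b'"
    obtain a b where 1: "a \<in> poly_over ?O" "b \<in> poly_over ?O" "b \<notin> Q1" "coeff a 0 = 0" "\<beta> = Fract a b"
      using b(1) by (auto simp: b'_def)
    obtain c d where 2: "c \<in> poly_over ?O" "d \<in> poly_over ?O" "d \<notin> Q1" "coeff c 0 = 0" "\<gamma> = Fract c d"
      using b(2) by (auto simp: b'_def)
    have bd: "b \<noteq> 0" "d \<noteq> 0" using unit0[OF 1(2,3)] unit0[OF 2(2,3)] by auto
    have eq: "\<beta> + \<gamma> = Fract (a * d + c * b) (b * d)" unfolding 1(5) 2(5) using bd by (simp add: add_fract)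
    have "b * d \<in> poly_over ?O" "b * d \<notin> Q1" using subring_mult[OF pO 1(2) 2(2)] pQ1(7)[OF 1(2) 2(2)] 1(3) 2(3) by blast+
    moreover have "a * d + c * b \<in> poly_over ?O" using 1 2 by (intro subring_add[OF pO] subring_mult[OF pO])
    moreover have "coeff (a * d + c * b) 0 = 0" using 1(4) 2(4) by (simp add: coeff_mult)
    moreover have "\<beta> + \<gamma> \<in> B" using b b'B subring_add[OF B] by blast
    ultimately show "\<beta> + \<gamma> \<in> b'" unfolding b'_def using eq by blast
  next
    fix \<beta> \<gamma> assume b: "\<beta> \<in> B" "\<gamma> \<in> b'"
    obtain a b where 1: "a \<in> poly_over ?O" "b \<in> poly_over ?O" "b \<notin> Q1" "\<beta> = Fract a b"
      using Brep[OF b(1)] by blast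
    obtain c d where 2: "c \<in> poly_over ?O" "d \<in> poly_over ?O" "d \<notin> Q1" "coeff c 0 = 0" "\<gamma> = Fract c d"
      using b(2) by (auto simp: b'_def)
    have eq: "\<beta> * \<gamma> = Fract (a * c) (b * d)" unfolding 1(4) 2(5) by simp
    have "b * d \<in> poly_over ?O" "b * d \<notin> Q1" using subring_mult[OF pO 1(2) 2(2)] pQ1(7)[OF 1(2) 2(2)] 1(3) 2(3) by blast+
    moreover have "a * c \<in> poly_over ?O" using 1 2 by (intro subring_mult[OF pO])
    moreover have "coeff (a * c) 0 = 0" using 2(4) by (simp add: coeff_mult)
    moreover have "\<beta> * \<gamma> \<in> B" using b b'B subring_mult[OF B] by blast
    ultimately show "\<beta> * \<gamma> \<in> b'" unfolding b'_def using eq by blast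
  next
    fix \<beta> \<gamma> assume b: "\<beta> \<in> B" "\<gamma> \<in> B" "\<beta> * \<gamma> \<in> b'"
    obtain a b where 1: "a \<in> poly_over ?O" "b \<in> poly_over ?O" "b \<notin> Q1" "\<beta> = Fract a b"
      using Brep[OF b(1)] by blast
    obtain c d where 2: "c \<in> poly_over ?O" "d \<in> poly_over ?O" "d \<notin> Q1" "\<gamma> = Fract c d"
      using Brep[OF b(2)] by blast
    have eq: "\<beta> * \<gamma> = Fract (a * c) (b * d)" unfolding 1(4) 2(4) by simp
    have "b * d \<in> poly_over ?O" "b * d \<notin> Q1" using subring_mult[OF pO 1(2) 2(2)] pQ1(7)[OF 1(2) 2(2)] 1(3) 2(3) by blast+
    moreover have "a * c \<in> poly_over ?O" using 1 2 by (intro subring_mult[OF pO])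
    ultimately have "coeff (a * c) 0 = 0" using ev[of "a * c" "b * d"] b(3) b'B eq by auto
    then have "coeff a 0 = 0 \<or> coeff c 0 = 0" by (simp add: coeff_mult)
    then show "\<beta> \<in> b' \<or> \<gamma> \<in> b'" using ev[OF _ 1(1-3)] ev[OF _ 2(1-3)] b(1,2) 1(4) 2(4) by blast
  qed
  obtain z where z: "z \<in> A1_points X" "\<theta> z = b'" using D(7)[OF prim] by blast
  obtain y Q' where yz: "z = (y, Q')" by (cases z)
  have yQ: "(y, Q') \<in> A1_points X" using z yz by simp
  note A = A1_pointsD[OF yQ]
  have stz: "stalk (times_A1 X) (y, Q') = localization B b'" using D(3)[OF z(1)] z(2) yz by simp
  obtain U \<phi> \<psi> where U: "y \<in> U" "affine_open X U" "chart X U \<phi> \<psi>" by (rule variety_chart[OF X A(1)])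
  note C = chartD[OF U(3)]
  have c: "0 \<in> stalk X y" "1 \<in> stalk X y" using c01[OF A(1)] by auto
  have p1: "1 \<in> poly_over (stalk X y)" "[:0, 1:] \<in> poly_over (stalk X y)"
    using poly_over_var[OF c] poly_over_const[OF c] by (simp_all add: pCons_one)
  have t0: "t \<noteq> 0" by (simp add: t_def)
  have "Fract [:0, 1:] 1 \<in> B" using tB by (simp add: t_def to_fract_def)
  then have "t \<in> b'"
    using ev[of "[:0, 1:]" 1] poly_over_var[of ?O] subring_zero[OF O] subring_one[OF O] subring_one[OF pO] pQ1(3)
    by (simp add: t_def to_fract_def)
  then have tm: "inverse t \<notin> localization B b'"
    using localization_unit_iff[OF B prim tB] t0 by (simp add: max_ideal_def)
  \<comment> \<open>A special point \<open>y\<close> would have a non-zero germ \<open>f\<close> in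
    its maximal ideal. Written as a fraction with denominator outside \<open>b'\<close>, it would
    have its numerator in \<open>b'\<close>, i.e. vanish at \<open>t = 0\<close>, although
    \<open>f\<close> is a non-zero constant.\<close>
  have gen: "\<phi> y = {0}"
  proof (rule ccontr)
    assume nz: "\<phi> y \<noteq> {0}"
    have sty: "stalk X y = localization (sections X U) (\<phi> y)" by (rule stalk_special_point[OF U(3,1) yQ nz])
    obtain f where f: "f \<in> \<phi> y" "f \<noteq> 0" using nz prime_idealD(2)[OF C(10)[OF U(1)]] by blast
    have fT: "f \<in> sections X U" using f prime_idealD(1)[OF C(10)[OF U(1)]] by blast
    have fO: "f \<in> stalk X y" using fT C(12)[OF U(1)] by blast
    have "f \<in> max_ideal (stalk X y)" using localization_unit_iff[OF C(11) C(10)[OF U(1)] fT] sty f(1) by simp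
    then have fQ: "[:f:] \<in> Q'" using A(3)[OF fO] by simp
    have pf: "[:f:] \<in> poly_over (stalk X y)" using poly_over_const[OF c(1) fO] .
    have "Fract [:f:] 1 \<in> localization B b'"
      unfolding stz[symmetric] stalk_times_A1 using pf p1(1) prime_idealD(3)[OF A(2)] by blast
    then obtain \<alpha> \<beta> where ab: "\<alpha> \<in> B" "\<beta> \<in> B" "\<beta> \<notin> b'" "Fract [:f:] 1 = \<alpha> / \<beta>" by (rule localizationE)
    have \<beta>0: "\<beta> \<noteq> 0" using ab(3) prime_idealD(2)[OF prim] by auto
    have fne: "Fract [:f:] 1 \<noteq> 0" using f(2) by (simp add: to_fract_def[symmetric])
    \<comment> \<open>With the numerator outside \<open>b'\<close>, the inverse of \<open>f\<close>
      would be a germ at \<open>(y, Q')\<close>, while \<open>f\<close> belongs to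
      \<open>Q'\<close>.\<close>
    have \<alpha>: "\<alpha> \<in> b'"
    proof (rule ccontr)
      assume "\<alpha> \<notin> b'"
      then have "\<beta> / \<alpha> \<in> localization B b'" using ab by (intro localizationI)
      moreover have "\<beta> / \<alpha> = Fract 1 [:f:]"
      proof -
        have "\<beta> / \<alpha> = inverse (\<alpha> / \<beta>)" by simp
        also have "\<dots> = Fract 1 [:f:]" unfolding ab(4)[symmetric] by simp
        finally show ?thesis .
      qed
      ultimately have "Fract 1 [:f:] \<in> stalk (times_A1 X) (y, Q')" using stz by simp
      then obtain a b where 1: "a \<in> poly_over (stalk X y)" "b \<in> poly_over (stalk X y)" "b \<notin> Q'" "Fract 1 [:f:] = Fract a b"
        unfolding stalk_times_A1 by blast
      have "b \<noteq> 0" using 1(3) prime_idealD(2)[OF A(2)] by auto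
      then have "b = a * [:f:]" using 1(4) f(2) by (simp add: eq_fract)
      then have "b \<in> Q'" using prime_idealD(5)[OF A(2) 1(1) fQ] by simp
      then show False using 1(3) by simp
    qed
    obtain a b where 1: "a \<in> poly_over ?O" "b \<in> poly_over ?O" "b \<notin> Q1" "coeff a 0 = 0" "\<alpha> = Fract a b"
      using \<alpha> by (auto simp: b'_def)
    obtain k d where 2: "k \<in> poly_over ?O" "d \<in> poly_over ?O" "d \<notin> Q1" "\<beta> = Fract k d"
      using Brep[OF ab(2)] by blast
    have k0: "coeff k 0 \<noteq> 0" using ev[OF _ 2(1-3)] ab(2,3) 2(4) by blast
    have bd: "b \<noteq> 0" "d \<noteq> 0" using unit0[OF 1(2,3)] unit0[OF 2(2,3)] by auto
    have "Fract [:f:] 1 * \<beta> = \<alpha>" using ab(4) \<beta>0 by simp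
    \<comment> \<open>Comparing constant terms, the right-hand numerator contributes zero and all
      factors on the left are non-zero.\<close>
    then have "Fract ([:f:] * k) d = Fract a b" unfolding 1(5) 2(4) by simp
    then have "([:f:] * k) * b = a * d" using bd by (simp add: eq_fract)
    then have "coeff (([:f:] * k) * b) 0 = coeff (a * d) 0" by simp
    then have "f * coeff k 0 * coeff b 0 = 0" using 1(4) by (simp add: coeff_mult)
    then show False using f(2) k0 unit0[OF 1(2,3)] by simp
  qed
  \<comment> \<open>For the zero prime, \<open>1 / t\<close> would be a germ at
    \<open>(y, Q')\<close>; but \<open>t\<close> lies in \<open>b'\<close>, the prime of
    \<open>B\<close> belonging to that point.\<close>
  have "Q' \<noteq> {0}"
  proof
    assume Q0: "Q' = {0}"
    then have nQ: "[:0, 1:] \<notin> Q'" by simp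
    have "Fract 1 [:0, 1:] \<in> stalk (times_A1 X) (y, Q')"
      unfolding stalk_times_A1 using p1 nQ by blast
    moreover have "Fract 1 [:0, 1:] = inverse t" by (simp add: t_def to_fract_def)
    ultimately show False using tm stz by simp
  qed
  then have "stalk X y = frac_field (sections X U)" using stalk_generic_point[OF U(3,1) yQ gen] by blast
  then show ?thesis using U gen by blast
qed

text \<open>If some base point is special, the preceding lemma produces the generic one; if a
  generic base point carries a non-zero fibre prime, it is itself suitable. Otherwise all fibre
  primes are zero, so every \<open>t - c\<close> is invertible in all stalks and hence in
  \<open>B\<close>, against finite generation.\<close>

lemma generic_stalk_of_cylinder:
  fixes X :: "('k::field_char_0, 'p, 'f::field) scheme"
  assumes X: "variety X" and m: "affine_model (times_A1 X) B \<theta>" and aff: "affine_algebra (scal (times_A1 X)) B"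
  shows "\<exists>y U \<phi> \<psi>. y \<in> U \<and> affine_open X U \<and> chart X U \<phi> \<psi> \<and> \<phi> y = {0} \<and>
     stalk X y = frac_field (sections X U)"
proof -
  have c01: "0 \<in> stalk X y \<and> 1 \<in> stalk X y" if y: "y \<in> points X" for y
  proof -
    obtain U \<phi> \<psi> where U: "y \<in> U" "chart X U \<phi> \<psi>" using variety_chart[OF X y] by metis
    show ?thesis using chartD(11)[OF U(2)] chartD(12)[OF U(2,1)] subring_zero subring_one by blast
  qed
  have pts: "points (times_A1 X) = A1_points X" using c01 by (rule points_times_A1)
  note D = affine_modelD[OF m, unfolded pts]
  obtain x0 Q0 where xQ0: "(x0, Q0) \<in> A1_points X" using D(7)[OF prime_ideal_zero[OF D(1)]] by auto
  consider (sp) x Q U \<phi> \<psi> where "(x, Q) \<in> A1_points X" "x \<in> U" "chart X U \<phi> \<psi>" "\<phi> x \<noteq> {0}"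
    | (gen) x Q U \<phi> \<psi> where "(x, Q) \<in> A1_points X" "x \<in> U" "affine_open X U" "chart X U \<phi> \<psi>" "\<phi> x = {0}" "Q \<noteq> {0}"
    | (none) "\<And>x Q. (x, Q) \<in> A1_points X \<Longrightarrow> Q = {0}"
    using variety_chart[OF X A1_pointsD(1)] by metis
  then show ?thesis
  proof cases
    case sp
    then show ?thesis
      using special_point_gives_generic[OF X pts m sp(1) stalk_special_point[OF sp(3,2,1,4)] chartD(11)[OF sp(3)] chartD(10)[OF sp(3,2)]]
      by blast
  next
    case gen
    then show ?thesis using stalk_generic_point[OF gen(4,2,1,5,6)] by blast
  next
    case none
    obtain U \<phi> \<psi> where U: "x0 \<in> U" "chart X U \<phi> \<psi>" using variety_chart[OF X A1_pointsD(1)[OF xQ0]] by metis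
    have s: "ring_hom_on UNIV (scal X)" using chartD(2)[OF U(2)] by (simp add: affine_algebra_def is_algebra_def)
    have sx: "scal (times_A1 X) = (\<lambda>c. to_fract [:scal X c:])" by (rule ext) (rule scal_times_A1)
    have "inverse (to_fract [:- scal X c, 1:]) \<in> B" for c
    proof -
      have "inverse (to_fract [:- scal X c, 1:]) \<in> stalk (times_A1 X) z" if z: "z \<in> A1_points X" for z
      proof -
        obtain x Q where zx: "z = (x, Q)" by (cases z)
        have xQ: "(x, Q) \<in> A1_points X" using z zx by simp
        note A = A1_pointsD[OF xQ]
        obtain U \<phi> \<psi> where U: "x \<in> U" "chart X U \<phi> \<psi>" using variety_chart[OF X A(1)] by metis
        have T: "is_subring (sections X U)" by (rule chartD(11)[OF U(2)])
        have "range (scal X) \<subseteq> sections X U" using chartD(2)[OF U(2)] by (simp add: affine_algebra_def is_algebra_def)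
        then have "- scal X c \<in> stalk X x" using subring_uminus[OF T] chartD(12)[OF U(2,1)] by blast
        then have "[:- scal X c, 1:] \<in> poly_over (stalk X x)" "1 \<in> poly_over (stalk X x)"
          using c01[OF A(1)] by (auto simp: poly_over_def coeff_pCons coeff_1 split: nat.split)
        moreover have "[:- scal X c, 1:] \<notin> Q" using none[OF xQ] by simp
        moreover have "inverse (to_fract [:- scal X c, 1:]) = Fract 1 [:- scal X c, 1:]" by (simp add: to_fract_def)
        ultimately show ?thesis unfolding zx stalk_times_A1 by blast
      qed
      then show ?thesis using model_sections[OF m] unfolding pts sections_def by blast
    qed
    then show ?thesis using not_all_linear_invertible[OF s aff[unfolded sx]] by blast
  qed
qed

text \<open>By irreducibility the generic point \<open>y\<close> lies in every non-empty open set,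
  so it is also the point of the zero ideal of \<open>U\<close>. Its stalk contains all stalks over
  \<open>U\<close> and is a field, so the function field of \<open>U\<close> is a ring and
  \<open>affine_variety_model\<close> applies.\<close>

lemma affine_opens_of_cylinder:
  fixes X :: "('k::field_char_0, 'p, 'f::field) scheme"
  assumes X: "variety X" and m: "affine_model (times_A1 X) B \<theta>" and aff: "affine_algebra (scal (times_A1 X)) B"
    and U: "affine_open X U"
  obtains \<phi> where "affine_model (open_subscheme X U) (sections X U) \<phi>"
proof -
  obtain y U' \<phi>' \<psi>' where y: "y \<in> U'" "affine_open X U'" "chart X U' \<phi>' \<psi>'" "\<phi>' y = {0}"
    "stalk X y = frac_field (sections X U')"
    using generic_stalk_of_cylinder[OF X m aff] by blast
  note C' = chartD[OF y(3)]
  have irr: "irreducible_in (zariski X) (points X)" using X by (simp add: variety_def)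
  have yV: "y \<in> V" if V: "openin (zariski X) V" "V \<noteq> {}" for V
  proof -
    have ne: "V \<inter> U' \<noteq> {}"
    proof
      assume e: "V \<inter> U' = {}"
      have cl: "closedin (zariski X) (points X - V)" "closedin (zariski X) (points X - U')"
        using V(1) C'(1) by auto
      have "points X \<subseteq> (points X - V) \<union> (points X - U')" using e by blast
      then have "points X \<subseteq> points X - V \<or> points X \<subseteq> points X - U'"
        using irr cl unfolding irreducible_in_def by blast
      then show False using V openin_subset[OF V(1)] y(1) openin_subset[OF C'(1)] by blast
    qed
    then obtain x where x: "x \<in> V" "x \<in> U'" by blast
    obtain f where f: "f \<in> sections X U'" "f \<notin> \<phi>' x" "{y\<in>U'. f \<notin> \<phi>' y} \<subseteq> V" using C'(5)[OF V(1) x] by blast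
    have "f \<noteq> 0" using f(2) prime_idealD(2)[OF C'(10)[OF x(2)]] by auto
    then show ?thesis using f(3) y(1,4) by auto
  qed
  obtain \<phi> \<psi> where c: "chart X U \<phi> \<psi>" by (rule affine_open_chart[OF U])
  note C = chartD[OF c]
  have oU: "openin (zariski X) U" by (rule C(1))
  obtain x where x: "x \<in> U" "\<phi> x = {0}" using C(13)[OF prime_ideal_zero[OF C(11)]] by blast
  have yU: "y \<in> U" using yV[OF oU] x(1) by blast
  have gen: "\<phi> y = {0}"
  proof (rule ccontr)
    assume "\<phi> y \<noteq> {0}"
    then obtain f where f: "f \<in> \<phi> y" "f \<noteq> 0" using prime_idealD(2)[OF C(10)[OF yU]] by blast
    have fT: "f \<in> sections X U" using f prime_idealD(1)[OF C(10)[OF yU]] by blast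
    have "x \<in> {x \<in> U. f \<notin> \<phi> x}" using x f(2) by simp
    then have "y \<in> {x \<in> U. f \<notin> \<phi> x}" using yV[OF C(4)[OF fT]] by blast
    then show False using f(1) by simp
  qed
  let ?K = "\<Union>x\<in>U. stalk X x"
  have "?K \<subseteq> stalk X y"
  proof
    fix r assume r: "r \<in> ?K"
    have "\<psi> ` stalk X y = frac_field (sections X U)" using C(9)[OF yU] gen localization_zero by metis
    moreover have "\<psi> r \<in> frac_field (sections X U)" using C(6) r by (auto simp: bij_betw_def)
    ultimately obtain r' where r': "r' \<in> stalk X y" "\<psi> r' = \<psi> r" by (metis imageE)
    have "r' \<in> ?K" using r' yU by blast
    then have "r' = r" using C(6) r r'(2) by (meson bij_betw_imp_inj_on inj_onD)
    then show "r \<in> stalk X y" using r'(1) by simp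
  qed
  then have K: "?K = stalk X y" using yU by blast
  have aff: "affine_variety (open_subscheme X U)" using U by (simp add: affine_open_def)
  have pU: "points (open_subscheme X U) = U" using openin_subset[OF oU] by (auto simp: points_open_subscheme)
  have sec: "sections (open_subscheme X U) U = sections X U" by (simp add: sections_def stalk_open_subscheme)
  have ff: "function_field (open_subscheme X U) = stalk X y"
    by (simp only: function_field_def pU stalk_open_subscheme K)
  have "is_subring (function_field (open_subscheme X U))"
    unfolding ff y(5) using subring_frac[OF C'(11)] .
  then show ?thesis using affine_variety_model[OF aff] that unfolding pU sec by metis
qed

text \<open>Over each affine open \<open>U\<close> of the base, a global function on the product is
  a polynomial over the sections of \<open>U\<close>. As \<open>to_fract\<close> is injective, it is
  the same polynomial for all \<open>U\<close>, so its coefficients are global sections of the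
  base.\<close>

lemma sections_of_cylinder:
  fixes X :: "('k::field_char_0, 'p, 'f::field) scheme"
  assumes X: "variety X" and m: "affine_model (times_A1 X) B \<theta>" and aff: "affine_algebra (scal (times_A1 X)) B"
  shows "B = to_fract ` poly_over (sections X (points X))"
    and "\<And>x. x \<in> points X \<Longrightarrow> is_subring (stalk X x)"
proof -
  obtain \<U> where \<U>: "\<And>U. U \<in> \<U> \<Longrightarrow> affine_open X U" "\<Union>\<U> = points X" using X by (auto simp: variety_def)
  have mod: "\<exists>\<phi>. affine_model (open_subscheme X U) (sections X U) \<phi>" if "U \<in> \<U>" for U
    using affine_opens_of_cylinder[OF X m aff \<U>(1)[OF that]] by blast
  have pU: "points (open_subscheme X U) = U" if "U \<in> \<U>" for U
    using that \<U>(2) by (auto simp: points_open_subscheme)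
  have st: "is_subring (stalk X x)" if x: "x \<in> points X" for x
  proof -
    obtain U where U: "U \<in> \<U>" "x \<in> U" using x \<U>(2) by blast
    obtain \<phi> where "affine_model (open_subscheme X U) (sections X U) \<phi>" using mod[OF U(1)] by blast
    note D = affine_modelD[OF this, unfolded pU[OF U(1)] stalk_open_subscheme]
    show ?thesis using D(3)[OF U(2)] subring_localization[OF D(1) D(4)[OF U(2)]] by simp
  qed
  then show "\<And>x. x \<in> points X \<Longrightarrow> is_subring (stalk X x)" .
  have pts: "points (times_A1 X) = A1_points X"
    using st subring_zero subring_one by (intro points_times_A1) blast
  have Bsec: "B = (\<Inter>z\<in>A1_points X. stalk (times_A1 X) z)"
    using model_sections[OF m] by (simp only: sections_def pts)
  show "B = to_fract ` poly_over (sections X (points X))"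
  proof (intro equalityI subsetI)
    fix F assume F: "F \<in> B"
    have FU: "F \<in> to_fract ` poly_over (sections X U)" if U: "U \<in> \<U>" for U
    proof -
      obtain \<phi> where mU: "affine_model (open_subscheme X U) (sections X U) \<phi>" using mod[OF U] by blast
      have "A1_points (open_subscheme X U) \<subseteq> A1_points X"
        by (auto simp: A1_points_def points_open_subscheme stalk_open_subscheme)
      moreover have "stalk (times_A1 (open_subscheme X U)) = stalk (times_A1 X)"
        by (simp add: times_A1_def stalk_open_subscheme)
      moreover have "points (times_A1 (open_subscheme X U)) = A1_points (open_subscheme X U)"
        using st subring_zero subring_one U \<U>(2)
        by (intro points_times_A1) (auto simp: points_open_subscheme stalk_open_subscheme)
      ultimately have "B \<subseteq> sections (times_A1 (open_subscheme X U)) (points (times_A1 (open_subscheme X U)))"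
        unfolding Bsec sections_def by auto
      then show ?thesis using F model_sections[OF affine_model_times_A1[OF mU]] by blast
    qed
    have "\<U> \<noteq> {}"
    proof
      assume "\<U> = {}"
      then have "points X = {}" using \<U>(2) by simp
      then have "points (times_A1 X) = {}" using pts by (auto simp: A1_points_def)
      then show False using affine_modelD(7)[OF m prime_ideal_zero[OF affine_modelD(1)[OF m]]] by auto
    qed
    then obtain U0 where "U0 \<in> \<U>" by blast
    then obtain g where g: "F = to_fract g" using FU by blast
    have "coeff g i \<in> sections X (points X)" for i
    proof -
      have "coeff g i \<in> stalk X x" if x: "x \<in> points X" for x
      proof -
        obtain U where U: "U \<in> \<U>" "x \<in> U" using x \<U>(2) by blast
        have "g \<in> poly_over (sections X U)" using FU[OF U(1)] g by auto
        then show ?thesis using poly_overD U(2) by (fastforce simp: sections_def)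
      qed
      then show ?thesis by (simp add: sections_def)
    qed
    then show "F \<in> to_fract ` poly_over (sections X (points X))" using g by (simp add: poly_over_def)
  next
    fix F assume "F \<in> to_fract ` poly_over (sections X (points X))"
    then obtain g where g: "g \<in> poly_over (sections X (points X))" "F = to_fract g" by blast
    have "F \<in> stalk (times_A1 X) (x, Q)" if xQ: "(x, Q) \<in> A1_points X" for x Q
    proof -
      note A = A1_pointsD[OF xQ]
      have "sections X (points X) \<subseteq> stalk X x" using A(1) by (auto simp: sections_def)
      then have "g \<in> poly_over (stalk X x)" using g(1) poly_over_mono by blast
      moreover have "1 \<in> poly_over (stalk X x)" using subring_one[OF subring_poly_over[OF st[OF A(1)]]] .
      ultimately show ?thesis unfolding stalk_times_A1 g(2) to_fract_def using prime_idealD(3)[OF A(2)] by blast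
    qed
    then show "F \<in> B" unfolding Bsec by auto
  qed
qed

lemma max_ideal_open:
  assumes m: "affine_model (open_subscheme X U) T \<phi>" and U: "openin (zariski X) U"
    and x: "x \<in> U" and f: "inverse f \<in> stalk X x"
  shows "\<exists>W. openin (zariski X) W \<and> x \<in> W \<and> W \<subseteq> U \<and> (\<forall>y\<in>W. inverse f \<in> stalk X y)"
proof -
  have pU: "points (open_subscheme X U) = U" using openin_subset[OF U] by (auto simp: points_open_subscheme)
  obtain b where b: "b \<in> T" "b \<notin> \<phi> x" "\<forall>y\<in>U. b \<notin> \<phi> y \<longrightarrow> inverse f \<in> stalk X y"
    using model_unit_nbhd[OF m, unfolded pU stalk_open_subscheme, OF x f] by blast
  have "openin (zariski (open_subscheme X U)) {y \<in> U. b \<notin> \<phi> y}"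
    using affine_modelD(5)[OF m b(1)] by (simp only: pU)
  then have "openin (zariski X) {y \<in> U. b \<notin> \<phi> y}"
    using U by (simp add: zariski_open_subscheme openin_open_subtopology)
  then show ?thesis using b x by (intro exI[of _ "{y \<in> U. b \<notin> \<phi> y}"]) auto
qed

text \<open>The base is recovered as the zero section of the affine cylinder: a point
  \<open>x\<close> is replaced by the origin \<open>(x, Z x)\<close> of the line over it, and
  functions are restricted by setting \<open>t = 0\<close>. The primes, stalks, open sets and
  generators of \<open>B = C[t]\<close> are transferred to \<open>C\<close> in this way.\<close>

lemma base_of_cylinder:
  fixes X :: "('k::field_char_0, 'p, 'f::field) scheme"
  assumes X: "variety X" and m: "affine_model (times_A1 X) B \<theta>" and aff: "affine_algebra (scal (times_A1 X)) B"
  defines "C \<equiv> sections X (points X)"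
  shows "affine_model X C (\<lambda>x. {c \<in> C. c \<in> max_ideal (stalk X x)})"
    and "affine_algebra (scal X) C" and "B = to_fract ` poly_over C"
proof -
  have B: "B = to_fract ` poly_over C" unfolding C_def by (rule sections_of_cylinder(1)[OF X m aff])
  then show "B = to_fract ` poly_over C" .
  have st: "is_subring (stalk X x)" if "x \<in> points X" for x by (rule sections_of_cylinder(2)[OF X m aff that])
  have C: "is_subring C" unfolding C_def using st by (rule subring_sections)
  have pC: "is_subring (poly_over C)" by (rule subring_poly_over[OF C])
  have CO: "C \<subseteq> stalk X x" if "x \<in> points X" for x using that by (auto simp: C_def sections_def)
  have pts: "points (times_A1 X) = A1_points X"
    using st subring_zero subring_one by (intro points_times_A1) blast
  note D = affine_modelD[OF m, unfolded pts]
  define \<phi> where "\<phi> x = {c \<in> C. c \<in> max_ideal (stalk X x)}" for x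
  have loc: "\<exists>U T \<chi>. openin (zariski X) U \<and> x \<in> U \<and> affine_model (open_subscheme X U) T \<chi>" if x: "x \<in> points X" for x
  proof -
    obtain \<U> where \<U>: "\<And>U. U \<in> \<U> \<Longrightarrow> affine_open X U" "\<Union>\<U> = points X" using X by (auto simp: variety_def)
    then obtain U where U: "U \<in> \<U>" "x \<in> U" using x by blast
    have "openin (zariski X) U" using \<U>(1)[OF U(1)] by (simp add: affine_open_def)
    then show ?thesis using affine_opens_of_cylinder[OF X m aff \<U>(1)[OF U(1)]] U(2) by metis
  qed
  have mp: "prime_ideal_of (stalk X x) (max_ideal (stalk X x))" if x: "x \<in> points X" for x
  proof -
    obtain U T \<chi> where U: "openin (zariski X) U" "x \<in> U" "affine_model (open_subscheme X U) T \<chi>" using loc[OF x] by blast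
    have pU: "points (open_subscheme X U) = U" using openin_subset[OF U(1)] by (auto simp: points_open_subscheme)
    note E = affine_modelD[OF U(3), unfolded pU stalk_open_subscheme]
    show ?thesis using max_ideal_prime[OF E(1) E(4)[OF U(2)]] E(3)[OF U(2)] by simp
  qed
  define Z where "Z x = {g \<in> poly_over (stalk X x). coeff g 0 \<in> max_ideal (stalk X x)}" for x
  have Zp: "(x, Z x) \<in> A1_points X" if x: "x \<in> points X" for x
  proof -
    obtain U T \<chi> where U: "openin (zariski X) U" "x \<in> U" "affine_model (open_subscheme X U) T \<chi>" using loc[OF x] by blast
    have pU: "points (open_subscheme X U) = U" using openin_subset[OF U(1)] by (auto simp: points_open_subscheme)
    note E = affine_modelD[OF U(3), unfolded pU stalk_open_subscheme]
    show ?thesis unfolding Z_def by (rule zero_section_point[OF x E(1) E(4)[OF U(2)] E(3)[OF U(2)]])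
  qed
  \<comment> \<open>The abstract labelling \<open>\<theta>\<close> of points by primes is made
    explicit by comparing both with the maximal ideal of the stalk.\<close>
  have \<theta>: "to_fract g \<in> \<theta> (x, Q) \<longleftrightarrow> g \<in> Q" if xQ: "(x, Q) \<in> A1_points X" and g: "g \<in> poly_over C" for x Q g
  proof -
    note A = A1_pointsD[OF xQ]
    have pO: "is_subring (poly_over (stalk X x))" by (rule subring_poly_over[OF st[OF A(1)]])
    have gO: "g \<in> poly_over (stalk X x)" using g poly_over_mono[OF CO[OF A(1)]] by blast
    have "to_fract g \<in> \<theta> (x, Q) \<longleftrightarrow> to_fract g \<in> max_ideal (stalk (times_A1 X) (x, Q))"
      using model_max_ideal[OF m, of "(x, Q)" "to_fract g"] xQ g B pts by blast
    also have "\<dots> \<longleftrightarrow> to_fract g \<in> to_fract ` Q"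
      unfolding stalk_times_A1_localization
      by (rule localization_unit_iff[OF hom_image_subring[OF hom_to_fract pO]
        hom_image_prime[OF hom_to_fract pO inj_to_fract A(2)] imageI[OF gO]])
    finally show ?thesis by auto
  qed
  have \<phi>Z: "c \<in> \<phi> x \<longleftrightarrow> [:c:] \<in> Q" if xQ: "(x, Q) \<in> A1_points X" and c: "c \<in> C" for x Q c
    using A1_pointsD(3)[OF xQ, of c] CO[OF A1_pointsD(1)[OF xQ]] c by (auto simp: \<phi>_def)
  have cC: "[:c:] \<in> poly_over C" if "c \<in> C" for c using poly_over_const[OF subring_zero[OF C] that] .
  have mod: "affine_model X C \<phi>"
    unfolding affine_model_def
  proof (intro conjI ballI allI impI)
    show "is_subring C" by fact
    show "bij_betw \<phi> (points X) (Collect (prime_ideal_of C))"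
      unfolding bij_betw_def
    proof
      show "inj_on \<phi> (points X)"
      proof (rule inj_onI)
        \<comment> \<open>On \<open>C[t]\<close> the prime of the origin over \<open>x\<close>
          consists of the polynomials with constant term in \<open>\<phi> x\<close>. So equal values
          of \<open>\<phi>\<close> give equal points of the cylinder.\<close>
        fix x y assume x: "x \<in> points X" and y: "y \<in> points X" and eq: "\<phi> x = \<phi> y"
        have gZ: "g \<in> Z x \<longleftrightarrow> coeff g 0 \<in> \<phi> x" if "x \<in> points X" "g \<in> poly_over C" for x g
          using that poly_over_mono[OF CO[OF that(1)]] poly_overD[OF that(2)] by (auto simp: Z_def \<phi>_def)
        have "F \<in> \<theta> (x, Z x) \<longleftrightarrow> F \<in> \<theta> (y, Z y)" if FB: "F \<in> B" for F
        proof -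
          obtain g where g: "g \<in> poly_over C" "F = to_fract g" using FB B by blast
          show ?thesis unfolding g(2) \<theta>[OF Zp[OF x] g(1)] \<theta>[OF Zp[OF y] g(1)] gZ[OF x g(1)] gZ[OF y g(1)] eq ..
        qed
        then have "\<theta> (x, Z x) = \<theta> (y, Z y)"
          using prime_idealD(1)[OF D(4)[OF Zp[OF x]]] prime_idealD(1)[OF D(4)[OF Zp[OF y]]] by blast
        then have "(x, Z x) = (y, Z y)" by (rule D(8)[OF Zp[OF x] Zp[OF y]])
        then show "x = y" by simp
      qed
      show "\<phi> ` points X = Collect (prime_ideal_of C)"
      proof (intro equalityI subsetI)
        fix p assume "p \<in> \<phi> ` points X"
        then obtain x where x: "x \<in> points X" "p = \<phi> x" by blast
        have "\<phi> x = max_ideal (stalk X x) \<inter> C" by (auto simp: \<phi>_def)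
        then show "p \<in> Collect (prime_ideal_of C)" using prime_contraction[OF mp[OF x(1)] CO[OF x(1)] C] x(2) by simp
      next
        fix p assume "p \<in> Collect (prime_ideal_of C)"
        then have p: "prime_ideal_of C p" by simp
        \<comment> \<open>The ideal generated by \<open>p\<close> and \<open>t\<close> is prime in
          \<open>C[t]\<close>, hence belongs to a point of the cylinder; that point lies over the
          required point of the base.\<close>
        let ?q = "{g \<in> poly_over C. coeff g 0 \<in> p}"
        have "prime_ideal_of B (to_fract ` ?q)"
          unfolding B by (rule hom_image_prime[OF hom_to_fract pC inj_to_fract prime_zero_section[OF C p]])
        then obtain z where z: "z \<in> A1_points X" "\<theta> z = to_fract ` ?q" using D(7) by blast
        obtain x Q where zx: "z = (x, Q)" by (cases z)
        have xQ: "(x, Q) \<in> A1_points X" using z zx by simp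
        have "c \<in> \<phi> x \<longleftrightarrow> c \<in> p" if c: "c \<in> C" for c
        proof -
          have "c \<in> \<phi> x \<longleftrightarrow> to_fract [:c:] \<in> to_fract ` ?q"
            using \<phi>Z[OF xQ c] \<theta>[OF xQ cC[OF c]] z(2) zx by simp
          also have "\<dots> \<longleftrightarrow> [:c:] \<in> ?q" by auto
          also have "\<dots> \<longleftrightarrow> c \<in> p" using cC[OF c] by simp
          finally show ?thesis .
        qed
        moreover have "\<phi> x \<subseteq> C" by (auto simp: \<phi>_def)
        ultimately have "\<phi> x = p" using prime_idealD(1)[OF p] by blast
        then show "p \<in> \<phi> ` points X" using A1_pointsD(1)[OF xQ] by blast
      qed
    qed
  next
    fix x assume x: "x \<in> points X"
    show "stalk X x = localization C (\<phi> x)"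
    proof (intro equalityI subsetI)
      fix c assume c: "c \<in> stalk X x"
      have "Fract [:c:] 1 \<in> stalk (times_A1 X) (x, Z x)"
        unfolding stalk_times_A1
        using poly_over_const[OF subring_zero[OF st[OF x]] c] subring_one[OF subring_poly_over[OF st[OF x]]]
          prime_idealD(3)[OF A1_pointsD(2)[OF Zp[OF x]]] by blast
      then have "to_fract [:c:] \<in> localization B (\<theta> (x, Z x))" using D(3)[OF Zp[OF x]] by (simp add: to_fract_def)
      then obtain F G where FG: "F \<in> B" "G \<in> B" "G \<notin> \<theta> (x, Z x)" "to_fract [:c:] = F / G" by (rule localizationE)
      obtain a where a: "a \<in> poly_over C" "F = to_fract a" using FG(1) B by blast
      obtain b where b: "b \<in> poly_over C" "G = to_fract b" using FG(2) B by blast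
      have bZ: "b \<notin> Z x" using \<theta>[OF Zp[OF x] b(1)] FG(3) b(2) by simp
      have "b \<noteq> 0" using bZ prime_idealD(2)[OF A1_pointsD(2)[OF Zp[OF x]]] by auto
      then have "to_fract ([:c:] * b) = to_fract a" using FG(4) a(2) b(2) by (simp only: to_fract_mult) simp
      then have "[:c:] * b = a" using to_fract_eq_iff by blast
      \<comment> \<open>At \<open>t = 0\<close> the fraction of polynomials becomes a fraction over
        \<open>C\<close>, with a denominator outside the prime of \<open>x\<close> because
        \<open>b\<close> does not vanish at the origin over \<open>x\<close>.\<close>
      then have "coeff ([:c:] * b) 0 = coeff a 0" by simp
      then have eq: "c * coeff b 0 = coeff a 0" by (simp add: coeff_mult)
      have b0: "coeff b 0 \<notin> max_ideal (stalk X x)" using bZ b(1) poly_over_mono[OF CO[OF x]] by (auto simp: Z_def)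
      then have "coeff b 0 \<noteq> 0" using subring_zero[OF st[OF x]] by (auto simp: max_ideal_def)
      then have "c = coeff a 0 / coeff b 0" using eq by (simp add: field_simps)
      moreover have "coeff b 0 \<notin> \<phi> x" using b0 by (simp add: \<phi>_def)
      ultimately show "c \<in> localization C (\<phi> x)" using poly_overD[OF a(1)] poly_overD[OF b(1)] by (simp add: localizationI)
    next
      fix c assume "c \<in> localization C (\<phi> x)"
      then obtain a b where ab: "a \<in> C" "b \<in> C" "b \<notin> \<phi> x" "c = a / b" by (rule localizationE)
      then have "b \<notin> max_ideal (stalk X x)" by (simp add: \<phi>_def)
      then have "inverse b \<in> stalk X x" using ab(2) CO[OF x] by (auto simp: max_ideal_def)
      then show "c \<in> stalk X x" unfolding ab(4) divide_inverse using ab(1) CO[OF x] by (intro subring_mult[OF st[OF x]]) auto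
    qed
  next
    fix f assume f: "f \<in> C"
    show "openin (zariski X) {x \<in> points X. f \<notin> \<phi> x}"
    proof (subst openin_subopen, intro ballI)
      fix x assume "x \<in> {x \<in> points X. f \<notin> \<phi> x}"
      then have x: "x \<in> points X" "f \<notin> max_ideal (stalk X x)" using f by (auto simp: \<phi>_def)
      then have f1: "f \<noteq> 0" "inverse f \<in> stalk X x" using f CO[OF x(1)] subring_zero[OF st[OF x(1)]] by (auto simp: max_ideal_def)
      obtain U T \<chi> where U: "openin (zariski X) U" "x \<in> U" "affine_model (open_subscheme X U) T \<chi>" using loc[OF x(1)] by blast
      obtain W where W: "openin (zariski X) W" "x \<in> W" "\<forall>y\<in>W. inverse f \<in> stalk X y"
        using max_ideal_open[OF U(3,1,2) f1(2)] by blast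
      have "W \<subseteq> {x \<in> points X. f \<notin> \<phi> x}"
        using W(3) f1(1) openin_subset[OF W(1)] by (auto simp: \<phi>_def max_ideal_def)
      then show "\<exists>S. openin (zariski X) S \<and> x \<in> S \<and> S \<subseteq> {x \<in> points X. f \<notin> \<phi> x}" using W by blast
    qed
  next
    fix W x assume W: "openin (zariski X) W" "x \<in> W"
    have Ws: "W \<subseteq> points X" using openin_subset[OF W(1)] .
    then have x: "x \<in> points X" using W(2) by blast
    have "is_subring (sections X W)" using st Ws by (intro subring_sections) blast
    then have "1 \<in> poly_over (sections X W)" using subring_one[OF subring_poly_over] by blast
    then have o: "openin (zariski (times_A1 X)) {(x, Q) \<in> A1_points X. x \<in> W \<and> 1 \<notin> Q}"
      by (rule openin_times_A1[OF W(1)])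
    have mem: "(x, Z x) \<in> {(x, Q) \<in> A1_points X. x \<in> W \<and> 1 \<notin> Q}"
      using Zp[OF x] W(2) prime_idealD(3)[OF A1_pointsD(2)[OF Zp[OF x]]] by simp
    obtain F where F: "F \<in> B" "F \<notin> \<theta> (x, Z x)" "{z \<in> A1_points X. F \<notin> \<theta> z} \<subseteq> {(x, Q) \<in> A1_points X. x \<in> W \<and> 1 \<notin> Q}"
      using D(6)[OF o mem] by blast
    obtain g where g: "g \<in> poly_over C" "F = to_fract g" using F(1) B by blast
    \<comment> \<open>A basic neighbourhood of the origin over \<open>x\<close> inside the preimage
      of \<open>W\<close> is intersected with the zero section, where \<open>g\<close> restricts to
      its constant term.\<close>
    define f where "f = coeff g 0"
    have fC: "f \<in> C" unfolding f_def by (rule poly_overD[OF g(1)])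
    have gZ: "g \<in> Z y \<longleftrightarrow> f \<in> \<phi> y" if "y \<in> points X" for y
      using g(1) poly_over_mono[OF CO[OF that]] fC by (auto simp: Z_def \<phi>_def f_def)
    have "f \<notin> \<phi> x" using F(2) g(2) \<theta>[OF Zp[OF x] g(1)] gZ[OF x] by simp
    moreover have "y \<in> W" if y: "y \<in> points X" "f \<notin> \<phi> y" for y
    proof -
      have "(y, Z y) \<in> {z \<in> A1_points X. F \<notin> \<theta> z}"
        using Zp[OF y(1)] g(2) \<theta>[OF Zp[OF y(1)] g(1)] gZ[OF y(1)] y(2) by simp
      then show ?thesis using F(3) by blast
    qed
    ultimately show "\<exists>f\<in>C. f \<notin> \<phi> x \<and> {y \<in> points X. f \<notin> \<phi> y} \<subseteq> W" using fC by blast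
  qed
  then show "affine_model X C (\<lambda>x. {c \<in> C. c \<in> max_ideal (stalk X x)})" unfolding \<phi>_def .
  \<comment> \<open>Evaluation at \<open>t = 0\<close> maps \<open>B\<close> onto \<open>C\<close>,
    so \<open>C\<close> inherits finite generation.\<close>
  define ev where "ev F = coeff (inv to_fract F) 0" for F :: "'f poly fract"
  have inj: "inj (to_fract :: 'f poly \<Rightarrow> _)" by (rule inj_to_fract)
  have ev: "ev (to_fract g) = coeff g 0" for g by (simp add: ev_def inv_f_f[OF inj])
  have "ring_hom_on B ev"
    unfolding ring_hom_on_def
  proof (intro conjI ballI)
    show "ev 1 = 1" using ev[of 1] by simp
    fix F G assume "F \<in> B" "G \<in> B"
    then obtain a b where "F = to_fract a" "G = to_fract b" using B by blast
    then show "ev (F + G) = ev F + ev G" "ev (F * G) = ev F * ev G"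
      by (simp_all only: to_fract_add[symmetric] to_fract_mult[symmetric] ev) (simp_all add: coeff_mult)
  qed
  then have "affine_algebra (scal X) (ev ` B)"
    by (rule affine_algebra_image[OF aff]) (simp add: scal_times_A1 ev)
  moreover have "ev ` B = C"
  proof (intro equalityI subsetI)
    fix c assume "c \<in> ev ` B"
    then obtain g where "g \<in> poly_over C" "c = ev (to_fract g)" using B by blast
    then show "c \<in> C" using ev poly_overD by metis
  next
    fix c assume "c \<in> C"
    then have "to_fract [:c:] \<in> B" using cC B by blast
    then have "ev (to_fract [:c:]) \<in> ev ` B" by (rule imageI)
    then show "c \<in> ev ` B" by (simp add: ev)
  qed
  ultimately show "affine_algebra (scal X) C" by simp
qed

section \<open>Graded domains\<close>

locale graded_domain =
  fixes s :: "'k::field \<Rightarrow> 'f::field" and A :: "nat \<Rightarrow> 'f set"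
  assumes graded: "positively_graded_algebra s A"
begin

lemma scal_hom: "ring_hom_on UNIV s"
  and scal_in: "s c \<in> A 0"
  and zero_in: "0 \<in> A i"
  and diff_in: "a \<in> A i \<Longrightarrow> b \<in> A i \<Longrightarrow> a - b \<in> A i"
  and mult_in: "a \<in> A i \<Longrightarrow> b \<in> A j \<Longrightarrow> a * b \<in> A (i + j)"
  using graded unfolding positively_graded_algebra_def by (auto simp: image_subset_iff)

lemma direct: "(\<And>i. i \<le> n \<Longrightarrow> x i \<in> A i) \<Longrightarrow> (\<Sum>i\<le>n. x i) = 0 \<Longrightarrow> i \<le> n \<Longrightarrow> x i = 0"
  using graded unfolding positively_graded_algebra_def by blast

lemma one_in: "1 \<in> A 0"
  using scal_in[of 1] scal_hom by (simp add: hom_one)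

lemma uminus_in: "a \<in> A i \<Longrightarrow> - a \<in> A i"
  using diff_in[of 0 i a] zero_in by simp

lemma add_in: "a \<in> A i \<Longrightarrow> b \<in> A i \<Longrightarrow> a + b \<in> A i"
  using diff_in[of a i "- b"] uminus_in by simp

lemma sum_in: "(\<And>j. j \<in> J \<Longrightarrow> f j \<in> A i) \<Longrightarrow> sum f J \<in> A i"
  by (induction J rule: infinite_finite_induct) (auto intro: zero_in add_in)

lemma power_in: "a \<in> A i \<Longrightarrow> a ^ n \<in> A (n * i)"
  by (induction n) (auto intro: one_in mult_in)

lemma mult_in': "a \<in> A i \<Longrightarrow> b \<in> A j \<Longrightarrow> k = i + j \<Longrightarrow> a * b \<in> A k"
  using mult_in by blast

lemma shift_degree: "a \<in> A (n * d) \<Longrightarrow> h \<in> A d \<Longrightarrow> a * h ^ m \<in> A ((n + m) * d)"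
  by (rule mult_in'[OF _ power_in[of h d m]]) (auto simp: algebra_simps)

text \<open>An element of the graded ring is the value at \<open>1\<close> of a unique polynomial whose
  coefficients are its homogeneous components.\<close>

definition gpoly :: "'f poly set" where
  "gpoly = {g. \<forall>i. coeff g i \<in> A i}"

definition hpoly :: "'f \<Rightarrow> 'f poly" where
  "hpoly x = (THE g. g \<in> gpoly \<and> poly g 1 = x)"

lemma gpolyD: "g \<in> gpoly \<Longrightarrow> coeff g i \<in> A i"
  by (simp add: gpoly_def)

lemma gpoly_eq_0:
  assumes "g \<in> gpoly" "poly g 1 = 0"
  shows "g = 0"
proof (rule poly_eqI)
  fix i
  have "(\<Sum>i\<le>degree g. coeff g i) = 0" using assms(2) by (simp add: poly_altdef)
  then have "coeff g i = 0" if "i \<le> degree g" for i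
    using direct[of "degree g" "coeff g" i] gpolyD[OF assms(1)] that by blast
  then show "coeff g i = coeff 0 i" by (cases "i \<le> degree g") (auto simp: coeff_eq_0)
qed

lemma gpoly_diff: "g \<in> gpoly \<Longrightarrow> g' \<in> gpoly \<Longrightarrow> g - g' \<in> gpoly"
  by (simp add: gpoly_def diff_in)

lemma gpoly_mult:
  assumes "g \<in> gpoly" "g' \<in> gpoly" shows "g * g' \<in> gpoly"
  unfolding gpoly_def mem_Collect_eq coeff_mult
  using assms by (intro allI sum_in mult_in') (auto dest: gpolyD)

lemma gpoly_monom: "a \<in> A i \<Longrightarrow> monom a i \<in> gpoly"
  by (auto simp: gpoly_def zero_in)

lemma gpoly_inj: "g \<in> gpoly \<Longrightarrow> g' \<in> gpoly \<Longrightarrow> poly g 1 = poly g' 1 \<Longrightarrow> g = g'"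
  using gpoly_eq_0[OF gpoly_diff[of g g']] by simp

lemma gpoly_sum: "(\<And>j. j \<in> J \<Longrightarrow> f j \<in> gpoly) \<Longrightarrow> sum f J \<in> gpoly"
  by (simp add: gpoly_def coeff_sum sum_in)

lemma total_ring_gpoly: "total_ring A = (\<lambda>g. poly g 1) ` gpoly"
proof (intro equalityI subsetI)
  fix x assume "x \<in> total_ring A"
  then obtain n a where 1: "x = (\<Sum>i\<le>n. a i)" "\<forall>i\<le>n. a i \<in> A i" by (auto simp: total_ring_def)
  have "(\<Sum>i\<le>n. monom (a i) i) \<in> gpoly" using 1(2) by (intro gpoly_sum gpoly_monom) auto
  moreover have "poly (\<Sum>i\<le>n. monom (a i) i) 1 = x" by (simp add: poly_sum poly_monom 1(1))
  ultimately show "x \<in> (\<lambda>g. poly g 1) ` gpoly" by blast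
next
  fix x assume "x \<in> (\<lambda>g. poly g 1) ` gpoly"
  then obtain g where g: "g \<in> gpoly" "x = poly g 1" by blast
  have "x = (\<Sum>i\<le>degree g. coeff g i)" by (simp add: g(2) poly_altdef)
  then show "x \<in> total_ring A" using gpolyD[OF g(1)] by (auto simp: total_ring_def)
qed

lemma hpoly_poly: "g \<in> gpoly \<Longrightarrow> hpoly (poly g 1) = g"
  unfolding hpoly_def using gpoly_inj by (intro the_equality) auto

lemma hpoly_in: "x \<in> total_ring A \<Longrightarrow> hpoly x \<in> gpoly"
  and poly_hpoly: "x \<in> total_ring A \<Longrightarrow> poly (hpoly x) 1 = x"
  using hpoly_poly by (auto simp: total_ring_gpoly)

lemma hpoly_coeff_in: "x \<in> total_ring A \<Longrightarrow> coeff (hpoly x) i \<in> A i"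
  using gpolyD hpoly_in by blast

lemma hpoly_homogeneous: "a \<in> A i \<Longrightarrow> hpoly a = monom a i"
  using hpoly_poly[OF gpoly_monom[of a i]] by (simp add: poly_monom)

lemma homogeneous_total: "a \<in> A i \<Longrightarrow> a \<in> total_ring A"
  unfolding total_ring_gpoly by (rule image_eqI[OF _ gpoly_monom[of a i]]) (simp_all add: poly_monom)

lemma subring_total: "is_subring (total_ring A)"
  unfolding is_subring_def
proof (intro conjI ballI)
  show "0 \<in> total_ring A" "1 \<in> total_ring A" using zero_in one_in homogeneous_total by blast+
  fix a b assume "a \<in> total_ring A" "b \<in> total_ring A"
  then obtain f g where fg: "f \<in> gpoly" "g \<in> gpoly" "a = poly f 1" "b = poly g 1" by (auto simp: total_ring_gpoly)
  then show "a - b \<in> total_ring A" "a * b \<in> total_ring A"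
    using gpoly_diff[OF fg(1,2)] gpoly_mult[OF fg(1,2)] unfolding total_ring_gpoly
    by (auto intro: image_eqI[of _ _ "f - g"] image_eqI[of _ _ "f * g"])
qed

lemma algebra_total: "is_algebra s (total_ring A)"
  using scal_hom subring_total scal_in homogeneous_total by (auto simp: is_algebra_def)

lemma hpoly_diff: "a \<in> total_ring A \<Longrightarrow> b \<in> total_ring A \<Longrightarrow> hpoly (a - b) = hpoly a - hpoly b"
  using hpoly_poly[OF gpoly_diff[OF hpoly_in hpoly_in]] by (simp add: poly_hpoly)

lemma hpoly_mult: "a \<in> total_ring A \<Longrightarrow> b \<in> total_ring A \<Longrightarrow> hpoly (a * b) = hpoly a * hpoly b"
  using hpoly_poly[OF gpoly_mult[OF hpoly_in hpoly_in]] by (simp add: poly_hpoly)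

lemma hpoly_sum:
  assumes "\<And>j. j \<in> J \<Longrightarrow> f j \<in> total_ring A"
  shows "hpoly (sum f J) = (\<Sum>j\<in>J. hpoly (f j))"
proof -
  have "hpoly (poly (\<Sum>j\<in>J. hpoly (f j)) 1) = (\<Sum>j\<in>J. hpoly (f j))"
    using assms hpoly_in by (intro hpoly_poly gpoly_sum) auto
  then show ?thesis using assms by (simp add: poly_sum poly_hpoly)
qed

lemma homogeneous_prime_mem:
  assumes P: "prime_ideal_of (total_ring A) P" and h: "homogeneous_ideal A P" and x: "x \<in> total_ring A"
  shows "x \<in> P \<longleftrightarrow> (\<forall>i. coeff (hpoly x) i \<in> P)"
proof
  have eq: "x = (\<Sum>i\<le>degree (hpoly x). coeff (hpoly x) i)"
    using poly_hpoly[OF x] by (simp add: poly_altdef)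
  {
    assume "x \<in> P"
    then have "coeff (hpoly x) i \<in> P" if "i \<le> degree (hpoly x)" for i
      using h hpoly_coeff_in[OF x] that eq unfolding homogeneous_ideal_def by metis
    then show "\<forall>i. coeff (hpoly x) i \<in> P"
      using prime_idealD(2)[OF P] by (metis coeff_eq_0 not_le)
  next
    assume "\<forall>i. coeff (hpoly x) i \<in> P"
    then have "(\<Sum>i\<le>degree (hpoly x). coeff (hpoly x) i) \<in> P" by (intro prime_ideal_sum[OF P]) blast
    then show "x \<in> P" using eq by simp
  }
qed

text \<open>The least indices of components outside \<open>P\<close> of two elements outside \<open>P\<close> produce a component
  of their product outside \<open>P\<close>.\<close>

lemma homogeneous_prime_criterion:
  assumes sub: "\<And>i. Pc i \<subseteq> A i" and zero: "\<And>i. 0 \<in> Pc i"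
    and add: "\<And>i a b. a \<in> Pc i \<Longrightarrow> b \<in> Pc i \<Longrightarrow> a + b \<in> Pc i"
    and mul: "\<And>i j a r. r \<in> A j \<Longrightarrow> a \<in> Pc i \<Longrightarrow> r * a \<in> Pc (j + i)"
    and one: "1 \<notin> Pc 0"
    and prime: "\<And>i j a b. a \<in> A i \<Longrightarrow> b \<in> A j \<Longrightarrow> a * b \<in> Pc (i + j) \<Longrightarrow> a \<in> Pc i \<or> b \<in> Pc j"
  defines "P \<equiv> {x \<in> total_ring A. \<forall>i. coeff (hpoly x) i \<in> Pc i}"
  shows "prime_ideal_of (total_ring A) P" "homogeneous_ideal A P" "\<And>i a. a \<in> A i \<Longrightarrow> a \<in> P \<longleftrightarrow> a \<in> Pc i"
proof -
  have sumP: "sum f J \<in> Pc i" if "\<And>j. j \<in> J \<Longrightarrow> f j \<in> Pc i" for f :: "nat \<Rightarrow> 'f" and J i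
    using that by (induction J rule: infinite_finite_induct) (auto intro: zero add)
  have um: "- a \<in> Pc i" if "a \<in> Pc i" for a i
    using mul[OF uminus_in[OF one_in] that] by simp
  show hom: "a \<in> P \<longleftrightarrow> a \<in> Pc i" if a: "a \<in> A i" for i a
    using homogeneous_total[OF a] zero by (auto simp: P_def hpoly_homogeneous[OF a] coeff_monom)
  show "homogeneous_ideal A P"
    unfolding homogeneous_ideal_def
  proof (intro allI impI)
    fix n a i assume 1: "(\<forall>i\<le>n. a i \<in> A i) \<and> (\<Sum>i\<le>n. a i) \<in> P" and i: "i \<le> n"
    have "hpoly (\<Sum>i\<le>n. a i) = (\<Sum>i\<le>n. monom (a i) i)"
      using 1 by (subst hpoly_sum) (auto intro: homogeneous_total simp: hpoly_homogeneous intro!: sum.cong)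
    then have "coeff (hpoly (\<Sum>i\<le>n. a i)) i = a i" using i by (simp add: coeff_sum coeff_monom)
    then have "a i \<in> Pc i" using 1 unfolding P_def by (metis (mono_tags, lifting) mem_Collect_eq)
    then show "a i \<in> P" using hom 1 i by blast
  qed
  show "prime_ideal_of (total_ring A) P"
    unfolding prime_ideal_of_def
  proof (intro conjI ballI impI)
    show "P \<subseteq> total_ring A" by (auto simp: P_def)
    show "0 \<in> P" using hom[OF zero_in[of 0]] zero by blast
    show "1 \<notin> P" using hom[OF one_in] one by blast
    show "x + y \<in> P" if xy: "x \<in> P" "y \<in> P" for x y
    proof -
      have t: "x \<in> total_ring A" "y \<in> total_ring A" "- y \<in> total_ring A"
        using xy subring_uminus[OF subring_total] by (auto simp: P_def)
      have "hpoly (- y) = - hpoly y" using hpoly_diff[OF subring_zero[OF subring_total] t(2)] hpoly_homogeneous[OF zero_in[of 0]] by simp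
      then have "hpoly (x + y) = hpoly x + hpoly y" using hpoly_diff[OF t(1,3)] by simp
      then show ?thesis using xy t(1,2) subring_add[OF subring_total] add by (auto simp: P_def)
    qed
    show "r * x \<in> P" if rx: "r \<in> total_ring A" "x \<in> P" for r x
    proof -
      have t: "x \<in> total_ring A" using rx by (auto simp: P_def)
      have "coeff (hpoly (r * x)) i \<in> Pc i" for i
        unfolding hpoly_mult[OF rx(1) t] coeff_mult
      proof (rule sumP)
        fix j assume "j \<in> {..i}"
        then show "coeff (hpoly r) j * coeff (hpoly x) (i - j) \<in> Pc i"
          using mul[OF hpoly_coeff_in[OF rx(1), of j], of "coeff (hpoly x) (i - j)" "i - j"] rx(2) by (auto simp: P_def)
      qed
      then show ?thesis using subring_mult[OF subring_total rx(1) t] by (auto simp: P_def)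
    qed
    show "x \<in> P \<or> y \<in> P" if xy: "x \<in> total_ring A" "y \<in> total_ring A" "x * y \<in> P" for x y
    proof (rule ccontr)
      assume "\<not> ?thesis"
      then obtain i0 j0 where n: "coeff (hpoly x) i0 \<notin> Pc i0" "coeff (hpoly y) j0 \<notin> Pc j0"
        using xy by (auto simp: P_def)
      define i where "i = (LEAST i. coeff (hpoly x) i \<notin> Pc i)"
      define j where "j = (LEAST j. coeff (hpoly y) j \<notin> Pc j)"
      have i: "coeff (hpoly x) i \<notin> Pc i" unfolding i_def by (rule LeastI[of _ i0]) (rule n)
      have j: "coeff (hpoly y) j \<notin> Pc j" unfolding j_def by (rule LeastI[of _ j0]) (rule n)
      have li: "coeff (hpoly x) k \<in> Pc k" if "k < i" for k using not_less_Least[of k] that unfolding i_def by blast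
      have lj: "coeff (hpoly y) k \<in> Pc k" if "k < j" for k using not_less_Least[of k] that unfolding j_def by blast
      have xA: "coeff (hpoly x) k \<in> A k" "coeff (hpoly y) k \<in> A k" for k using hpoly_coeff_in xy(1,2) by auto
      \<comment> \<open>By minimality of \<open>i\<close> and \<open>j\<close>, each remaining
        product has a factor in \<open>Pc\<close>: the first one if \<open>k < i\<close>, the second
        one if \<open>k > i\<close>, since then \<open>i + j - k < j\<close>.\<close>
      have rest: "(\<Sum>k\<in>{..i + j} - {i}. coeff (hpoly x) k * coeff (hpoly y) (i + j - k)) \<in> Pc (i + j)"
      proof (rule sumP)
        fix k assume k: "k \<in> {..i + j} - {i}"
        show "coeff (hpoly x) k * coeff (hpoly y) (i + j - k) \<in> Pc (i + j)"
        proof (cases "k < i")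
          case True
          show ?thesis using mul[OF xA(2)[of "i + j - k"] li[OF True]] True by (simp add: mult.commute)
        next
          case False
          then have "i + j - k < j" using k by auto
          then show ?thesis using mul[OF xA(1)[of k] lj[of "i + j - k"]] k by simp
        qed
      qed
      have c: "coeff (hpoly (x * y)) (i + j) \<in> Pc (i + j)" using xy(3) by (auto simp: P_def)
      have "coeff (hpoly (x * y)) (i + j) = coeff (hpoly x) i * coeff (hpoly y) j +
        (\<Sum>k\<in>{..i + j} - {i}. coeff (hpoly x) k * coeff (hpoly y) (i + j - k))"
        unfolding hpoly_mult[OF xy(1,2)] coeff_mult by (subst sum.remove[of _ i]) auto
      then have "coeff (hpoly x) i * coeff (hpoly y) j \<in> Pc (i + j)"
        using add[OF c um[OF rest]] by simp
      then show False using prime[OF xA(1) xA(2)] i j by blast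
    qed
  qed
qed

section \<open>Proj\<close>

lemma points_Proj: "points (Proj s A) = Proj_points A"
proof (intro equalityI subsetI)
  fix P assume "P \<in> points (Proj s A)"
  then show "P \<in> Proj_points A" by (auto simp: Proj_def)
next
  fix P assume P: "P \<in> Proj_points A"
  then obtain i f where "i \<in> {1..}" "f \<in> A i" "f \<notin> P" unfolding Proj_points_def by blast
  then have "i > 0" "f \<in> A i" "f \<notin> P" by auto
  then show "P \<in> points (Proj s A)" using P by (auto simp: Proj_def)
qed

lemma stalk_Proj: "stalk (Proj s A) P = {a / b | a b i. a \<in> A i \<and> b \<in> A i \<and> b \<notin> P}"
  and scal_Proj: "scal (Proj s A) = s"
  by (simp_all add: Proj_def)

lemma Proj_pointsD:
  assumes "P \<in> Proj_points A"
  shows "prime_ideal_of (total_ring A) P" "homogeneous_ideal A P" "\<exists>i>0. \<exists>f\<in>A i. f \<notin> P"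
proof -
  show "prime_ideal_of (total_ring A) P" "homogeneous_ideal A P" using assms by (auto simp: Proj_points_def)
  obtain i f where "i \<in> {1..}" "f \<in> A i" "f \<notin> P" using assms unfolding Proj_points_def by blast
  then show "\<exists>i>0. \<exists>f\<in>A i. f \<notin> P" by (intro exI[of _ i]) auto
qed

lemma openin_Proj: "i > 0 \<Longrightarrow> f \<in> A i \<Longrightarrow> openin (zariski (Proj s A)) {P \<in> Proj_points A. f \<notin> P}"
  by (auto simp: Proj_def intro!: topology_generated_by_Basis)

lemma hom_prime_mult:
  assumes P: "P \<in> Proj_points A" and "a \<in> A i" "b \<in> A j"
  shows "a * b \<in> P \<longleftrightarrow> a \<in> P \<or> b \<in> P"
  using prime_idealD(5-7)[OF Proj_pointsD(1)[OF P]] homogeneous_total assms(2,3) by metis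

lemma hom_prime_power:
  assumes P: "P \<in> Proj_points A" and "a \<in> A i" "n > 0"
  shows "a ^ n \<in> P \<longleftrightarrow> a \<in> P"
proof
  show "a ^ n \<in> P \<Longrightarrow> a \<in> P"
    by (rule prime_ideal_power[OF Proj_pointsD(1)[OF P] subring_total homogeneous_total[OF assms(2)]])
  assume "a \<in> P"
  then have "a * a ^ (n - 1) \<in> P" using hom_prime_mult[OF P assms(2) power_in[OF assms(2)]] by blast
  then show "a ^ n \<in> P" using assms(3) by (simp add: power_eq_if)
qed

lemma hom_prime_power': "P \<in> Proj_points A \<Longrightarrow> a \<in> A i \<Longrightarrow> a \<notin> P \<Longrightarrow> a ^ n \<notin> P"
  using prime_ideal_power[OF Proj_pointsD(1) subring_total homogeneous_total] by blast

lemma Proj_basis: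
  assumes "openin (zariski (Proj s A)) U" "P \<in> U"
  shows "\<exists>i>0. \<exists>f\<in>A i. f \<notin> P \<and> {Q \<in> Proj_points A. f \<notin> Q} \<subseteq> U"
proof -
  let ?S = "{{P \<in> Proj_points A. f \<notin> P} | f i. i > 0 \<and> f \<in> A i}"
  have "\<exists>C\<in>?S. P \<in> C \<and> C \<subseteq> U"
  proof (rule generated_topology_basis[OF _ assms(2)])
    show "openin (topology_generated_by ?S) U" using assms(1) by (simp add: Proj_def)
    fix V W y assume VW: "V \<in> ?S" "W \<in> ?S" "y \<in> V" "y \<in> W"
    obtain f i where f: "V = {P \<in> Proj_points A. f \<notin> P}" "i > 0" "f \<in> A i" using VW(1) by blast
    obtain g j where g: "W = {P \<in> Proj_points A. g \<notin> P}" "j > 0" "g \<in> A j" using VW(2) by blast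
    have "{P \<in> Proj_points A. f * g \<notin> P} = V \<inter> W"
      unfolding f(1) g(1) using hom_prime_mult[OF _ f(3) g(3)] by auto
    moreover have "{P \<in> Proj_points A. f * g \<notin> P} \<in> ?S" using mult_in[OF f(3) g(3)] f(2) by auto
    ultimately show "\<exists>C\<in>?S. y \<in> C \<and> C \<subseteq> V \<inter> W" using VW by auto
  qed
  then obtain C where "C \<in> ?S" "P \<in> C" "C \<subseteq> U" by blast
  then obtain f i where "C = {P \<in> Proj_points A. f \<notin> P}" "i > 0" "f \<in> A i" by blast
  then show ?thesis using \<open>P \<in> C\<close> \<open>C \<subseteq> U\<close> by blast
qed

text \<open>For \<open>h\<close> of degree \<open>d\<close> this is the degree-zero part of the
  localization of the graded ring at \<open>h\<close>.\<close>

definition hloc :: "'f \<Rightarrow> nat \<Rightarrow> 'f set" where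
  "hloc h d = {a / h ^ n | a n. a \<in> A (n * d)}"

lemma hlocI: "a \<in> A (n * d) \<Longrightarrow> a / h ^ n \<in> hloc h d"
  by (auto simp: hloc_def)

lemma hlocE:
  assumes "x \<in> hloc h d"
  obtains a n where "a \<in> A (n * d)" "x = a / h ^ n"
  using assms by (auto simp: hloc_def)

lemma subring_hloc:
  assumes h: "h \<in> A d" "h \<noteq> 0"
  shows "is_subring (hloc h d)"
  unfolding is_subring_def
proof (intro conjI ballI)
  show "0 \<in> hloc h d" "1 \<in> hloc h d"
    using hlocI[of 0 0 d h] hlocI[of 1 0 d h] zero_in one_in by simp_all
  fix x y assume x: "x \<in> hloc h d" and y: "y \<in> hloc h d"
  obtain a n where a: "a \<in> A (n * d)" "x = a / h ^ n" using x by (rule hlocE)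
  obtain b m where b: "b \<in> A (m * d)" "y = b / h ^ m" using y by (rule hlocE)
  have eq: "x - y = (a * h ^ m - b * h ^ n) / h ^ (n + m)" "x * y = (a * b) / h ^ (n + m)"
    unfolding a(2) b(2) using h(2) by (simp_all add: field_simps power_add)
  have "a * h ^ m \<in> A ((n + m) * d)" "b * h ^ n \<in> A ((n + m) * d)" "a * b \<in> A ((n + m) * d)"
    using shift_degree[OF a(1) h(1), of m] shift_degree[OF b(1) h(1), of n] mult_in'[OF a(1) b(1)]
    by (simp_all add: algebra_simps)
  then show "x - y \<in> hloc h d" "x * y \<in> hloc h d"
    unfolding eq by (simp_all only: hlocI diff_in)
qed

text \<open>The degree-zero part of the extension of \<open>P\<close> to the localization at
  \<open>h\<close>.\<close>

definition hprime :: "'f \<Rightarrow> nat \<Rightarrow> 'f set \<Rightarrow> 'f set" where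
  "hprime h d P = {a / h ^ n | a n. a \<in> A (n * d) \<and> a \<in> P}"

lemma hprime_mem_iff:
  assumes h: "h \<in> A d" and P: "P \<in> Proj_points A" "h \<notin> P" and a: "a \<in> A (n * d)"
  shows "a / h ^ n \<in> hprime h d P \<longleftrightarrow> a \<in> P"
proof
  assume "a / h ^ n \<in> hprime h d P"
  then obtain b m where b: "b \<in> A (m * d)" "b \<in> P" "a / h ^ n = b / h ^ m" by (auto simp: hprime_def)
  have h0: "h \<noteq> 0" using P(2) prime_idealD(2)[OF Proj_pointsD(1)[OF P(1)]] by auto
  have "a * h ^ m = b * h ^ n" using b(3) h0 by (simp add: frac_eq_eq)
  moreover have "b * h ^ n \<in> P" using hom_prime_mult[OF P(1) b(1) power_in[OF h]] b(2) by blast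
  ultimately have "a \<in> P \<or> h ^ m \<in> P" using hom_prime_mult[OF P(1) a power_in[OF h, of m]] by simp
  then show "a \<in> P" using hom_prime_power'[OF P(1) h P(2)] by blast
qed (use a in \<open>auto simp: hprime_def\<close>)

lemma hprime_prime:
  assumes h: "h \<in> A d" and P: "P \<in> Proj_points A" "h \<notin> P"
  shows "prime_ideal_of (hloc h d) (hprime h d P)"
  unfolding prime_ideal_of_def
proof (intro conjI ballI impI)
  note D = prime_idealD[OF Proj_pointsD(1)[OF P(1)]]
  have h0: "h \<noteq> 0" using P(2) D(2) by auto
  show "hprime h d P \<subseteq> hloc h d" by (auto simp: hprime_def hloc_def)
  show "0 \<in> hprime h d P" using hprime_mem_iff[OF h P, of 0 0] zero_in D(2) by simp
  show "1 \<notin> hprime h d P" using hprime_mem_iff[OF h P, of 1 0] one_in D(3) by simp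
  have deg: "a * h ^ m \<in> A ((n + m) * d)" "b * h ^ n \<in> A ((n + m) * d)" "a * b \<in> A ((n + m) * d)"
    if "a \<in> A (n * d)" "b \<in> A (m * d)" for a b n m
    using shift_degree[OF that(1) h, of m] shift_degree[OF that(2) h, of n] mult_in'[OF that]
    by (simp_all add: algebra_simps)
  show "x + y \<in> hprime h d P" if x: "x \<in> hprime h d P" and y: "y \<in> hprime h d P" for x y
  proof -
    obtain a n where a: "a \<in> A (n * d)" "a \<in> P" "x = a / h ^ n" using x by (auto simp: hprime_def)
    obtain b m where b: "b \<in> A (m * d)" "b \<in> P" "y = b / h ^ m" using y by (auto simp: hprime_def)
    have eq: "x + y = (a * h ^ m + b * h ^ n) / h ^ (n + m)"
      unfolding a(3) b(3) using h0 by (simp add: field_simps power_add)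
    have "a * h ^ m + b * h ^ n \<in> P"
      using a b hom_prime_mult[OF P(1) a(1) power_in[OF h]] hom_prime_mult[OF P(1) b(1) power_in[OF h]] by (intro D(4)) blast+
    then show ?thesis unfolding eq using hprime_mem_iff[OF h P add_in[OF deg(1,2)[OF a(1) b(1)]]] by blast
  qed
  show "x * y \<in> hprime h d P" if x: "x \<in> hloc h d" and y: "y \<in> hprime h d P" for x y
  proof -
    obtain a n where a: "a \<in> A (n * d)" "x = a / h ^ n" using x by (rule hlocE)
    obtain b m where b: "b \<in> A (m * d)" "b \<in> P" "y = b / h ^ m" using y by (auto simp: hprime_def)
    have eq: "x * y = (a * b) / h ^ (n + m)"
      unfolding a(2) b(3) using h0 by (simp add: field_simps power_add)
    show ?thesis unfolding eq using hprime_mem_iff[OF h P deg(3)[OF a(1) b(1)]] hom_prime_mult[OF P(1) a(1) b(1)] b(2) by blast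
  qed
  show "x \<in> hprime h d P \<or> y \<in> hprime h d P"
    if x: "x \<in> hloc h d" and y: "y \<in> hloc h d" and xy: "x * y \<in> hprime h d P" for x y
  proof -
    obtain a n where a: "a \<in> A (n * d)" "x = a / h ^ n" using x by (rule hlocE)
    obtain b m where b: "b \<in> A (m * d)" "y = b / h ^ m" using y by (rule hlocE)
    have eq: "x * y = (a * b) / h ^ (n + m)"
      unfolding a(2) b(2) using h0 by (simp add: field_simps power_add)
    have "a * b \<in> P" using xy unfolding eq hprime_mem_iff[OF h P deg(3)[OF a(1) b(1)]] .
    then show ?thesis unfolding a(2) b(2) hprime_mem_iff[OF h P a(1)] hprime_mem_iff[OF h P b(1)]
      using hom_prime_mult[OF P(1) a(1) b(1)] by blast
  qed
qed

text \<open>The prime \<open>p\<close> sees only degree zero, so a homogeneous \<open>a\<close> of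
  degree \<open>i\<close> is tested through \<open>a ^ d / h ^ i\<close>. The sets
  \<open>Pc i\<close> of elements passing the test are the graded pieces of the wanted homogeneous
  prime; closure under addition is the only delicate point.\<close>

lemma hprime_surj:
  assumes h: "h \<in> A d" "h \<noteq> 0" and d: "d > 0" and p: "prime_ideal_of (hloc h d) p"
  shows "\<exists>P\<in>Proj_points A. h \<notin> P \<and> hprime h d P = p"
proof -
  note D = prime_idealD[OF p]
  have B: "is_subring (hloc h d)" by (rule subring_hloc[OF h])
  define Pc where "Pc i = {a \<in> A i. a ^ d / h ^ i \<in> p}" for i
  have loc: "a / h ^ i \<in> hloc h d" if "a \<in> A (d * i)" for a i using hlocI[of a i d h] that by (simp add: mult.commute)
  have ad: "a + b \<in> Pc i" if ab: "a \<in> Pc i" "b \<in> Pc i" for a b i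
  proof -
    have abA: "a \<in> A i" "b \<in> A i" and abp: "a ^ d / h ^ i \<in> p" "b ^ d / h ^ i \<in> p" using ab by (auto simp: Pc_def)
    \<comment> \<open>Among the terms of \<open>(a + b) ^ (2 * d)\<close> each contains
      \<open>a ^ d\<close> or \<open>b ^ d\<close>. So the square of the test fraction of
      \<open>a + b\<close> lies in \<open>p\<close>, and the fraction itself by primality.\<close>
    have trm: "a ^ k * b ^ (2 * d - k) / h ^ (2 * i) \<in> p" if k: "k \<le> 2 * d" for k
    proof (cases "d \<le> k")
      case True
      have "a ^ (k - d) * b ^ (2 * d - k) \<in> A (d * i)"
        using True k by (intro mult_in'[OF power_in[OF abA(1)] power_in[OF abA(2)]]) (simp add: add_mult_distrib[symmetric])
      then have "a ^ (k - d) * b ^ (2 * d - k) / h ^ i * (a ^ d / h ^ i) \<in> p" by (intro D(5) loc abp(1))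
      moreover have "a ^ (k - d) * b ^ (2 * d - k) / h ^ i * (a ^ d / h ^ i) = (a ^ (k - d) * a ^ d) * b ^ (2 * d - k) / (h ^ i * h ^ i)"
        by (simp add: field_simps)
      moreover have "a ^ (k - d) * a ^ d = a ^ k" using True by (simp add: power_add[symmetric])
      moreover have "h ^ i * h ^ i = h ^ (2 * i)" by (simp add: power_add[symmetric] mult_2)
      ultimately show ?thesis by metis
    next
      case False
      have "a ^ k * b ^ (d - k) \<in> A (d * i)"
        using False by (intro mult_in'[OF power_in[OF abA(1)] power_in[OF abA(2)]]) (simp add: add_mult_distrib[symmetric])
      then have "a ^ k * b ^ (d - k) / h ^ i * (b ^ d / h ^ i) \<in> p" by (intro D(5) loc abp(2))
      moreover have "a ^ k * b ^ (d - k) / h ^ i * (b ^ d / h ^ i) = a ^ k * (b ^ (d - k) * b ^ d) / (h ^ i * h ^ i)"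
        by (simp add: field_simps)
      moreover have "b ^ (d - k) * b ^ d = b ^ (2 * d - k)" using False by (simp add: power_add[symmetric] mult_2)
      moreover have "h ^ i * h ^ i = h ^ (2 * i)" by (simp add: power_add[symmetric] mult_2)
      ultimately show ?thesis by metis
    qed
    have ofn: "of_nat n \<in> hloc h d" for n
      by (induction n) (auto intro: subring_zero[OF B] subring_add[OF B subring_one[OF B]])
    have "((a + b) ^ d / h ^ i) ^ 2 = (a + b) ^ (2 * d) / h ^ (2 * i)" by (simp add: power_divide power_mult[symmetric] mult.commute)
    also have "\<dots> = (\<Sum>k\<le>2 * d. of_nat (2 * d choose k) * (a ^ k * b ^ (2 * d - k) / h ^ (2 * i)))"
      unfolding binomial_ring sum_divide_distrib by (simp add: mult.assoc)
    also have "\<dots> \<in> p" using trm ofn by (intro prime_ideal_sum[OF p] D(5)) auto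
    finally have "((a + b) ^ d / h ^ i) ^ 2 \<in> p" .
    then have "(a + b) ^ d / h ^ i \<in> p"
      by (rule prime_ideal_power[OF p B loc[OF power_in[OF add_in[OF abA]]]])
    then show ?thesis using add_in[OF abA] by (simp add: Pc_def)
  qed
  have split: "(r * a) ^ d / h ^ (j + i) = (r ^ d / h ^ j) * (a ^ d / h ^ i)" for r a i j
    by (simp add: power_mult_distrib power_add)
  define P where "P = {x \<in> total_ring A. \<forall>i. coeff (hpoly x) i \<in> Pc i}"
  note crit = homogeneous_prime_criterion[of Pc, folded P_def]
  have c: "\<And>i. Pc i \<subseteq> A i" "\<And>i. 0 \<in> Pc i"
    using zero_in D(2) d by (auto simp: Pc_def zero_power)
  have c2: "r * a \<in> Pc (j + i)" if "r \<in> A j" "a \<in> Pc i" for i j a r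
    using that mult_in D(5)[OF loc[OF power_in[OF that(1)]]] unfolding Pc_def mem_Collect_eq split by blast
  have c3: "1 \<notin> Pc 0" using D(3) by (simp add: Pc_def)
  have c4: "a \<in> Pc i \<or> b \<in> Pc j" if "a \<in> A i" "b \<in> A j" "a * b \<in> Pc (i + j)" for i j a b
    using that D(7)[OF loc[OF power_in[OF that(1)]] loc[OF power_in[OF that(2)]]] unfolding Pc_def mem_Collect_eq split by blast
  have P: "prime_ideal_of (total_ring A) P" "homogeneous_ideal A P" "\<And>i a. a \<in> A i \<Longrightarrow> a \<in> P \<longleftrightarrow> a \<in> Pc i"
    using crit[OF c ad c2 c3 c4] by blast+
  have hP: "h \<notin> P"
    using P(3)[OF h(1)] D(3) h(2) by (simp add: Pc_def)
  have "d \<in> {1..}" using d by simp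
  then have "\<not> (\<Union>i\<in>{1..}. A i) \<subseteq> P" using h(1) hP by blast
  then have PP: "P \<in> Proj_points A" using P(1,2) by (simp add: Proj_points_def)
  have "a / h ^ n \<in> hprime h d P \<longleftrightarrow> a / h ^ n \<in> p" if a: "a \<in> A (n * d)" for a n
  proof -
    have "a / h ^ n \<in> hprime h d P \<longleftrightarrow> a \<in> Pc (n * d)" using hprime_mem_iff[OF h(1) PP hP a] P(3)[OF a] by simp
    also have "\<dots> \<longleftrightarrow> (a / h ^ n) ^ d \<in> p" using a by (simp add: Pc_def power_divide power_mult)
    also have "\<dots> \<longleftrightarrow> a / h ^ n \<in> p"
    proof
      show "(a / h ^ n) ^ d \<in> p \<Longrightarrow> a / h ^ n \<in> p" by (rule prime_ideal_power[OF p B hlocI[OF a]])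
      assume "a / h ^ n \<in> p"
      then have "(a / h ^ n) ^ (d - 1) * (a / h ^ n) \<in> p" by (intro D(5) subring_power[OF B] hlocI[OF a])
      then show "(a / h ^ n) ^ d \<in> p" using d by (metis Suc_diff_1 power_Suc2)
    qed
    finally show ?thesis .
  qed
  then have "x \<in> hprime h d P \<longleftrightarrow> x \<in> p" if "x \<in> hloc h d" for x using that by (metis hlocE)
  then have "hprime h d P = p" using D(1) prime_idealD(1)[OF hprime_prime[OF h(1) PP hP]] by blast
  then show ?thesis using PP hP by blast
qed

text \<open>The standard chart of Proj: the complement of the zero locus of \<open>h\<close> is the
  spectrum of the degree-zero localization.\<close>

lemma affine_model_Proj:
  assumes h: "h \<in> A d" "h \<noteq> 0" and d: "d > 0"
  shows "affine_model (open_subscheme (Proj s A) {P \<in> Proj_points A. h \<notin> P}) (hloc h d) (hprime h d)"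
proof -
  let ?D = "{P \<in> Proj_points A. h \<notin> P}"
  have pts: "points (open_subscheme (Proj s A) ?D) = ?D" by (auto simp: points_open_subscheme points_Proj)
  \<comment> \<open>A homogeneous prime avoiding \<open>h\<close> can be read off from its
    degree-zero trace, since the power \<open>a ^ d\<close> has a degree divisible by
    \<open>d\<close>.\<close>
  have test: "a \<in> P \<longleftrightarrow> a ^ d / h ^ i \<in> hprime h d P" if "P \<in> ?D" "a \<in> A i" for P a i
  proof -
    have "a ^ d \<in> A (i * d)" using power_in[OF that(2), of d] by (simp add: mult.commute)
    then show ?thesis using hprime_mem_iff[OF h(1)] hom_prime_power[OF _ that(2) d] that(1) by simp
  qed
  show ?thesis
    unfolding affine_model_def pts unfolding stalk_open_subscheme zariski_open_subscheme
  proof (intro conjI ballI allI impI)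
    show "is_subring (hloc h d)" by (rule subring_hloc[OF h])
    show "bij_betw (hprime h d) ?D (Collect (prime_ideal_of (hloc h d)))"
      unfolding bij_betw_def
    proof
      show "inj_on (hprime h d) ?D"
      proof (rule inj_onI)
        fix P Q assume PQ: "P \<in> ?D" "Q \<in> ?D" "hprime h d P = hprime h d Q"
        have "coeff (hpoly x) i \<in> P \<longleftrightarrow> coeff (hpoly x) i \<in> Q" if "x \<in> total_ring A" for x i
          using test[OF PQ(1) hpoly_coeff_in[OF that]] test[OF PQ(2) hpoly_coeff_in[OF that]] PQ(3) by simp
        then have "x \<in> P \<longleftrightarrow> x \<in> Q" if "x \<in> total_ring A" for x
          using homogeneous_prime_mem[OF Proj_pointsD(1,2)[of P] that] homogeneous_prime_mem[OF Proj_pointsD(1,2)[of Q] that] PQ that by simp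
        then show "P = Q" using prime_idealD(1)[OF Proj_pointsD(1)[of P]] prime_idealD(1)[OF Proj_pointsD(1)[of Q]] PQ by blast
      qed
      show "hprime h d ` ?D = Collect (prime_ideal_of (hloc h d))"
      proof (intro equalityI subsetI)
        fix p assume "p \<in> hprime h d ` ?D"
        then show "p \<in> Collect (prime_ideal_of (hloc h d))" using hprime_prime[OF h(1)] by auto
      next
        fix p assume "p \<in> Collect (prime_ideal_of (hloc h d))"
        then obtain P where "P \<in> Proj_points A" "h \<notin> P" "hprime h d P = p" using hprime_surj[OF h d] by blast
        then show "p \<in> hprime h d ` ?D" by blast
      qed
    qed
  next
    fix P assume P: "P \<in> ?D"
    then have PP: "P \<in> Proj_points A" "h \<notin> P" by auto
    show "stalk (Proj s A) P = localization (hloc h d) (hprime h d P)"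
    proof (intro equalityI subsetI)
      fix x assume "x \<in> stalk (Proj s A) P"
      then obtain a b i where ab: "a \<in> A i" "b \<in> A i" "b \<notin> P" "x = a / b" by (auto simp: stalk_Proj)
      have b0: "b \<noteq> 0" using ab(3) prime_idealD(2)[OF Proj_pointsD(1)[OF PP(1)]] by auto
      have dd: "d = Suc (d - 1)" using d by simp
      \<comment> \<open>\<open>a / b\<close> is rewritten as
        \<open>(a * b ^ (d - 1)) / b ^ d\<close> to reach a degree divisible by \<open>d\<close>;
        then both parts can be divided by \<open>h ^ i\<close>.\<close>
      have 1: "a * b ^ (d - 1) \<in> A (i * d)"
        by (rule mult_in'[OF ab(1) power_in[OF ab(2)]]) (use dd in \<open>metis mult.commute mult_Suc_right\<close>)
      have 2: "b ^ d \<in> A (i * d)" using power_in[OF ab(2), of d] by (simp add: mult.commute)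
      have "b ^ d / h ^ i \<notin> hprime h d P" using test[OF P ab(2)] ab(3) by simp
      then have "(a * b ^ (d - 1) / h ^ i) / (b ^ d / h ^ i) \<in> localization (hloc h d) (hprime h d P)"
        by (intro localizationI hlocI 1 2)
      moreover have "(a * b ^ (d - 1) / h ^ i) / (b ^ d / h ^ i) = x"
      proof -
        have "b ^ d = b * b ^ (d - 1)" using dd by (metis power_Suc)
        then show ?thesis unfolding ab(4) using b0 h(2) by simp
      qed
      ultimately show "x \<in> localization (hloc h d) (hprime h d P)" by simp
    next
      fix x assume "x \<in> localization (hloc h d) (hprime h d P)"
      then obtain y z where yz: "y \<in> hloc h d" "z \<in> hloc h d" "z \<notin> hprime h d P" "x = y / z" by (rule localizationE)
      obtain a n where a: "a \<in> A (n * d)" "y = a / h ^ n" using yz(1) by (rule hlocE)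
      obtain b m where b: "b \<in> A (m * d)" "z = b / h ^ m" using yz(2) by (rule hlocE)
      have bP: "b \<notin> P" using yz(3) hprime_mem_iff[OF h(1) PP b(1)] b(2) by simp
      have 1: "a * h ^ m \<in> A ((n + m) * d)" "b * h ^ n \<in> A ((n + m) * d)"
        using shift_degree[OF a(1) h(1), of m] shift_degree[OF b(1) h(1), of n] by (simp_all add: algebra_simps)
      have "b * h ^ n \<notin> P" using hom_prime_mult[OF PP(1) b(1) power_in[OF h(1)]] bP hom_prime_power'[OF PP(1) h(1) PP(2)] by blast
      moreover have "x = (a * h ^ m) / (b * h ^ n)" unfolding yz(4) a(2) b(2) using h(2) by (simp add: mult.commute)
      ultimately show "x \<in> stalk (Proj s A) P" unfolding stalk_Proj using 1 by blast
    qed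
  next
    fix f assume "f \<in> hloc h d"
    then obtain a n where a: "a \<in> A (n * d)" "f = a / h ^ n" by (rule hlocE)
    \<comment> \<open>The extra factor \<open>h\<close> restricts to the chart and makes the degree
      positive even for \<open>n = 0\<close>, as basic open sets of Proj require.\<close>
    have ah: "a * h \<in> A (n * d + d)" by (rule mult_in[OF a(1) h(1)])
    have e: "{P \<in> Proj_points A. a * h \<notin> P} = {P \<in> ?D. f \<notin> hprime h d P}"
      unfolding a(2) using hprime_mem_iff[OF h(1) _ _ a(1)] hom_prime_mult[OF _ a(1) h(1)] by blast
    have "openin (zariski (Proj s A)) {P \<in> Proj_points A. a * h \<notin> P}" by (rule openin_Proj[OF _ ah]) (use d in simp)
    then have "openin (zariski (Proj s A)) {P \<in> ?D. f \<notin> hprime h d P}" unfolding e .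
    moreover have "{P \<in> ?D. f \<notin> hprime h d P} = {P \<in> ?D. f \<notin> hprime h d P} \<inter> ?D" by blast
    ultimately show "openin (subtopology (zariski (Proj s A)) ?D) {P \<in> ?D. f \<notin> hprime h d P}"
      unfolding openin_subtopology by (intro exI conjI)
  next
    fix U P assume U: "openin (subtopology (zariski (Proj s A)) ?D) U" "P \<in> U"
    obtain V where V: "openin (zariski (Proj s A)) V" "U = V \<inter> ?D" using U(1) by (auto simp: openin_subtopology)
    have P: "P \<in> V" "P \<in> ?D" using U(2) V(2) by auto
    obtain i g where g: "i > 0" "g \<in> A i" "g \<notin> P" "{Q \<in> Proj_points A. g \<notin> Q} \<subseteq> V" using Proj_basis[OF V(1) P(1)] by blast
    have "g ^ d \<in> A (i * d)" using power_in[OF g(2), of d] by (simp add: mult.commute)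
    then have fB: "g ^ d / h ^ i \<in> hloc h d" by (rule hlocI)
    have "g ^ d / h ^ i \<notin> hprime h d P" using test[OF P(2) g(2)] g(3) by simp
    moreover have "{Q \<in> ?D. g ^ d / h ^ i \<notin> hprime h d Q} \<subseteq> U"
    proof
      fix Q assume Q: "Q \<in> {Q \<in> ?D. g ^ d / h ^ i \<notin> hprime h d Q}"
      then have QD: "Q \<in> ?D" by blast
      then have "g \<notin> Q" using test[OF QD g(2)] Q by blast
      then show "Q \<in> U" using QD g(4) V(2) by blast
    qed
    ultimately show "\<exists>f\<in>hloc h d. f \<notin> hprime h d P \<and> {Q \<in> ?D. f \<notin> hprime h d Q} \<subseteq> U" using fB by blast
  qed
qed

end

section \<open>Noetherian subrings\<close>

text \<open>A sequential form of the finiteness of ideals: in any sequence some member is a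
  combination of its predecessors. It can be applied directly to sequences such as powers or
  numerators, without naming the ideals involved.\<close>

definition noetherian :: "'a::comm_ring_1 set \<Rightarrow> bool" where
  "noetherian R \<longleftrightarrow> is_subring R \<and> (\<forall>a :: nat \<Rightarrow> 'a. range a \<subseteq> R \<longrightarrow>
     (\<exists>N c. (\<forall>i<N. c i \<in> R) \<and> a N = (\<Sum>i<N. c i * a i)))"

lemma noetherianD: "noetherian R \<Longrightarrow> is_subring R"
  "noetherian R \<Longrightarrow> (\<And>n. a n \<in> R) \<Longrightarrow> \<exists>N c. (\<forall>i<N. c i \<in> R) \<and> a N = (\<Sum>i<N. c i * a i)" for a :: "nat \<Rightarrow> _"
  by (auto simp: noetherian_def image_subset_iff)

lemma ideal_combination:
  assumes "ideal_of R J" "\<And>i. i < (n::nat) \<Longrightarrow> c i \<in> R" "\<And>i. i < n \<Longrightarrow> a i \<in> J"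
  shows "(\<Sum>i<n. c i * a i) \<in> J"
  using assms(2,3) by (induction n) (use assms(1) in \<open>auto simp: ideal_of_def\<close>)

text \<open>A family without maximal member contains a strictly increasing chain; elements chosen
  from successive differences form a sequence in which no member is a combination of its
  predecessors.\<close>

lemma noetherian_maximal:
  assumes R: "noetherian R" and F: "F \<noteq> {}" "\<And>I. I \<in> F \<Longrightarrow> ideal_of R I"
  shows "\<exists>I\<in>F. \<forall>J\<in>F. I \<subseteq> J \<longrightarrow> J = I"
proof (rule ccontr)
  assume "\<not> ?thesis"
  then have "\<forall>I\<in>F. \<exists>J. J \<in> F \<and> I \<subset> J" by blast
  then obtain f where f: "\<And>I. I \<in> F \<Longrightarrow> f I \<in> F \<and> I \<subset> f I" by metis
  obtain I0 where I0: "I0 \<in> F" using F(1) by blast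
  define I where "I n = (f ^^ n) I0" for n
  have IF: "I n \<in> F" for n unfolding I_def by (induction n) (use I0 f in auto)
  have st: "I n \<subset> I (Suc n)" for n using f[OF IF[of n]] by (simp add: I_def)
  then have mono: "I n \<subseteq> I m" if "n \<le> m" for n m using lift_Suc_mono_le[of I n m] that by blast
  have "\<forall>n. \<exists>x. x \<in> I (Suc n) \<and> x \<notin> I n" using st by blast
  then obtain a where a: "\<And>n. a n \<in> I (Suc n) \<and> a n \<notin> I n" by metis
  have "a n \<in> R" for n
  proof -
    have "I (Suc n) \<subseteq> R" using F(2)[OF IF] by (auto simp: ideal_of_def)
    then show ?thesis using a[of n] by blast
  qed
  then obtain N c where N: "\<forall>i<N. c i \<in> R" "a N = (\<Sum>i<N. c i * a i)" using noetherianD(2)[OF R] by blast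
  have "a i \<in> I N" if "i < N" for i using a[of i] mono[of "Suc i" N] that by auto
  then have "(\<Sum>i<N. c i * a i) \<in> I N" using N(1) by (intro ideal_combination[OF F(2)[OF IF]]) auto
  then show False using a[of N] N(2) by simp
qed

lemma hom_poly_eval: "ring_hom_on R (\<lambda>g. poly g x)"
  by (simp add: ring_hom_on_def)

text \<open>Hilbert's proof by polynomials of least degree. Stating it for the values
  \<open>poly g x\<close> at an arbitrary \<open>x\<close>, transcendental or not, yields finitely
  generated algebras directly, without passing to a quotient of a polynomial ring.\<close>

theorem Hilbert_basis:
  fixes R :: "'a::idom set"
  assumes R: "noetherian R"
  shows "noetherian ((\<lambda>g. poly g x) ` poly_over R)"
proof -
  let ?R = "(\<lambda>g. poly g x) ` poly_over R"
  have sR: "is_subring R" by (rule noetherianD(1)[OF R])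
  have pR: "is_subring (poly_over R)" by (rule subring_poly_over[OF sR])
  have sub: "is_subring ?R" by (rule hom_image_subring[OF hom_poly_eval pR])
  have "\<exists>N c. (\<forall>i<N. c i \<in> ?R) \<and> a N = (\<Sum>i<N. c i * a i)" if a: "range a \<subseteq> ?R" for a :: "nat \<Rightarrow> 'a"
  proof (rule ccontr)
    assume bad: "\<not> ?thesis"
    define span where "span b n = {\<Sum>i<n. c i * b i | c. \<forall>i<n. c i \<in> ?R}" for b :: "nat \<Rightarrow> 'a" and n :: nat
    have spanI: "(\<Sum>i<n. c i * b i) \<in> span b n" if "\<forall>i<n. c i \<in> ?R" for c b and n :: nat
      unfolding span_def using that by (intro CollectI exI[of _ c]) simp
    have span_ideal: "ideal_of ?R (span b n)" if b: "\<And>i. i < n \<Longrightarrow> b i \<in> ?R" for b n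
      unfolding ideal_of_def
    proof (intro conjI ballI)
      show "span b n \<subseteq> ?R" using b by (auto simp: span_def intro!: subring_sum[OF sub] subring_mult[OF sub])
      show "0 \<in> span b n" using spanI[of n "\<lambda>_. 0" b] subring_zero[OF sub] by simp
      fix y z assume "y \<in> span b n" "z \<in> span b n"
      then obtain c d where cd: "y = (\<Sum>i<n. c i * b i)" "z = (\<Sum>i<n. d i * b i)" "\<forall>i<n. c i \<in> ?R" "\<forall>i<n. d i \<in> ?R"
        unfolding span_def by blast
      have "y + z = (\<Sum>i<n. (c i + d i) * b i)" using cd by (simp add: sum.distrib distrib_right)
      moreover have "\<forall>i<n. c i + d i \<in> ?R" using cd subring_add[OF sub] by blast
      ultimately show "y + z \<in> span b n" using spanI[of n "\<lambda>i. c i + d i" b] by simp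
    next
      fix r y assume r: "r \<in> ?R" "y \<in> span b n"
      then obtain c where c: "y = (\<Sum>i<n. c i * b i)" "\<forall>i<n. c i \<in> ?R" unfolding span_def by blast
      have "r * y = (\<Sum>i<n. (r * c i) * b i)" using c by (simp add: sum_distrib_left mult.assoc)
      moreover have "\<forall>i<n. r * c i \<in> ?R" using c r subring_mult[OF sub] by blast
      ultimately show "r * y \<in> span b n" using spanI[of n "\<lambda>i. r * c i" b] by simp
    qed
    have span_mem: "b j \<in> span b n" if "j < n" for b j n
    proof -
      have "(\<Sum>i<n. (if i = j then 1 else 0) * b i) = b j" using that by (simp add: if_distrib[of "\<lambda>c. c * _"] cong: if_cong)
      moreover have "\<forall>i<n. (if i = j then 1 else 0) \<in> ?R" using subring_one[OF sub] subring_zero[OF sub] by simp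
      ultimately show ?thesis using spanI[of n "\<lambda>i. if i = j then 1 else 0" b] by simp
    qed
    have span_least: "span b n \<subseteq> J" if "ideal_of ?R J" "\<And>i. i < n \<Longrightarrow> b i \<in> J" for b n J
      using that by (auto simp: span_def intro!: ideal_combination)
    have aR: "a n \<in> ?R" for n using a by blast
    have nota: "a n \<notin> span a n" for n using bad unfolding span_def by blast
    have mono: "span a n \<subseteq> span a m" if "n \<le> m" for n m
      using that aR by (intro span_least span_ideal span_mem) auto
    have sid: "ideal_of ?R (span a n)" for n using span_ideal[of n a] aR by blast
    have sp: "span a n \<subseteq> ?R" "0 \<in> span a n" for n using sid[of n] unfolding ideal_of_def by blast+
    define J where "J = (\<Union>n. span a n)"
    have Jid: "ideal_of ?R J"
      unfolding ideal_of_def J_def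
    proof (intro conjI ballI)
      show "(\<Union>n. span a n) \<subseteq> ?R" using sp(1) by blast
      show "0 \<in> (\<Union>n. span a n)" using sp(2) by blast
      fix y z assume "y \<in> (\<Union>n. span a n)" "z \<in> (\<Union>n. span a n)"
      then obtain n m where "y \<in> span a n" "z \<in> span a m" by blast
      then have "y \<in> span a (max n m)" "z \<in> span a (max n m)" using mono[of n "max n m"] mono[of m "max n m"] by auto
      then show "y + z \<in> (\<Union>n. span a n)" using sid[of "max n m"] unfolding ideal_of_def by blast
    next
      fix r y assume "r \<in> ?R" "y \<in> (\<Union>n. span a n)"
      then obtain n where n: "y \<in> span a n" by blast
      have "r * y \<in> span a n" using sid[of n] n \<open>r \<in> ?R\<close> unfolding ideal_of_def by blast
      then show "r * y \<in> (\<Union>n. span a n)" by blast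
    qed
    \<comment> \<open>At stage \<open>n\<close>, \<open>Q\<close> admits the polynomials whose value
      lies in \<open>J\<close> but not in the span of the values chosen so far, and \<open>P\<close>
      selects one of least degree.\<close>
    define Q where "Q G n g \<longleftrightarrow> g \<in> poly_over R \<and> poly g x \<in> J \<and> poly g x \<notin> span (\<lambda>i. poly (G i) x) n"
      for G :: "nat \<Rightarrow> 'a poly" and n g
    define P where "P G n g \<longleftrightarrow> Q G n g \<and> (\<forall>g'. Q G n g' \<longrightarrow> degree g \<le> degree g')" for G n g
    have "\<exists>G. \<forall>n. P G n (G n)"
    proof (rule dependent_wellorder_choice)
      fix r :: "'a poly" and f g :: "nat \<Rightarrow> 'a poly" and n :: nat
      assume "\<And>y. y < n \<Longrightarrow> f y = g y"
      then have "span (\<lambda>i. poly (f i) x) n = span (\<lambda>i. poly (g i) x) n" unfolding span_def by simp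
      then show "P f n r = P g n r" unfolding P_def Q_def by simp
    next
      fix n :: nat and f :: "nat \<Rightarrow> 'a poly"
      assume f: "\<And>y. y < n \<Longrightarrow> P f y (f y)"
      then have fJ: "poly (f i) x \<in> J" if "i < n" for i using that unfolding P_def Q_def by blast
      then have "\<forall>i\<in>{..<n}. \<exists>k. poly (f i) x \<in> span a k" unfolding J_def by blast
      then obtain k where k: "\<And>i. i < n \<Longrightarrow> poly (f i) x \<in> span a (k i)" by (metis lessThan_iff)
      \<comment> \<open>The sum serves as a common upper bound: all values chosen so far lie in
        \<open>span a M\<close>, while \<open>a M\<close> does not, so a candidate for the next
        stage exists.\<close>
      define M where "M = (\<Sum>i<n. k i)"
      have "k i \<le> M" if "i < n" for i unfolding M_def using that by (intro member_le_sum) auto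
      then have "poly (f i) x \<in> span a M" if "i < n" for i using k[OF that] mono that by blast
      then have sM: "span (\<lambda>i. poly (f i) x) n \<subseteq> span a M" using sid by (intro span_least) auto
      obtain g where g: "g \<in> poly_over R" "a M = poly g x" using aR[of M] by blast
      have "a M \<in> J" unfolding J_def using span_mem[of M "Suc M" a] by blast
      then have "Q f n g" using g sM nota[of M] unfolding Q_def by auto
      then show "\<exists>r. P f n r" using ex_has_least_nat[of "Q f n" g degree] unfolding P_def by blast
    qed
    then obtain G where G: "\<And>n. P G n (G n)" by blast
    then have GQ: "Q G n (G n)" for n unfolding P_def by blast
    define b where "b i = poly (G i) x" for i
    have GR: "G n \<in> poly_over R" and bJ: "b n \<in> J" and bs: "b n \<notin> span b n" for n
      using GQ[of n] unfolding Q_def b_def by auto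
    have bR: "b n \<in> ?R" for n using GR b_def by blast
    have degle: "degree (G i) \<le> degree (G n)" if "i \<le> n" for i n
    proof -
      have "span b i \<subseteq> span b n" using that bR by (intro span_least span_ideal span_mem) auto
      then have "Q G i (G n)" using GR[of n] bJ[of n] bs[of n] unfolding Q_def b_def by blast
      then show ?thesis using G[of i] unfolding P_def by blast
    qed
    obtain N c where N: "\<forall>i<N. c i \<in> R" "lead_coeff (G N) = (\<Sum>i<N. c i * lead_coeff (G i))"
      using noetherianD(2)[OF R, of "\<lambda>n. lead_coeff (G n)"] poly_overD[OF GR] by blast
    let ?d = "degree (G N)"
    \<comment> \<open>Each earlier polynomial is shifted to the degree of \<open>G N\<close>, so
      that subtracting the combination cancels the leading term. The difference \<open>g\<close>
      still has a value outside the span, contradicting the minimal degree of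
      \<open>G N\<close>.\<close>
    define T where "T i = monom (c i) (?d - degree (G i)) * G i" for i
    define g where "g = G N - (\<Sum>i<N. T i)"
    have monR: "monom (c i) k \<in> poly_over R" if "i < N" for i k
      using N(1) that subring_zero[OF sR] by (auto simp: poly_over_def)
    have TR: "T i \<in> poly_over R" if "i < N" for i
      unfolding T_def using monR[OF that] GR by (rule subring_mult[OF pR])
    have gR: "g \<in> poly_over R" unfolding g_def using GR TR by (intro subring_diff[OF pR] subring_sum[OF pR]) auto
    have Teval: "poly (\<Sum>i<N. T i) x = (\<Sum>i<N. poly (monom (c i) (?d - degree (G i))) x * b i)"
      by (simp add: poly_sum T_def b_def)
    have Tspan: "poly (\<Sum>i<N. T i) x \<in> span b N"
    proof -
      have "\<forall>i<N. poly (monom (c i) (?d - degree (G i))) x \<in> ?R" using monR by blast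
      then show ?thesis unfolding Teval by (rule spanI)
    qed
    have "poly g x \<notin> span b N"
    proof
      assume "poly g x \<in> span b N"
      then have "poly g x + poly (\<Sum>i<N. T i) x \<in> span b N" using Tspan span_ideal[of N b] bR unfolding ideal_of_def by blast
      then show False using bs[of N] by (simp add: g_def b_def)
    qed
    moreover have "poly g x \<in> J"
    proof -
      have "span b N \<subseteq> J" using Jid bJ by (rule span_least)
      then have TJ: "poly (\<Sum>i<N. T i) x \<in> J" using Tspan by blast
      have "- 1 \<in> ?R" using subring_uminus[OF sub subring_one[OF sub]] .
      then have "- 1 * poly (\<Sum>i<N. T i) x \<in> J" using Jid TJ unfolding ideal_of_def by blast
      then have "b N + - 1 * poly (\<Sum>i<N. T i) x \<in> J" using Jid bJ[of N] unfolding ideal_of_def by blast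
      then show ?thesis by (simp add: g_def b_def)
    qed
    ultimately have "Q G N g" using gR unfolding Q_def b_def by blast
    then have dg: "?d \<le> degree g" using G[of N] unfolding P_def by blast
    have Tc: "coeff (T i) k = (if k < ?d - degree (G i) then 0 else c i * coeff (G i) (k - (?d - degree (G i))))" for i k
      unfolding T_def by (simp add: coeff_monom_mult)
    have "coeff g k = 0" if k: "k \<ge> ?d" for k
    proof (cases "k = ?d")
      case True
      have "coeff (T i) ?d = c i * lead_coeff (G i)" if "i < N" for i
        using Tc[of i ?d] degle[of i N] that by simp
      then have "coeff g ?d = lead_coeff (G N) - (\<Sum>i<N. c i * lead_coeff (G i))"
        by (simp add: g_def coeff_sum)
      then show ?thesis using N(2) True by simp
    next
      case False
      then have kd: "k > ?d" using k by simp
      have "coeff (T i) k = 0" if "i < N" for i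
      proof -
        have "degree (G i) < k - (?d - degree (G i))" using kd degle[of i N] that by simp
        then show ?thesis using Tc[of i k] by (simp add: coeff_eq_0)
      qed
      then show ?thesis using kd by (simp add: g_def coeff_sum coeff_eq_0)
    qed
    then have "lead_coeff g = 0" using dg by blast
    then have "g = 0" by simp
    then show False using \<open>poly g x \<notin> span b N\<close> span_ideal[of N b] bR by (simp add: ideal_of_def)
  qed
  then show ?thesis using sub by (simp add: noetherian_def)
qed

lemma noetherian_field_image:
  fixes s :: "'k::field \<Rightarrow> 'f::field"
  assumes s: "ring_hom_on UNIV s"
  shows "noetherian (range s)"
proof -
  have U: "is_subring (UNIV :: 'k set)" by (simp add: is_subring_def)
  have sub: "is_subring (range s)" by (rule hom_image_subring[OF s U])
  have "\<exists>N c. (\<forall>i<N. c i \<in> range s) \<and> a N = (\<Sum>i<N. c i * a i)" if a: "range a \<subseteq> range s" for a :: "nat \<Rightarrow> 'f"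
  proof (cases "a 0 = 0")
    case True
    \<comment> \<open>With \<open>N = 0\<close> the combination is the empty sum, which equals the
      first member exactly if that is zero.\<close>
    then show ?thesis by (intro exI[of _ 0]) simp
  next
    case False
    have "a 0 \<in> range s" "a 1 \<in> range s" using a by auto
    then obtain k l where kl: "a 0 = s k" "a 1 = s l" by blast
    have FU: "frac_field (UNIV :: 'k set) = UNIV" using frac_base[OF U] by blast
    have "s (l / k) = s l / s k" using hom_frac_divide[OF _ U, of s l k] s FU by simp
    then have "a 1 = s (l / k) * a 0" using kl False by simp
    then show ?thesis by (intro exI[of _ 1] exI[of _ "\<lambda>_. s (l / k)"]) simp
  qed
  then show ?thesis using sub by (simp add: noetherian_def)
qed

lemma generated_insert:
  fixes s :: "'k::field \<Rightarrow> 'f::field"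
  assumes s: "ring_hom_on UNIV s"
  shows "algebra_generated s (insert x G) = (\<lambda>g. poly g x) ` poly_over (algebra_generated s G)"
proof
  let ?E = "algebra_generated s G" and ?E' = "algebra_generated s (insert x G)"
  have E: "is_subring ?E" "range s \<subseteq> ?E" and E': "is_subring ?E'" "range s \<subseteq> ?E'"
    using subring_generated[OF s] by (auto simp: is_algebra_def)
  have pE: "is_subring (poly_over ?E)" by (rule subring_poly_over[OF E(1)])
  have c: "e \<in> (\<lambda>g. poly g x) ` poly_over ?E" if "e \<in> ?E" for e
    by (rule image_eqI[OF _ poly_over_const[OF subring_zero[OF E(1)] that]]) simp
  have v: "x \<in> (\<lambda>g. poly g x) ` poly_over ?E"
    by (rule image_eqI[OF _ poly_over_var[OF subring_zero[OF E(1)] subring_one[OF E(1)]]]) simp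
  show "?E' \<subseteq> (\<lambda>g. poly g x) ` poly_over ?E"
  proof (rule generated_least)
    show "is_algebra s ((\<lambda>g. poly g x) ` poly_over ?E)"
      using s hom_image_subring[OF hom_poly_eval pE] c E(2) by (auto simp: is_algebra_def)
    show "insert x G \<subseteq> (\<lambda>g. poly g x) ` poly_over ?E" using c v generated_incl[of G s] by blast
  qed
  have EE: "?E \<subseteq> ?E'" by (rule generated_mono) blast
  have x: "x \<in> ?E'" using generated_incl[of "insert x G" s] by blast
  show "(\<lambda>g. poly g x) ` poly_over ?E \<subseteq> ?E'"
    using EE x by (auto simp: poly_altdef dest!: poly_overD intro!: subring_sum[OF E'(1)] subring_mult[OF E'(1)] subring_power[OF E'(1)])
qed

lemma noetherian_affine_algebra:
  fixes s :: "'k::field \<Rightarrow> 'f::field"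
  assumes "affine_algebra s R"
  shows "noetherian R"
proof -
  obtain G where G: "finite G" "R = algebra_generated s G" and s: "ring_hom_on UNIV s"
    using assms by (auto simp: affine_algebra_def is_algebra_def)
  have "noetherian (algebra_generated s G)" using G(1)
  proof (induction G)
    case empty
    have U: "is_subring (UNIV :: 'k set)" by (simp add: is_subring_def)
    have "is_algebra s (range s)" using s hom_image_subring[OF s U] by (simp add: is_algebra_def)
    then have "algebra_generated s {} = range s"
      using generated_least[of s "range s" "{}"] subring_generated[OF s, of "{}"] by (auto simp: is_algebra_def)
    then show ?case using noetherian_field_image[OF s] by simp
  next
    case (insert x G)
    then show ?case unfolding generated_insert[OF s] by (intro Hilbert_basis)
  qed
  then show ?thesis using G(2) by simp
qed

section \<open>Discrete valuation rings\<close>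

text \<open>The classical proof that a normal Noetherian local domain of dimension one has a
  principal maximal ideal. An element \<open>z = b / a\<close> outside \<open>R\<close> is found
  that multiplies the maximal ideal into \<open>R\<close>; normality prevents it from mapping that
  ideal into itself, so some \<open>z * w\<close> is a unit and \<open>w\<close> generates.\<close>

lemma dvr_uniformizer:
  fixes R :: "'f::field set"
  assumes R: "noetherian R" and ne: "max_ideal R \<noteq> {0}"
    and primes: "{P. prime_ideal_of R P} = {{0}, max_ideal R}"
    and normal: "\<And>z f. z \<in> frac_field R \<Longrightarrow> lead_coeff f = 1 \<Longrightarrow> (\<And>i. coeff f i \<in> R) \<Longrightarrow> poly f z = 0 \<Longrightarrow> z \<in> R"
  obtains w where "w \<in> max_ideal R" "w \<noteq> 0" "max_ideal R = {w * r | r. r \<in> R}"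
proof -
  let ?m = "max_ideal R"
  have sub: "is_subring R" by (rule noetherianD(1)[OF R])
  have mp: "prime_ideal_of R ?m" using primes by blast
  note D = prime_idealD[OF mp]
  obtain a where a: "a \<in> ?m" "a \<noteq> 0" using ne D(2) by blast
  have aR: "a \<in> R" using a(1) D(1) by blast
  define aO where "aO = {a * r | r. r \<in> R}"
  have aOid: "ideal_of R aO"
    unfolding ideal_of_def
  proof (intro conjI ballI)
    show "aO \<subseteq> R" using aR subring_mult[OF sub] by (auto simp: aO_def)
    show "0 \<in> aO" using subring_zero[OF sub] by (auto simp: aO_def intro!: exI[of _ 0])
    fix y z assume "y \<in> aO" "z \<in> aO"
    then obtain r t where "y = a * r" "z = a * t" "r \<in> R" "t \<in> R" by (auto simp: aO_def)
    then show "y + z \<in> aO" using subring_add[OF sub] by (auto simp: aO_def distrib_left[symmetric])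
  next
    fix r y assume "r \<in> R" "y \<in> aO"
    then obtain t where t: "y = a * t" "t \<in> R" by (auto simp: aO_def)
    then have "r * y = a * (r * t)" by simp
    then show "r * y \<in> aO" using subring_mult[OF sub \<open>r \<in> R\<close> t(2)] by (auto simp: aO_def)
  qed
  have sub_aO: "x + y \<in> aO" if "x \<in> aO" "y \<in> aO" for x y using that aOid by (auto simp: ideal_of_def)
  have mul_aO: "r * y \<in> aO" if "r \<in> R" "y \<in> aO" for r y using that aOid by (auto simp: ideal_of_def)
  \<comment> \<open>The annihilator of the class of \<open>b\<close> modulo \<open>a R\<close>. A
    maximal one among those of non-zero classes is prime, and since it contains \<open>a\<close>, it
    can only be the maximal ideal.\<close>
  define ann where "ann b = {r \<in> R. r * b \<in> aO}" for b
  define F where "F = {ann b | b. b \<in> R \<and> b \<notin> aO}"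
  have annid: "ideal_of R (ann b)" for b
    unfolding ideal_of_def
  proof (intro conjI ballI)
    show "ann b \<subseteq> R" by (auto simp: ann_def)
    show "0 \<in> ann b" using subring_zero[OF sub] aOid by (auto simp: ann_def ideal_of_def)
    fix x y assume "x \<in> ann b" "y \<in> ann b"
    then show "x + y \<in> ann b" using sub_aO subring_add[OF sub] by (auto simp: ann_def distrib_right)
  next
    fix r y assume "r \<in> R" "y \<in> ann b"
    then show "r * y \<in> ann b" using mul_aO subring_mult[OF sub] by (auto simp: ann_def mult.assoc)
  qed
  have "1 \<notin> aO"
  proof
    assume "1 \<in> aO"
    then obtain r where "1 = a * r" "r \<in> R" by (auto simp: aO_def)
    then show False using D(3) D(6)[OF _ a(1)] by metis
  qed
  then have "F \<noteq> {}" using subring_one[OF sub] by (auto simp: F_def)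
  then have "\<exists>I\<in>F. \<forall>J\<in>F. I \<subseteq> J \<longrightarrow> J = I"
    by (rule noetherian_maximal[OF R]) (use annid in \<open>auto simp: F_def\<close>)
  then obtain b where b: "b \<in> R" "b \<notin> aO" "\<And>J. J \<in> F \<Longrightarrow> ann b \<subseteq> J \<Longrightarrow> J = ann b"
    by (auto simp: F_def)
  have "prime_ideal_of R (ann b)"
    unfolding prime_ideal_of_def
  proof (intro conjI ballI impI)
    show "1 \<notin> ann b" using b(2) by (simp add: ann_def)
    show "x \<in> ann b \<or> y \<in> ann b" if xy: "x \<in> R" "y \<in> R" "x * y \<in> ann b" for x y
    proof (cases "y \<in> ann b")
      case False
      then have yb: "y * b \<notin> aO" "y * b \<in> R" using xy(2) b(1) subring_mult[OF sub] by (auto simp: ann_def)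
      have "ann b \<subseteq> ann (y * b)"
      proof
        fix x assume x: "x \<in> ann b"
        then have "y * (x * b) \<in> aO" using mul_aO[OF xy(2)] by (simp add: ann_def)
        then show "x \<in> ann (y * b)" using x by (simp add: ann_def mult.left_commute)
      qed
      moreover have "ann (y * b) \<in> F" using yb by (auto simp: F_def)
      ultimately have "ann (y * b) = ann b" using b(3) by blast
      moreover have "x \<in> ann (y * b)" using xy by (auto simp: ann_def mult.assoc)
      ultimately show ?thesis by blast
    qed simp
  qed (use annid[of b] in \<open>auto simp: ideal_of_def\<close>)
  moreover have "a \<in> ann b" using aR b(1) by (auto simp: ann_def aO_def)
  ultimately have annm: "ann b = ?m" using primes a(2) by blast
  define z where "z = b / a"
  have zF: "z \<in> frac_field R" unfolding z_def using b(1) aR a(2) by (rule fracI)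
  have zm: "z * y \<in> R" if "y \<in> ?m" for y
  proof -
    have "y * b \<in> aO" using that annm by (auto simp: ann_def)
    then obtain r where "y * b = a * r" "r \<in> R" by (auto simp: aO_def)
    then show ?thesis using a(2) by (simp add: z_def mult.commute)
  qed
  have zR: "z \<notin> R"
  proof
    assume "z \<in> R"
    then have "a * z \<in> aO" by (auto simp: aO_def)
    then show False using b(2) a(2) by (simp add: z_def)
  qed
  have "\<exists>r\<in>?m. z * r \<notin> ?m"
  proof (rule ccontr)
    assume "\<not> ?thesis"
    then have st: "z * r \<in> ?m" if "r \<in> ?m" for r using that by blast
    have pw: "z ^ n * a \<in> ?m" for n by (induction n) (use a(1) st in \<open>auto simp: mult.assoc\<close>)
    then have "z ^ n * a \<in> R" for n using D(1) by blast
    then obtain N c where N: "\<forall>i<N. c i \<in> R" "z ^ N * a = (\<Sum>i<N. c i * (z ^ i * a))"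
      using noetherianD(2)[OF R, of "\<lambda>n. z ^ n * a"] by blast
    \<comment> \<open>The Noetherian relation among the elements \<open>z ^ n * a\<close>, divided
      by \<open>a\<close>, is an equation of integral dependence for \<open>z\<close>.\<close>
    define f where "f = monom 1 N - (\<Sum>i<N. monom (c i) i)"
    have cf: "coeff f k = (if k = N then 1 else if k < N then - c k else 0)" for k
      by (auto simp: f_def coeff_sum)
    have "degree f = N"
    proof (rule antisym)
      show "degree f \<le> N" by (rule degree_le) (simp add: cf)
      show "N \<le> degree f" by (rule le_degree) (simp add: cf)
    qed
    then have "lead_coeff f = 1" by (simp add: cf)
    moreover have "coeff f i \<in> R" for i
      unfolding cf using N(1) subring_zero[OF sub] subring_one[OF sub] subring_uminus[OF sub] by simp
    moreover have "poly f z = 0"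
    proof -
      have "a * poly f z = z ^ N * a - (\<Sum>i<N. c i * (z ^ i * a))"
        by (simp add: f_def poly_monom poly_sum algebra_simps sum_distrib_left)
      then show ?thesis using N(2) a(2) by simp
    qed
    ultimately show False using normal[OF zF] zR by blast
  qed
  then obtain w where w: "w \<in> ?m" "z * w \<notin> ?m" by blast
  have unit: "inverse (z * w) \<in> R" using zm[OF w(1)] w(2) by (simp add: max_ideal_def)
  have zw0: "z * w \<noteq> 0" using w(2) D(2) by metis
  have "?m = {w * r | r. r \<in> R}"
  proof (intro equalityI subsetI)
    fix y assume y: "y \<in> ?m"
    have "y = w * (inverse (z * w) * (z * y))" using zw0 by (simp add: field_simps)
    moreover have "inverse (z * w) * (z * y) \<in> R" using unit zm[OF y] by (rule subring_mult[OF sub])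
    ultimately show "y \<in> {w * r | r. r \<in> R}" by blast
  next
    fix y assume "y \<in> {w * r | r. r \<in> R}"
    then show "y \<in> ?m" using D(6)[OF _ w(1)] by blast
  qed
  then show ?thesis using that[of w] w(1) zw0 by simp
qed

text \<open>If \<open>r\<close> were divisible by every power of \<open>w\<close>, the Noetherian
  relation among the quotients \<open>r / w ^ n\<close>, multiplied by \<open>w ^ N\<close> and
  divided by \<open>r\<close>, would write \<open>1\<close> as a sum of multiples of
  \<open>w\<close>. So there is a largest divisible power, and its cofactor is a unit.\<close>

lemma dvr_factor:
  fixes R :: "'f::field set"
  assumes R: "noetherian R" and mp: "prime_ideal_of R (max_ideal R)"
    and w: "w \<noteq> 0" "max_ideal R = {w * r | r. r \<in> R}" and r: "r \<in> R" "r \<noteq> 0"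
  shows "\<exists>u n. u \<in> R - max_ideal R \<and> r = u * w ^ n"
proof -
  have sub: "is_subring R" by (rule noetherianD(1)[OF R])
  have wm: "w \<in> max_ideal R" using w(2) subring_one[OF sub] by force
  have "\<exists>n. r / w ^ n \<notin> R"
  proof (rule ccontr)
    assume "\<not> ?thesis"
    then have "r / w ^ n \<in> R" for n by blast
    then obtain N c where N: "\<forall>i<N. c i \<in> R" "r / w ^ N = (\<Sum>i<N. c i * (r / w ^ i))"
      using noetherianD(2)[OF R, of "\<lambda>n. r / w ^ n"] by blast
    have "r = w ^ N * (r / w ^ N)" using w(1) by simp
    also have "\<dots> = (\<Sum>i<N. r * (c i * w ^ (N - i)))"
      unfolding N(2) sum_distrib_left by (rule sum.cong) (use w(1) in \<open>auto simp: field_simps power_diff\<close>)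
    also have "\<dots> = r * (\<Sum>i<N. c i * w ^ (N - i))" by (simp add: sum_distrib_left)
    finally have "(\<Sum>i<N. c i * w ^ (N - i)) = 1" using r(2) by simp
    moreover have "c i * w ^ (N - i) \<in> max_ideal R" if "i < N" for i
    proof -
      have wR: "w \<in> R" using wm prime_idealD(1)[OF mp] by blast
      have "(c i * w ^ (N - i - 1)) * w \<in> max_ideal R"
        using N(1) that wR by (intro prime_idealD(5)[OF mp _ wm] subring_mult[OF sub] subring_power[OF sub]) auto
      moreover have "w ^ (N - i - 1) * w = w ^ (N - i)" using that by (simp add: power_Suc2[symmetric] Suc_diff_Suc)
      ultimately show ?thesis by (simp add: mult.assoc)
    qed
    ultimately have "1 \<in> max_ideal R" using prime_ideal_sum[OF mp, of "{..<N}" "\<lambda>i. c i * w ^ (N - i)"] by simp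
    then show False using prime_idealD(3)[OF mp] by simp
  qed
  then obtain n0 where n0: "r / w ^ n0 \<notin> R" by blast
  define n where "n = (LEAST n. r / w ^ n \<notin> R)"
  have n: "r / w ^ n \<notin> R" unfolding n_def by (rule LeastI[of _ n0]) (rule n0)
  have "n \<noteq> 0" using n r(1) by (auto intro: ccontr)
  then obtain k where k: "n = Suc k" by (cases n) auto
  have kR: "r / w ^ k \<in> R" using not_less_Least[of k "\<lambda>n. r / w ^ n \<notin> R"] k unfolding n_def by auto
  have "r / w ^ k \<notin> max_ideal R"
  proof
    assume "r / w ^ k \<in> max_ideal R"
    then obtain t where t: "r / w ^ k = w * t" "t \<in> R" using w(2) by auto
    then have "r / w ^ n = t" using w(1) k by (simp add: field_simps)
    then show False using n t(2) by simp
  qed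
  moreover have "r = r / w ^ k * w ^ k" using w(1) by simp
  ultimately show ?thesis using kR by blast
qed

text \<open>This justifies the \<open>THE\<close> in \<open>ord_at\<close>: another generator of the
  maximal ideal differs from \<open>w\<close> by a unit, and no non-zero power of \<open>w\<close>
  is a unit.\<close>

lemma ord_at_unique:
  fixes X :: "('k, 'p, 'f::field) scheme"
  assumes O: "is_subring (stalk X x)" and mp: "prime_ideal_of (stalk X x) (max_ideal (stalk X x))"
    and w: "w \<noteq> 0" "max_ideal (stalk X x) = {w * r | r. r \<in> stalk X x}"
    and v: "v \<in> stalk X x - max_ideal (stalk X x)"
  shows "ord_at X x (v * w powi n) = n"
proof -
  let ?O = "stalk X x" and ?m = "max_ideal (stalk X x)"
  note D = prime_idealD[OF mp]
  have umul: "a * b \<in> ?O - ?m" if "a \<in> ?O - ?m" "b \<in> ?O - ?m" for a b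
    using that D(7) subring_mult[OF O] by blast
  have uinv: "inverse a \<in> ?O - ?m" if a: "a \<in> ?O - ?m" for a
  proof -
    have i: "inverse a \<in> ?O" using a by (simp add: max_ideal_def)
    have a0: "a \<noteq> 0" using a D(2) by auto
    have "inverse a \<notin> ?m"
    proof
      assume "inverse a \<in> ?m"
      then have "a * inverse a \<in> ?m" using a D(5) by blast
      then show False using a0 D(3) by simp
    qed
    then show ?thesis using i by blast
  qed
  have one: "1 \<in> ?O - ?m" using subring_one[OF O] D(3) by blast
  have upow: "a ^ k \<in> ?O - ?m" if "a \<in> ?O - ?m" for a and k :: nat
    by (induction k) (use one umul[OF that] in auto)
  have upowi: "a powi k \<in> ?O - ?m" if "a \<in> ?O - ?m" for a k
    using upow[OF that] upow[OF uinv[OF that]] by (simp add: power_int_def power_inverse)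
  have wm: "w \<in> ?m" using w(2) subring_one[OF O] by force
  have wpos: "w powi k \<notin> ?O - ?m" if "k \<noteq> 0" for k
  proof (cases "k > 0")
    case True
    then have "w powi k = w ^ (nat k - 1) * w" by (simp add: power_int_def power_Suc2[symmetric])
    moreover have "w ^ (nat k - 1) * w \<in> ?m" using wm D(1) by (intro D(5) subring_power[OF O]) auto
    ultimately show ?thesis by simp
  next
    case False
    then have "inverse (w powi k) = w ^ (nat (- k) - 1) * w"
      using that by (simp add: power_int_def power_Suc2[symmetric] power_inverse)
    moreover have "w ^ (nat (- k) - 1) * w \<in> ?m" using wm D(1) by (intro D(5) subring_power[OF O]) auto
    ultimately show ?thesis using uinv[of "w powi k"] by auto
  qed
  have "n' = n" if w': "?m = {w' * r | r. r \<in> ?O}" and v': "v' \<in> ?O - ?m" and eq: "v * w powi n = v' * w' powi n'" for n' w' v'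
  proof -
    have v0: "v \<noteq> 0" "v' \<noteq> 0" using v v' D(2) by auto
    have "w \<in> {w' * r | r. r \<in> ?O}" using wm w' by simp
    then obtain e where e: "w = w' * e" "e \<in> ?O" by blast
    have "w' \<in> ?m" using w' subring_one[OF O] by force
    then have "w' \<in> {w * r | r. r \<in> ?O}" using w(2) by simp
    then obtain e' where e': "w' = w * e'" "e' \<in> ?O" by blast
    have w'0: "w' \<noteq> 0" using e(1) w(1) by auto
    have "w = w * (e' * e)" using e(1) e'(1) by simp
    then have "e' * e = 1" using w(1) by simp
    then have "e' \<notin> ?m" using D(3) D(6)[OF e(2), of e'] by auto
    then have eu: "e' \<in> ?O - ?m" using e'(2) by blast
    then have e0: "e' \<noteq> 0" using D(2) by auto
    have "v * w powi n = v' * (w powi n' * e' powi n')" using eq e'(1) by (simp add: power_int_mult_distrib)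
    then have "w powi (n - n') = v' * e' powi n' * inverse v"
      using v0 w(1) by (simp add: power_int_diff field_simps)
    moreover have "v' * e' powi n' * inverse v \<in> ?O - ?m" using v v' eu by (intro umul upowi uinv)
    ultimately show ?thesis using wpos[of "n - n'"] by force
  qed
  then show ?thesis unfolding ord_at_def using w(2) v by (intro the_equality) blast+
qed

section \<open>Prime divisors on Proj\<close>

context graded_domain
begin

lemma stalk_ProjI: "a \<in> A i \<Longrightarrow> b \<in> A i \<Longrightarrow> b \<notin> P \<Longrightarrow> a / b \<in> stalk (Proj s A) P"
  unfolding stalk_Proj by blast

lemma stalk_ProjE:
  assumes "x \<in> stalk (Proj s A) P"
  obtains a b i where "a \<in> A i" "b \<in> A i" "b \<notin> P" "x = a / b"
  using assms unfolding stalk_Proj by blast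

lemma subring_stalk_Proj:
  assumes P: "P \<in> Proj_points A"
  shows "is_subring (stalk (Proj s A) P)"
  unfolding is_subring_def
proof (intro conjI ballI)
  note D = prime_idealD[OF Proj_pointsD(1)[OF P]]
  show "0 \<in> stalk (Proj s A) P" "1 \<in> stalk (Proj s A) P"
    using stalk_ProjI[OF zero_in one_in D(3)] stalk_ProjI[OF one_in one_in D(3)] by simp_all
  fix x y assume x: "x \<in> stalk (Proj s A) P" and y: "y \<in> stalk (Proj s A) P"
  obtain a b i where ab: "a \<in> A i" "b \<in> A i" "b \<notin> P" "x = a / b" using x by (rule stalk_ProjE)
  obtain c d j where cd: "c \<in> A j" "d \<in> A j" "d \<notin> P" "y = c / d" using y by (rule stalk_ProjE)
  have nz: "b \<noteq> 0" "d \<noteq> 0" using ab(3) cd(3) D(2) by auto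
  have bd: "b * d \<in> A (i + j)" "b * d \<notin> P" using mult_in[OF ab(2) cd(2)] hom_prime_mult[OF P ab(2) cd(2)] ab(3) cd(3) by auto
  have eq: "x - y = (a * d - b * c) / (b * d)" "x * y = (a * c) / (b * d)"
    unfolding ab(4) cd(4) using nz by (simp_all add: field_simps)
  show "x - y \<in> stalk (Proj s A) P" unfolding eq
    by (intro stalk_ProjI[OF _ bd] diff_in mult_in[OF ab(1) cd(2)] mult_in[OF ab(2) cd(1)])
  show "x * y \<in> stalk (Proj s A) P" unfolding eq
    by (intro stalk_ProjI[OF _ bd] mult_in[OF ab(1) cd(1)])
qed

text \<open>The relation is taken among the homogeneous numerators in the graded ring. Only its
  component in the degree of the last numerator is kept, so that after division by denominators the
  coefficients have degree zero.\<close>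

lemma noetherian_stalk_Proj:
  assumes N: "noetherian (total_ring A)" and P: "P \<in> Proj_points A"
  shows "noetherian (stalk (Proj s A) P)"
proof -
  note D = prime_idealD[OF Proj_pointsD(1)[OF P]]
  have "\<exists>N c. (\<forall>i<N. c i \<in> stalk (Proj s A) P) \<and> z N = (\<Sum>i<N. c i * z i)"
    if z: "range z \<subseteq> stalk (Proj s A) P" for z :: "nat \<Rightarrow> 'f"
  proof -
    have "\<forall>n. \<exists>a b i. a \<in> A i \<and> b \<in> A i \<and> b \<notin> P \<and> z n = a / b" using z unfolding stalk_Proj by blast
    then obtain a b e where ab: "\<And>n. a n \<in> A (e n)" "\<And>n. b n \<in> A (e n)" "\<And>n. b n \<notin> P" "\<And>n. z n = a n / b n"
      by metis
    have b0: "b n \<noteq> 0" for n using ab(3)[of n] D(2) by auto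
    obtain N c where Nc: "\<forall>i<N. c i \<in> total_ring A" "a N = (\<Sum>i<N. c i * a i)"
      using noetherianD(2)[OF N, of a] homogeneous_total[OF ab(1)] by blast
    \<comment> \<open>The component of \<open>c i\<close> of the degree missing between
      \<open>a i\<close> and \<open>a N\<close>; it is zero if \<open>a i\<close> already has a
      larger degree.\<close>
    define c' where "c' i = (if e i \<le> e N then coeff (hpoly (c i)) (e N - e i) else 0)" for i
    have "hpoly (a N) = (\<Sum>i<N. hpoly (c i) * monom (a i) (e i))"
      unfolding Nc(2) using Nc(1) ab(1) subring_mult[OF subring_total] homogeneous_total[OF ab(1)]
      by (subst hpoly_sum) (auto simp: hpoly_mult hpoly_homogeneous[OF ab(1)] intro!: sum.cong)
    then have "coeff (hpoly (a N)) (e N) = (\<Sum>i<N. coeff (hpoly (c i) * monom (a i) (e i)) (e N))"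
      by (simp add: coeff_sum)
    moreover have "coeff (hpoly (c i) * monom (a i) (e i)) (e N) = c' i * a i" for i
      unfolding mult.commute[of "hpoly (c i)"] by (simp add: coeff_monom_mult c'_def mult.commute[of "a i"])
    ultimately have aN: "a N = (\<Sum>i<N. c' i * a i)"
      unfolding hpoly_homogeneous[OF ab(1)[of N]] by simp
    have c'A: "c' i * b i \<in> A (e N)" if "i < N" for i
    proof (cases "e i \<le> e N")
      case True
      then show ?thesis using mult_in'[OF hpoly_coeff_in[of "c i" "e N - e i"] ab(2)[of i]] Nc(1) that by (simp add: c'_def)
    qed (simp add: c'_def zero_in)
    have "z N = (\<Sum>i<N. (c' i * b i / b N) * z i)"
    proof -
      have *: "(c' i * b i / b N) * z i = (c' i * a i) / b N" for i using b0[of i] by (simp add: ab(4))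
      have "z N = (\<Sum>i<N. (c' i * a i) / b N)" unfolding ab(4)[of N] aN sum_divide_distrib ..
      then show ?thesis unfolding * .
    qed
    moreover have "c' i * b i / b N \<in> stalk (Proj s A) P" if "i < N" for i
      by (rule stalk_ProjI[OF c'A[OF that] ab(2,3)])
    ultimately show ?thesis
      by (intro exI[of _ N] exI[of _ "\<lambda>i. c' i * b i / b N"] conjI allI impI)
  qed
  then show ?thesis using subring_stalk_Proj[OF P] by (simp add: noetherian_def)
qed

lemma stalk_common_denominator:
  assumes P: "P \<in> Proj_points A" and "finite I" "\<And>k. k \<in> I \<Longrightarrow> f k \<in> stalk (Proj s A) P"
  shows "\<exists>c i. c \<in> A i \<and> c \<notin> P \<and> (\<forall>k\<in>I. c * f k \<in> A i)"
  using assms(2,3)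
proof (induction I)
  case empty
  then show ?case using one_in prime_idealD(3)[OF Proj_pointsD(1)[OF P]] by blast
next
  case (insert m I)
  then obtain c i where c: "c \<in> A i" "c \<notin> P" "\<forall>k\<in>I. c * f k \<in> A i" by auto
  obtain a b j where ab: "a \<in> A j" "b \<in> A j" "b \<notin> P" "f m = a / b" using insert.prems[OF insertI1] by (rule stalk_ProjE)
  have b0: "b \<noteq> 0" using ab(3) prime_idealD(2)[OF Proj_pointsD(1)[OF P]] by auto
  have "b * c * f k \<in> A (j + i)" if "k \<in> insert m I" for k
  proof (cases "k = m")
    case True
    have "b * c * f m = a * c" using ab(4) b0 by simp
    then show ?thesis using True mult_in[OF ab(1) c(1)] by metis
  next
    case False
    then have "b * (c * f k) \<in> A (j + i)" using that c(3) by (intro mult_in[OF ab(2)]) auto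
    then show ?thesis by (simp add: mult.assoc)
  qed
  then show ?case using mult_in[OF ab(2) c(1)] hom_prime_mult[OF P ab(2) c(1)] ab(3) c(2) by blast
qed

text \<open>A homogeneous common denominator \<open>c\<close> of the coefficients makes
  \<open>c * z\<close> integral over the whole graded ring, so normality puts it there. Since
  \<open>z\<close> is a quotient of elements of equal degree, \<open>c * z\<close> is homogeneous of
  the degree of \<open>c\<close>, and dividing by \<open>c\<close> gives a germ.\<close>

lemma normal_stalk_Proj:
  assumes nd: "normal_domain (total_ring A)" and P: "P \<in> Proj_points A"
    and z: "z \<in> frac_field (stalk (Proj s A) P)"
    and f: "lead_coeff f = 1" "\<And>i. coeff f i \<in> stalk (Proj s A) P" "poly f z = 0"
  shows "z \<in> stalk (Proj s A) P"
proof -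
  note D = prime_idealD[OF Proj_pointsD(1)[OF P]]
  let ?R = "total_ring A"
  obtain c i where c: "c \<in> A i" "c \<notin> P" "\<forall>k\<in>{..degree f}. c * coeff f k \<in> A i"
    using stalk_common_denominator[OF P, of "{..degree f}" "coeff f"] f(2) by blast
  have c0: "c \<noteq> 0" using c(2) D(2) by auto
  obtain x y where xy: "x \<in> stalk (Proj s A) P" "y \<in> stalk (Proj s A) P" "y \<noteq> 0" "z = x / y" using z by (rule fracE)
  obtain a b j where ab: "a \<in> A j" "b \<in> A j" "b \<notin> P" "x = a / b" using xy(1) by (rule stalk_ProjE)
  obtain a' b' j' where ab': "a' \<in> A j'" "b' \<in> A j'" "b' \<notin> P" "y = a' / b'" using xy(2) by (rule stalk_ProjE)
  define e where "e = a * b'"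
  define g where "g = b * a'"
  have eg: "e \<in> A (j + j')" "g \<in> A (j + j')" unfolding e_def g_def
    using mult_in[OF ab(1) ab'(2)] mult_in[OF ab(2) ab'(1)] by auto
  have g0: "g \<noteq> 0" using ab(3) D(2) xy(3) ab'(4) by (auto simp: g_def)
  have zeg: "z = e / g" unfolding xy(4) ab(4) ab'(4) e_def g_def by simp
  let ?n = "degree f"
  \<comment> \<open>The usual substitution: multiplying the coefficient of index \<open>k\<close> by
    \<open>c ^ (?n - k)\<close> keeps the polynomial monic and turns the root \<open>z\<close> into
    \<open>c * z\<close>.\<close>
  define f' where "f' = (\<Sum>k\<le>?n. monom (coeff f k * c ^ (?n - k)) k)"
  have cf: "coeff f' k = (if k \<le> ?n then coeff f k * c ^ (?n - k) else 0)" for k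
    by (simp add: f'_def coeff_sum)
  have deg: "degree f' = ?n"
  proof (rule antisym)
    show "degree f' \<le> ?n" by (rule degree_le) (simp add: cf)
    show "?n \<le> degree f'" by (rule le_degree) (use f(1) in \<open>simp add: cf\<close>)
  qed
  have lc: "lead_coeff f' = 1" unfolding deg using f(1) by (simp add: cf)
  have cR: "c \<in> ?R" by (rule homogeneous_total[OF c(1)])
  have cfR: "coeff f' k \<in> ?R" for k
  proof (cases "k < ?n")
    case True
    then have "c ^ (?n - k) = c * c ^ (?n - k - 1)" by (metis Suc_diff_Suc diff_Suc_eq_diff_pred minus_nat.diff_0 power_Suc diff_commute)
    then have "coeff f' k = (c * coeff f k) * c ^ (?n - k - 1)" using True by (simp add: cf)
    moreover have "c * coeff f k \<in> A i" using c(3) True by simp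
    then have "c * coeff f k \<in> ?R" by (rule homogeneous_total)
    ultimately show ?thesis using subring_mult[OF subring_total] subring_power[OF subring_total cR] by simp
  next
    case False
    then show ?thesis using lc subring_zero[OF subring_total] subring_one[OF subring_total] f(1)
      by (cases "k = ?n") (auto simp: cf)
  qed
  have "poly f' (c * z) = (\<Sum>k\<le>?n. c ^ ?n * (coeff f k * z ^ k))"
  proof -
    have *: "coeff f k * c ^ (?n - k) * (c * z) ^ k = c ^ ?n * (coeff f k * z ^ k)" if "k \<le> ?n" for k
    proof -
      have "c ^ ?n = c ^ (?n - k) * c ^ k" using that by (simp add: power_add[symmetric])
      then show ?thesis by (simp add: power_mult_distrib mult_ac)
    qed
    have "poly f' (c * z) = (\<Sum>k\<le>?n. coeff f k * c ^ (?n - k) * (c * z) ^ k)"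
      by (simp add: f'_def poly_sum poly_monom)
    also have "\<dots> = (\<Sum>k\<le>?n. c ^ ?n * (coeff f k * z ^ k))" by (rule sum.cong[OF refl], rule *) simp
    finally show ?thesis .
  qed
  also have "\<dots> = c ^ ?n * poly f z" by (simp add: poly_altdef sum_distrib_left)
  finally have root: "poly f' (c * z) = 0" using f(3) by simp
  have "c * z = (c * e) / g" by (simp add: zeg)
  moreover have ceR: "c * e \<in> A (i + (j + j'))" by (rule mult_in[OF c(1) eg(1)])
  ultimately have "c * z \<in> frac_field ?R" using homogeneous_total[OF ceR] homogeneous_total[OF eg(2)] g0 by (metis fracI)
  then have yR: "c * z \<in> ?R" using nd root lc cfR unfolding normal_domain_def by blast
  have eq: "c * z * g = c * e" using zeg g0 by simp
  \<comment> \<open>The product of \<open>c * z\<close> with the homogeneous \<open>g\<close> is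
    homogeneous, so \<open>c * z\<close> has a component only in degree \<open>i\<close>.\<close>
  have "hpoly (c * z) * monom g (j + j') = hpoly (c * z * g)"
    using hpoly_mult[OF yR homogeneous_total[OF eg(2)]] hpoly_homogeneous[OF eg(2)] by simp
  also have "\<dots> = hpoly (c * e)" by (simp only: eq)
  also have "\<dots> = monom (c * e) (i + (j + j'))" by (rule hpoly_homogeneous[OF ceR])
  finally have "hpoly (c * z) * monom g (j + j') = monom (c * e) (i + (j + j'))" .
  then have ce: "coeff (monom g (j + j') * hpoly (c * z)) (k + (j + j')) = coeff (monom (c * e) (i + (j + j'))) (k + (j + j'))" for k
    by (simp add: mult.commute)
  have "coeff (hpoly (c * z)) k = 0" if "k \<noteq> i" for k
  proof -
    have "coeff (monom g (j + j') * hpoly (c * z)) (k + (j + j')) = 0"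
      unfolding ce using that by simp
    then show ?thesis using g0 by (simp add: coeff_monom_mult)
  qed
  then have "hpoly (c * z) = monom (coeff (hpoly (c * z)) i) i" by (intro poly_eqI) (auto)
  then have "poly (hpoly (c * z)) 1 = poly (monom (coeff (hpoly (c * z)) i) i) 1" by (rule arg_cong)
  then have "poly (hpoly (c * z)) 1 = coeff (hpoly (c * z)) i" by (simp add: poly_monom)
  then have "c * z = coeff (hpoly (c * z)) i" using poly_hpoly[OF yR] by simp
  then have "c * z \<in> A i" using hpoly_coeff_in[OF yR] by metis
  then have "(c * z) / c \<in> stalk (Proj s A) P" by (rule stalk_ProjI[OF _ c(1,2)])
  then show ?thesis using c0 by simp
qed

lemma zero_Proj_point:
  assumes "P \<in> Proj_points A"
  shows "{0} \<in> Proj_points A"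
proof -
  obtain i f where f: "i > 0" "f \<in> A i" "f \<notin> P" using Proj_pointsD(3)[OF assms] by blast
  have "f \<noteq> 0" using f(3) prime_idealD(2)[OF Proj_pointsD(1)[OF assms]] by auto
  moreover have "i \<in> {1..}" using f(1) by simp
  ultimately have "\<not> (\<Union>i\<in>{1..}. A i) \<subseteq> {0}" using f(2) by blast
  moreover have "homogeneous_ideal A {0}"
    unfolding homogeneous_ideal_def using direct by blast
  ultimately show ?thesis using prime_ideal_zero[OF subring_total] by (simp add: Proj_points_def)
qed

lemma function_field_Proj:
  assumes P: "P \<in> Proj_points A"
  shows "function_field (Proj s A) = stalk (Proj s A) {0}"
proof
  show "stalk (Proj s A) {0} \<subseteq> function_field (Proj s A)"
    unfolding function_field_def points_Proj using zero_Proj_point[OF P] by blast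
  show "function_field (Proj s A) \<subseteq> stalk (Proj s A) {0}"
  proof
    fix x assume "x \<in> function_field (Proj s A)"
    then obtain P' where P': "P' \<in> Proj_points A" "x \<in> stalk (Proj s A) P'"
      unfolding function_field_def points_Proj by blast
    obtain a b i where ab: "a \<in> A i" "b \<in> A i" "b \<notin> P'" "x = a / b" using P'(2) by (rule stalk_ProjE)
    have "b \<notin> {0}" using ab(3) prime_idealD(2)[OF Proj_pointsD(1)[OF P'(1)]] by auto
    then show "x \<in> stalk (Proj s A) {0}" unfolding ab(4) by (rule stalk_ProjI[OF ab(1,2)])
  qed
qed

lemma function_field_inverse:
  assumes P: "P \<in> Proj_points A" and f: "f \<in> function_field (Proj s A)"
  shows "inverse f \<in> function_field (Proj s A)"
proof (cases "f = 0")
  case False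
  obtain a b i where ab: "a \<in> A i" "b \<in> A i" "b \<notin> {0}" "f = a / b"
    using f unfolding function_field_Proj[OF P] by (rule stalk_ProjE)
  have "b / a \<in> stalk (Proj s A) {0}" using False ab by (intro stalk_ProjI[of _ i]) auto
  then show ?thesis unfolding function_field_Proj[OF P] ab(4) by simp
qed (use f in simp)

text \<open>Numerator and denominator of \<open>f\<close> are brought to a degree divisible by
  \<open>j\<close> and divided by a power of a homogeneous \<open>t\<close> of degree
  \<open>j\<close> outside \<open>P\<close>, which makes each of them a germ at
  \<open>P\<close>.\<close>

lemma function_field_frac_stalk:
  assumes P: "P \<in> Proj_points A" and f: "f \<in> function_field (Proj s A)"
  shows "f \<in> frac_field (stalk (Proj s A) P)"
proof -
  obtain a b i where ab: "a \<in> A i" "b \<in> A i" "b \<notin> {0}" "f = a / b"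
    using f unfolding function_field_Proj[OF P] by (rule stalk_ProjE)
  obtain j t where t: "j > 0" "t \<in> A j" "t \<notin> P" using Proj_pointsD(3)[OF P] by blast
  have t0: "t \<noteq> 0" using t(3) prime_idealD(2)[OF Proj_pointsD(1)[OF P]] by auto
  have ti: "t ^ i \<in> A (i * j)" "t ^ i \<notin> P" using power_in[OF t(2)] hom_prime_power'[OF P t(2,3)] by auto
  have jj: "j = Suc (j - 1)" using t(1) by simp
  have 1: "a * b ^ (j - 1) \<in> A (i * j)"
    by (rule mult_in'[OF ab(1) power_in[OF ab(2)]]) (use jj in \<open>metis mult.commute mult_Suc_right\<close>)
  have 2: "b ^ j \<in> A (i * j)" using power_in[OF ab(2), of j] by (simp add: mult.commute)
  have bj: "b ^ j = b * b ^ (j - 1)" using jj by (metis power_Suc)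
  have "(a * b ^ (j - 1) / t ^ i) / (b ^ j / t ^ i) \<in> frac_field (stalk (Proj s A) P)"
    using ab(3) t0 by (intro fracI stalk_ProjI[OF 1 ti] stalk_ProjI[OF 2 ti]) auto
  moreover have "(a * b ^ (j - 1) / t ^ i) / (b ^ j / t ^ i) = f"
    unfolding ab(4) bj using ab(3) t0 by simp
  ultimately show ?thesis by simp
qed

end

section \<open>Valuations along prime divisors of Proj\<close>

locale divisor_graded = graded_domain s A
  for s :: "'k::field \<Rightarrow> 'f::field" and A :: "nat \<Rightarrow> 'f set" +
  fixes H :: "'f set \<Rightarrow> rat" and u :: 'f
  assumes fin: "affine_algebra s (total_ring A)" and nrm: "normal_domain (total_ring A)"
    and u0: "u \<noteq> 0" and ample: "ample_Q_divisor (Proj s A) H"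
    and A_eq: "A = divisor_ring (Proj s A) H u"
begin

abbreviation "Y \<equiv> Proj s A"
abbreviation "K \<equiv> function_field (Proj s A)"
abbreviation "ord \<equiv> ord_at (Proj s A)"

context
  fixes x assumes x: "x \<in> prime_divisors Y"
begin

lemma divisor_point: "x \<in> Proj_points A"
  using x by (simp add: prime_divisors_def points_Proj)

lemma K_subring: "is_subring K"
  unfolding function_field_Proj[OF divisor_point] by (rule subring_stalk_Proj[OF zero_Proj_point[OF divisor_point]])

lemma divisor_stalk_noetherian: "noetherian (stalk Y x)"
  by (rule noetherian_stalk_Proj[OF noetherian_affine_algebra[OF fin] divisor_point])

lemma divisor_max_prime: "prime_ideal_of (stalk Y x) (max_ideal (stalk Y x))"
  using x unfolding prime_divisors_def by blast

lemma uniformizer_exists: "\<exists>w. w \<noteq> 0 \<and> max_ideal (stalk Y x) = {w * r | r. r \<in> stalk Y x}"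
  by (rule dvr_uniformizer[OF divisor_stalk_noetherian])
    (use x normal_stalk_Proj[OF nrm divisor_point] in \<open>auto simp: prime_divisors_def\<close>)

definition unif :: 'f where
  "unif = (SOME w. w \<noteq> 0 \<and> max_ideal (stalk Y x) = {w * r | r. r \<in> stalk Y x})"

lemma unif: "unif \<noteq> 0" "max_ideal (stalk Y x) = {unif * r | r. r \<in> stalk Y x}"
  using someI_ex[OF uniformizer_exists] unfolding unif_def by auto

lemma ord_unique: "v \<in> stalk Y x - max_ideal (stalk Y x) \<Longrightarrow> ord x (v * unif powi n) = n"
  by (rule ord_at_unique[OF subring_stalk_Proj[OF divisor_point] divisor_max_prime unif])

lemma stalk_unit_mult: "a \<in> stalk Y x - max_ideal (stalk Y x) \<Longrightarrow> b \<in> stalk Y x - max_ideal (stalk Y x) \<Longrightarrow>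
   a * b \<in> stalk Y x - max_ideal (stalk Y x)"
  using prime_idealD(7)[OF divisor_max_prime] subring_mult[OF subring_stalk_Proj[OF divisor_point]] by blast

lemma stalk_unit_inverse:
  assumes a: "a \<in> stalk Y x - max_ideal (stalk Y x)"
  shows "inverse a \<in> stalk Y x - max_ideal (stalk Y x)"
proof -
  have i: "inverse a \<in> stalk Y x" and a0: "a \<noteq> 0" using a prime_idealD(2)[OF divisor_max_prime] by (auto simp: max_ideal_def)
  have "inverse a \<notin> max_ideal (stalk Y x)"
  proof
    assume "inverse a \<in> max_ideal (stalk Y x)"
    then have "a * inverse a \<in> max_ideal (stalk Y x)" using a prime_idealD(5)[OF divisor_max_prime] by blast
    then show False using a0 prime_idealD(3)[OF divisor_max_prime] by simp
  qed
  then show ?thesis using i by blast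
qed

lemma ord_rep:
  assumes f: "f \<in> K" "f \<noteq> 0"
  shows "\<exists>v\<in>stalk Y x - max_ideal (stalk Y x). f = v * unif powi (ord x f)"
proof -
  obtain a b where ab: "a \<in> stalk Y x" "b \<in> stalk Y x" "b \<noteq> 0" "f = a / b"
    using function_field_frac_stalk[OF divisor_point f(1)] by (rule fracE)
  have a0: "a \<noteq> 0" using f(2) ab(4) by auto
  obtain v n where v: "v \<in> stalk Y x - max_ideal (stalk Y x)" "a = v * unif ^ n"
    using dvr_factor[OF divisor_stalk_noetherian divisor_max_prime unif ab(1) a0] by blast
  obtain v' n' where v': "v' \<in> stalk Y x - max_ideal (stalk Y x)" "b = v' * unif ^ n'"
    using dvr_factor[OF divisor_stalk_noetherian divisor_max_prime unif ab(2,3)] by blast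
  have "f = (v * inverse v') * unif powi (int n - int n')"
    unfolding ab(4) v(2) v'(2) using unif(1) by (simp add: power_int_diff field_simps)
  moreover have "v * inverse v' \<in> stalk Y x - max_ideal (stalk Y x)" by (intro stalk_unit_mult stalk_unit_inverse v(1) v'(1))
  ultimately show ?thesis using ord_unique by metis
qed

lemma ord_mult:
  assumes "f \<in> K" "f \<noteq> 0" "g \<in> K" "g \<noteq> 0"
  shows "ord x (f * g) = ord x f + ord x g"
proof -
  obtain v where v: "v \<in> stalk Y x - max_ideal (stalk Y x)" "f = v * unif powi (ord x f)" using ord_rep assms by blast
  obtain v' where v': "v' \<in> stalk Y x - max_ideal (stalk Y x)" "g = v' * unif powi (ord x g)" using ord_rep assms by blast
  have "f * g = (v * unif powi (ord x f)) * (v' * unif powi (ord x g))"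
    using v(2) v'(2) by (rule arg_cong2)
  also have "\<dots> = (v * v') * unif powi (ord x f + ord x g)" using unif(1) by (simp add: power_int_add)
  finally have "ord x (f * g) = ord x ((v * v') * unif powi (ord x f + ord x g))" by (rule arg_cong)
  also have "\<dots> = ord x f + ord x g" by (rule ord_unique[OF stalk_unit_mult[OF v(1) v'(1)]])
  finally show ?thesis .
qed

lemma ord_one: "ord x 1 = 0"
  using ord_unique[of 1 0] prime_idealD(3)[OF divisor_max_prime] subring_one[OF subring_stalk_Proj[OF divisor_point]] by simp

lemma ord_power:
  assumes "f \<in> K" "f \<noteq> 0"
  shows "ord x (f ^ n) = int n * ord x f"
proof (induction n)
  case 0 then show ?case by (simp add: ord_one)
next
  case (Suc n)
  then show ?case using ord_mult[OF assms subring_power[OF K_subring assms(1)], of n] assms(2) by (simp add: algebra_simps)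
qed

lemma ord_inverse:
  assumes "f \<in> K" "f \<noteq> 0"
  shows "ord x (inverse f) = - ord x f"
  using ord_mult[OF assms function_field_inverse[OF divisor_point assms(1)]] assms(2) ord_one by simp

lemma ord_nonneg:
  assumes "f \<in> stalk Y x" "f \<noteq> 0"
  shows "ord x f \<ge> 0"
proof -
  obtain v n where v: "v \<in> stalk Y x - max_ideal (stalk Y x)" "f = v * unif ^ n"
    using dvr_factor[OF divisor_stalk_noetherian divisor_max_prime unif assms] by blast
  then show ?thesis using ord_unique[OF v(1), of "int n"] by simp
qed

lemma stalk_of_ord:
  assumes "f \<in> K" "f \<noteq> 0" "ord x f \<ge> 0"
  shows "f \<in> stalk Y x"
proof -
  obtain v where v: "v \<in> stalk Y x - max_ideal (stalk Y x)" "f = v * unif powi (ord x f)" using ord_rep assms by blast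
  have "unif \<in> stalk Y x"
    using unif(2) subring_one[OF subring_stalk_Proj[OF divisor_point]] prime_idealD(1)[OF divisor_max_prime] by force
  then have "v * unif ^ nat (ord x f) \<in> stalk Y x"
    using v(1) by (intro subring_mult[OF subring_stalk_Proj[OF divisor_point]] subring_power[OF subring_stalk_Proj[OF divisor_point]]) auto
  moreover have "unif powi ord x f = unif ^ nat (ord x f)" using assms(3) by (simp add: power_int_def)
  ultimately have "v * unif powi ord x f \<in> stalk Y x" by (simp only:)
  then show ?thesis by (subst v(2))
qed

end

section \<open>Homogeneous elements as sections of multiples of \<open>H\<close>\<close>

lemma A_iff: "g \<in> A n \<longleftrightarrow> g / u ^ n \<in> H0 Y (divisor_floor (\<lambda>x. of_nat n * H x))"
proof -
  let ?H = "H0 Y (divisor_floor (\<lambda>x. of_nat n * H x))"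
  have "A n = {f * u ^ n | f. f \<in> ?H}" by (subst A_eq) (simp add: divisor_ring_def)
  then have "g \<in> A n \<longleftrightarrow> (\<exists>f\<in>?H. g = f * u ^ n)" by blast
  also have "\<dots> \<longleftrightarrow> g / u ^ n \<in> ?H"
  proof
    show "\<exists>f\<in>?H. g = f * u ^ n \<Longrightarrow> g / u ^ n \<in> ?H" using u0 by auto
    assume "g / u ^ n \<in> ?H"
    moreover have "g = g / u ^ n * u ^ n" using u0 by simp
    ultimately show "\<exists>f\<in>?H. g = f * u ^ n" by blast
  qed
  finally show ?thesis .
qed

text \<open>The coefficient at \<open>x\<close> of \<open>div (g / u ^ n) + n H\<close>, the divisor
  of \<open>g\<close> as a section of \<open>n H\<close>. The floor in \<open>divisor_ring\<close>
  is omitted so that the value is additive for products.\<close>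

definition val :: "'f set \<Rightarrow> nat \<Rightarrow> 'f \<Rightarrow> rat" where
  "val x n g = of_int (ord x (g / u ^ n)) + of_nat n * H x"

lemma A_K: "g \<in> A n \<Longrightarrow> g / u ^ n \<in> K"
  unfolding A_iff by (simp add: H0_def)

lemma val_nonneg:
  assumes x: "x \<in> prime_divisors Y" and g: "g \<in> A n" "g \<noteq> 0"
  shows "val x n g \<ge> 0"
proof -
  have "g / u ^ n \<noteq> 0" using g(2) u0 by simp
  then have "(of_int (ord x (g / u ^ n)) :: rat) + of_int \<lfloor>of_nat n * H x\<rfloor> \<ge> 0"
    using g(1) x unfolding A_iff H0_def divisor_of_def divisor_floor_def by auto
  then show ?thesis unfolding val_def using of_int_floor_le[of "of_nat n * H x"] by linarith
qed

text \<open>Orders are integers, so the bound by the rational number \<open>n H\<close> already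
  implies the bound by its floor.\<close>

lemma A_intro:
  assumes F: "F \<in> K" "F \<noteq> 0" and v: "\<And>x. x \<in> prime_divisors Y \<Longrightarrow> of_int (ord x F) + of_nat n * H x \<ge> 0"
  shows "F * u ^ n \<in> A n"
proof -
  have "(of_int (ord x F) :: rat) + of_int \<lfloor>of_nat n * H x\<rfloor> \<ge> 0" if "x \<in> prime_divisors Y" for x
  proof -
    have "of_int (- ord x F) \<le> of_nat n * H x" using v[OF that] by simp
    then have "- ord x F \<le> \<lfloor>of_nat n * H x\<rfloor>" by (simp only: le_floor_iff)
    then show ?thesis by linarith
  qed
  then have "F \<in> H0 Y (divisor_floor (\<lambda>x. of_nat n * H x))"
    using F(1) by (simp add: H0_def divisor_of_def divisor_floor_def)
  then show ?thesis unfolding A_iff using u0 by simp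
qed

text \<open>In the degree-zero fraction \<open>b ^ i / g ^ j\<close> the powers of \<open>u\<close>
  cancel, and with them the contributions of \<open>H\<close>. So comparing values of homogeneous
  elements becomes a statement about germs of rational functions.\<close>

lemma ord_ratio:
  assumes x: "x \<in> prime_divisors Y" and b: "b \<in> A j" "b \<noteq> 0" and g: "g \<in> A i" "g \<noteq> 0"
  shows "b ^ i / g ^ j \<in> K" "of_int (ord x (b ^ i / g ^ j)) = of_nat i * val x j b - of_nat j * val x i g"
proof -
  have b': "b / u ^ j \<in> K" "b / u ^ j \<noteq> 0" and g': "g / u ^ i \<in> K" "g / u ^ i \<noteq> 0"
    using A_K b g u0 by auto
  have bi: "(b / u ^ j) ^ i \<in> K" "(b / u ^ j) ^ i \<noteq> 0" and gj: "(g / u ^ i) ^ j \<in> K" "(g / u ^ i) ^ j \<noteq> 0"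
    using b' g' subring_power[OF K_subring[OF x]] by auto
  have gi: "inverse ((g / u ^ i) ^ j) \<in> K" "inverse ((g / u ^ i) ^ j) \<noteq> 0"
    using function_field_inverse[OF divisor_point[OF x] gj(1)] gj(2) by auto
  have eq: "b ^ i / g ^ j = (b / u ^ j) ^ i * inverse ((g / u ^ i) ^ j)"
    using u0 by (simp add: power_divide power_mult[symmetric] mult.commute[of i j])
  show "b ^ i / g ^ j \<in> K" unfolding eq using subring_mult[OF K_subring[OF x] bi(1) gi(1)] .
  have "ord x (b ^ i / g ^ j) = int i * ord x (b / u ^ j) - int j * ord x (g / u ^ i)"
    unfolding eq ord_mult[OF x bi gi] ord_inverse[OF x gj] ord_power[OF x b'] ord_power[OF x g'] by simp
  then have "of_int (ord x (b ^ i / g ^ j)) = (of_int (int i * ord x (b / u ^ j) - int j * ord x (g / u ^ i)) :: rat)"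
    by (simp only:)
  then show "of_int (ord x (b ^ i / g ^ j)) = of_nat i * val x j b - of_nat j * val x i g"
    unfolding val_def by (simp add: algebra_simps)
qed

text \<open>If \<open>g\<close> had value zero, the fraction \<open>b ^ i / g ^ j\<close>, for some
  \<open>b\<close> of positive degree outside \<open>x\<close>, would have non-negative order and be
  a germ at \<open>x\<close>. Cross-multiplication then puts \<open>b\<close> into the prime
  \<open>x\<close>.\<close>

lemma val_pos_of_mem:
  assumes x: "x \<in> prime_divisors Y" and g: "g \<in> A i" "g \<noteq> 0" "g \<in> x"
  shows "val x i g > 0"
proof (rule ccontr)
  assume "\<not> ?thesis"
  then have v0: "val x i g = 0" using val_nonneg[OF x g(1,2)] by simp
  note P = divisor_point[OF x]
  obtain j b where b: "j > 0" "b \<in> A j" "b \<notin> x" using Proj_pointsD(3)[OF P] by blast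
  have b0: "b \<noteq> 0" using b(3) prime_idealD(2)[OF Proj_pointsD(1)[OF P]] by auto
  note r = ord_ratio[OF x b(2) b0 g(1,2)]
  have "(of_int (ord x (b ^ i / g ^ j)) :: rat) \<ge> 0" unfolding r(2) v0 using val_nonneg[OF x b(2) b0] by simp
  then have "b ^ i / g ^ j \<in> stalk Y x" using b0 g(2) by (intro stalk_of_ord[OF x r(1)]) auto
  then obtain c d k where cd: "c \<in> A k" "d \<in> A k" "d \<notin> x" "b ^ i / g ^ j = c / d" by (rule stalk_ProjE)
  have "d \<noteq> 0" using cd(3) prime_idealD(2)[OF Proj_pointsD(1)[OF P]] by auto
  then have "b ^ i * d = c * g ^ j" using cd(4) g(2) by (simp add: frac_eq_eq)
  moreover have "c * g ^ j \<in> x" using hom_prime_mult[OF P cd(1) power_in[OF g(1)]] hom_prime_power[OF P g(1) b(1)] g(3) by blast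
  ultimately have "b ^ i \<in> x \<or> d \<in> x" using hom_prime_mult[OF P power_in[OF b(2)] cd(2)] by metis
  then show False using cd(3) hom_prime_power'[OF P b(2,3)] by blast
qed

text \<open>Here ampleness enters: a section of a multiple of \<open>H\<close> that does not vanish
  at \<open>x\<close> becomes, after multiplication by a power of \<open>u\<close>, a homogeneous
  element of value zero.\<close>

lemma ample_section:
  assumes x: "x \<in> prime_divisors Y"
  obtains k b where "k > 0" "b \<in> A k" "b \<noteq> 0" "val x k b = 0"
proof -
  have xp: "x \<in> points Y" using x by (simp add: prime_divisors_def)
  obtain m where m: "m > 0" "ample_cartier Y (\<lambda>x. of_nat m * H x)" using ample by (auto simp: ample_Q_divisor_def)
  obtain n t where t: "n > 0" "t \<in> H0 Y (\<lambda>x. of_nat n * (of_nat m * H x))" "t \<noteq> 0"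
    "x \<notin> divisor_supp Y (\<lambda>x. divisor_of Y t x + of_nat n * (of_nat m * H x))"
    using m(2) xp unfolding ample_cartier_def Let_def by blast
  let ?E = "{x. divisor_of Y t x + of_nat n * (of_nat m * H x) \<noteq> 0}"
  have "x \<notin> ?E"
  proof
    assume "x \<in> ?E"
    then have "x \<in> points Y \<inter> ?E" using xp by blast
    then have "x \<in> zariski Y closure_of ?E" by (rule subsetD[OF closure_of_subset_Int])
    then show False using t(4) unfolding divisor_supp_def by (rule notE[rotated])
  qed
  then have z: "(of_int (ord x t) :: rat) + of_nat (n * m) * H x = 0" using x by (simp add: divisor_of_def mult.assoc)
  have tK: "t \<in> K" using t(2) by (simp add: H0_def)
  have "t * u ^ (n * m) \<in> A (n * m)"
  proof (rule A_intro[OF tK t(3)])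
    fix y assume "y \<in> prime_divisors Y"
    then show "of_int (ord y t) + of_nat (n * m) * H y \<ge> 0"
      using t(2,3) by (auto simp: H0_def divisor_of_def mult.assoc)
  qed
  moreover have "val x (n * m) (t * u ^ (n * m)) = 0" using z u0 by (simp add: val_def)
  moreover have "t * u ^ (n * m) \<noteq> 0" using t(3) u0 by simp
  ultimately show ?thesis using that[of "n * m" "t * u ^ (n * m)"] t(1) m(1) by simp
qed

text \<open>If \<open>g\<close> were outside \<open>x\<close>, a power of the nowhere negative
  \<open>b\<close> of value zero at \<open>x\<close> divided by a power of \<open>g\<close> would be
  a germ at \<open>x\<close>, although \<open>ord_ratio\<close> gives it negative order.\<close>

lemma mem_of_val_pos:
  assumes x: "x \<in> prime_divisors Y" and g: "g \<in> A i" "g \<noteq> 0" "val x i g > 0"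
  shows "g \<in> x"
proof (rule ccontr)
  assume n: "g \<notin> x"
  note P = divisor_point[OF x]
  obtain k b where b: "k > 0" "b \<in> A k" "b \<noteq> 0" "val x k b = 0" by (rule ample_section[OF x])
  note r = ord_ratio[OF x b(2,3) g(1,2)]
  have "b ^ i \<in> A (i * k)" "g ^ k \<in> A (i * k)" using power_in[OF b(2), of i] power_in[OF g(1), of k] by (simp_all add: mult.commute)
  then have "b ^ i / g ^ k \<in> stalk Y x" using hom_prime_power'[OF P g(1) n] by (rule stalk_ProjI)
  then have "ord x (b ^ i / g ^ k) \<ge> 0" using b(3) g(2) by (intro ord_nonneg[OF x]) auto
  then have "(of_int (ord x (b ^ i / g ^ k)) :: rat) \<ge> 0" by simp
  moreover have "of_nat k * val x i g > 0" using b(1) g(3) by simp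
  ultimately show False unfolding r(2) b(4) by simp
qed

text \<open>Off the support of \<open>D\<close>, some power of a homogeneous \<open>g\<close> vanishing on that support is divisible
  by \<open>f ^ q * u ^ p\<close>; here \<open>A = A(Y,H)\<close> replaces the principal ideal theorem.\<close>

lemma complement_support:
  assumes D: "effective_Q_divisor Y D" and p: "p > 0" and q: "q > 0"
    and f: "f \<in> K" "f \<noteq> 0" "\<And>x. D x - (of_nat p / of_nat q) * H x = divisor_of Y f x"
  defines "h \<equiv> f ^ q * u ^ p"
  shows "h \<in> A p" "h \<noteq> 0" "points Y - divisor_supp Y D = {P \<in> Proj_points A. h \<notin> P}"
proof -
  obtain P0 where P0: "P0 \<in> Proj_points A" using f(1) by (auto simp: function_field_def points_Proj)
  have Kp: "f ^ q \<in> K" unfolding function_field_Proj[OF P0]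
    using f(1)[unfolded function_field_Proj[OF P0]] by (rule subring_power[OF subring_stalk_Proj[OF zero_Proj_point[OF P0]]])
  have fq: "f ^ q \<noteq> 0" using f(2) by simp
  have pd: "x \<in> prime_divisors Y" if "D x \<noteq> 0" for x using D that by (auto simp: effective_Q_divisor_def Q_divisor_def)
  have Dn: "D x \<ge> 0" for x using D by (simp add: effective_Q_divisor_def)
  have vh: "of_int (ord x (f ^ q)) + of_nat p * H x = of_nat q * D x" if x: "x \<in> prime_divisors Y" for x
  proof -
    have "D x = of_int (ord x f) + (of_nat p / of_nat q) * H x" using f(3)[of x] x by (simp add: divisor_of_def)
    then show ?thesis unfolding ord_power[OF x f(1,2)] using q by (simp add: field_simps)
  qed
  show hA: "h \<in> A p" unfolding h_def
    by (rule A_intro[OF Kp fq]) (use vh Dn in simp)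
  show h0: "h \<noteq> 0" using fq u0 by (simp add: h_def)
  have hval: "val x p h = of_nat q * D x" if "x \<in> prime_divisors Y" for x
    unfolding val_def using vh[OF that] u0 by (simp add: h_def)
  let ?E = "{x. D x \<noteq> 0}"
  have finE: "finite ?E" using D by (simp add: effective_Q_divisor_def Q_divisor_def)
  have hx: "h \<in> x" if "D x \<noteq> 0" for x
  proof (rule mem_of_val_pos[OF pd[OF that] hA h0])
    have "D x > 0" using Dn[of x] that by simp
    then show "val x p h > 0" unfolding hval[OF pd[OF that]] using q by simp
  qed
  show "points Y - divisor_supp Y D = {P \<in> Proj_points A. h \<notin> P}"
  proof (intro equalityI subsetI)
    fix P assume P: "P \<in> {P \<in> Proj_points A. h \<notin> P}"
    have o: "openin (zariski Y) {P \<in> Proj_points A. h \<notin> P}" by (rule openin_Proj[OF p hA])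
    have "P \<notin> zariski Y closure_of ?E"
    proof
      assume "P \<in> zariski Y closure_of ?E"
      then have "\<forall>T. P \<in> T \<and> openin (zariski Y) T \<longrightarrow> (\<exists>y. y \<in> ?E \<and> y \<in> T)"
        unfolding in_closure_of by (rule conjunct2)
      from this[rule_format, OF conjI[OF P o]] obtain y where "D y \<noteq> 0" "h \<notin> y" by blast
      then show False using hx by blast
    qed
    then show "P \<in> points Y - divisor_supp Y D" using P by (simp add: divisor_supp_def points_Proj)
  next
    fix P assume "P \<in> points Y - divisor_supp Y D"
    then have P: "P \<in> Proj_points A" "P \<notin> zariski Y closure_of ?E" by (auto simp: divisor_supp_def points_Proj)
    then have "\<not> (\<forall>T. P \<in> T \<and> openin (zariski Y) T \<longrightarrow> (\<exists>y. y \<in> ?E \<and> y \<in> T))"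
      by (simp add: in_closure_of points_Proj)
    then obtain U where U: "P \<in> U" "openin (zariski Y) U" "\<And>y. y \<in> ?E \<Longrightarrow> y \<notin> U" by blast
    obtain i g where g: "i > 0" "g \<in> A i" "g \<notin> P" "{Q \<in> Proj_points A. g \<notin> Q} \<subseteq> U" using Proj_basis[OF U(2,1)] by blast
    have g0: "g \<noteq> 0" using g(3) prime_idealD(2)[OF Proj_pointsD(1)[OF P(1)]] by auto
    have gx: "g \<in> x" if "x \<in> ?E" for x using U(3)[OF that] g(4) divisor_point[OF pd, of x] that by blast
    have vg: "val x i g > 0" if "x \<in> ?E" for x
      using val_pos_of_mem[OF pd g(2) g0 gx[OF that]] that by simp
    have "\<forall>x\<in>?E. \<exists>n. of_nat q * D x \<le> of_nat n * val x i g"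
    proof
      fix x assume x: "x \<in> ?E"
      obtain n where "of_nat q * D x / val x i g < of_nat n" using reals_Archimedean2 by blast
      then have "of_nat q * D x \<le> of_nat n * val x i g" using vg[OF x] by (simp add: field_simps)
      then show "\<exists>n. of_nat q * D x \<le> of_nat n * val x i g" by blast
    qed
    then obtain n where n: "\<And>x. x \<in> ?E \<Longrightarrow> of_nat q * D x \<le> of_nat (n x) * val x i g" by metis
    \<comment> \<open>The sum makes \<open>N\<close> times the divisor of \<open>g\<close> dominate
      \<open>q D\<close> at all the finitely many components of \<open>D\<close>; the summand
      \<open>p\<close> guarantees \<open>p \<le> N * i\<close>, so that the quotient below has a
      degree in the natural numbers.\<close>
    define N where "N = p + (\<Sum>x\<in>?E. n x)"
    have nN: "of_nat q * D x \<le> of_nat N * val x i g" if x: "x \<in> prime_divisors Y" for x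
    proof (cases "D x = 0")
      case True
      then show ?thesis using val_nonneg[OF x g(2) g0] by simp
    next
      case False
      then have "n x \<le> N" unfolding N_def using finE member_le_sum[of x ?E n] by simp
      then have "of_nat (n x) * val x i g \<le> of_nat N * val x i g" using val_nonneg[OF x g(2) g0] by (intro mult_right_mono) auto
      then show ?thesis using n[of x] False by simp
    qed
    have Ni: "p \<le> N * i"
    proof -
      have "p \<le> N * 1" by (simp add: N_def)
      also have "\<dots> \<le> N * i" using g(1) by (intro mult_le_mono2) simp
      finally show ?thesis .
    qed
    \<comment> \<open>The quotient of \<open>g ^ N\<close> by \<open>h\<close>, dehomogenized by a
      power of \<open>u\<close>. Its divisor is non-negative by the choice of \<open>N\<close>, so
      it is regular, and \<open>h\<close> divides \<open>g ^ N\<close>; a prime avoiding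
      \<open>g\<close> therefore avoids \<open>h\<close>.\<close>
    define F where "F = (g / u ^ i) ^ N * inverse (f ^ q)"
    have gK: "g / u ^ i \<in> K" "g / u ^ i \<noteq> 0" using A_K[OF g(2)] g0 u0 by auto
    have gN: "(g / u ^ i) ^ N \<in> K" "(g / u ^ i) ^ N \<noteq> 0"
      using gK subring_power[OF subring_stalk_Proj[OF zero_Proj_point[OF P0]]] unfolding function_field_Proj[OF P0] by auto
    have fi: "inverse (f ^ q) \<in> K" "inverse (f ^ q) \<noteq> 0" using function_field_inverse[OF P0 Kp] fq by auto
    have FK: "F \<in> K" "F \<noteq> 0"
      using gN fi subring_mult[OF subring_stalk_Proj[OF zero_Proj_point[OF P0]]] unfolding F_def function_field_Proj[OF P0] by auto
    have "F * u ^ (N * i - p) \<in> A (N * i - p)"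
    proof (rule A_intro[OF FK])
      fix x assume x: "x \<in> prime_divisors Y"
      have "ord x F = int N * ord x (g / u ^ i) - ord x (f ^ q)"
        unfolding F_def ord_mult[OF x gN fi] ord_inverse[OF x Kp fq] ord_power[OF x gK] by simp
      then have "of_int (ord x F) = (of_int (int N * ord x (g / u ^ i) - ord x (f ^ q)) :: rat)" by (simp only:)
      then have "of_int (ord x F) + of_nat (N * i - p) * H x = of_nat N * val x i g - of_nat q * D x"
        unfolding val_def vh[OF x, symmetric] using Ni by (simp add: of_nat_diff algebra_simps)
      then show "of_int (ord x F) + of_nat (N * i - p) * H x \<ge> 0" using nN[OF x] by simp
    qed
    moreover have "g ^ N = h * (F * u ^ (N * i - p))"
    proof -
      have "h * (F * u ^ (N * i - p)) = (f ^ q * inverse (f ^ q)) * ((u ^ p * u ^ (N * i - p)) * (g / u ^ i) ^ N)"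
        by (simp add: h_def F_def mult_ac)
      also have "u ^ p * u ^ (N * i - p) = u ^ (i * N)" using Ni by (simp add: power_add[symmetric] mult.commute)
      also have "u ^ (i * N) * (g / u ^ i) ^ N = g ^ N" using u0 by (simp add: power_divide power_mult)
      finally show ?thesis using fq by simp
    qed
    ultimately have "h \<in> P \<Longrightarrow> g ^ N \<in> P" using hom_prime_mult[OF P(1) hA] by metis
    then have "h \<notin> P" using hom_prime_power'[OF P(1) g(2,3)] by blast
    then show "P \<in> {P \<in> Proj_points A. h \<notin> P}" using P(1) by blast
  qed
qed

end

section \<open>Veronese subrings\<close>

text \<open>The linear span over the constants, built by adding one scalar multiple at a time; the
  spans of monomials of fixed degree will be the graded pieces.\<close>

inductive_set kspan :: "('k \<Rightarrow> 'f::comm_ring_1) \<Rightarrow> 'f set \<Rightarrow> 'f set" for s S where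
  kspan_zero: "0 \<in> kspan s S"
| kspan_step: "a \<in> kspan s S \<Longrightarrow> x \<in> S \<Longrightarrow> a + s c * x \<in> kspan s S"

lemma kspan_incl:
  fixes s :: "'k::field \<Rightarrow> 'f::comm_ring_1"
  assumes "ring_hom_on UNIV s" "x \<in> S"
  shows "x \<in> kspan s S"
  using kspan_step[OF kspan_zero assms(2), of s 1] hom_one[OF assms(1)] by simp

lemma kspan_add: "b \<in> kspan s S \<Longrightarrow> a \<in> kspan s S \<Longrightarrow> a + b \<in> kspan s S"
proof (induction rule: kspan.induct)
  case kspan_zero then show ?case by simp
next
  case (kspan_step b x c)
  then show ?case using kspan.kspan_step[of "a + b" s S x c] by (simp add: add.assoc)
qed

lemma kspan_mult_step:
  assumes s: "ring_hom_on UNIV s" and "a \<in> kspan s S" "\<And>y. y \<in> S \<Longrightarrow> x * y \<in> U"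
  shows "s c * x * a \<in> kspan s U"
  using assms(2)
proof (induction rule: kspan.induct)
  case kspan_zero then show ?case by (simp add: kspan.kspan_zero)
next
  case (kspan_step a y d)
  have "s c * x * (a + s d * y) = s c * x * a + s (c * d) * (x * y)"
    using hom_mult[OF s, of c d] by (simp add: algebra_simps)
  then show ?case using kspan.kspan_step[OF kspan_step.IH assms(3)[OF kspan_step.hyps(2)], of "c * d"] by simp
qed

lemma kspan_mult:
  assumes s: "ring_hom_on UNIV s" and "a \<in> kspan s S" "b \<in> kspan s T" "\<And>x y. x \<in> S \<Longrightarrow> y \<in> T \<Longrightarrow> x * y \<in> U"
  shows "a * b \<in> kspan s U"
  using assms(2)
proof (induction rule: kspan.induct)
  case kspan_zero then show ?case by (simp add: kspan.kspan_zero)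
next
  case (kspan_step a x c)
  have "(a + s c * x) * b = a * b + s c * x * b" by (simp add: distrib_right)
  then show ?case using kspan_add[OF kspan_mult_step[OF s assms(3) assms(4)[OF kspan_step.hyps(2)]] kspan_step.IH] by simp
qed

lemma kspan_uminus:
  assumes s: "ring_hom_on UNIV s" and "a \<in> kspan s S"
  shows "- a \<in> kspan s S"
proof -
  have U: "is_subring UNIV" by (simp add: is_subring_def)
  have "s (- 1) = - 1" using hom_diff[OF s U, of 0 1] hom_one[OF s] hom_zero[OF s] by simp
  then show ?thesis using kspan_mult_step[OF s assms(2), of 1 S "- 1"] by simp
qed

lemma kspan_least:
  assumes "a \<in> kspan s S" "is_subring E" "range s \<subseteq> E" "S \<subseteq> E"
  shows "a \<in> E"
  using assms(1) by (induction rule: kspan.induct)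
    (use assms(2-) in \<open>auto intro!: subring_zero subring_add subring_mult\<close>)

context graded_domain
begin

lemma graded_veronese:
  assumes p: "p > 0"
  shows "graded_domain s (veronese p A)"
proof unfold_locales
  show "positively_graded_algebra s (veronese p A)"
    unfolding positively_graded_algebra_def
  proof (intro conjI allI impI ballI)
    show "ring_hom_on UNIV s" by (rule scal_hom)
    show "range s \<subseteq> veronese p A 0" using scal_in by (auto simp: veronese_def)
    show "0 \<in> veronese p A i" for i using zero_in by (simp add: veronese_def)
    show "a - b \<in> veronese p A i" if "a \<in> veronese p A i" "b \<in> veronese p A i" for a b i
      using that diff_in by (simp add: veronese_def)
    show "a * b \<in> veronese p A (i + j)" if "a \<in> veronese p A i" "b \<in> veronese p A j" for a b i j
      using that mult_in by (simp add: veronese_def distrib_left)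
    fix n a i assume a: "(\<forall>i\<le>n. a i \<in> veronese p A i) \<and> (\<Sum>i\<le>n. a i) = 0" and i: "i \<le> n"
    have g: "(\<Sum>i\<le>n. monom (a i) (p * i)) \<in> gpoly"
      using a by (intro gpoly_sum gpoly_monom) (auto simp: veronese_def)
    have "poly (\<Sum>i\<le>n. monom (a i) (p * i)) 1 = 0" using a by (simp add: poly_sum poly_monom)
    then have "(\<Sum>i\<le>n. monom (a i) (p * i)) = 0" using gpoly_eq_0[OF g] by blast
    then have "coeff (\<Sum>i\<le>n. monom (a i) (p * i)) (p * i) = 0" by simp
    then show "a i = 0" using p i by (simp add: coeff_sum)
  qed
qed

lemma kspan_graded:
  assumes W: "\<And>i. W i \<subseteq> A i" "\<And>i j x y. x \<in> W i \<Longrightarrow> y \<in> W j \<Longrightarrow> x * y \<in> W (i + j)" "1 \<in> W 0"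
  shows "graded_domain s (\<lambda>n. kspan s (W n))" "kspan s (W n) \<subseteq> A n"
proof -
  show sub: "kspan s (W n) \<subseteq> A n" for n
  proof
    fix a assume "a \<in> kspan s (W n)"
    then show "a \<in> A n"
    proof (induction rule: kspan.induct)
      case (kspan_step a x c)
      then have "s c * x \<in> A n" using W(1) mult_in[OF scal_in[of c], of x n] by auto
      then show ?case by (rule add_in[OF kspan_step.IH])
    qed (rule zero_in)
  qed
  show "graded_domain s (\<lambda>n. kspan s (W n))"
  proof unfold_locales
    show "positively_graded_algebra s (\<lambda>n. kspan s (W n))"
      unfolding positively_graded_algebra_def
    proof (intro conjI allI impI ballI)
      show "ring_hom_on UNIV s" by (rule scal_hom)
      show "range s \<subseteq> kspan s (W 0)" using kspan_step[OF kspan_zero W(3)] by auto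
      show "0 \<in> kspan s (W i)" for i by (rule kspan_zero)
      show "a - b \<in> kspan s (W i)" if "a \<in> kspan s (W i)" "b \<in> kspan s (W i)" for a b i
        using kspan_add[OF kspan_uminus[OF scal_hom that(2)] that(1)] by simp
      show "a * b \<in> kspan s (W (i + j))" if "a \<in> kspan s (W i)" "b \<in> kspan s (W j)" for a b i j
        by (rule kspan_mult[OF scal_hom that W(2)])
      fix n a i assume a: "(\<forall>i\<le>n. a i \<in> kspan s (W i)) \<and> (\<Sum>i\<le>n. a i) = 0" and i: "i \<le> n"
      then show "a i = 0" using direct[of n a i] sub by blast
    qed
  qed
qed

text \<open>The components of \<open>a\<close> with respect to the smaller family are also
  components with respect to \<open>A\<close>, and those are unique.\<close>

lemma graded_piece_of_subfamily:
  assumes W: "graded_domain s W" "\<And>i. W i \<subseteq> A i" and sub: "total_ring A \<subseteq> total_ring W"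
  shows "A n \<subseteq> W n"
proof
  fix a assume a: "a \<in> A n"
  have "a \<in> (\<lambda>g. poly g 1) ` graded_domain.gpoly W"
    using homogeneous_total[OF a] sub graded_domain.total_ring_gpoly[OF W(1)] by blast
  then obtain g where g: "g \<in> graded_domain.gpoly W" "a = poly g 1" by blast
  have gW: "coeff g i \<in> W i" for i using g(1) graded_domain.gpolyD[OF W(1)] by blast
  then have "g \<in> gpoly" using W(2) by (auto simp: gpoly_def)
  then have "g = monom a n" using hpoly_poly[of g] hpoly_homogeneous[OF a] g(2) by simp
  then have "coeff g n = a" by simp
  then show "a \<in> W n" using gW[of n] by simp
qed

text \<open>Writing the exponents as \<open>\<alpha> = p \<beta> + \<gamma>\<close> with \<open>\<gamma> < p\<close>, a monomial of degree divisible by \<open>p\<close> is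
  a product of \<open>p\<close>th powers of generators and one of finitely many monomials of this kind.\<close>

lemma affine_veronese:
  assumes fin: "affine_algebra s (total_ring A)" and p: "p > 0"
  shows "affine_algebra s (total_ring (veronese p A))"
proof -
  obtain G where G: "finite G" "total_ring A = algebra_generated s G"
    using fin by (auto simp: affine_algebra_def)
  have GR: "G \<subseteq> total_ring A" unfolding G(2) by (rule generated_incl)
  \<comment> \<open>Homogeneous components of the generators are stored together with their degree,
    because a zero component does not determine one.\<close>
  define X where "X = (\<Union>x\<in>G. (\<lambda>i. (coeff (hpoly x) i, i)) ` {..degree (hpoly x)})"
  have finX: "finite X" using G(1) by (simp add: X_def)
  have XA: "fst z \<in> A (snd z)" if "z \<in> X" for z using that GR hpoly_coeff_in by (auto simp: X_def)
  define mon where "mon \<alpha> = (\<Prod>z\<in>X. fst z ^ \<alpha> z)" for \<alpha> :: "'f \<times> nat \<Rightarrow> nat"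
  define dg where "dg \<alpha> = (\<Sum>z\<in>X. \<alpha> z * snd z)" for \<alpha> :: "'f \<times> nat \<Rightarrow> nat"
  have prodA: "(\<Prod>z\<in>X'. fst z ^ \<alpha> z) \<in> A (\<Sum>z\<in>X'. \<alpha> z * snd z)" if "X' \<subseteq> X" for X' and \<alpha> :: "'f \<times> nat \<Rightarrow> nat"
    using finite_subset[OF that finX] that
    by (induction X' rule: finite_induct) (auto simp: one_in intro!: mult_in power_in XA)
  have monA: "mon \<alpha> \<in> A (dg \<alpha>)" for \<alpha> unfolding mon_def dg_def by (rule prodA) simp
  define W where "W n = {mon \<alpha> | \<alpha>. dg \<alpha> = n}" for n
  have W1: "W i \<subseteq> A i" for i using monA by (auto simp: W_def)
  have W2: "x * y \<in> W (i + j)" if xy: "x \<in> W i" "y \<in> W j" for i j x y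
  proof -
    obtain \<alpha> \<beta> where ab: "x = mon \<alpha>" "dg \<alpha> = i" "y = mon \<beta>" "dg \<beta> = j" using xy by (auto simp: W_def)
    have "x * y = mon (\<lambda>z. \<alpha> z + \<beta> z)" "dg (\<lambda>z. \<alpha> z + \<beta> z) = i + j"
      using ab by (simp_all add: mon_def dg_def power_add prod.distrib sum.distrib distrib_right)
    then show ?thesis unfolding W_def by blast
  qed
  have W3: "1 \<in> W 0" unfolding W_def by (intro CollectI exI[of _ "\<lambda>_. 0"]) (simp add: mon_def dg_def)
  note gW = kspan_graded[of W, OF W1 W2 W3]
  have "G \<subseteq> total_ring (\<lambda>n. kspan s (W n))"
  proof
    fix x assume x: "x \<in> G"
    have "coeff (hpoly x) i \<in> total_ring (\<lambda>n. kspan s (W n))" if i: "i \<le> degree (hpoly x)" for i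
    proof -
      let ?z = "(coeff (hpoly x) i, i)"
      have z: "?z \<in> X" using x i by (auto simp: X_def)
      have "mon (\<lambda>y. if y = ?z then 1 else 0) = (\<Prod>y\<in>X. if y = ?z then fst y else 1)"
        unfolding mon_def by (rule prod.cong) auto
      also have "\<dots> = coeff (hpoly x) i" using z finX by simp
      finally have m: "mon (\<lambda>y. if y = ?z then 1 else 0) = coeff (hpoly x) i" .
      have "dg (\<lambda>y. if y = ?z then 1 else 0) = (\<Sum>y\<in>X. if y = ?z then snd y else 0)"
        unfolding dg_def by (rule sum.cong) auto
      also have "\<dots> = i" using z finX by simp
      finally have d: "dg (\<lambda>y. if y = ?z then 1 else 0) = i" .
      have "coeff (hpoly x) i \<in> W i" unfolding W_def
        by (intro CollectI exI[of _ "\<lambda>y. if y = ?z then 1 else 0"] conjI m[symmetric] d)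
      then have "coeff (hpoly x) i \<in> kspan s (W i)" by (rule kspan_incl[OF scal_hom])
      then show ?thesis using graded_domain.homogeneous_total[OF gW(1)] by blast
    qed
    then have "(\<Sum>i\<le>degree (hpoly x). coeff (hpoly x) i) \<in> total_ring (\<lambda>n. kspan s (W n))"
      by (intro subring_sum[OF graded_domain.subring_total[OF gW(1)]]) auto
    moreover have "x = (\<Sum>i\<le>degree (hpoly x). coeff (hpoly x) i)"
      using poly_hpoly[of x] x GR by (auto simp: poly_altdef)
    ultimately show "x \<in> total_ring (\<lambda>n. kspan s (W n))" by simp
  qed
  then have "algebra_generated s G \<subseteq> total_ring (\<lambda>n. kspan s (W n))"
    using generated_least graded_domain.algebra_total[OF gW(1)] by blast
  then have "total_ring A \<subseteq> total_ring (\<lambda>n. kspan s (W n))" unfolding G(2) .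
  \<comment> \<open>The spans of monomials form a graded subalgebra containing all generators, so
    each homogeneous element is a combination of monomials of exactly its degree.\<close>
  then have AW: "A n \<subseteq> kspan s (W n)" for n
    using graded_piece_of_subfamily[of "\<lambda>n. kspan s (W n)" n] gW by blast
  \<comment> \<open>Remainder exponents are taken as extensional functions on \<open>X\<close> with
    values below \<open>p\<close>, so that there are finitely many of them.\<close>
  define F where "F = mon ` {\<gamma> \<in> X \<rightarrow>\<^sub>E {..<p}. p dvd dg \<gamma>} \<union> (\<lambda>z. fst z ^ p) ` X"
  have "finite (X \<rightarrow>\<^sub>E {..<p})" using finX by (intro finite_PiE) auto
  then have finF: "finite F" unfolding F_def using finX by auto
  let ?E = "algebra_generated s F"
  have E: "is_subring ?E" "range s \<subseteq> ?E" "F \<subseteq> ?E"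
    using subring_generated[OF scal_hom, of F] generated_incl[of F s] by (auto simp: is_algebra_def)
  have V: "graded_domain s (veronese p A)" by (rule graded_veronese[OF p])
  have "total_ring (veronese p A) = ?E"
  proof (intro equalityI subsetI)
    have monE: "mon \<alpha> \<in> ?E" if d: "p dvd dg \<alpha>" for \<alpha>
    proof -
      define \<gamma> where "\<gamma> = restrict (\<lambda>z. \<alpha> z mod p) X"
      have "fst z ^ \<alpha> z = (fst z ^ p) ^ (\<alpha> z div p) * fst z ^ \<gamma> z" if "z \<in> X" for z
        using that by (simp add: \<gamma>_def power_mult[symmetric] power_add[symmetric])
      then have m: "mon \<alpha> = (\<Prod>z\<in>X. (fst z ^ p) ^ (\<alpha> z div p)) * mon \<gamma>"
        unfolding mon_def prod.distrib[symmetric] by (rule prod.cong[OF refl])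
      have "\<alpha> z * snd z = p * ((\<alpha> z div p) * snd z) + \<gamma> z * snd z" if "z \<in> X" for z
      proof -
        have "\<alpha> z * snd z = (p * (\<alpha> z div p) + \<alpha> z mod p) * snd z" by simp
        also have "\<dots> = p * ((\<alpha> z div p) * snd z) + (\<alpha> z mod p) * snd z" by (simp only: distrib_right mult.assoc)
        also have "\<alpha> z mod p = \<gamma> z" using that by (simp add: \<gamma>_def)
        finally show ?thesis .
      qed
      then have "dg \<alpha> = p * (\<Sum>z\<in>X. (\<alpha> z div p) * snd z) + dg \<gamma>"
        unfolding dg_def sum_distrib_left sum.distrib[symmetric] by (rule sum.cong[OF refl])
      then have "p dvd dg \<gamma>" using d by (metis dvd_add_right_iff dvd_triv_left)
      moreover have "\<gamma> \<in> X \<rightarrow>\<^sub>E {..<p}" using p by (auto simp: \<gamma>_def)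
      ultimately have "mon \<gamma> \<in> F" unfolding F_def by blast
      then have "mon \<gamma> \<in> ?E" using E(3) by blast
      moreover have "fst z ^ p \<in> ?E" if "z \<in> X" for z using that E(3) by (auto simp: F_def)
      then have "(\<Prod>z\<in>X. (fst z ^ p) ^ (\<alpha> z div p)) \<in> ?E"
        by (intro subring_prod[OF E(1)] subring_power[OF E(1), of "fst _ ^ p"])
      ultimately show ?thesis unfolding m by (rule subring_mult[OF E(1), rotated])
    qed
    have AE: "A (p * i) \<subseteq> ?E" for i
    proof
      fix a assume "a \<in> A (p * i)"
      then have "a \<in> kspan s (W (p * i))" using AW by blast
      then show "a \<in> ?E" by (rule kspan_least[OF _ E(1,2)]) (auto simp: W_def intro: monE)
    qed
    fix x assume "x \<in> total_ring (veronese p A)"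
    then obtain n a where "x = (\<Sum>i\<le>n. a i)" "\<forall>i\<le>n. a i \<in> A (p * i)" by (auto simp: total_ring_def veronese_def)
    then show "x \<in> ?E" using AE by (auto intro!: subring_sum[OF E(1)])
  next
    have "F \<subseteq> total_ring (veronese p A)"
    proof
      fix x assume "x \<in> F"
      then consider \<gamma> where "x = mon \<gamma>" "p dvd dg \<gamma>" | z where "z \<in> X" "x = fst z ^ p" by (auto simp: F_def)
      then show "x \<in> total_ring (veronese p A)"
      proof cases
        case 1
        then obtain k where "dg \<gamma> = p * k" by (auto elim: dvdE)
        then have "x \<in> veronese p A k" using monA[of \<gamma>] 1(1) by (simp add: veronese_def)
        then show ?thesis by (rule graded_domain.homogeneous_total[OF V])
      next
        case 2
        then have "x \<in> veronese p A (snd z)" using power_in[OF XA[OF 2(1)], of p] by (simp add: veronese_def)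
        then show ?thesis by (rule graded_domain.homogeneous_total[OF V])
      qed
    qed
    then have "?E \<subseteq> total_ring (veronese p A)" by (rule generated_least[OF graded_domain.algebra_total[OF V]])
    then show "x \<in> total_ring (veronese p A)" if "x \<in> ?E" for x using that by blast
  qed
  then show ?thesis using subring_generated[OF scal_hom, of F] finF unfolding affine_algebra_def by auto
qed

text \<open>Dehomogenization by setting \<open>h\<close> to \<open>1\<close> maps the Veronese ring
  onto the degree-zero localization: a component of Veronese degree \<open>i\<close> is divided by
  \<open>h ^ i\<close>. Finite generation passes to the image.\<close>

lemma affine_hloc:
  assumes fin: "affine_algebra s (total_ring A)" and p: "p > 0" and h: "h \<in> A p" "h \<noteq> 0"
  shows "affine_algebra s (hloc h p)"
proof -
  interpret V: graded_domain s "veronese p A" by (rule graded_veronese[OF p])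
  define \<Phi> where "\<Phi> x = poly (V.hpoly x) (1 / h)" for x
  let ?R = "total_ring (veronese p A)"
  have hom: "ring_hom_on ?R \<Phi>"
    unfolding ring_hom_on_def
  proof (intro conjI ballI)
    show "\<Phi> 1 = 1" using V.hpoly_homogeneous[OF V.one_in] by (simp add: \<Phi>_def poly_monom)
    fix a b assume ab: "a \<in> ?R" "b \<in> ?R"
    show "\<Phi> (a * b) = \<Phi> a * \<Phi> b" by (simp add: \<Phi>_def V.hpoly_mult[OF ab])
    have "V.hpoly a = V.hpoly (a + b) - V.hpoly b"
      using V.hpoly_diff[OF subring_add[OF V.subring_total ab] ab(2)] by simp
    then show "\<Phi> (a + b) = \<Phi> a + \<Phi> b" by (simp add: \<Phi>_def)
  qed
  have B: "is_subring (hloc h p)" by (rule subring_hloc[OF h])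
  have "\<Phi> ` ?R = hloc h p"
  proof (intro equalityI subsetI)
    fix y assume "y \<in> \<Phi> ` ?R"
    then obtain x where x: "x \<in> ?R" "y = \<Phi> x" by blast
    have "coeff (V.hpoly x) i * (1 / h) ^ i \<in> hloc h p" for i
      using hlocI[of "coeff (V.hpoly x) i" i p h] V.hpoly_coeff_in[OF x(1), of i]
      by (simp add: veronese_def mult.commute power_divide)
    then show "y \<in> hloc h p" unfolding x(2) \<Phi>_def poly_altdef by (intro subring_sum[OF B])
  next
    fix y assume "y \<in> hloc h p"
    then obtain a n where a: "a \<in> A (n * p)" "y = a / h ^ n" by (rule hlocE)
    have aV: "a \<in> veronese p A n" using a(1) by (simp add: veronese_def mult.commute)
    have "\<Phi> a = y" unfolding \<Phi>_def V.hpoly_homogeneous[OF aV] a(2) by (simp add: poly_monom power_divide)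
    then show "y \<in> \<Phi> ` ?R" using V.homogeneous_total[OF aV] by blast
  qed
  moreover have "\<Phi> (s c) = s c" for c using V.hpoly_homogeneous[OF V.scal_in] by (simp add: \<Phi>_def poly_monom)
  ultimately show ?thesis using affine_algebra_image[OF affine_veronese[OF fin p] hom, of s] by simp
qed

lemma hloc_degree_zero:
  assumes h: "h \<in> A d" "h \<noteq> 0"
  shows "hloc h d \<subseteq> stalk (Proj s A) {0}"
proof
  fix x assume "x \<in> hloc h d"
  then obtain a n where a: "a \<in> A (n * d)" "x = a / h ^ n" by (rule hlocE)
  show "x \<in> stalk (Proj s A) {0}" unfolding a(2)
    by (rule stalk_ProjI[OF a(1) power_in[OF h(1)]]) (use h(2) in simp)
qed

text \<open>After multiplication by a homogeneous common denominator \<open>c\<close>, the summands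
  of \<open>poly g h\<close> have the pairwise distinct degrees \<open>i + k * d\<close>, so each of
  them vanishes. Positivity of \<open>d\<close> is what separates the degrees.\<close>

lemma homogeneous_transcendental:
  assumes d: "d > 0" and h: "h \<in> A d" "h \<noteq> 0" and g: "g \<in> poly_over (hloc h d)" "poly g h = 0"
  shows "g = 0"
proof -
  have "\<not> (\<Union>i\<in>{1..}. A i) \<subseteq> {0}" using h d by force
  moreover have "homogeneous_ideal A {0}" unfolding homogeneous_ideal_def using direct by blast
  ultimately have Z: "{0} \<in> Proj_points A" using prime_ideal_zero[OF subring_total] by (simp add: Proj_points_def)
  have "coeff g k \<in> stalk (Proj s A) {0}" for k using poly_overD[OF g(1)] hloc_degree_zero[OF h] by blast
  then obtain c i where c: "c \<in> A i" "c \<noteq> 0" "\<forall>k\<in>{..degree g}. c * coeff g k \<in> A i"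
    using stalk_common_denominator[OF Z, of "{..degree g}" "coeff g"] by auto
  define g' where "g' = (\<Sum>k\<le>degree g. monom (c * coeff g k * h ^ k) (i + k * d))"
  have "g' \<in> gpoly" unfolding g'_def
    using c(3) power_in[OF h(1)] by (intro gpoly_sum gpoly_monom mult_in) auto
  moreover have "poly g' 1 = c * poly g h"
    by (simp add: g'_def poly_sum poly_monom poly_altdef[of g] sum_distrib_left mult.assoc)
  ultimately have "g' = 0" using gpoly_eq_0 g(2) by simp
  have "coeff g k = 0" for k
  proof (cases "k \<le> degree g")
    case True
    have "coeff g' (i + k * d) = c * coeff g k * h ^ k" using True d by (simp add: g'_def coeff_sum)
    then show ?thesis using \<open>g' = 0\<close> c(2) h(2) by simp
  qed (simp add: coeff_eq_0)
  then show ?thesis by (simp add: poly_eq_iff)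
qed

end

section \<open>Laurent extensions inside a field\<close>

definition adjoin :: "'f::field set \<Rightarrow> 'f \<Rightarrow> 'f set" where
  "adjoin R y = (\<lambda>g. poly g y) ` poly_over R"

lemma subring_adjoin: "is_subring R \<Longrightarrow> is_subring (adjoin R y)"
  unfolding adjoin_def by (intro hom_image_subring[OF hom_poly_eval] subring_poly_over)

lemma adjoin_base: "0 \<in> R \<Longrightarrow> a \<in> R \<Longrightarrow> a \<in> adjoin R y"
  unfolding adjoin_def by (rule image_eqI[of _ _ "[:a:]"]) (simp_all add: poly_over_const)

lemma adjoin_gen: "is_subring R \<Longrightarrow> y \<in> adjoin R y"
  unfolding adjoin_def
  by (rule image_eqI[OF _ poly_over_var]) (simp_all add: subring_zero subring_one)

lemma adjoin_least: "is_subring T \<Longrightarrow> R \<subseteq> T \<Longrightarrow> y \<in> T \<Longrightarrow> adjoin R y \<subseteq> T"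
  unfolding adjoin_def poly_altdef
  by (intro image_subsetI subring_sum subring_mult subring_power) (auto dest: poly_overD)

lemma away_least:
  assumes "is_subring T" "P \<subseteq> T" "inverse h \<in> T"
  shows "away P h \<subseteq> T"
  using assms subring_mult[OF assms(1) _ subring_power[OF assms(1,3)]]
  by (auto elim!: awayE simp: divide_inverse power_inverse[symmetric] subset_iff)

lemma away_inverse: "1 \<in> P \<Longrightarrow> inverse h \<in> away P h"
  using awayI[of 1 P h 1] by (simp add: divide_inverse)

text \<open>The ring generated over \<open>R\<close> by \<open>h\<close> and its inverse. In this
  form it is literally the image of the coordinate ring of a product with the punctured line, by
  \<open>hom_away\<close>.\<close>

definition laurent :: "'f::field set \<Rightarrow> 'f \<Rightarrow> 'f set" where
  "laurent R h = away (adjoin R h) h"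

lemma laurent_facts:
  assumes R: "is_subring R" and h: "h \<noteq> 0"
  shows "is_subring (laurent R h)" "R \<subseteq> laurent R h" "h \<in> laurent R h" "inverse h \<in> laurent R h"
    and "\<And>T. is_subring T \<Longrightarrow> R \<subseteq> T \<Longrightarrow> h \<in> T \<Longrightarrow> inverse h \<in> T \<Longrightarrow> laurent R h \<subseteq> T"
proof -
  show "is_subring (laurent R h)" unfolding laurent_def
    by (rule subring_away[OF subring_adjoin[OF R] adjoin_gen[OF R] h])
  show "R \<subseteq> laurent R h" unfolding laurent_def using adjoin_base[OF subring_zero[OF R]] away_base by blast
  show "h \<in> laurent R h" unfolding laurent_def by (rule away_base[OF adjoin_gen[OF R]])
  show "inverse h \<in> laurent R h" unfolding laurent_def by (rule away_inverse[OF subring_one[OF subring_adjoin[OF R]]])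
  show "laurent R h \<subseteq> T" if "is_subring T" "R \<subseteq> T" "h \<in> T" "inverse h \<in> T" for T
    unfolding laurent_def by (rule away_least[OF that(1) adjoin_least[OF that(1-3)] that(4)])
qed

lemma affine_laurent:
  assumes R: "affine_algebra s R" and h: "h \<noteq> 0"
  shows "affine_algebra s (laurent R h)"
proof -
  have s: "ring_hom_on UNIV s" "range s \<subseteq> R" and sub: "is_subring R" using R by (auto simp: affine_algebra_def is_algebra_def)
  note L = laurent_facts[OF sub h]
  let ?E = "algebra_generated s (R \<union> {h, inverse h})"
  have E: "is_subring ?E" "R \<union> {h, inverse h} \<subseteq> ?E"
    using subring_generated[OF s(1)] generated_incl[of "R \<union> {h, inverse h}" s] by (simp_all add: is_algebra_def)
  have "is_algebra s (laurent R h)" using s L(1,2) by (auto simp: is_algebra_def)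
  then have "?E \<subseteq> laurent R h" by (rule generated_least) (use L in auto)
  moreover have "laurent R h \<subseteq> ?E" using E by (intro L(5)) auto
  ultimately have "laurent R h = ?E" by blast
  then show ?thesis using affine_algebra_finite_ext[OF R, of "{h, inverse h}"] by simp
qed

definition transcendental_over :: "'f::field set \<Rightarrow> 'f \<Rightarrow> bool" where
  "transcendental_over R y \<longleftrightarrow> (\<forall>g\<in>poly_over R. poly g y = 0 \<longrightarrow> g = 0)"

text \<open>The roles of the two variables are exchanged: a relation for \<open>t\<close> with
  coefficients in \<open>h\<close> and its inverse is, up to a power of \<open>h\<close>, a relation
  for \<open>h\<close> with coefficients in \<open>B\<close>. These coefficients vanish, and each is
  a polynomial in \<open>t\<close> over \<open>C\<close>, to which the transcendence of
  \<open>t\<close> applies.\<close>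

lemma transcendental_over_laurent:
  assumes B: "is_subring B" and C: "is_subring C" "C \<subseteq> B" and t: "t \<in> B" "transcendental_over C t"
    and h: "h \<noteq> 0" "transcendental_over B h"
  shows "transcendental_over (laurent C h) t"
  unfolding transcendental_over_def
proof (intro ballI impI)
  fix g assume g: "g \<in> poly_over (laurent C h)" "poly g t = 0"
  have "\<forall>i. \<exists>G n. G \<in> poly_over C \<and> coeff g i = poly G h / h ^ n"
    using poly_overD[OF g(1)] unfolding laurent_def adjoin_def by (blast elim: awayE)
  then obtain G0 n where G0: "\<And>i. G0 i \<in> poly_over C" "\<And>i. coeff g i = poly (G0 i) h / h ^ n i" by metis
  define N where "N = (\<Sum>i\<le>degree g. n i)"
  define G where "G i = G0 i * monom 1 (N - n i)" for i
  have pC: "is_subring (poly_over C)" by (rule subring_poly_over[OF C(1)])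
  have mC: "monom 1 k \<in> poly_over C" for k using subring_zero[OF C(1)] subring_one[OF C(1)] by (simp add: poly_over_def)
  have GC: "G i \<in> poly_over C" for i unfolding G_def using G0(1) mC by (rule subring_mult[OF pC])
  have Gc: "poly (G i) h = h ^ N * coeff g i" if i: "i \<le> degree g" for i
  proof -
    have "n i \<le> N" unfolding N_def using i by (intro member_le_sum) auto
    then have "h ^ N = h ^ n i * h ^ (N - n i)" by (simp add: power_add[symmetric])
    then show ?thesis using h(1) by (simp add: G_def G0(2) poly_monom)
  qed
  \<comment> \<open>The relation multiplied by \<open>h ^ N\<close> and regarded as a polynomial in
    \<open>h\<close> over \<open>B\<close>.\<close>
  define P where "P = (\<Sum>i\<le>degree g. smult (t ^ i) (G i))"
  have pB: "is_subring (poly_over B)" by (rule subring_poly_over[OF B])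
  have "P \<in> poly_over B" unfolding P_def
    using GC poly_over_mono[OF C(2)] t(1) by (intro subring_sum[OF pB] poly_over_smult[OF B] subring_power[OF B]) auto
  moreover have "poly P h = 0"
  proof -
    have "poly P h = (\<Sum>i\<le>degree g. t ^ i * (h ^ N * coeff g i))" unfolding P_def by (simp add: poly_sum Gc)
    also have "\<dots> = h ^ N * poly g t" by (simp add: poly_altdef sum_distrib_left mult_ac)
    finally show ?thesis using g(2) by simp
  qed
  ultimately have P0: "P = 0" using h(2) unfolding transcendental_over_def by blast
  have "coeff (G i) j = 0" if i: "i \<le> degree g" for i j
  proof -
    define f where "f = (\<Sum>i\<le>degree g. monom (coeff (G i) j) i)"
    have cf: "coeff f k = (if k \<le> degree g then coeff (G k) j else 0)" for k by (simp add: f_def coeff_sum)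
    have "f \<in> poly_over C" using poly_overD[OF GC] subring_zero[OF C(1)] by (simp add: poly_over_def cf)
    moreover have "poly f t = coeff P j" by (simp add: f_def P_def poly_sum poly_monom coeff_sum mult.commute)
    ultimately have "f = 0" using t(2) P0 unfolding transcendental_over_def by simp
    then have "coeff f i = 0" by simp
    then show ?thesis using cf i by simp
  qed
  then have "G i = 0" if "i \<le> degree g" for i using that by (simp add: poly_eq_iff)
  then have "h ^ N * coeff g i = 0" if "i \<le> degree g" for i using Gc[OF that] that by simp
  then have "coeff g i = 0" for i using h(1) by (cases "i \<le> degree g") (auto simp: coeff_eq_0)
  then show "g = 0" by (simp add: poly_eq_iff)
qed

context graded_domain
begin

text \<open>An element \<open>a\<close> of Veronese degree \<open>i\<close> equals
  \<open>(a / h ^ i) * h ^ i\<close>, with the first factor of degree zero. This uses that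
  \<open>h\<close> has Veronese degree exactly one.\<close>

lemma away_veronese:
  assumes p: "p > 0" and h: "h \<in> A p" "h \<noteq> 0"
  shows "away (total_ring (veronese p A)) h = laurent (hloc h p) h"
proof
  interpret V: graded_domain s "veronese p A" by (rule graded_veronese[OF p])
  let ?R = "total_ring (veronese p A)"
  have B: "is_subring (hloc h p)" by (rule subring_hloc[OF h])
  note L = laurent_facts[OF B h(2)]
  have hV: "h \<in> ?R" using V.homogeneous_total[of h 1] h(1) by (simp add: veronese_def)
  have aR: "is_subring (away ?R h)" by (rule subring_away[OF V.subring_total hV h(2)])
  show "away ?R h \<subseteq> laurent (hloc h p) h"
  proof (rule away_least[OF L(1) _ L(4)])
    show "?R \<subseteq> laurent (hloc h p) h"
    proof
      fix x assume "x \<in> ?R"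
      then obtain n a where x: "x = (\<Sum>i\<le>n. a i)" "\<forall>i\<le>n. a i \<in> A (p * i)" by (auto simp: total_ring_def veronese_def)
      have "a i \<in> laurent (hloc h p) h" if "i \<le> n" for i
      proof -
        have "a i / h ^ i \<in> hloc h p" using x(2) that by (intro hlocI) (simp add: mult.commute)
        then have "a i / h ^ i * h ^ i \<in> laurent (hloc h p) h"
          using L(2) by (intro subring_mult[OF L(1)] subring_power[OF L(1) L(3)]) auto
        then show ?thesis using h(2) by simp
      qed
      then show "x \<in> laurent (hloc h p) h" unfolding x(1) by (intro subring_sum[OF L(1)]) simp
    qed
  qed
  show "laurent (hloc h p) h \<subseteq> away ?R h"
  proof (rule L(5)[OF aR _ away_base[OF hV] away_inverse[OF subring_one[OF V.subring_total]]])
    show "hloc h p \<subseteq> away ?R h"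
    proof
      fix x assume "x \<in> hloc h p"
      then obtain a n where a: "a \<in> A (n * p)" "x = a / h ^ n" by (rule hlocE)
      have "a \<in> ?R" using V.homogeneous_total[of a n] a(1) by (simp add: veronese_def mult.commute)
      then show "x \<in> away ?R h" unfolding a(2) by (rule awayI)
    qed
  qed
qed

end

section \<open>The principal cylinder\<close>

text \<open>The available ring maps are evaluations of polynomials, which start at the coordinate
  ring of the product; they run against the direction in which the isomorphism is stated.\<close>

lemma isomorphic_of_models_inv:
  assumes X: "affine_model X C \<phi>" and X': "affine_model X' C' \<phi>'"
    and \<Theta>: "ring_hom_on (frac_field C') \<Theta>" and im: "\<Theta> ` C' = C"
    and sc: "\<And>c. \<Theta> (scal X' c) = scal X c" and scC: "range (scal X') \<subseteq> C'"
  shows "isomorphic X X'"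
proof (rule isomorphic_of_models[OF X X', where \<Psi> = "inv_into (frac_field C') \<Theta>"])
  have C': "is_subring C'" by (rule affine_modelD(1)[OF X'])
  have inj: "inj_on \<Theta> (frac_field C')" by (rule hom_frac_inj[OF \<Theta> C'])
  have F: "\<Theta> ` frac_field C' = frac_field C" using hom_image_frac[OF \<Theta> C'] im by simp
  have CF: "C' \<subseteq> frac_field C'" using frac_base[OF C'] by blast
  show "ring_hom_on (frac_field C) (inv_into (frac_field C') \<Theta>)"
    using hom_inv_into[OF \<Theta> subring_frac[OF C'] inj] F by simp
  show "inv_into (frac_field C') \<Theta> ` C = C'"
    unfolding im[symmetric] by (rule inv_into_image_cancel[OF inj CF])
  show "inv_into (frac_field C') \<Theta> (scal X c) = scal X' c" for c
    unfolding sc[symmetric] using scC CF by (intro inv_into_f_f[OF inj]) auto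
qed

lemma hom_map_poly:
  assumes \<chi>: "ring_hom_on C \<chi>" and C: "is_subring C"
  shows "ring_hom_on (poly_over C) (\<lambda>g. poly (map_poly \<chi> g) y)"
proof -
  have z: "\<chi> 0 = 0" using hom_zero[OF \<chi> subring_zero[OF C]] .
  have "map_poly \<chi> (f + g) = map_poly \<chi> f + map_poly \<chi> g" if "f \<in> poly_over C" "g \<in> poly_over C" for f g
    using that by (intro poly_eqI) (simp add: coeff_map_poly z hom_add[OF \<chi>] poly_overD)
  moreover have "map_poly \<chi> (f * g) = map_poly \<chi> f * map_poly \<chi> g" if "f \<in> poly_over C" "g \<in> poly_over C" for f g
  proof (rule poly_eqI)
    fix n
    have "\<chi> (\<Sum>i\<le>n. coeff f i * coeff g (n - i)) = (\<Sum>i\<le>n. \<chi> (coeff f i * coeff g (n - i)))"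
      using that by (intro hom_sum[OF \<chi> C] subring_mult[OF C] poly_overD)
    also have "\<dots> = (\<Sum>i\<le>n. \<chi> (coeff f i) * \<chi> (coeff g (n - i)))"
      using that by (simp add: hom_mult[OF \<chi>] poly_overD)
    finally show "coeff (map_poly \<chi> (f * g)) n = coeff (map_poly \<chi> f * map_poly \<chi> g) n"
      by (simp add: coeff_map_poly z coeff_mult)
  qed
  moreover have "map_poly \<chi> 1 = 1" using hom_one[OF \<chi>] by simp
  ultimately show ?thesis by (simp add: ring_hom_on_def)
qed

lemma map_poly_image:
  fixes \<chi> :: "'a::comm_ring_1 \<Rightarrow> 'b::comm_ring_1"
  assumes z: "0 \<in> C" "\<chi> 0 = 0"
  shows "map_poly \<chi> ` poly_over C = poly_over (\<chi> ` C)"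
proof (intro equalityI subsetI)
  fix g assume "g \<in> map_poly \<chi> ` poly_over C"
  then show "g \<in> poly_over (\<chi> ` C)" using z(2) by (auto simp: poly_over_def coeff_map_poly)
next
  fix g assume g: "g \<in> poly_over (\<chi> ` C)"
  have "\<exists>c. c \<in> C \<and> \<chi> c = coeff g i" for i
  proof -
    have "coeff g i \<in> \<chi> ` C" by (rule poly_overD[OF g])
    then show ?thesis by auto
  qed
  then obtain c where c: "\<And>i. c i \<in> C" "\<And>i. \<chi> (c i) = coeff g i" by metis
  define f where "f = (\<Sum>i\<le>degree g. monom (c i) i)"
  have cf: "coeff f k = (if k \<le> degree g then c k else 0)" for k by (simp add: f_def coeff_sum)
  have "map_poly \<chi> f = g" by (intro poly_eqI) (simp add: coeff_map_poly[of \<chi>, OF z(2)] cf c(2) z(2) coeff_eq_0)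
  moreover have "f \<in> poly_over C" using c(1) z(1) by (simp add: poly_over_def cf)
  ultimately show "g \<in> map_poly \<chi> ` poly_over C" by blast
qed

lemma hom_to_fract_inv:
  assumes "ring_hom_on R f"
  shows "ring_hom_on (to_fract ` R) (\<lambda>F. f (inv to_fract F))"
proof -
  have i: "inv to_fract (to_fract g) = g" for g :: 'a by (rule inv_f_f[OF inj_to_fract])
  show ?thesis
    unfolding ring_hom_on_def
  proof (intro conjI ballI)
    show "f (inv to_fract 1) = 1" using i[of 1] hom_one[OF assms] by simp
    fix F G assume "F \<in> to_fract ` R" "G \<in> to_fract ` R"
    then obtain a b where ab: "F = to_fract a" "G = to_fract b" "a \<in> R" "b \<in> R" by blast
    show "f (inv to_fract (F + G)) = f (inv to_fract F) + f (inv to_fract G)"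
      unfolding ab(1,2) to_fract_add[symmetric] i by (rule hom_add[OF assms ab(3,4)])
    show "f (inv to_fract (F * G)) = f (inv to_fract F) * f (inv to_fract G)"
      unfolding ab(1,2) to_fract_mult[symmetric] i by (rule hom_mult[OF assms ab(3,4)])
  qed
qed

text \<open>Evaluation at \<open>y\<close> after applying \<open>\<chi>\<close> to the coefficients;
  transcendence of \<open>y\<close> makes it injective, so it extends to the field of
  fractions.\<close>

lemma polynomial_ring_hom:
  fixes \<chi> :: "'g::field \<Rightarrow> 'f::field"
  assumes \<chi>: "ring_hom_on C \<chi>" "inj_on \<chi> C" and C: "is_subring C"
    and y: "transcendental_over (\<chi> ` C) y"
  obtains \<Theta> where "ring_hom_on (frac_field (to_fract ` poly_over C)) \<Theta>"
    "\<And>g. g \<in> poly_over C \<Longrightarrow> \<Theta> (to_fract g) = poly (map_poly \<chi> g) y"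
    "\<Theta> ` to_fract ` poly_over C = adjoin (\<chi> ` C) y"
proof -
  have z: "\<chi> 0 = 0" using hom_zero[OF \<chi>(1) subring_zero[OF C]] .
  have i: "inv to_fract (to_fract g) = g" for g :: "'g poly" by (rule inv_f_f[OF inj_to_fract])
  let ?f = "\<lambda>g. poly (map_poly \<chi> g) y"
  have pC: "is_subring (poly_over C)" by (rule subring_poly_over[OF C])
  have hf: "ring_hom_on (poly_over C) ?f" by (rule hom_map_poly[OF \<chi>(1) C])
  have "inj_on ?f (poly_over C)"
    unfolding hom_inj_iff[OF hf pC]
  proof (intro ballI impI)
    fix g assume g: "g \<in> poly_over C" "?f g = 0"
    have "map_poly \<chi> g \<in> poly_over (\<chi> ` C)" using map_poly_image[of C \<chi>, OF subring_zero[OF C] z] g(1) by blast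
    then have "map_poly \<chi> g = 0" using y g(2) unfolding transcendental_over_def by blast
    then have "\<chi> (coeff g k) = 0" for k by (metis coeff_0 coeff_map_poly[of \<chi>, OF z])
    then have "coeff g k = 0" for k using \<chi>(2) poly_overD[OF g(1)] z subring_zero[OF C] by (metis inj_onD)
    then show "g = 0" by (simp add: poly_eq_iff)
  qed
  then have inj: "inj_on (\<lambda>F. ?f (inv to_fract F)) (to_fract ` poly_over C)"
    by (auto simp: inj_on_def i)
  obtain \<Theta> where \<Theta>: "ring_hom_on (frac_field (to_fract ` poly_over C)) \<Theta>"
    "\<And>F. F \<in> to_fract ` poly_over C \<Longrightarrow> \<Theta> F = ?f (inv to_fract F)"
    using hom_extend[OF hom_to_fract_inv[OF hf] hom_image_subring[OF hom_to_fract pC] inj] by blast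
  have ev: "\<Theta> (to_fract g) = ?f g" if "g \<in> poly_over C" for g
    using \<Theta>(2)[OF imageI[OF that]] by (simp only: i)
  have "\<Theta> ` to_fract ` poly_over C = (\<lambda>g. poly g y) ` map_poly \<chi> ` poly_over C"
    unfolding image_image using ev by (rule image_cong[OF refl])
  also have "\<dots> = adjoin (\<chi> ` C) y" unfolding map_poly_image[of C \<chi>, OF subring_zero[OF C] z] adjoin_def ..
  finally show ?thesis using that \<Theta>(1) ev by blast
qed

lemma hom_away:
  fixes C :: "'g::field set" and \<Theta> :: "'g \<Rightarrow> 'f::field"
  assumes \<Theta>: "ring_hom_on (frac_field C) \<Theta>" and C: "is_subring C" and h: "h \<in> C"
  shows "\<Theta> ` away C h = away (\<Theta> ` C) (\<Theta> h)"
proof -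
  have F: "C \<subseteq> frac_field C" using frac_base[OF C] by blast
  have eq: "\<Theta> (a / h ^ n) = \<Theta> a / \<Theta> h ^ n" if "a \<in> C" for a n
    using hom_frac_divide[OF \<Theta> C, of a "h ^ n"] hom_power[OF hom_subset[OF \<Theta> F] C h] that F subring_power[OF C h]
    by auto
  show ?thesis
  proof (intro equalityI subsetI)
    fix x assume "x \<in> \<Theta> ` away C h"
    then obtain a n where "a \<in> C" "x = \<Theta> (a / h ^ n)" by (auto elim: awayE)
    then show "x \<in> away (\<Theta> ` C) (\<Theta> h)" using eq by (auto intro: awayI)
  next
    fix x assume "x \<in> away (\<Theta> ` C) (\<Theta> h)"
    then obtain y n where y: "y \<in> \<Theta> ` C" "x = y / \<Theta> h ^ n" by (rule awayE)
    then obtain a where a: "a \<in> C" "x = \<Theta> a / \<Theta> h ^ n" by blast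
    show "x \<in> \<Theta> ` away C h" unfolding a(2) eq[OF a(1), symmetric] by (rule imageI[OF awayI[OF a(1)]])
  qed
qed

text \<open>The punctured line is cut out by non-vanishing of the coordinate, so its product becomes
  a principal open subscheme and inherits an affine model.\<close>

lemma times_A1_star_principal_open:
  assumes m: "affine_model X C \<phi>"
  shows "times_A1_star X = open_subscheme (times_A1 X) (principal_open (times_A1 X) (to_fract [:0, 1:]))"
proof -
  have C: "is_subring C" by (rule affine_modelD(1)[OF m])
  have t: "[:0, 1:] \<in> poly_over C" using poly_over_var[OF subring_zero[OF C] subring_one[OF C]] .
  have st: "0 \<in> stalk X x \<and> 1 \<in> stalk X x" if "x \<in> points X" for x
    using model_subset_stalk[OF m that] subring_zero[OF C] subring_one[OF C] by blast
  have pts: "points (times_A1 X) = A1_points X" by (rule points_times_A1[OF st])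
  have "principal_open (times_A1 X) (to_fract [:0, 1:])
    = {(x, Q) \<in> A1_points X. [:0, 1:] \<notin> Q}"
    unfolding principal_open_model[OF affine_model_times_A1[OF m] imageI[OF t]]
    using t by (auto simp: pts)
  then show ?thesis by (simp add: times_A1_star_def)
qed

text \<open>A homomorphism on \<open>C[t]\<close> is determined by its values on constants and on
  \<open>t\<close>. This turns the abstract inverse of the cylinder isomorphism into an
  evaluation.\<close>

lemma polynomial_hom_eval:
  assumes \<eta>: "ring_hom_on (poly_over C) \<eta>" and C: "is_subring C" and g: "g \<in> poly_over C"
  shows "\<eta> g = poly (map_poly (\<lambda>c. \<eta> [:c:]) g) (\<eta> [:0, 1:])"
proof -
  have pC: "is_subring (poly_over C)" by (rule subring_poly_over[OF C])
  have c: "[:c:] \<in> poly_over C" if "c \<in> C" for c by (rule poly_over_const[OF subring_zero[OF C] that])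
  have t: "[:0, 1:] \<in> poly_over C" by (rule poly_over_var[OF subring_zero[OF C] subring_one[OF C]])
  have z: "\<eta> [:0:] = 0" using hom_zero[OF \<eta> subring_zero[OF pC]] by simp
  have "(\<Sum>i\<le>degree g. [:coeff g i:] * [:0, 1:] ^ i) = g"
    using poly_as_sum_of_monoms[of g] by (simp add: monom_altdef)
  from this[symmetric] have "\<eta> g = \<eta> (\<Sum>i\<le>degree g. [:coeff g i:] * [:0, 1:] ^ i)" by (rule arg_cong)
  also have "\<dots> = (\<Sum>i\<le>degree g. \<eta> ([:coeff g i:] * [:0, 1:] ^ i))"
    by (intro hom_sum[OF \<eta> pC] subring_mult[OF pC] subring_power[OF pC] c poly_overD[OF g] t)
  also have "\<dots> = (\<Sum>i\<le>degree g. \<eta> [:coeff g i:] * \<eta> [:0, 1:] ^ i)"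
    by (simp only: hom_mult[OF \<eta> c[OF poly_overD[OF g]] subring_power[OF pC t]] hom_power[OF \<eta> pC t])
  also have "\<dots> = poly (map_poly (\<lambda>c. \<eta> [:c:]) g) (\<eta> [:0, 1:])"
  proof -
    have d: "degree (map_poly (\<lambda>c. \<eta> [:c:]) g) \<le> degree g" by (rule map_poly_degree_leq)
    have "poly (map_poly (\<lambda>c. \<eta> [:c:]) g) (\<eta> [:0, 1:])
      = (\<Sum>i\<le>degree g. coeff (map_poly (\<lambda>c. \<eta> [:c:]) g) i * \<eta> [:0, 1:] ^ i)"
      unfolding poly_altdef
      by (rule sum.mono_neutral_left) (use d in \<open>auto simp: coeff_eq_0\<close>)
    then show ?thesis using z by (simp add: coeff_map_poly)
  qed
  finally show ?thesis .
qed

theorem lemma2p8: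
  fixes s :: "'k::{alg_closed_field, field_char_0} \<Rightarrow> 'f::field"
    and A :: "nat \<Rightarrow> 'f set"
    and S Y V :: "('k, 'f set, 'f) scheme"
    and u :: 'f
    and H D :: "'f set \<Rightarrow> rat"
    and p q :: nat
    and Z :: "('k, 'q, 'g::field) scheme"
  assumes "positively_graded_algebra s A"
    and "affine_algebra s (total_ring A)"
    and "normal_domain (total_ring A)"
    and "saturation_index A = 1"
    and S: "S = Spec s (A 0)"
    and Y: "Y = Proj s A"
    and "rel_dim S Y \<ge> 1"
    and "ample_Q_divisor Y H"
    and "u \<in> frac_degree A 1" and "u \<noteq> 0"
    and "A = divisor_ring Y H u"
    and "cylindrical_pair_by Y H D p q Z"
    and V: "V = Spec s (total_ring (veronese p A))"
  shows "cylindrical V \<and> affine_variety Z \<and>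
    (\<exists>h\<in>A p. \<exists>Z' :: ('k, 'f set, 'f) scheme.
       principal_cylinder V h Z' \<and> isomorphic Z' (times_A1_star Z))"
proof -
  interpret divisor_graded s A H u
    using assms(1-3,8,10,11) unfolding Y by unfold_locales
  have cyl: "effective_Q_divisor Y D" "p > 0" "q > 0" "divisor_equiv Y D (\<lambda>x. (of_nat p / of_nat q) * H x)"
    "variety Z" "isomorphic (open_subscheme Y (points Y - divisor_supp Y D)) (times_A1 Z)"
    using assms(12) by (auto simp: cylindrical_pair_by_def)
  obtain f where f: "f \<in> function_field Y" "f \<noteq> 0" "\<And>x. D x - (of_nat p / of_nat q) * H x = divisor_of Y f x"
    using cyl(4) by (auto simp: divisor_equiv_def)
  define h where "h = f ^ q * u ^ p"
  note CS = complement_support[OF cyl(1)[unfolded Y] cyl(2,3) f[unfolded Y], folded h_def]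
  have h: "h \<in> A p" "h \<noteq> 0" by (fact CS)+
  define B where "B = hloc h p"
  have B: "is_subring B" unfolding B_def by (rule subring_hloc[OF h])
  have affB: "affine_algebra s B" unfolding B_def by (rule affine_hloc[OF fin cyl(2) h])
  have sB: "s c \<in> B" for c using affB by (auto simp: affine_algebra_def is_algebra_def)
  have mB: "affine_model (open_subscheme Y (points Y - divisor_supp Y D)) B (hprime h p)"
    unfolding Y CS(3) B_def by (rule affine_model_Proj[OF h cyl(2)])
  obtain \<psi> \<theta> where \<psi>: "ring_hom_on (frac_field B) \<psi>"
    and sc: "\<And>c. \<psi> (scal (open_subscheme Y (points Y - divisor_supp Y D)) c) = scal (times_A1 Z) c"
    and m: "affine_model (times_A1 Z) (\<psi> ` B) \<theta>"
    using affine_model_transport[OF mB cyl(6)] by blast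
  have \<psi>s: "\<psi> (s c) = scal (times_A1 Z) c" for c using sc by (simp add: scal_open_subscheme Y scal_Proj)
  have BF: "B \<subseteq> frac_field B" using frac_base[OF B] by blast
  have \<psi>B: "ring_hom_on B \<psi>" by (rule hom_subset[OF \<psi> BF])
  have injB: "inj_on \<psi> B" using hom_frac_inj[OF \<psi> B] BF by (rule inj_on_subset)
  have aff: "affine_algebra (scal (times_A1 Z)) (\<psi> ` B)" by (rule affine_algebra_image[OF affB \<psi>B \<psi>s])
  define C where "C = sections Z (points Z)"
  note base = base_of_cylinder[OF cyl(5) m aff, folded C_def]
  obtain \<phi>Z where mZ: "affine_model Z C \<phi>Z" using base(1) by blast
  have affZ: "affine_variety Z" by (rule affine_variety_of_model[OF mZ base(2)])
  have C: "is_subring C" by (rule affine_modelD(1)[OF mZ])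
  have scC: "scal Z c \<in> C" for c using base(2) by (auto simp: affine_algebra_def is_algebra_def)

  \<comment> \<open>\<open>\<eta>\<close> is the inverse of the cylinder isomorphism on coordinate
    rings, from \<open>C[t]\<close> to \<open>B\<close>. It moves the coordinate ring of
    \<open>Z\<close>, which lives in another field, into the ambient field of
    \<open>A\<close>.\<close>
  define \<eta> where "\<eta> g = inv_into B \<psi> (to_fract g)" for g
  have pC: "is_subring (poly_over C)" by (rule subring_poly_over[OF C])
  have cC: "[:c:] \<in> poly_over C" if "c \<in> C" for c by (rule poly_over_const[OF subring_zero[OF C] that])
  have tC: "[:0, 1:] \<in> poly_over C" by (rule poly_over_var[OF subring_zero[OF C] subring_one[OF C]])
  have tfB: "to_fract g \<in> \<psi> ` B" if "g \<in> poly_over C" for g unfolding base(3) using that by (rule imageI)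
  have inv: "ring_hom_on (\<psi> ` B) (inv_into B \<psi>)" by (rule hom_inv_into[OF \<psi>B B injB])
  have \<eta>: "ring_hom_on (poly_over C) \<eta>"
    unfolding ring_hom_on_def \<eta>_def using hom_one[OF inv] hom_add[OF inv] hom_mult[OF inv] tfB by simp
  have \<eta>B: "\<eta> ` poly_over C = B"
  proof -
    have "\<eta> ` poly_over C = inv_into B \<psi> ` to_fract ` poly_over C" unfolding \<eta>_def image_image ..
    also have "\<dots> = inv_into B \<psi> ` \<psi> ` B" unfolding base(3) ..
    also have "\<dots> = B" by (rule inv_into_image_cancel[OF injB order_refl])
    finally show ?thesis .
  qed
  have inj\<eta>: "inj_on \<eta> (poly_over C)"
    unfolding \<eta>_def using tfB by (auto intro!: inj_onI dest: inv_into_injective)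
  \<comment> \<open>The isomorphism is split into its effect on \<open>C\<close>, whose image
    \<open>C'\<close> is a copy of the coordinate ring of \<open>Z\<close> inside \<open>B\<close>,
    and the image \<open>t\<close> of the coordinate; then \<open>B = C'[t]\<close> with
    \<open>t\<close> transcendental over \<open>C'\<close>.\<close>
  define \<chi> where "\<chi> c = \<eta> [:c:]" for c
  define t where "t = \<eta> [:0, 1:]"
  have \<chi>: "ring_hom_on C \<chi>"
    unfolding ring_hom_on_def \<chi>_def
  proof (intro conjI ballI)
    show "\<eta> [:1:] = 1" using hom_one[OF \<eta>] by (simp add: pCons_one)
    fix a b assume ab: "a \<in> C" "b \<in> C"
    show "\<eta> [:a + b:] = \<eta> [:a:] + \<eta> [:b:]" using hom_add[OF \<eta> cC[OF ab(1)] cC[OF ab(2)]] by simp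
    show "\<eta> [:a * b:] = \<eta> [:a:] * \<eta> [:b:]" using hom_mult[OF \<eta> cC[OF ab(1)] cC[OF ab(2)]] by (simp add: mult.commute)
  qed
  have \<chi>inj: "inj_on \<chi> C"
  proof (rule inj_onI)
    fix a b assume ab: "a \<in> C" "b \<in> C" "\<chi> a = \<chi> b"
    then have "[:a:] = [:b:]" using inj_onD[OF inj\<eta> _ cC[OF ab(1)] cC[OF ab(2)]] by (simp add: \<chi>_def)
    then show "a = b" by simp
  qed
  have \<chi>0: "\<chi> 0 = 0" by (rule hom_zero[OF \<chi> subring_zero[OF C]])
  have \<eta>ev: "\<eta> g = poly (map_poly \<chi> g) t" if "g \<in> poly_over C" for g
    using polynomial_hom_eval[OF \<eta> C that] by (simp add: \<chi>_def[abs_def] t_def)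
  have \<chi>s: "\<chi> (scal Z c) = s c" for c
    unfolding \<chi>_def \<eta>_def scal_times_A1[symmetric] \<psi>s[symmetric] using injB sB by simp
  define C' where "C' = \<chi> ` C"
  have C': "is_subring C'" unfolding C'_def by (rule hom_image_subring[OF \<chi> C])
  have C'B: "C' \<subseteq> B" unfolding C'_def \<chi>_def using \<eta>B cC by blast
  have tB: "t \<in> B" unfolding t_def using \<eta>B tC by blast
  have affC': "affine_algebra s C'" unfolding C'_def by (rule affine_algebra_image[OF base(2) \<chi> \<chi>s])
  have hB: "transcendental_over B h"
    unfolding transcendental_over_def B_def using homogeneous_transcendental[OF cyl(2) h] by blast
  have hC': "transcendental_over C' h"
    using hB poly_over_mono[OF C'B] unfolding transcendental_over_def by blast
  have polyC': "map_poly \<chi> ` poly_over C = poly_over C'"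
    unfolding C'_def by (rule map_poly_image[of C \<chi>, OF subring_zero[OF C] \<chi>0])
  have adjC': "adjoin C' t = B"
    unfolding adjoin_def polyC'[symmetric] image_image \<eta>B[symmetric] using \<eta>ev by (intro image_cong) auto
  \<comment> \<open>A relation for \<open>t\<close> over \<open>C'\<close> is the image under
    \<open>\<eta>\<close> of a polynomial over \<open>C\<close>, and \<open>\<eta>\<close> is
    injective.\<close>
  have tC': "transcendental_over C' t"
    unfolding transcendental_over_def
  proof (intro ballI impI)
    fix g assume g: "g \<in> poly_over C'" "poly g t = 0"
    obtain g0 where g0: "g0 \<in> poly_over C" "g = map_poly \<chi> g0" using g(1) polyC' by blast
    have "\<eta> g0 = \<eta> 0" using \<eta>ev[OF g0(1)] g(2) g0(2) hom_zero[OF \<eta> subring_zero[OF pC]] by simp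
    then have "g0 = 0" using inj\<eta> g0(1) subring_zero[OF pC] by (meson inj_onD)
    then show "g = 0" using g0(2) by simp
  qed

  define R' where "R' = laurent C' h"
  note LR = laurent_facts[OF C' h(2), folded R'_def]
  \<comment> \<open>Realizing \<open>Z'\<close> as the spectrum of a subring of the ambient field
    gives it the types over which \<open>cylindrical\<close> quantifies.\<close>
  define Z' :: "('k, 'f set, 'f) scheme" where "Z' = Spec s R'"
  have mZ': "affine_model Z' R' (\<lambda>P. P)" unfolding Z'_def by (rule affine_model_Spec[OF LR(1)])
  have affR': "affine_algebra s R'" unfolding R'_def by (rule affine_laurent[OF affC' h(2)])
  have varZ': "variety Z'" by (rule variety_of_model[OF mZ']) (simp add: Z'_def scal_Spec affR')
  have sR': "s c \<in> R'" for c using affR' by (auto simp: affine_algebra_def is_algebra_def)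

  have star: "isomorphic Z' (times_A1_star Z)"
  proof -
    obtain \<Theta> where \<Theta>: "ring_hom_on (frac_field (to_fract ` poly_over C)) \<Theta>"
      "\<And>g. g \<in> poly_over C \<Longrightarrow> \<Theta> (to_fract g) = poly (map_poly \<chi> g) h"
      "\<Theta> ` to_fract ` poly_over C = adjoin C' h"
      using polynomial_ring_hom[OF \<chi> \<chi>inj C] hC' unfolding C'_def by blast
    let ?P = "to_fract ` poly_over C" and ?t = "to_fract [:0, 1 :: 'g:]"
    have P: "is_subring ?P" by (rule hom_image_subring[OF hom_to_fract pC])
    have t0: "?t \<noteq> 0" by simp
    have tP: "?t \<in> ?P" using tC by (rule imageI)
    have \<Theta>t: "\<Theta> ?t = h" using \<Theta>(2)[OF tC] hom_one[OF \<chi>] \<chi>0 by (simp add: map_poly_pCons)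
    have mS: "affine_model (times_A1_star Z) (away ?P ?t) (\<lambda>x. away (case x of (x, Q) \<Rightarrow> to_fract ` (Q \<inter> poly_over C)) ?t)"
      unfolding times_A1_star_principal_open[OF mZ]
      by (rule affine_model_principal_open[OF affine_model_times_A1[OF mZ] tP t0])
    have sS: "scal (times_A1_star Z) c = to_fract [:scal Z c:]" for c
      by (simp add: times_A1_star_def scal_open_subscheme scal_times_A1)
    show ?thesis
    proof (rule isomorphic_of_models_inv[OF mZ' mS])
      show "ring_hom_on (frac_field (away ?P ?t)) \<Theta>" unfolding frac_away[OF P tP t0] by (rule \<Theta>(1))
      show "\<Theta> ` away ?P ?t = R'" unfolding hom_away[OF \<Theta>(1) P tP] \<Theta>(3) \<Theta>t R'_def laurent_def ..
      show "\<Theta> (scal (times_A1_star Z) c) = scal Z' c" for c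
        unfolding sS \<Theta>(2)[OF cC[OF scC]] using \<chi>s \<chi>0 by (simp add: map_poly_pCons Z'_def scal_Spec)
      show "range (scal (times_A1_star Z)) \<subseteq> away ?P ?t"
        using cC[OF scC] by (auto simp: sS intro!: away_base)
    qed
  qed

  have Vg: "graded_domain s (veronese p A)" by (rule graded_veronese[OF cyl(2)])
  let ?T = "total_ring (veronese p A)"
  have T: "is_subring ?T" by (rule graded_domain.subring_total[OF Vg])
  have mV: "affine_model V ?T (\<lambda>P. P)" unfolding V by (rule affine_model_Spec[OF T])
  have affV: "affine_variety V"
    by (rule affine_variety_of_model[OF mV]) (simp add: V scal_Spec affine_veronese[OF fin cyl(2)])
  have hT: "h \<in> ?T" using graded_domain.homogeneous_total[OF Vg, of h 1] h(1) by (simp add: veronese_def)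
  have LB: "away ?T h = laurent B h" unfolding B_def by (rule away_veronese[OF cyl(2) h])
  note LBf = laurent_facts[OF B h(2)]

  have prod: "isomorphic (open_subscheme V (principal_open V h)) (times_A1 Z')"
  proof -
    have id: "ring_hom_on R' (\<lambda>x. x)" "inj_on (\<lambda>x. x) R'" "(\<lambda>x. x) ` R' = R'" by (auto simp: ring_hom_on_def)
    have tR': "transcendental_over R' t"
      unfolding R'_def by (rule transcendental_over_laurent[OF B C' C'B tB tC' h(2) hB])
    obtain \<Theta> where \<Theta>: "ring_hom_on (frac_field (to_fract ` poly_over R')) \<Theta>"
      "\<And>g. g \<in> poly_over R' \<Longrightarrow> \<Theta> (to_fract g) = poly (map_poly (\<lambda>x. x) g) t"
      "\<Theta> ` to_fract ` poly_over R' = adjoin R' t"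
      using polynomial_ring_hom[OF id(1,2) LR(1), of t] tR' unfolding id(3) by blast
    have aR': "is_subring (adjoin R' t)" by (rule subring_adjoin[OF LR(1)])
    have RA: "R' \<subseteq> adjoin R' t" using adjoin_base[OF subring_zero[OF LR(1)]] by blast
    have tA: "t \<in> adjoin R' t" by (rule adjoin_gen[OF LR(1)])
    \<comment> \<open>The two extensions commute: adjoining \<open>h\<close> and its inverse to
      \<open>C'\<close> and then \<open>t\<close> gives the same ring as adjoining \<open>t\<close>
      first, since \<open>B = C'[t]\<close>.\<close>
    have "adjoin R' t = laurent B h"
    proof
      have "R' \<subseteq> laurent B h" using C'B LBf(1-4) by (intro LR(5)) auto
      then show "adjoin R' t \<subseteq> laurent B h" using LBf(2) tB by (intro adjoin_least[OF LBf(1)]) auto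
      have "B \<subseteq> adjoin R' t" unfolding adjC'[symmetric] using LR(2) RA tA by (intro adjoin_least[OF aR']) auto
      then show "laurent B h \<subseteq> adjoin R' t" using LR(3,4) RA by (intro LBf(5)[OF aR']) auto
    qed
    then have im: "\<Theta> ` to_fract ` poly_over R' = away ?T h" unfolding \<Theta>(3) LB .
    have cR: "[:s c:] \<in> poly_over R'" for c by (rule poly_over_const[OF subring_zero[OF LR(1)] sR'])
    have sZ: "scal (times_A1 Z') c = to_fract [:s c:]" for c by (simp add: scal_times_A1 Z'_def scal_Spec)
    show ?thesis
    proof (rule isomorphic_of_models_inv[OF affine_model_principal_open[OF mV hT h(2)] affine_model_times_A1[OF mZ'] \<Theta>(1) im])
      show "\<Theta> (scal (times_A1 Z') c) = scal (open_subscheme V (principal_open V h)) c" for c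
        unfolding sZ \<Theta>(2)[OF cR] by (simp add: map_poly_pCons scal_open_subscheme V scal_Spec)
      show "range (scal (times_A1 Z')) \<subseteq> to_fract ` poly_over R'" using cR by (auto simp: sZ)
    qed
  qed

  have "h \<in> sections V (points V)" unfolding model_sections[OF mV] by (rule hT)
  then have pc: "principal_cylinder V h Z'"
    unfolding principal_cylinder_def using affV varZ' prod by blast
  then have "cylindrical V" unfolding cylindrical_def by blast
  then show ?thesis using affZ pc star h(1) by blast
qed

end
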